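(* Let $\Omega$ be a domain in $\mathbb{R}^N$, $N\ge2$, with nonempty compact boundary. Assume $g\in C(\mathbb{R})$ is nondecreasing, $g(0)\ge0$, $g$ satisfies the Keller–Osserman condition, and that $-\Delta u+g(u)=0$ possesses a subsolution $V$ in $\Omega$. Put $\mathcal{U}_V(\Omega)=\{h\in L^1_{loc}(\Omega): h\ge V \text{ a.e.}\}$. Then: (i) For every nonnegative $f\in L^1_{loc}(\Omega)$, the equation $-\Delta u+g(u)=f$ in $\Omega$ possesses a minimal solution $V_f$ in $\mathcal{U}_V(\Omega)$ (i.e. $V_f\in\mathcal U_V(\Omega)$ is a solution and $V_f\le u$ for every solution $u\in\mathcal U_V(\Omega)$), and $V_f$ increases as $f$ increases. (ii) If, in addition, $\Omega$ satisfies the classical Wiener criterion, then for every nonnegative $f\in L^1_{loc}(\Omega)$ the equation $-\Delta u+g(u)=f$ possesses a large solution in $\Omega$; moreover there exists a minimal large solution of this equation in $\mathcal U_V(\Omega)$. (iii) If $\Omega$ is bounded and satisfies the classical Wiener criterion, then for every nonnegative $f\in L^1_{loc}(\Omega)$ the equation $-\Delta u+g(u)=f$ possesses a minimal large solution in $\Omega$.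
   Context: Keller–Osserman condition: for every $a>0$, $\int_a^\infty\big(\int_0^t g(s)\,ds\big)^{-1/2}dt<\infty$. A solution (resp. subsolution) of $-\Delta u+g(u)=f$ is a $u\in L^1_{loc}(\Omega)$ with $g(u)\in L^1_{loc}(\Omega)$ and $-\Delta u+g(u)-f=0$ (resp. $\le0$) in the sense of distributions. A large solution is a solution $u$ that blows up at the boundary: for every bounded $K\subset\mathbb{R}^N$, $u(x)\to\infty$ as $\operatorname{dist}(x,\partial\Omega)\to0$, $x\in K\cap\Omega$, understood in the essential sense (u is bounded below a.e. by a function having this property). Wiener criterion: for every $\sigma\in\partial\Omega$, $\int_0^1 C_{1,2}(B_s(\sigma)\cap\Omega^c)\,s^{1-N}ds=\infty$, $C_{1,2}$ the classical capacity. *)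

theory Defs
  imports "HOL-Analysis.Analysis"
begin

definition pdiff :: "'a::euclidean_space \<Rightarrow> ('a \<Rightarrow> real) \<Rightarrow> 'a \<Rightarrow> real" where
  "pdiff b f x = deriv (\<lambda>t. f (x + t *\<^sub>R b)) 0"

fun ipdiff :: "'a::euclidean_space list \<Rightarrow> ('a \<Rightarrow> real) \<Rightarrow> 'a \<Rightarrow> real" where
  "ipdiff [] f = f"
| "ipdiff (b # bs) f = pdiff b (ipdiff bs f)"

definition smooth :: "('a::euclidean_space \<Rightarrow> real) \<Rightarrow> bool" where
  "smooth f \<longleftrightarrow> (\<forall>bs. set bs \<subseteq> Basis \<longrightarrow> (\<forall>x. ipdiff bs f differentiable (at x)))"

definition tsupport :: "('a::euclidean_space \<Rightarrow> real) \<Rightarrow> 'a set" where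
  "tsupport f = closure {x. f x \<noteq> 0}"

definition test_fun :: "'a::euclidean_space set \<Rightarrow> ('a \<Rightarrow> real) \<Rightarrow> bool" where
  "test_fun \<Omega> \<phi> \<longleftrightarrow> smooth \<phi> \<and> compact (tsupport \<phi>) \<and> tsupport \<phi> \<subseteq> \<Omega>"

definition laplacian :: "('a::euclidean_space \<Rightarrow> real) \<Rightarrow> 'a \<Rightarrow> real" where
  "laplacian \<phi> x = (\<Sum>b\<in>Basis. pdiff b (pdiff b \<phi>) x)"

definition grad_norm2 :: "('a::euclidean_space \<Rightarrow> real) \<Rightarrow> 'a \<Rightarrow> real" where
  "grad_norm2 \<phi> x = (\<Sum>b\<in>Basis. (pdiff b \<phi> x)\<^sup>2)"

definition locL1 :: "'a::euclidean_space set \<Rightarrow> ('a \<Rightarrow> real) \<Rightarrow> bool" where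
  "locL1 \<Omega> u \<longleftrightarrow> (\<forall>K. compact K \<and> K \<subseteq> \<Omega> \<longrightarrow> set_integrable lebesgue K u)"

definition nonneg_locL1 :: "'a::euclidean_space set \<Rightarrow> ('a \<Rightarrow> real) \<Rightarrow> bool" where
  "nonneg_locL1 \<Omega> f \<longleftrightarrow> locL1 \<Omega> f \<and> (AE x in lebesgue. x \<in> \<Omega> \<longrightarrow> 0 \<le> f x)"

definition is_sol :: "'a::euclidean_space set \<Rightarrow> (real \<Rightarrow> real) \<Rightarrow> ('a \<Rightarrow> real) \<Rightarrow> ('a \<Rightarrow> real) \<Rightarrow> bool" where
  "is_sol \<Omega> g f u \<longleftrightarrow> locL1 \<Omega> u \<and> locL1 \<Omega> (\<lambda>x. g (u x)) \<and>
     (\<forall>\<phi>. test_fun \<Omega> \<phi> \<longrightarrow>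
        (LINT x:\<Omega>|lebesgue. - u x * laplacian \<phi> x + g (u x) * \<phi> x - f x * \<phi> x) = 0)"

definition is_subsol :: "'a::euclidean_space set \<Rightarrow> (real \<Rightarrow> real) \<Rightarrow> ('a \<Rightarrow> real) \<Rightarrow> ('a \<Rightarrow> real) \<Rightarrow> bool" where
  "is_subsol \<Omega> g f u \<longleftrightarrow> locL1 \<Omega> u \<and> locL1 \<Omega> (\<lambda>x. g (u x)) \<and>
     (\<forall>\<phi>. test_fun \<Omega> \<phi> \<and> (\<forall>x. 0 \<le> \<phi> x) \<longrightarrow>
        (LINT x:\<Omega>|lebesgue. - u x * laplacian \<phi> x + g (u x) * \<phi> x - f x * \<phi> x) \<le> 0)"

definition UV :: "'a::euclidean_space set \<Rightarrow> ('a \<Rightarrow> real) \<Rightarrow> ('a \<Rightarrow> real) set" where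
  "UV \<Omega> V = {h. locL1 \<Omega> h \<and> (AE x in lebesgue. x \<in> \<Omega> \<longrightarrow> V x \<le> h x)}"

definition ae_le :: "'a::euclidean_space set \<Rightarrow> ('a \<Rightarrow> real) \<Rightarrow> ('a \<Rightarrow> real) \<Rightarrow> bool" where
  "ae_le \<Omega> u v \<longleftrightarrow> (AE x in lebesgue. x \<in> \<Omega> \<longrightarrow> u x \<le> v x)"

text \<open>Blow-up at the boundary in the essential sense.\<close>
definition is_large :: "'a::euclidean_space set \<Rightarrow> ('a \<Rightarrow> real) \<Rightarrow> bool" where
  "is_large \<Omega> u \<longleftrightarrow> (\<exists>w. ae_le \<Omega> w u \<and>
     (\<forall>K. bounded K \<longrightarrow> (\<forall>M. \<exists>\<delta>>0. \<forall>x\<in>K \<inter> \<Omega>. infdist x (frontier \<Omega>) < \<delta> \<longrightarrow> M \<le> w x)))"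

definition large_sol :: "'a::euclidean_space set \<Rightarrow> (real \<Rightarrow> real) \<Rightarrow> ('a \<Rightarrow> real) \<Rightarrow> ('a \<Rightarrow> real) \<Rightarrow> bool" where
  "large_sol \<Omega> g f u \<longleftrightarrow> is_sol \<Omega> g f u \<and> is_large \<Omega> u"

definition min_sol_in :: "'a::euclidean_space set \<Rightarrow> (real \<Rightarrow> real) \<Rightarrow> ('a \<Rightarrow> real) \<Rightarrow> ('a \<Rightarrow> real) set \<Rightarrow> ('a \<Rightarrow> real) \<Rightarrow> bool" where
  "min_sol_in \<Omega> g f C u \<longleftrightarrow> u \<in> C \<and> is_sol \<Omega> g f u \<and>
     (\<forall>v. v \<in> C \<and> is_sol \<Omega> g f v \<longrightarrow> ae_le \<Omega> u v)"

definition min_large_sol_in :: "'a::euclidean_space set \<Rightarrow> (real \<Rightarrow> real) \<Rightarrow> ('a \<Rightarrow> real) \<Rightarrow> ('a \<Rightarrow> real) set \<Rightarrow> ('a \<Rightarrow> real) \<Rightarrow> bool" where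
  "min_large_sol_in \<Omega> g f C u \<longleftrightarrow> u \<in> C \<and> large_sol \<Omega> g f u \<and>
     (\<forall>v. v \<in> C \<and> large_sol \<Omega> g f v \<longrightarrow> ae_le \<Omega> u v)"

definition keller_osserman :: "(real \<Rightarrow> real) \<Rightarrow> bool" where
  "keller_osserman g \<longleftrightarrow> (\<forall>a>0.
     (\<integral>\<^sup>+ t\<in>{a..}. inverse (ennreal (sqrt (integral {0..t} g))) \<partial>lborel) < top)"

text \<open>Classical (Bessel) capacity C_{1,2}, outer definition via test functions.\<close>
definition cap12 :: "'a::euclidean_space set \<Rightarrow> ennreal" where
  "cap12 E = (INF \<phi>\<in>{\<phi>. smooth \<phi> \<and> compact (tsupport \<phi>) \<and>
                     (\<exists>G. open G \<and> E \<subseteq> G \<and> (\<forall>x\<in>G. 1 \<le> \<phi> x))}.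
       \<integral>\<^sup>+ x. ennreal (grad_norm2 \<phi> x + (\<phi> x)\<^sup>2) \<partial>lebesgue)"

definition wiener :: "'a::euclidean_space set \<Rightarrow> bool" where
  "wiener \<Omega> \<longleftrightarrow> (\<forall>\<sigma>\<in>frontier \<Omega>.
     (\<integral>\<^sup>+ s\<in>{0<..1}. cap12 (ball \<sigma> s \<inter> - \<Omega>) * ennreal (s powr (1 - real DIM('a))) \<partial>lborel) = top)"

end

theory Submission
  imports Defs
begin

text \<open>
  Everything is tested against dilates of one radial kernel, for which averaging minus the identity is
  convolution of the Laplacian with another positive kernel.  This yields the weak mean value
  inequality, Kato's inequality for maxima and the comparison principle without any regularity theory.

  The Keller--Osserman condition bounds every subsolution locally by comparison with paraboloids on a
  dyadic sequence of levels.  Monotone iteration solves the equation with a penalty that pins the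
  solution to the subsolution off a compact set; exhausting the domain gives a solution below every
  supersolution that dominates \<open>V\<close>.

  At a boundary point \<open>z\<close> the Wiener criterion makes the product of the factors
  \<open>1 - c * r ^ (2 - N) * cap (ball z r - \<Omega>)\<close>, taken over radii \<open>r\<close> in geometric progression, vanish.
  Gluing the capacitary potentials of these parts of the complement therefore produces a
  superharmonic barrier.  Barriers and compactness of the boundary turn \<open>V\<close> into a large subsolution
  that lies below every large solution above \<open>V\<close>, and the minimal solution above it is the minimal
  large one.  On a bounded domain every large solution lies above a suitable paraboloid, which then
  takes the role of \<open>V\<close>.
\<close>

section \<open>Smooth functions\<close>

text \<open>The data are only locally integrable, so neither pointwise values nor elliptic estimates
  are at hand: inequalities are tested with nonnegative functions, and pointwise statements hold
  almost everywhere. The gradient of \<open>psi\<close> at y is - y times \<open>rho\<close>, so the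
  t-derivative of the \<open>rho\<close> average over the dilate by t is t times the
  \<open>psi\<close> average of the Laplacian; integrating against 1 - (t/R)^m gives the averaging
  identity with compactly supported kernels. The exponent m is tuned: 2 makes monotone iteration
  order preserving, dimension plus one gives pointwise bounds. The iteration asks for a Lipschitz
  nonlinearity and bounded data, which g, f and V do not provide; hence inf-convolutions of g,
  truncations of f, a paraboloid that bounds V from below, and a potential that absorbs f in the
  Keller--Osserman bound. The capacity of the theorem carries a zero order term, so its minimiser w
  makes w minus its Laplacian a measure; the potentials are convolutions of that measure with
  \<open>kP\<close>, which makes them compactly supported and subharmonic off the set.\<close>

lemma ipdiff_append: "ipdiff (as @ bs) f = ipdiff as (ipdiff bs f)"
 by (induct as) auto

lemma smooth_differentiable: "smooth f ==> f differentiable (at x)"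
 unfolding smooth_def by (metis ipdiff.simps(1) empty_set empty_subsetI)

lemma smooth_pdiff:
 assumes "smooth f" "b \<in> Basis"
 shows "smooth (pdiff b f)"
proof -
 have "ipdiff bs (pdiff b f) = ipdiff (bs @ [b]) f" for bs
  by (simp add: ipdiff_append)
 then show ?thesis using assms unfolding smooth_def by simp
qed

text \<open>Smoothness quantifies over all lists of directions. A class of differentiable functions
  closed under \<open>pdiff\<close> absorbs that quantifier, so each later smoothness proof only has
  to name such a class.\<close>

lemma smooth_coinduct:
 assumes "f \<in> S" "\<And>h x. h \<in> S ==> h differentiable (at x)"
  and "\<And>h b. h \<in> S ==> b \<in> Basis ==> pdiff b h \<in> S"
 shows "smooth f"
proof -
 have "set bs \<subseteq> Basis ==> ipdiff bs f \<in> S" for bs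
  by (induct bs) (use assms in auto)
 then show ?thesis using assms(2) unfolding smooth_def by blast
qed

lemma pdiff_eq:
 assumes "(f has_derivative D) (at x)"
 shows "pdiff b f x = D b"
proof -
 have l: "linear D" using assms has_derivative_linear by blast
 have "((\<lambda>t. f (x + t *\<^sub>R b)) has_derivative (\<lambda>t. D (t *\<^sub>R b))) (at 0)"
  by (rule has_derivative_compose[of "\<lambda>t. x + t *\<^sub>R b" _ _ _ f D])
   (auto intro!: derivative_eq_intros assms)
 moreover have "(\<lambda>t. D (t *\<^sub>R b)) = (*) (D b)"
  using l by (auto simp: linear_scale)
 ultimately have "((\<lambda>t. f (x + t *\<^sub>R b)) has_field_derivative D b) (at 0)"
  by (simp add: has_field_derivative_def)
 then show ?thesis unfolding pdiff_def by (rule DERIV_imp_deriv)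
qed

lemma differentiable_pdiff:
 fixes f :: "'a::euclidean_space => real"
 assumes "f differentiable (at x)"
 shows "(f has_derivative (\<lambda>h. \<Sum>b\<in>Basis. (h \<bullet> b) * pdiff b f x)) (at x)"
proof -
 obtain D where D: "(f has_derivative D) (at x)"
  using assms by (auto simp: differentiable_def)
 have "D h = (\<Sum>b\<in>Basis. (h \<bullet> b) * pdiff b f x)" for h
 proof -
  have "D h = D (\<Sum>b\<in>Basis. (h \<bullet> b) *\<^sub>R b)" by (simp add: euclidean_representation)
  also have "\<dots> = (\<Sum>b\<in>Basis. (h \<bullet> b) * D b)"
   using has_derivative_linear[OF D] by (simp add: linear_sum linear_scale)
  finally show ?thesis using pdiff_eq[OF D] by simp
 qed
 then have "D = (\<lambda>h. \<Sum>b\<in>Basis. (h \<bullet> b) * pdiff b f x)" by (rule ext)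
 then show ?thesis using D by simp
qed

lemmas smooth_has_derivative = differentiable_pdiff[OF smooth_differentiable]

lemma pdiff_add:
 assumes "f differentiable (at x)" "h differentiable (at x)"
 shows "pdiff b (\<lambda>x. f x + h x) x = pdiff b f x + pdiff b h x"
proof -
 obtain D E where D: "(f has_derivative D) (at x)" "(h has_derivative E) (at x)"
  using assms by (auto simp: differentiable_def)
 show ?thesis
  using pdiff_eq[OF has_derivative_add[OF D]] pdiff_eq[OF D(1)] pdiff_eq[OF D(2)] by simp
qed

lemma pdiff_mult:
 fixes f :: "'a::euclidean_space => real"
 assumes "f differentiable (at x)" "h differentiable (at x)"
 shows "pdiff b (\<lambda>x. f x * h x) x = f x * pdiff b h x + pdiff b f x * h x"
proof -
 obtain D E where D: "(f has_derivative D) (at x)" "(h has_derivative E) (at x)"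
  using assms by (auto simp: differentiable_def)
 show ?thesis
  using pdiff_eq[OF has_derivative_mult[OF D]] pdiff_eq[OF D(1)] pdiff_eq[OF D(2)] by simp
qed

lemma pdiff_comp:
 fixes f :: "'a::euclidean_space => real" and j :: "real => real"
 assumes "f differentiable (at x)" "j differentiable (at (f x))"
 shows "pdiff b (\<lambda>x. j (f x)) x = pdiff 1 j (f x) * pdiff b f x"
proof -
 obtain D E where D: "(f has_derivative D) (at x)" "(j has_derivative E) (at (f x))"
  using assms by (auto simp: differentiable_def)
 have "E t = t * E 1" for t
  using linear_scale[OF has_derivative_linear[OF D(2)], of t 1] by simp
 then show ?thesis
  using pdiff_eq[OF has_derivative_compose[OF D]] pdiff_eq[OF D(1), of b] pdiff_eq[OF D(2), of 1]
  by (metis mult.commute)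
qed

text \<open>The derivative of a product or of a composition is again a sum of products, so the
  closure properties of smooth functions support each other and cannot be proved one at a time. This
  class contains all these combinations and is stable under \<open>pdiff\<close>.\<close>

inductive_set smooth_algebra :: "('a::euclidean_space => real) set" where
 base: "smooth f ==> f \<in> smooth_algebra"
| comp: "smooth f ==> smooth (j :: real => real) ==> (\<lambda>x. j (f x)) \<in> smooth_algebra"
| add: "f \<in> smooth_algebra ==> h \<in> smooth_algebra ==> (\<lambda>x. f x + h x) \<in> smooth_algebra"
| mult: "f \<in> smooth_algebra ==> h \<in> smooth_algebra ==> (\<lambda>x. f x * h x) \<in> smooth_algebra"

lemma smooth_algebra_differentiable: "f \<in> smooth_algebra ==> f differentiable (at x)"
proof (induct rule: smooth_algebra.induct)
 case (comp f j)
 have "(j \<circ> f) differentiable (at x)"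
  by (rule differentiable_chain_at) (use comp smooth_differentiable in auto)
 then show ?case by (simp add: o_def)
qed (auto intro: smooth_differentiable)

lemma smooth_algebra_pdiff:
 assumes "f \<in> smooth_algebra" "b \<in> Basis"
 shows "pdiff b f \<in> smooth_algebra"
 using assms(1)
proof (induct rule: smooth_algebra.induct)
 case (base f)
 then show ?case using smooth_pdiff[OF _ assms(2)] smooth_algebra.base by blast
next
 case (comp f j)
 have "pdiff b (\<lambda>x. j (f x)) = (\<lambda>x. pdiff 1 j (f x) * pdiff b f x)"
  using comp by (intro ext pdiff_comp smooth_differentiable)
 moreover have "smooth (pdiff 1 j)" using comp by (intro smooth_pdiff) auto
 ultimately show ?case using comp(1) smooth_pdiff[OF comp(1) assms(2)]
  by (simp add: smooth_algebra.mult smooth_algebra.comp smooth_algebra.base)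
next
 case (add f h)
 have "pdiff b (\<lambda>x. f x + h x) = (\<lambda>x. pdiff b f x + pdiff b h x)"
  using add by (intro ext pdiff_add smooth_algebra_differentiable)
 then show ?case using add by (auto intro!: smooth_algebra.add)
next
 case (mult f h)
 have "pdiff b (\<lambda>x. f x * h x) = (\<lambda>x. f x * pdiff b h x + pdiff b f x * h x)"
  using mult by (intro ext pdiff_mult smooth_algebra_differentiable)
 then show ?case using mult by (auto intro!: smooth_algebra.add smooth_algebra.mult)
qed

lemma smooth_algebra_smooth: "f \<in> smooth_algebra ==> smooth f"
 by (rule smooth_coinduct[of _ smooth_algebra])
  (auto intro: smooth_algebra_differentiable smooth_algebra_pdiff)

lemma smooth_add: "smooth f ==> smooth h ==> smooth (\<lambda>x. f x + h x)"
 and smooth_mult: "smooth f ==> smooth h ==> smooth (\<lambda>x. f x * h x)"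
 and smooth_comp: "smooth f ==> smooth (j :: real => real) ==> smooth (\<lambda>x. j (f x))"
 by (auto intro!: smooth_algebra_smooth intro: smooth_algebra.intros)

lemma pdiff_const [simp]: "pdiff b (\<lambda>_. c) = (\<lambda>_. 0)"
 by (auto simp: pdiff_def)

lemma smooth_const [simp]: "smooth (\<lambda>_. c)"
 by (rule smooth_coinduct[of _ "range (\<lambda>c _. c)"]) auto

lemma smooth_cmult: "smooth f ==> smooth (\<lambda>x. c * f x)"
 by (rule smooth_mult) auto

lemma smooth_uminus: "smooth f ==> smooth (\<lambda>x. - f x)"
 using smooth_cmult[of f "-1"] by simp

lemma smooth_diff: "smooth f ==> smooth h ==> smooth (\<lambda>x. f x - h x)"
 using smooth_add[of f "\<lambda>x. - h x"] smooth_uminus[of h] by simp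

lemma smooth_sum: "(\<And>i. i \<in> I ==> smooth (f i)) ==> smooth (\<lambda>x. \<Sum>i\<in>I. f i x)"
 by (induct I rule: infinite_finite_induct) (auto intro: smooth_add)

lemma smooth_continuous: "smooth f ==> continuous_on S f"
 by (meson continuous_at_imp_continuous_on differentiable_imp_continuous_within smooth_differentiable)

lemma smooth_borel [measurable]: "smooth f ==> f \<in> borel_measurable borel"
 by (intro borel_measurable_continuous_onI smooth_continuous)

lemma pdiff_inner_const: "pdiff b (\<lambda>x. x \<bullet> a) = (\<lambda>_. b \<bullet> a)"
proof
 fix x have "((\<lambda>x. x \<bullet> a) has_derivative (\<lambda>x. x \<bullet> a)) (at x)"
  by (auto intro!: derivative_eq_intros)
 from pdiff_eq[OF this] show "pdiff b (\<lambda>x. x \<bullet> a) x = b \<bullet> a" .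
qed

lemma smooth_inner: "smooth (\<lambda>x. x \<bullet> a)"
 by (rule smooth_coinduct[of _ "insert (\<lambda>x. x \<bullet> a) (range (\<lambda>c _. c))"])
  (auto simp: pdiff_inner_const)

lemma norm_sq_diff_eq:
 "(norm (x - a))\<^sup>2 = (\<Sum>b\<in>Basis. (x \<bullet> b - a \<bullet> b) * (x \<bullet> b - a \<bullet> b))" for x a :: "'a::euclidean_space"
 unfolding power2_norm_eq_inner by (subst euclidean_inner) (simp add: inner_diff_left)

lemma smooth_norm_sq: "smooth (\<lambda>x::'a::euclidean_space. (norm (x - a))\<^sup>2)"
 unfolding norm_sq_diff_eq by (intro smooth_sum smooth_mult smooth_diff smooth_inner smooth_const)

lemma laplacian_smooth: "smooth f ==> smooth (laplacian f)"
 unfolding laplacian_def[abs_def] by (intro smooth_sum smooth_pdiff) auto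

lemma laplacian_add: "smooth f ==> smooth h ==> laplacian (\<lambda>x. f x + h x) x = laplacian f x + laplacian h x"
proof -
 assume s: "smooth f" "smooth h"
 have "pdiff b (\<lambda>x. f x + h x) = (\<lambda>x. pdiff b f x + pdiff b h x)" for b
  using s by (intro ext pdiff_add smooth_differentiable)
 then show ?thesis unfolding laplacian_def
  using s by (simp add: pdiff_add smooth_differentiable smooth_pdiff sum.distrib)
qed

lemma pdiff_cmult: "f differentiable (at x) ==> pdiff b (\<lambda>x. c * f x) x = c * pdiff b f x"
 using pdiff_mult[of "\<lambda>_. c" x f b] by simp

lemma laplacian_cmult: "smooth f ==> laplacian (\<lambda>x. c * f x) x = c * laplacian f x"
proof -
 assume s: "smooth f"
 have "pdiff b (\<lambda>x. c * f x) = (\<lambda>x. c * pdiff b f x)" for b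
  using s by (intro ext pdiff_cmult smooth_differentiable)
 then show ?thesis unfolding laplacian_def
  using s by (simp add: pdiff_cmult smooth_differentiable smooth_pdiff sum_distrib_left)
qed

lemma laplacian_diff: "smooth f ==> smooth h ==> laplacian (\<lambda>x. f x - h x) x = laplacian f x - laplacian h x"
 using laplacian_add[of f "\<lambda>x. -1 * h x" x] laplacian_cmult[of h "-1" x] smooth_cmult[of h "-1"] by simp

lemma laplacian_const [simp]: "laplacian (\<lambda>_. c) x = 0"
 by (simp add: laplacian_def)

lemma laplacian_norm_sq:
 "laplacian (\<lambda>x::'a::euclidean_space. (norm (x - a))\<^sup>2) x = 2 * real DIM('a)"
proof -
 have 1: "pdiff b (\<lambda>x::'a. (norm (x - a))\<^sup>2) y = y \<bullet> (2 *\<^sub>R b) - a \<bullet> (2 *\<^sub>R b)" for b y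
 proof -
  have "((\<lambda>x. (norm (x - a))\<^sup>2) has_derivative (\<lambda>h. 2 * (h \<bullet> (y - a)))) (at y)"
   unfolding power2_norm_eq_inner
   by (auto intro!: derivative_eq_intros simp: inner_commute algebra_simps)
  from pdiff_eq[OF this, of b] show ?thesis by (simp add: inner_diff_right inner_commute)
 qed
 have 2: "pdiff b (\<lambda>y. y \<bullet> (2 *\<^sub>R b) - a \<bullet> (2 *\<^sub>R b)) x = 2" if "b \<in> Basis" for b
 proof -
  have "((\<lambda>y. y \<bullet> (2 *\<^sub>R b) - a \<bullet> (2 *\<^sub>R b)) has_derivative (\<lambda>y. y \<bullet> (2 *\<^sub>R b))) (at x)"
   by (auto intro!: derivative_eq_intros)
  from pdiff_eq[OF this, of b] that show ?thesis by simp
 qed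
 have "laplacian (\<lambda>x::'a. (norm (x - a))\<^sup>2) x = (\<Sum>b\<in>(Basis::'a set). 2)"
  unfolding laplacian_def 1[abs_def] by (intro sum.cong refl 2)
 then show ?thesis by simp
qed

section \<open>A smooth bump\<close>

text \<open>For t > 0 this is exp(-1/t) t^(-n). The derivative of one such function is a combination
  of two others, so their span \<open>exp_inv_span\<close> is stable under differentiation; n = 0 is
  the flat function behind the bump.\<close>

definition exp_inv_pow :: "nat => real => real" where
 "exp_inv_pow n t = (if t > 0 then exp (- (1 / t)) / t ^ n else 0)"

lemma exp_inv_pow_tendsto: "(exp_inv_pow n \<longlongrightarrow> 0) (at 0)"
proof (rule filterlim_split_at)
 show "filterlim (exp_inv_pow n) (nhds 0) (at_left 0)"
  by (rule tendsto_eventually) (auto simp: exp_inv_pow_def eventually_at_filter)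
 have "((\<lambda>t. (inverse t) ^ n / exp (inverse t)) \<longlongrightarrow> (0::real)) (at_right 0)"
  by (rule filterlim_compose[OF tendsto_power_div_exp_0 filterlim_inverse_at_top_right])
 moreover have "\<forall>\<^sub>F t in at_right 0. (inverse t) ^ n / exp (inverse t) = exp_inv_pow n t"
  by (auto simp: exp_inv_pow_def eventually_at_filter field_simps exp_minus power_inverse)
 ultimately show "filterlim (exp_inv_pow n) (nhds 0) (at_right 0)"
  by (rule Lim_transform_eventually)
qed

lemma exp_inv_pow_deriv:
 "(exp_inv_pow n has_field_derivative (exp_inv_pow (n + 2) t + (- real n) * exp_inv_pow (n + 1) t)) (at t)"
proof (cases "t = 0")
 case True
 \<comment> \<open>The difference quotient at 0 is \<open>exp_inv_pow (Suc n)\<close>, whose limit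
   there is 0.\<close>
 have "((\<lambda>h. (exp_inv_pow n (0 + h) - exp_inv_pow n 0) / h) \<longlongrightarrow> 0) (at 0)"
  by (rule Lim_transform_eventually[OF exp_inv_pow_tendsto[of "Suc n"]])
   (auto simp: exp_inv_pow_def eventually_at_filter)
 then show ?thesis using True by (simp add: DERIV_def exp_inv_pow_def)
next
 case False
 show ?thesis
 proof (cases "t > 0")
  case True
  have "((\<lambda>t. exp (- (1 / t)) / t ^ n) has_field_derivative
    (exp_inv_pow (n + 2) t + (- real n) * exp_inv_pow (n + 1) t)) (at t)"
   using True
   by (auto intro!: derivative_eq_intros simp: exp_inv_pow_def divide_simps power2_eq_square)
    (cases n; simp add: algebra_simps)
  then show ?thesis
   by (rule has_field_derivative_transform_within_open[of _ _ _ "{0<..}"])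
    (use True in \<open>auto simp: exp_inv_pow_def\<close>)
 next
  case False
  have "((\<lambda>t. 0) has_field_derivative 0) (at t)" by simp
  then have "(exp_inv_pow n has_field_derivative 0) (at t)"
   by (rule has_field_derivative_transform_within_open[of _ _ _ "{..<0}"])
    (use False \<open>t \<noteq> 0\<close> in \<open>auto simp: exp_inv_pow_def\<close>)
  then show ?thesis using False by (simp add: exp_inv_pow_def)
 qed
qed

inductive_set exp_inv_span :: "(real => real) set" where
 base: "exp_inv_pow n \<in> exp_inv_span"
| add: "f \<in> exp_inv_span ==> h \<in> exp_inv_span ==> (\<lambda>t. f t + h t) \<in> exp_inv_span"
| scale: "f \<in> exp_inv_span ==> (\<lambda>t. c * f t) \<in> exp_inv_span"

lemma field_derivative_pdiff:
 assumes "(f has_field_derivative d) (at t)"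
 shows "f differentiable (at t)" "pdiff 1 f t = d"
 using assms pdiff_eq[of f "(*) d" t 1]
 by (auto simp: has_field_derivative_def differentiable_def)

lemma smooth_exp_inv_pow: "smooth (exp_inv_pow n)"
proof (rule smooth_coinduct[of _ exp_inv_span])
 show d: "h differentiable (at x)" if "h \<in> exp_inv_span" for h x
  using that by induct (auto intro: field_derivative_pdiff(1)[OF exp_inv_pow_deriv])
 show "pdiff b h \<in> exp_inv_span" if "h \<in> exp_inv_span" "b \<in> Basis" for h and b :: real
  using that(1)
 proof induct
  case (base n)
  have "pdiff b (exp_inv_pow n) = (\<lambda>t. exp_inv_pow (n + 2) t + (- real n) * exp_inv_pow (n + 1) t)"
   using that(2) field_derivative_pdiff(2)[OF exp_inv_pow_deriv] by auto
  then show ?case by (metis exp_inv_span.intros)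
 next
  case (add f h)
  then have "pdiff b (\<lambda>t. f t + h t) = (\<lambda>t. pdiff b f t + pdiff b h t)"
   by (intro ext pdiff_add d)
  then show ?case using add by (auto intro: exp_inv_span.add)
 next
  case (scale f c)
  then have "pdiff b (\<lambda>t. c * f t) = (\<lambda>t. c * pdiff b f t)"
   by (intro ext pdiff_cmult d)
  then show ?case using scale by (auto intro: exp_inv_span.scale)
 qed
qed (rule exp_inv_span.base)

lemma bump_exists:
 fixes e :: real
 assumes "e > 0"
 shows "\<exists>\<beta>::'a::euclidean_space => real. smooth \<beta> \<and> (\<forall>x. 0 <= \<beta> x) \<and> (\<forall>x. 0 < \<beta> x \<longleftrightarrow> norm x < e)"
proof (intro exI conjI allI)
 let ?\<beta> = "\<lambda>x::'a. exp_inv_pow 0 (e\<^sup>2 - (norm (x - 0))\<^sup>2)"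
 show "smooth ?\<beta>"
  by (rule smooth_comp[OF smooth_diff[OF smooth_const smooth_norm_sq] smooth_exp_inv_pow])
 show "0 <= ?\<beta> x" for x by (simp add: exp_inv_pow_def)
 show "0 < ?\<beta> x \<longleftrightarrow> norm x < e" for x
  using assms by (auto simp: exp_inv_pow_def intro!: power_strict_mono elim: power_less_imp_less_base)
qed

section \<open>Test functions\<close>

lemma not_tsupport: "x \<notin> tsupport \<phi> ==> \<phi> x = 0"
 using closure_subset[of "{x. \<phi> x \<noteq> 0}"] unfolding tsupport_def by auto

lemma tsupport_subset: "(\<And>x. x \<notin> K ==> \<phi> x = 0) ==> closed K ==> tsupport \<phi> \<subseteq> K"
 unfolding tsupport_def by (rule closure_minimal) auto

lemma test_funI:
 assumes "smooth \<phi>" "compact K" "K \<subseteq> U" "\<And>x. x \<notin> K ==> \<phi> x = 0"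
 shows "test_fun U \<phi>"
proof -
 have s: "tsupport \<phi> \<subseteq> K" by (rule tsupport_subset) (use assms compact_imp_closed in auto)
 have "closed (tsupport \<phi>)" unfolding tsupport_def by simp
 then have "compact (K \<inter> tsupport \<phi>)" using assms(2) compact_Int_closed by blast
 moreover have "K \<inter> tsupport \<phi> = tsupport \<phi>" using s by auto
 ultimately show ?thesis using s assms unfolding test_fun_def by auto
qed

lemma test_funE:
 assumes "test_fun U \<phi>"
 obtains K where "smooth \<phi>" "compact K" "K \<subseteq> U" "\<And>x. x \<notin> K ==> \<phi> x = 0"
 using assms that not_tsupport unfolding test_fun_def by metis

lemma test_fun_smooth: "test_fun U \<phi> ==> smooth \<phi>"
 by (simp add: test_fun_def)

lemma test_fun_mono: "test_fun U \<phi> ==> U \<subseteq> W ==> test_fun W \<phi>"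
 by (auto simp: test_fun_def)

lemma test_fun_UNIV: "test_fun U \<phi> ==> test_fun UNIV \<phi>"
 by (auto simp: test_fun_def)

lemma test_fun_add: "test_fun U f ==> test_fun U h ==> test_fun U (\<lambda>x. f x + h x)"
proof -
 assume "test_fun U f" "test_fun U h"
 then obtain K L where "smooth f" "compact K" "K \<subseteq> U" "\<And>x. x \<notin> K ==> f x = 0"
  "smooth h" "compact L" "L \<subseteq> U" "\<And>x. x \<notin> L ==> h x = 0"
  by (meson test_funE)
 then show ?thesis by (intro test_funI[of _ "K \<union> L"] smooth_add) auto
qed

lemma test_fun_mult:
 assumes "test_fun U f" "smooth h"
 shows "test_fun U (\<lambda>x. f x * h x)" "test_fun U (\<lambda>x. h x * f x)"
 using assms(1) by (auto elim!: test_funE intro!: test_funI smooth_mult assms(2))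

lemma test_fun_cmult: "test_fun U f ==> test_fun U (\<lambda>x. c * f x)"
 using test_fun_mult(2)[of U f "\<lambda>_. c"] by simp

lemma test_fun_diff: "test_fun U f ==> test_fun U h ==> test_fun U (\<lambda>x. f x - h x)"
 using test_fun_add[of U f "\<lambda>x. -1 * h x"] test_fun_cmult[of U h "-1"] by simp

lemma pdiff_outside:
 assumes "closed K" "\<And>x. x \<notin> K ==> f x = 0" "x \<notin> K"
 shows "pdiff b f x = 0"
proof -
 have "((\<lambda>x. 0) has_derivative (\<lambda>x. 0)) (at x)" by simp
 then have "(f has_derivative (\<lambda>x. 0)) (at x)"
  by (rule has_derivative_transform_within_open[of _ _ _ _ "- K"]) (use assms in auto)
 then show ?thesis by (rule pdiff_eq)
qed

lemma laplacian_outside: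
 assumes "closed K" "\<And>x. x \<notin> K ==> f x = 0" "x \<notin> K"
 shows "laplacian f x = 0"
 unfolding laplacian_def by (intro sum.neutral ballI pdiff_outside[OF assms(1)] assms)

lemma test_fun_pdiff: "test_fun U f ==> b \<in> Basis ==> test_fun U (pdiff b f)"
 by (erule test_funE, rule test_funI)
  (auto intro: smooth_pdiff pdiff_outside[OF compact_imp_closed])

lemma test_fun_laplacian: "test_fun U f ==> test_fun U (laplacian f)"
 by (erule test_funE, rule test_funI)
  (auto intro: laplacian_smooth laplacian_outside[OF compact_imp_closed])

lemma test_fun_bounded:
 assumes "test_fun U f"
 obtains B where "\<And>x. \<bar>f x\<bar> <= B" "B > 0"
proof -
 obtain K where K: "smooth f" "compact K" "\<And>x. x \<notin> K ==> f x = 0" using test_funE[OF assms] by metis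
 then have "bounded (f ` K)"
  by (intro compact_imp_bounded compact_continuous_image smooth_continuous)
 then obtain B where "B > 0" "\<And>x. x \<in> K ==> \<bar>f x\<bar> <= B"
  by (auto simp: bounded_pos)
 with K(3) show thesis by (intro that[of B]) (metis abs_zero less_imp_le)
qed

lemma test_fun_integrable:
 assumes "test_fun U f"
 shows "integrable lborel f"
proof -
 obtain K where K: "smooth f" "compact K" "\<And>x. x \<notin> K ==> f x = 0" using test_funE[OF assms] by metis
 then have "set_integrable lborel K f"
  by (intro borel_integrable_compact[unfolded set_integrable_def[symmetric]] smooth_continuous)
 moreover have "(\<lambda>x. indicat_real K x *\<^sub>R f x) = f"
  using K(3) by (intro ext) (metis indicator_simps mult_eq_0_iff mult_1 real_scaleR_def)
 ultimately show ?thesis unfolding set_integrable_def by simp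
qed

text \<open>Two points at distance below 1 either both lie in the ball of radius B + 1, which is
  compact, or both lie off the support.\<close>

lemma continuous_compact_support_uniform:
 fixes f :: "'a::euclidean_space => real"
 assumes "continuous_on UNIV f" "compact K" "\<And>x. x \<notin> K ==> f x = 0"
 shows "uniformly_continuous_on UNIV f"
proof -
 obtain B where B: "K \<subseteq> ball 0 B" "B > 0"
  using bounded_subset_ballD[OF compact_imp_bounded[OF assms(2)], of 0] by auto
 have u: "uniformly_continuous_on (cball 0 (B + 1)) f"
  by (intro compact_uniformly_continuous) (use assms(1) continuous_on_subset in auto)
 show ?thesis unfolding uniformly_continuous_on_def
 proof (intro allI impI)
  fix e :: real assume "e > 0"
  then obtain d where d: "d > 0"
   "\<And>x y. x \<in> cball 0 (B+1) ==> y \<in> cball 0 (B+1) ==> dist y x < d ==> dist (f y) (f x) < e"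
   using u unfolding uniformly_continuous_on_def by metis
  have "dist (f y) (f x) < e" if "dist y x < min d 1" for x y
  proof (cases "x \<in> ball 0 B \<or> y \<in> ball 0 B")
   case True
   have "dist 0 y <= dist 0 x + dist y x" "dist 0 x <= dist 0 y + dist y x"
    by (metis dist_commute dist_triangle)+
   then have "x \<in> cball 0 (B+1)" "y \<in> cball 0 (B+1)" using True that by auto
   then show ?thesis using d that by auto
  next
   case False
   then have "f x = 0" "f y = 0" using B assms(3) by blast+
   then show ?thesis using \<open>e > 0\<close> by simp
  qed
  then show "\<exists>d>0. \<forall>x\<in>UNIV. \<forall>x'\<in>UNIV. dist x' x < d --> dist (f x') (f x) < e"
   using d(1) by (intro exI[of _ "min d 1"]) auto
 qed
qed

lemma test_fun_uniformly_continuous: "test_fun U f ==> uniformly_continuous_on UNIV f"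
 by (metis test_funE continuous_compact_support_uniform smooth_continuous)

section \<open>Integration by parts\<close>

lemma lborel_integral_affine:
 fixes f :: "'a::euclidean_space => real"
 assumes "c \<noteq> 0" and [measurable]: "f \<in> borel_measurable borel"
 shows "integrable lborel (\<lambda>x. f (t + c *\<^sub>R x)) \<longleftrightarrow> integrable lborel f"
  and "integral\<^sup>L lborel f = \<bar>c\<bar> ^ DIM('a) * (LBINT x. f (t + c *\<^sub>R x))"
proof -
 have *: "(lborel :: 'a measure) = density (distr lborel borel (\<lambda>x. t + c *\<^sub>R x)) (\<lambda>_. ennreal (\<bar>c\<bar> ^ DIM('a)))"
  using lborel_affine[OF assms(1), of t] by simp
 show "integral\<^sup>L lborel f = \<bar>c\<bar> ^ DIM('a) * (LBINT x. f (t + c *\<^sub>R x))"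
  by (subst *, subst integral_density) (auto simp: integral_distr)
 show "integrable lborel (\<lambda>x. f (t + c *\<^sub>R x)) \<longleftrightarrow> integrable lborel f"
  by (subst (2) *, subst integrable_density) (auto simp: integrable_distr_eq assms(1))
qed

lemma lborel_integral_translate:
 fixes f :: "'a::euclidean_space => real"
 assumes [measurable]: "f \<in> borel_measurable borel"
 shows "(LBINT x. f (x + t)) = integral\<^sup>L lborel f"
  "integrable lborel (\<lambda>x. f (x + t)) \<longleftrightarrow> integrable lborel f"
  "(LBINT x. f (x - t)) = integral\<^sup>L lborel f"
  "integrable lborel (\<lambda>x. f (x - t)) \<longleftrightarrow> integrable lborel f"
  "(LBINT x. f (t - x)) = integral\<^sup>L lborel f"
  "integrable lborel (\<lambda>x. f (t - x)) \<longleftrightarrow> integrable lborel f"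
 using lborel_integral_affine[of 1 f t] lborel_integral_affine[of 1 f "- t"] lborel_integral_affine[of "-1" f t]
 by (simp_all add: add.commute)

lemma pdiff_DERIV:
 assumes "f differentiable (at x)"
 shows "((\<lambda>t. f (x + t *\<^sub>R b)) has_field_derivative pdiff b f x) (at 0)"
proof -
 have "((\<lambda>t. f (x + t *\<^sub>R b)) has_derivative (\<lambda>t. \<Sum>i\<in>Basis. ((t *\<^sub>R b) \<bullet> i) * pdiff i f x)) (at 0)"
  by (rule has_derivative_compose[of "\<lambda>t. x + t *\<^sub>R b" _ _ _ f])
   (auto intro!: derivative_eq_intros differentiable_pdiff assms)
 moreover have "(\<lambda>t. \<Sum>i\<in>Basis. ((t *\<^sub>R b) \<bullet> i) * pdiff i f x) = (*) (\<Sum>i\<in>Basis. (b \<bullet> i) * pdiff i f x)"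
  by (rule ext) (simp add: sum_distrib_left mult_ac)
 ultimately have "((\<lambda>t. f (x + t *\<^sub>R b)) has_field_derivative (\<Sum>i\<in>Basis. (b \<bullet> i) * pdiff i f x)) (at 0)"
  by (simp add: has_field_derivative_def)
 then show ?thesis unfolding pdiff_def using DERIV_imp_deriv by fastforce
qed

lemma pdiff_DERIV_at:
 assumes "\<And>x. f differentiable (at x)"
 shows "((\<lambda>t. f (x + t *\<^sub>R b)) has_field_derivative pdiff b f (x + s *\<^sub>R b)) (at s)"
proof -
 have "((\<lambda>t. f ((x + s *\<^sub>R b) + t *\<^sub>R b)) has_field_derivative pdiff b f (x + s *\<^sub>R b)) (at 0)"
  by (rule pdiff_DERIV[OF assms])
 then have "((\<lambda>t. f (x + (t + s) *\<^sub>R b)) has_field_derivative pdiff b f (x + s *\<^sub>R b)) (at 0)"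
  by (simp add: algebra_simps)
 then show ?thesis using DERIV_shift[of "\<lambda>t. f (x + t *\<^sub>R b)" _ 0 s] by simp
qed

lemma compact_support_bound:
 fixes f :: "'a::euclidean_space => real"
 assumes "continuous_on UNIV f" "compact K" "\<And>x. x \<notin> K ==> f x = 0"
 obtains B where "\<And>x. \<bar>f x\<bar> <= B" "B > 0"
proof -
 have "bounded (f ` K)"
  by (intro compact_imp_bounded compact_continuous_image assms continuous_on_subset[OF assms(1)]) auto
 then obtain B where "B > 0" "\<And>x. x \<in> K ==> \<bar>f x\<bar> <= B"
  by (auto simp: bounded_pos)
 with assms(3) show thesis by (intro that[of B]) (metis abs_zero less_imp_le)
qed

lemma compact_support_integrable:
 fixes f :: "'a::euclidean_space => real"
 assumes "f \<in> borel_measurable borel" "\<And>x. \<bar>f x\<bar> <= B" "bounded K" "\<And>x. x \<notin> K ==> f x = 0"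
 shows "integrable lborel f"
proof -
 obtain r where r: "K \<subseteq> cball 0 r" using bounded_subset_ballD[OF assms(3), of 0] ball_subset_cball by blast
 have "integrable lborel (\<lambda>x::'a. B * indicator (cball 0 r) x :: real)"
  using emeasure_lborel_cball_finite[of "0::'a" r] by (intro integrable_mult_right integrable_real_indicator) auto
 then show ?thesis
 proof (rule Bochner_Integration.integrable_bound)
  show "AE x in lborel. norm (f x) <= norm (B * indicator (cball 0 r) x :: real)"
  proof (rule AE_I2)
   fix x :: 'a
   show "norm (f x) <= norm (B * indicator (cball 0 r) x :: real)"
    using assms(2)[of x] assms(4)[of x] subsetD[OF r, of x] by (cases "x \<in> cball 0 r") auto
  qed
 qed (use assms(1) in auto)
qed

text \<open>By translation invariance every difference quotient in the direction \<open>b\<close>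
  has integral 0. The mean value theorem bounds these quotients by the supremum of
  \<open>pdiff b f\<close>, and steps of length at most 1 keep them supported in one ball, so
  dominated convergence passes to the derivative.\<close>

lemma integral_pdiff_eq_0:
 fixes f :: "'a::euclidean_space => real"
 assumes d: "\<And>x. f differentiable (at x)" and c: "continuous_on UNIV (pdiff b f)"
  and K: "compact K" "\<And>x. x \<notin> K ==> f x = 0"
 shows "integral\<^sup>L lborel (pdiff b f) = 0"
proof -
 have z: "pdiff b f x = 0" if "x \<notin> K" for x
  using pdiff_outside[OF compact_imp_closed[OF K(1)] K(2) that] .
 obtain B where B: "\<And>x. \<bar>pdiff b f x\<bar> <= B" "B > 0"
  using compact_support_bound[OF c K(1) z] by blast
 have cf: "continuous_on UNIV f"
  using d by (simp add: continuous_at_imp_continuous_on differentiable_imp_continuous_within)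
 have [measurable]: "f \<in> borel_measurable borel" "pdiff b f \<in> borel_measurable borel"
  using cf c by (auto intro: borel_measurable_continuous_onI)
 obtain B' where B': "\<And>x. \<bar>f x\<bar> <= B'" using compact_support_bound[OF cf K] by blast
 have fi: "integrable lborel f"
  by (rule compact_support_integrable[OF _ B' compact_imp_bounded[OF K(1)] K(2)]) auto
 define h where "h n = 1 / real (Suc n)" for n
 have h: "0 < h n" "h n <= 1" for n by (auto simp: h_def)
 define D where "D n x = (f (x + h n *\<^sub>R b) - f x) / h n" for n x
 have mv: "\<bar>D n x\<bar> <= B" for n x
 proof -
  have "\<exists>z>0. z < h n \<and> f (x + h n *\<^sub>R b) - f (x + 0 *\<^sub>R b) = (h n - 0) * pdiff b f (x + z *\<^sub>R b)"
   by (rule MVT2[OF h(1)]) (rule pdiff_DERIV_at[OF d])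
  then obtain z where "f (x + h n *\<^sub>R b) - f x = h n * pdiff b f (x + z *\<^sub>R b)" by auto
  then have "D n x = pdiff b f (x + z *\<^sub>R b)" using h(1)[of n] by (simp add: D_def)
  then show ?thesis using B by simp
 qed
 obtain r where r: "K \<subseteq> cball 0 r"
  using bounded_subset_ballD[OF compact_imp_bounded[OF K(1)], of 0] ball_subset_cball by blast
 have out: "D n x = 0" if "x \<notin> cball 0 (r + norm b)" for n x
 proof -
  have "norm (h n *\<^sub>R b) <= norm b" using h[of n] by (simp add: mult_left_le_one_le)
  then have "norm (x + h n *\<^sub>R b) > r" "norm x > r"
   using that norm_diff_ineq[of x "h n *\<^sub>R b"] norm_ge_zero[of b]
   unfolding mem_cball dist_norm diff_0 norm_minus_cancel by linarith+
  then have "x \<notin> K" "x + h n *\<^sub>R b \<notin> K" using r by (auto simp: subset_iff)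
  then show ?thesis using K(2) by (simp add: D_def)
 qed
 have "(\<lambda>n. integral\<^sup>L lborel (D n)) \<longlonglongrightarrow> integral\<^sup>L lborel (pdiff b f)"
 proof (rule integral_dominated_convergence[where w="\<lambda>x. B * indicator (cball 0 (r + norm b)) x"])
  show "integrable lborel (\<lambda>x::'a. B * indicator (cball 0 (r + norm b)) x :: real)"
   using emeasure_lborel_cball_finite[of "0::'a"] by (intro integrable_mult_right integrable_real_indicator) auto
  show "AE x in lborel. (\<lambda>n. D n x) \<longlonglongrightarrow> pdiff b f x"
  proof (rule AE_I2)
   fix x
   have "((\<lambda>t. (f (x + t *\<^sub>R b) - f x) / t) \<longlongrightarrow> pdiff b f x) (at 0)"
    using pdiff_DERIV[OF d, of x b] by (simp add: DERIV_def)
   moreover have "filterlim h (at 0) sequentially"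
    unfolding filterlim_at using LIMSEQ_inverse_real_of_nat less_imp_neq[OF h(1)]
    by (auto simp: h_def[abs_def] inverse_eq_divide)
   ultimately show "(\<lambda>n. D n x) \<longlonglongrightarrow> pdiff b f x" unfolding D_def
    by (rule filterlim_compose[where f=h])
  qed
  show "AE x in lborel. norm (D n x) <= B * indicator (cball 0 (r + norm b)) x" for n
   using mv out by (intro AE_I2) (auto simp: indicator_def)
 qed (auto simp: D_def[abs_def])
 moreover have "integral\<^sup>L lborel (D n) = 0" for n
 proof -
  have "integrable lborel (\<lambda>x. f (x + h n *\<^sub>R b))" "(LBINT x. f (x + h n *\<^sub>R b)) = integral\<^sup>L lborel f"
   using lborel_integral_translate(1,2)[of f "h n *\<^sub>R b"] fi by auto
  then have "(LBINT x. f (x + h n *\<^sub>R b) - f x) = 0" using fi by simp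
  then show ?thesis unfolding D_def by simp
 qed
 ultimately have "(\<lambda>n::nat. 0) \<longlonglongrightarrow> integral\<^sup>L lborel (pdiff b f)" by simp
 then show ?thesis by (rule LIMSEQ_unique[OF _ tendsto_const])
qed

lemma integral_by_parts:
 fixes f h :: "'a::euclidean_space => real"
 assumes "\<And>x. f differentiable (at x)" "\<And>x. h differentiable (at x)"
  and "continuous_on UNIV (pdiff b f)" "continuous_on UNIV (pdiff b h)"
  and K: "compact K" "\<And>x. x \<notin> K ==> f x = 0"
 shows "(LBINT x. pdiff b f x * h x) = - (LBINT x. f x * pdiff b h x)"
  and "integrable lborel (\<lambda>x. f x * pdiff b h x)"
  and "integrable lborel (\<lambda>x. pdiff b f x * h x)"
proof -
 have c: "continuous_on UNIV f" "continuous_on UNIV h"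
  using assms by (simp_all add: continuous_at_imp_continuous_on differentiable_imp_continuous_within)
 have i: "integrable lborel p" if p: "continuous_on UNIV p" "\<And>x. x \<notin> K ==> p x = 0" for p :: "'a => real"
  using compact_support_bound[OF p(1) K(1) p(2)]
   compact_support_integrable[OF borel_measurable_continuous_onI[OF p(1)] _ compact_imp_bounded[OF K(1)] p(2)]
  by metis
 have z: "pdiff b f x = 0" if "x \<notin> K" for x
  using pdiff_outside[OF compact_imp_closed[OF K(1)] K(2) that] .
 show 1: "integrable lborel (\<lambda>x. f x * pdiff b h x)"
  by (rule i) (auto intro!: continuous_intros c assms simp: K(2))
 show 2: "integrable lborel (\<lambda>x. pdiff b f x * h x)"
  by (rule i) (auto intro!: continuous_intros c assms simp: z)
 have e: "pdiff b (\<lambda>x. f x * h x) = (\<lambda>x. f x * pdiff b h x + pdiff b f x * h x)"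
  by (intro ext pdiff_mult assms)
 have "integral\<^sup>L lborel (pdiff b (\<lambda>x. f x * h x)) = 0"
  by (rule integral_pdiff_eq_0[OF _ _ K(1)])
   (auto simp: K(2) e intro!: continuous_intros c assms differentiable_mult)
 then show "(LBINT x. pdiff b f x * h x) = - (LBINT x. f x * pdiff b h x)"
  unfolding e using 1 2 by simp
qed

lemma test_fun_by_parts:
 assumes f: "test_fun UNIV f" and h: "smooth h" and b: "b \<in> Basis"
 shows "(LBINT x. pdiff b f x * h x) = - (LBINT x. f x * pdiff b h x)"
  and "integrable lborel (\<lambda>x. f x * pdiff b h x)"
  and "integrable lborel (\<lambda>x. pdiff b f x * h x)"
proof -
 obtain K where K: "smooth f" "compact K" "\<And>x. x \<notin> K ==> f x = 0" using test_funE[OF f] by metis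
 note * = integral_by_parts[OF smooth_differentiable[OF K(1)] smooth_differentiable[OF h]
  smooth_continuous[OF smooth_pdiff[OF K(1) b]] smooth_continuous[OF smooth_pdiff[OF h b]] K(2,3)]
 show "(LBINT x. pdiff b f x * h x) = - (LBINT x. f x * pdiff b h x)"
  "integrable lborel (\<lambda>x. f x * pdiff b h x)" "integrable lborel (\<lambda>x. pdiff b f x * h x)"
  using * by auto
qed

lemma green_first:
 assumes f: "test_fun UNIV f" and h: "smooth h"
 shows "(LBINT x. f x * laplacian h x) = - (LBINT x. (\<Sum>b\<in>Basis. pdiff b f x * pdiff b h x))"
proof -
 have "(LBINT x. f x * laplacian h x) = (\<Sum>b\<in>Basis. \<integral>x. f x * pdiff b (pdiff b h) x \<partial>lborel)"
  unfolding laplacian_def sum_distrib_left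
  by (rule Bochner_Integration.integral_sum) (rule test_fun_by_parts[OF f smooth_pdiff[OF h]])
 also have "\<dots> = (\<Sum>b\<in>Basis. - (LBINT x. pdiff b f x * pdiff b h x))"
  by (intro sum.cong refl) (simp add: test_fun_by_parts(1)[OF f smooth_pdiff[OF h]])
 also have "\<dots> = - (LBINT x. (\<Sum>b\<in>Basis. pdiff b f x * pdiff b h x))"
  by (subst Bochner_Integration.integral_sum) (auto simp: sum_negf intro: test_fun_by_parts[OF f smooth_pdiff[OF h]])
 finally show ?thesis .
qed

lemma green_second:
 assumes f: "test_fun UNIV f" and h: "smooth h"
 shows "(LBINT x. h x * laplacian f x) = (LBINT x. f x * laplacian h x)"
proof -
 have "(LBINT x. h x * laplacian f x) = (\<Sum>b\<in>Basis. \<integral>x. pdiff b (pdiff b f) x * h x \<partial>lborel)"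
  unfolding laplacian_def sum_distrib_right mult.commute[of "h _"]
  by (rule Bochner_Integration.integral_sum) (rule test_fun_by_parts[OF test_fun_pdiff[OF f] h])
 also have "\<dots> = (\<Sum>b\<in>Basis. - (LBINT x. pdiff b f x * pdiff b h x))"
  by (intro sum.cong refl) (simp add: test_fun_by_parts(1)[OF test_fun_pdiff[OF f] h])
 also have "\<dots> = - (LBINT x. (\<Sum>b\<in>Basis. pdiff b f x * pdiff b h x))"
  by (subst Bochner_Integration.integral_sum) (auto simp: sum_negf intro: test_fun_by_parts[OF f smooth_pdiff[OF h]])
 finally show ?thesis using green_first[OF f h] by simp
qed

section \<open>Convolution with a finite measure\<close>

text \<open>The kernel is a measure and not a density, because the averaging kernels arise as image
  measures.\<close>

definition conv :: "'a::euclidean_space measure => ('a => real) => 'a => real" where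
 "conv \<nu> f x = (\<integral>y. f (x - y) \<partial>\<nu>)"

locale finite_borel = finite_measure \<nu> for \<nu> :: "'a::euclidean_space measure" +
 assumes sets_borel [measurable_cong, simp]: "sets \<nu> = sets borel"
begin

lemma space_UNIV [simp]: "space \<nu> = UNIV"
 using sets_eq_imp_space_eq[OF sets_borel] by simp

lemma conv_integrable:
 fixes f :: "'a => real"
 assumes "f \<in> borel_measurable borel" "\<And>x. \<bar>f x\<bar> <= B"
 shows "integrable \<nu> (\<lambda>y. f (x - y))"
proof -
 have [measurable]: "f \<in> borel_measurable borel" by fact
 show ?thesis by (rule integrable_const_bound[of _ B]) (use assms(2) in auto)
qed

lemma test_conv_integrable: "test_fun UNIV f ==> integrable \<nu> (\<lambda>y. f (x - y))"
proof -
 assume f: "test_fun UNIV f"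
 obtain B where "\<And>x. \<bar>f x\<bar> <= B" using test_fun_bounded[OF f] by blast
 then show ?thesis by (rule conv_integrable[OF smooth_borel[OF test_fun_smooth[OF f]]])
qed

end

text \<open>The first order Taylor remainder is small uniformly in the base point, because the
  partial derivatives of a test function are uniformly continuous. This uniformity survives
  integration against a finite measure and so allows differentiation under the integral
  sign.\<close>

lemma test_fun_uniform_derivative:
 fixes f :: "'a::euclidean_space => real"
 assumes f: "test_fun UNIV f" and "e > 0"
 obtains d where "d > 0"
  "\<And>z h. norm h < d ==> \<bar>f (z + h) - f z - (\<Sum>b\<in>Basis. (h \<bullet> b) * pdiff b f z)\<bar> <= e * norm h"
proof -
 define \<epsilon> where "\<epsilon> = e / real DIM('a)"
 have \<epsilon>: "\<epsilon> > 0" using assms(2) by (simp add: \<epsilon>_def)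
 have "\<forall>b\<in>Basis. \<exists>d>0. \<forall>z w. norm (z - w) < d --> \<bar>pdiff b f z - pdiff b f w\<bar> < \<epsilon>"
  using test_fun_uniformly_continuous[OF test_fun_pdiff[OF f]] \<epsilon>
  unfolding uniformly_continuous_on_def dist_norm by (metis UNIV_I real_norm_def)
 then obtain d where d: "\<And>b. b \<in> Basis ==> d b > 0"
  "\<And>b z w. b \<in> Basis ==> norm (z - w) < d b ==> \<bar>pdiff b f z - pdiff b f w\<bar> < \<epsilon>"
  by metis
 define \<delta> where "\<delta> = Min (d ` Basis)"
 have \<delta>: "\<delta> > 0" "\<And>b. b \<in> Basis ==> \<delta> <= d b" using d(1) by (auto simp: \<delta>_def)
 have "\<bar>f (z + h) - f z - (\<Sum>b\<in>Basis. (h \<bullet> b) * pdiff b f z)\<bar> <= e * norm h" if h: "norm h < \<delta>" for z h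
 proof -
  have deriv: "((\<lambda>t. f (z + t *\<^sub>R h)) has_field_derivative (\<Sum>b\<in>Basis. (h \<bullet> b) * pdiff b f (z + s *\<^sub>R h))) (at s)" for s
  proof -
   have "((\<lambda>t. f (z + t *\<^sub>R h)) has_derivative (\<lambda>t. \<Sum>b\<in>Basis. ((t *\<^sub>R h) \<bullet> b) * pdiff b f (z + s *\<^sub>R h))) (at s)"
    by (rule has_derivative_compose[of "\<lambda>t. z + t *\<^sub>R h" _ _ _ f])
     (auto intro!: derivative_eq_intros smooth_has_derivative test_fun_smooth[OF f])
   moreover have "(\<lambda>t. \<Sum>b\<in>Basis. ((t *\<^sub>R h) \<bullet> b) * pdiff b f (z + s *\<^sub>R h)) = (*) (\<Sum>b\<in>Basis. (h \<bullet> b) * pdiff b f (z + s *\<^sub>R h))"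
    by (rule ext) (simp add: sum_distrib_left mult_ac)
   ultimately show ?thesis by (simp add: has_field_derivative_def)
  qed
  have "\<exists>s>0. s < 1 \<and> f (z + 1 *\<^sub>R h) - f (z + 0 *\<^sub>R h) = (1 - 0) * (\<Sum>b\<in>Basis. (h \<bullet> b) * pdiff b f (z + s *\<^sub>R h))"
   by (rule MVT2) (auto intro: deriv)
  then obtain s where s: "0 < s" "s < 1" "f (z + h) - f z = (\<Sum>b\<in>Basis. (h \<bullet> b) * pdiff b f (z + s *\<^sub>R h))" by auto
  have sm: "norm ((z + s *\<^sub>R h) - z) < \<delta>" using s h by (simp add: mult_less_cancel_right1 order.strict_trans1[of _ "norm h"] mult_left_le_one_le)
  have "\<bar>f (z + h) - f z - (\<Sum>b\<in>Basis. (h \<bullet> b) * pdiff b f z)\<bar> =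
    \<bar>\<Sum>b\<in>Basis. (h \<bullet> b) * (pdiff b f (z + s *\<^sub>R h) - pdiff b f z)\<bar>"
   by (simp add: s(3) sum_subtractf right_diff_distrib)
  also have "\<dots> <= (\<Sum>b\<in>(Basis::'a set). norm h * \<epsilon>)"
  proof (rule order_trans[OF sum_abs] sum_mono)+
   fix b :: 'a assume b: "b \<in> Basis"
   have "\<bar>pdiff b f (z + s *\<^sub>R h) - pdiff b f z\<bar> <= \<epsilon>"
    using d(2)[OF b, of "z + s *\<^sub>R h" z] sm \<delta>(2)[OF b] by simp
   then show "\<bar>(h \<bullet> b) * (pdiff b f (z + s *\<^sub>R h) - pdiff b f z)\<bar> <= norm h * \<epsilon>"
    unfolding abs_mult using Basis_le_norm[OF b, of h] \<epsilon> by (intro mult_mono) auto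
  qed
  also have "\<dots> = e * norm h" by (simp add: \<epsilon>_def)
  finally show ?thesis .
 qed
 then show thesis using that \<delta>(1) by blast
qed

context finite_borel begin

lemma conv_has_derivative:
 assumes f: "test_fun UNIV f"
 shows "(conv \<nu> f has_derivative (\<lambda>h. \<Sum>b\<in>Basis. (h \<bullet> b) * conv \<nu> (pdiff b f) x)) (at x)"
 unfolding has_derivative_at'
proof (intro conjI allI impI)
 show "bounded_linear (\<lambda>h. \<Sum>b\<in>Basis. (h \<bullet> b) * conv \<nu> (pdiff b f) x)"
  by (intro bounded_linear_sum bounded_linear_mult_const bounded_linear_inner_left)
 fix e :: real assume e: "e > 0"
 define m where "m = measure \<nu> UNIV"
 have m: "m >= 0" by (simp add: m_def)
 obtain d where d: "d > 0"
  "\<And>z h. norm h < d ==> \<bar>f (z + h) - f z - (\<Sum>b\<in>Basis. (h \<bullet> b) * pdiff b f z)\<bar> <= (e / (m + 1)) * norm h"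
  using test_fun_uniform_derivative[OF f, of "e / (m+1)"] e m by auto
 have "norm (conv \<nu> f y - conv \<nu> f x - (\<Sum>b\<in>Basis. ((y - x) \<bullet> b) * conv \<nu> (pdiff b f) x)) / norm (y - x) < e"
  if y: "0 < norm (y - x)" "norm (y - x) < d" for y
 proof -
  have "conv \<nu> f y - conv \<nu> f x - (\<Sum>b\<in>Basis. ((y - x) \<bullet> b) * conv \<nu> (pdiff b f) x) =
   (\<integral>w. f ((x - w) + (y - x)) - f (x - w) - (\<Sum>b\<in>Basis. ((y - x) \<bullet> b) * pdiff b f (x - w)) \<partial>\<nu>)"
   unfolding conv_def using f
   by (subst Bochner_Integration.integral_diff | subst Bochner_Integration.integral_sum |
     simp add: test_conv_integrable test_fun_pdiff)+
  also have "norm \<dots> <= (\<integral>w. (e / (m + 1)) * norm (y - x) \<partial>\<nu>)"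
  proof (rule order_trans[OF integral_norm_bound] integral_mono)+
   show "integrable \<nu> (\<lambda>w. norm (f (x - w + (y - x)) - f (x - w) - (\<Sum>b\<in>Basis. ((y - x) \<bullet> b) * pdiff b f (x - w))))"
    using test_conv_integrable[OF f, of x] test_conv_integrable[OF f, of y] test_conv_integrable[OF test_fun_pdiff[OF f], of _ x]
    by (intro integrable_norm Bochner_Integration.integrable_diff Bochner_Integration.integrable_sum integrable_mult_right) auto
   show "norm (f (x - w + (y - x)) - f (x - w) - (\<Sum>b\<in>Basis. ((y - x) \<bullet> b) * pdiff b f (x - w)))
     <= e / (m + 1) * norm (y - x)" for w
    using d(2)[OF y(2), of "x - w"] by (simp only: real_norm_def)
  qed auto
  also have "\<dots> = m * (e / (m + 1)) * norm (y - x)" by (simp add: m_def)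
  also have "\<dots> < e * norm (y - x)"
   using y e m by (intro mult_strict_right_mono) (auto simp: field_simps)
  finally show ?thesis using y by (simp add: field_simps)
 qed
 with d(1) show "\<exists>d>0. \<forall>y. 0 < norm (y - x) \<and> norm (y - x) < d -->
   norm (conv \<nu> f y - conv \<nu> f x - (\<Sum>b\<in>Basis. ((y - x) \<bullet> b) * conv \<nu> (pdiff b f) x)) / norm (y - x) < e"
  by blast
qed

lemma pdiff_conv: "test_fun UNIV f ==> b \<in> Basis ==> pdiff b (conv \<nu> f) = conv \<nu> (pdiff b f)"
 by (intro ext) (simp add: pdiff_eq[OF conv_has_derivative] inner_Basis if_distrib if_distribR sum.If_cases)

lemma smooth_conv:
 assumes "test_fun UNIV f"
 shows "smooth (conv \<nu> f)"
proof (rule smooth_coinduct[of _ "conv \<nu> ` {f. test_fun UNIV f}"])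
 show "h differentiable (at x)" if "h \<in> conv \<nu> ` {f. test_fun UNIV f}" for h x
  using that conv_has_derivative differentiable_def by fastforce
 show "pdiff b h \<in> conv \<nu> ` {f. test_fun UNIV f}" if "h \<in> conv \<nu> ` {f. test_fun UNIV f}" "b \<in> Basis" for b h
  using that pdiff_conv test_fun_pdiff by fastforce
qed (use assms in auto)

lemma laplacian_conv:
 assumes f: "test_fun UNIV f"
 shows "laplacian (conv \<nu> f) = conv \<nu> (laplacian f)"
proof
 fix x
 have "laplacian (conv \<nu> f) x = (\<Sum>b\<in>Basis. conv \<nu> (pdiff b (pdiff b f)) x)"
  unfolding laplacian_def by (intro sum.cong refl) (simp add: pdiff_conv f test_fun_pdiff)
 also have "\<dots> = conv \<nu> (laplacian f) x" unfolding conv_def laplacian_def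
  by (rule Bochner_Integration.integral_sum[symmetric]) (intro test_conv_integrable test_fun_pdiff f)
 finally show "laplacian (conv \<nu> f) x = conv \<nu> (laplacian f) x" .
qed

end

text \<open>For compact K and nonnegative r this is the closed r-neighbourhood; written as a
  Minkowski sum with a closed ball it inherits compactness from K.\<close>

definition enlarge :: "real => 'a::euclidean_space set => 'a set" where
 "enlarge r K = {x + y |x y. x \<in> K \<and> y \<in> cball 0 r}"

lemma compact_enlarge: "compact K ==> compact (enlarge r K)"
 unfolding enlarge_def by (rule compact_sums) auto

lemma enlarge_eq: "enlarge r K = (\<Union>x\<in>K. cball x r)"
proof (intro set_eqI iffI)
 fix z assume "z \<in> (\<Union>x\<in>K. cball x r)"
 then obtain x where "x \<in> K" "dist x z <= r" by auto
 then have "z = x + (z - x)" "z - x \<in> cball 0 r" by (auto simp: dist_norm norm_minus_commute)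
 then show "z \<in> enlarge r K" using \<open>x \<in> K\<close> unfolding enlarge_def by blast
next
 fix z assume "z \<in> enlarge r K"
 then obtain x y where "z = x + y" "x \<in> K" "norm y <= r" by (auto simp: enlarge_def)
 then show "z \<in> (\<Union>x\<in>K. cball x r)" by (intro UN_I[of x]) (auto simp: dist_norm)
qed

lemma enlarge_mono: "K \<subseteq> L ==> r <= s ==> enlarge r K \<subseteq> enlarge s L"
 unfolding enlarge_eq by (meson UN_mono subset_cball)

lemma enlarge_enlarge: "r >= 0 ==> s >= 0 ==> enlarge r (enlarge s K) \<subseteq> enlarge (r + s) K"
 unfolding enlarge_def
proof safe
 fix x y z :: 'a assume "x \<in> K" "y \<in> cball 0 s" "z \<in> cball 0 r"
 then show "\<exists>x' y'. x + y + z = x' + y' \<and> x' \<in> K \<and> y' \<in> cball 0 (r + s)"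
  by (intro exI[of _ x] exI[of _ "y + z"]) (auto intro: norm_triangle_le)
qed

lemma enlarge_superset: "r >= 0 ==> K \<subseteq> enlarge r K"
 unfolding enlarge_eq by force

lemma compact_enlarge_subset:
 assumes "compact K" "open U" "K \<subseteq> U"
 obtains r where "r > 0" "enlarge r K \<subseteq> U"
 using compact_subset_open_imp_cball_epsilon_subset[OF assms] unfolding enlarge_eq by metis

lemma infdist_enlarge:
 assumes "closed F" "F \<noteq> {}" "infdist x F < d"
 shows "x \<in> enlarge d F"
proof -
 obtain y where "y \<in> F" "infdist x F = dist x y" using infdist_attains_inf[OF assms(1,2)] by metis
 then show ?thesis using assms(3) by (auto simp: enlarge_eq dist_commute intro!: bexI[of _ y])
qed

lemma conv_outside:
 assumes "AE y in \<nu>. y \<in> cball 0 r" "\<And>x. x \<notin> K ==> f x = 0" "x \<notin> enlarge r K"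
 shows "conv \<nu> f x = 0"
proof -
 have "AE y in \<nu>. f (x - y) = 0"
  using assms(1)
 proof eventually_elim
  case (elim y)
  have "x - y \<notin> K"
  proof
   assume "x - y \<in> K"
   then have "x \<in> enlarge r K" using elim unfolding enlarge_eq by (auto simp: dist_norm intro!: bexI[of _ "x - y"])
   then show False using assms(3) by simp
  qed
  then show ?case using assms(2) by simp
 qed
 then show ?thesis unfolding conv_def by (rule integral_eq_zero_AE)
qed

lemma (in finite_borel) test_fun_conv:
 assumes f: "smooth f" "compact K" "\<And>x. x \<notin> K ==> f x = 0"
  and r: "AE y in \<nu>. y \<in> cball 0 r" "enlarge r K \<subseteq> U"
 shows "test_fun U (conv \<nu> f)"
proof (rule test_funI[OF smooth_conv compact_enlarge[OF f(2)] r(2)])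
 show "test_fun UNIV f" by (rule test_funI[OF f(1,2)]) (use f(3) in auto)
 show "conv \<nu> f x = 0" if "x \<notin> enlarge r K" for x
  by (rule conv_outside[OF r(1) f(3) that])
qed

lemma finite_borel_density_indicator:
 fixes A :: "'a::euclidean_space set"
 assumes "bounded A" "A \<in> sets borel"
 shows "finite_borel (density lborel (indicator A))"
proof -
 have f: "emeasure lborel A < \<infinity>" using assms emeasure_bounded_finite by auto
 have "emeasure (density lborel (indicator A)) (space lborel) = emeasure lborel A"
  using assms(2) by (subst emeasure_density) (simp_all add: nn_integral_indicator)
 then show ?thesis using f
  by (intro finite_borel.intro finite_measureI finite_borel_axioms.intro) simp_all
qed

text \<open>A bump supported in radius r is averaged over the 2r-neighbourhood of K and divided by
  its integral. The result is 1 on the r-neighbourhood, from where the bump sees only that set, and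
  0 off the 3r-neighbourhood, which fits into U.\<close>

lemma cutoff_exists:
 assumes "compact (K :: 'a::euclidean_space set)" "open U" "K \<subseteq> U"
 obtains \<theta> r where "test_fun U \<theta>" "\<And>x. 0 <= \<theta> x" "\<And>x. \<theta> x <= 1" "r > 0" "\<And>x. x \<in> enlarge r K ==> \<theta> x = 1"
proof -
 obtain r0 where r0: "r0 > 0" "enlarge r0 K \<subseteq> U" by (rule compact_enlarge_subset[OF assms])
 define r where "r = r0 / 3"
 have r: "r > 0" using r0 by (simp add: r_def)
 obtain \<beta> :: "'a => real" where \<beta>: "smooth \<beta>" "\<And>x. 0 <= \<beta> x" "\<And>x. 0 < \<beta> x \<longleftrightarrow> norm x < r"
  using bump_exists[OF r] by blast
 have \<beta>0: "\<beta> x = 0" if "x \<notin> cball 0 r" for x using \<beta>(2,3)[of x] that by (auto simp: less_eq_real_def)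
 have t: "test_fun UNIV \<beta>" by (rule test_funI[OF \<beta>(1), of "cball 0 r"]) (use \<beta>0 in auto)
 have [measurable]: "\<beta> \<in> borel_measurable borel" using smooth_borel[OF \<beta>(1)] .
 have int: "integrable lborel \<beta>" by (rule test_fun_integrable[OF t])
 define I where "I = integral\<^sup>L lborel \<beta>"
 have "I \<noteq> 0"
 proof
  assume "I = 0"
  then have "AE x in lborel. \<beta> x = 0" using \<beta>(2) int unfolding I_def by (subst (asm) integral_nonneg_eq_0_iff_AE) auto
  then have "AE x in lborel. x \<notin> ball (0::'a) r"
   by eventually_elim (metis \<beta>(3) less_irrefl mem_ball_0)
  then have "ball (0::'a) r \<in> null_sets lborel" by (subst (asm) AE_iff_null_sets[symmetric]) auto
  then show False using r emeasure_ball[of r "0::'a"] unit_ball_vol_pos[of "real DIM('a)"] by (auto simp: null_sets_def)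
 qed
 moreover have "I >= 0" unfolding I_def using \<beta>(2) by (intro Bochner_Integration.integral_nonneg) auto
 ultimately have I: "I > 0" by simp
 define A where "A = enlarge (2 * r) K"
 have A: "compact A" unfolding A_def by (rule compact_enlarge[OF assms(1)])
 then have [measurable]: "A \<in> sets borel" by (simp add: compact_imp_closed)
 interpret finite_borel "density lborel (indicator A :: 'a => ennreal)"
  by (rule finite_borel_density_indicator) (use A compact_imp_bounded in auto)
 define \<theta> where "\<theta> x = (1 / I) * conv (density lborel (indicator A)) \<beta> x" for x
 have ceq: "conv (density lborel (indicator A)) \<beta> x = (LBINT y. indicator A y * \<beta> (x - y))" for x
 proof -
  have "density lborel (indicator A) = density lborel (\<lambda>y. ennreal (indicator A y))"
   by (intro arg_cong[of _ _ "density lborel"] ext) (auto simp: indicator_def)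
  moreover have "(\<integral>y. \<beta> (x - y) \<partial>density lborel (\<lambda>y. ennreal (indicator A y))) = (LBINT y. indicator A y *\<^sub>R \<beta> (x - y))"
   by (rule integral_density) auto
  ultimately show ?thesis unfolding conv_def by simp
 qed
 have i1: "integrable lborel (\<lambda>y. \<beta> (x - y))" "(LBINT y. \<beta> (x - y)) = I" for x
  using int lborel_integral_translate(5,6)[of \<beta> x] by (auto simp: I_def)
 have i2: "integrable lborel (\<lambda>y. indicator A y * \<beta> (x - y))" for x
  using integrable_mult_indicator[OF _ i1(1), of A x] by simp
 have "smooth \<theta>" unfolding \<theta>_def by (intro smooth_cmult smooth_conv t)
 moreover have "\<theta> x = 0" if "x \<notin> enlarge (3 * r) K" for x
 proof -
  have "indicator A y * \<beta> (x - y) = 0" for y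
  proof (rule ccontr)
   assume "\<not> ?thesis"
   then have "y \<in> A" "x - y \<in> cball 0 r" using \<beta>0 by (auto simp: indicator_def split: if_splits)
   then have "y + (x - y) \<in> enlarge r A" unfolding enlarge_def by blast
   then show False using that enlarge_enlarge[of r "2*r" K] r by (auto simp: A_def)
  qed
  then show ?thesis by (simp only: \<theta>_def ceq Bochner_Integration.integral_zero mult_zero_right)
 qed
 moreover have "enlarge (3 * r) K \<subseteq> U" using r0 by (simp add: r_def)
 ultimately have 1: "test_fun U \<theta>" by (intro test_funI[OF _ compact_enlarge[OF assms(1)]]) auto
 have 2: "0 <= \<theta> x" for x unfolding \<theta>_def ceq using I \<beta>(2) by (auto intro!: mult_nonneg_nonneg Bochner_Integration.integral_nonneg)
 have 3: "\<theta> x <= 1" for x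
 proof -
  have "(LBINT y. indicator A y * \<beta> (x - y)) <= I"
   unfolding i1(2)[of x, symmetric] by (rule integral_mono[OF i2 i1(1)]) (use \<beta>(2) in \<open>auto simp: indicator_def\<close>)
  then show ?thesis using I by (simp add: \<theta>_def ceq)
 qed
 have 4: "\<theta> x = 1" if "x \<in> enlarge r K" for x
 proof -
  have "indicator A y * \<beta> (x - y) = \<beta> (x - y)" for y
  proof (cases "x - y \<in> cball 0 r")
   case True
   then have "x + (y - x) \<in> enlarge r (enlarge r K)" using that unfolding enlarge_def[of r "enlarge r K"]
    by (intro CollectI exI[of _ x] exI[of _ "y - x"]) (auto simp: norm_minus_commute)
   then have "y \<in> A" using enlarge_enlarge[of r r K] r by (auto simp: A_def)
   then show ?thesis by simp
  qed (use \<beta>0 in auto)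
  then show ?thesis using i1(2)[of x] I by (simp only: \<theta>_def ceq) simp
 qed
 show thesis by (rule that[OF 1 2 3 r 4])
qed

section \<open>The averaging kernels\<close>

text \<open>Convolution with this measure averages against the dilates of the profile
  \<open>\<beta>\<close> by factors t and then over t with weight a, see
  \<open>conv_kernel\<close>.\<close>

definition dilation_kernel :: "(real => real) => ('a::euclidean_space => real) => 'a measure" where
 "dilation_kernel a \<beta> = distr (density (lborel \<Otimes>\<^sub>M lborel) (\<lambda>p. ennreal (a (fst p) * \<beta> (snd p)))) borel
  (\<lambda>p. fst p *\<^sub>R snd p)"

locale kernel_data =
 fixes a :: "real => real" and \<beta> :: "'a::euclidean_space => real" and R A B :: real
 assumes a_borel [measurable]: "a \<in> borel_measurable borel"
  and a_nonneg: "0 <= a t" and a_bound: "a t <= A" and a_outside: "t \<notin> {0..R} ==> a t = 0"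
  and \<beta>_borel [measurable]: "\<beta> \<in> borel_measurable borel"
  and \<beta>_nonneg: "0 <= \<beta> y" and \<beta>_bound: "\<beta> y <= B" and \<beta>_outside: "y \<notin> cball 0 1 ==> \<beta> y = 0"
  and \<beta>_even: "\<beta> (- y) = \<beta> y"
begin

lemma profile_integrable:
 assumes "f \<in> borel_measurable borel" "\<And>y. \<bar>f y\<bar> <= C"
 shows "integrable lborel (\<lambda>y. \<beta> y * f y)"
proof (rule compact_support_integrable)
 show "(\<lambda>y. \<beta> y * f y) \<in> borel_measurable borel" using assms(1) by auto
 show "\<bar>\<beta> y * f y\<bar> <= B * C" for y
  unfolding abs_mult using \<beta>_nonneg[of y] \<beta>_bound[of y] assms(2)[of y] by (intro mult_mono) auto
 show "bounded (cball (0::'a) 1)" by simp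
 show "y \<notin> cball 0 1 ==> \<beta> y * f y = 0" for y using \<beta>_outside by simp
qed

lemma \<beta>_integrable: "integrable lborel \<beta>"
 using profile_integrable[of "\<lambda>_. 1" 1] by simp

lemma weight_integrable:
 assumes [measurable]: "f \<in> borel_measurable borel" and "\<And>y. \<bar>f y\<bar> <= C"
 shows "integrable (lborel \<Otimes>\<^sub>M lborel) (\<lambda>p. (a (fst p) * \<beta> (snd p)) * f (x - fst p *\<^sub>R snd p))"
proof -
 have "integrable lborel (\<lambda>p::real \<times> 'a. (a (fst p) * \<beta> (snd p)) * f (x - fst p *\<^sub>R snd p))"
 proof (rule compact_support_integrable)
  show "bounded ({0..R} \<times> cball (0::'a) 1)" by (intro bounded_Times) auto
  show "\<bar>a (fst p) * \<beta> (snd p) * f (x - fst p *\<^sub>R snd p)\<bar> <= A * B * C" for p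
   unfolding abs_mult
   using a_nonneg[of "fst p"] a_bound[of "fst p"] \<beta>_nonneg[of "snd p"] \<beta>_bound[of "snd p"] assms(2)[of "x - fst p *\<^sub>R snd p"]
   by (intro mult_mono mult_nonneg_nonneg) auto
  show "p \<notin> {0..R} \<times> cball 0 1 ==> a (fst p) * \<beta> (snd p) * f (x - fst p *\<^sub>R snd p) = 0" for p
   using a_outside[of "fst p"] \<beta>_outside[of "snd p"] by (cases p) auto
  show "(\<lambda>p. a (fst p) * \<beta> (snd p) * f (x - fst p *\<^sub>R snd p)) \<in> borel_measurable borel"
   unfolding borel_prod[symmetric] by measurable
 qed
 then show ?thesis by (simp add: lborel_prod)
qed

lemma kernel_emeasure:
 assumes [measurable]: "S \<in> sets borel"
 shows "emeasure (dilation_kernel a \<beta>) S = (\<integral>\<^sup>+p. ennreal (a (fst p) * \<beta> (snd p)) * indicator S (fst p *\<^sub>R snd p) \<partial>(lborel \<Otimes>\<^sub>M lborel))"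
proof -
 let ?M = "lborel \<Otimes>\<^sub>M lborel :: (real \<times> 'a) measure" and ?T = "\<lambda>p::real \<times> 'a. fst p *\<^sub>R snd p"
 have T[measurable]: "?T \<in> ?M \<rightarrow>\<^sub>M borel" by measurable
 have m: "?T -` S \<inter> space ?M \<in> sets ?M" by (rule measurable_sets[OF T]) auto
 have "emeasure (dilation_kernel a \<beta>) S = emeasure (density ?M (\<lambda>p. ennreal (a (fst p) * \<beta> (snd p)))) (?T -` S \<inter> space ?M)"
  unfolding dilation_kernel_def by (subst emeasure_distr) auto
 also have "\<dots> = (\<integral>\<^sup>+p. ennreal (a (fst p) * \<beta> (snd p)) * indicator (?T -` S \<inter> space ?M) p \<partial>?M)"
  by (rule emeasure_density) (use m in auto)
 also have "\<dots> = (\<integral>\<^sup>+p. ennreal (a (fst p) * \<beta> (snd p)) * indicator S (fst p *\<^sub>R snd p) \<partial>?M)"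
  by (intro nn_integral_cong) (auto simp: indicator_def)
 finally show ?thesis .
qed

lemma weight_nonneg: "0 <= a t * \<beta> y"
 using a_nonneg \<beta>_nonneg by simp

lemma finite_borel_kernel: "finite_borel (dilation_kernel a \<beta>)"
proof -
 have "integrable (lborel \<Otimes>\<^sub>M lborel) (\<lambda>p. a (fst p) * \<beta> (snd p))"
  using weight_integrable[of "\<lambda>_. 1" 1] by simp
 then have "(\<integral>\<^sup>+p. ennreal (norm (a (fst p) * \<beta> (snd p))) \<partial>(lborel \<Otimes>\<^sub>M lborel)) < \<infinity>"
  by (simp add: integrable_iff_bounded)
 then have "emeasure (dilation_kernel a \<beta>) UNIV \<noteq> \<infinity>"
  by (subst kernel_emeasure) (auto simp: weight_nonneg abs_mult a_nonneg \<beta>_nonneg)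
 moreover have "space (dilation_kernel a \<beta>) = UNIV" by (simp add: dilation_kernel_def)
 ultimately show ?thesis
  by (intro finite_borel.intro finite_measureI finite_borel_axioms.intro) (simp_all add: dilation_kernel_def)
qed

sublocale finite_borel "dilation_kernel a \<beta>" by (rule finite_borel_kernel)

lemma kernel_support: "AE y in dilation_kernel a \<beta>. y \<in> cball 0 R"
proof -
 have "emeasure (dilation_kernel a \<beta>) (- cball 0 R) = 0"
 proof (subst kernel_emeasure)
  have "ennreal (a (fst p) * \<beta> (snd p)) * indicator (- cball 0 R) (fst p *\<^sub>R snd p) = 0" for p
  proof (cases "fst p \<in> {0..R} \<and> snd p \<in> cball 0 1")
   case True
   then have "norm (fst p *\<^sub>R snd p) <= R * 1" unfolding norm_scaleR by (intro mult_mono) auto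
   then show ?thesis by simp
  qed (use a_outside[of "fst p"] \<beta>_outside[of "snd p"] in auto)
  then show "(\<integral>\<^sup>+p. ennreal (a (fst p) * \<beta> (snd p)) * indicator (- cball 0 R) (fst p *\<^sub>R snd p) \<partial>(lborel \<Otimes>\<^sub>M lborel)) = 0"
   by (simp only: nn_integral_const mult_zero_left)
 qed auto
 then show ?thesis by (subst AE_iff_measurable[of "- cball 0 R"]) (auto simp: Compl_eq)
qed

definition avg :: "('a => real) => 'a => real => real" where
 "avg f x t = (LBINT y. \<beta> y * f (x - t *\<^sub>R y))"

lemma conv_kernel:
 assumes [measurable]: "f \<in> borel_measurable borel" and "\<And>y. \<bar>f y\<bar> <= C"
 shows "conv (dilation_kernel a \<beta>) f x = (LBINT t. a t * avg f x t)"
  and "integrable lborel (\<lambda>t. a t * avg f x t)"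
proof -
 have i: "integrable (lborel \<Otimes>\<^sub>M lborel) (\<lambda>p. (a (fst p) * \<beta> (snd p)) * f (x - fst p *\<^sub>R snd p))"
  by (rule weight_integrable) fact+
 have "conv (dilation_kernel a \<beta>) f x = (\<integral>p. f (x - fst p *\<^sub>R snd p) \<partial>density (lborel \<Otimes>\<^sub>M lborel) (\<lambda>p. ennreal (a (fst p) * \<beta> (snd p))))"
  unfolding conv_def dilation_kernel_def by (subst integral_distr) auto
 also have "\<dots> = (\<integral>p. (a (fst p) * \<beta> (snd p)) *\<^sub>R f (x - fst p *\<^sub>R snd p) \<partial>(lborel \<Otimes>\<^sub>M lborel))"
  by (rule integral_density) (auto simp: weight_nonneg)
 also have "\<dots> = (LBINT t. (LBINT y. (a t * \<beta> y) * f (x - t *\<^sub>R y)))"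
  using lborel_pair.integral_fst'[OF i] by simp
 also have "\<dots> = (LBINT t. a t * avg f x t)"
  unfolding avg_def by (simp add: mult.assoc)
 finally show "conv (dilation_kernel a \<beta>) f x = (LBINT t. a t * avg f x t)" .
 show "integrable lborel (\<lambda>t. a t * avg f x t)"
  using lborel_pair.integrable_fst'[OF i] by (simp add: avg_def mult.assoc)
qed

lemma mass_kernel: "measure (dilation_kernel a \<beta>) UNIV = integral\<^sup>L lborel a * integral\<^sup>L lborel \<beta>"
proof -
 have "measure (dilation_kernel a \<beta>) UNIV = conv (dilation_kernel a \<beta>) (\<lambda>_. 1) 0"
  by (simp add: conv_def)
 also have "\<dots> = integral\<^sup>L lborel a * integral\<^sup>L lborel \<beta>"
  by (subst conv_kernel[of _ 1]) (simp_all add: avg_def)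
 finally show ?thesis .
qed

text \<open>Evenness makes convolution with the kernel symmetric, see \<open>conv_dual\<close>; on
  that symmetry rests every passage between tested and pointwise inequalities.\<close>

lemma kernel_even: "distr (dilation_kernel a \<beta>) borel uminus = dilation_kernel a \<beta>"
proof (rule measure_eqI)
 show "sets (distr (dilation_kernel a \<beta>) borel uminus) = sets (dilation_kernel a \<beta>)" by simp
 fix S assume "S \<in> sets (distr (dilation_kernel a \<beta>) borel uminus)"
 then have [measurable]: "S \<in> sets borel" by simp
 have *: "(lborel :: 'a measure) = distr lborel borel uminus"
  using lborel_affine[of "-1" "0::'a"] by (simp add: density_1)
 have "emeasure (distr (dilation_kernel a \<beta>) borel uminus) S = emeasure (dilation_kernel a \<beta>) (uminus -` S)"
  by (subst emeasure_distr) auto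
 also have "\<dots> = (\<integral>\<^sup>+t. \<integral>\<^sup>+y. ennreal (a t * \<beta> y) * indicator (uminus -` S) (t *\<^sub>R y) \<partial>lborel \<partial>lborel)"
  by (subst kernel_emeasure) (auto simp: lborel.nn_integral_fst[symmetric] measurable_sets_borel[OF borel_measurable_uminus])
 also have "\<dots> = (\<integral>\<^sup>+t. \<integral>\<^sup>+y. ennreal (a t * \<beta> y) * indicator S (t *\<^sub>R y) \<partial>lborel \<partial>lborel)"
 proof (rule nn_integral_cong)
  fix t :: real
  have "(\<integral>\<^sup>+y. ennreal (a t * \<beta> y) * indicator (uminus -` S) (t *\<^sub>R y) \<partial>lborel)
    = (\<integral>\<^sup>+y. ennreal (a t * \<beta> (- y)) * indicator S (t *\<^sub>R (- y)) \<partial>lborel)"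
   by (intro nn_integral_cong) (auto simp: \<beta>_even indicator_def)
  also have "\<dots> = (\<integral>\<^sup>+y. ennreal (a t * \<beta> y) * indicator S (t *\<^sub>R y) \<partial>distr lborel borel uminus)"
   by (subst nn_integral_distr) auto
  finally show "(\<integral>\<^sup>+y. ennreal (a t * \<beta> y) * indicator (uminus -` S) (t *\<^sub>R y) \<partial>lborel) =
    (\<integral>\<^sup>+y. ennreal (a t * \<beta> y) * indicator S (t *\<^sub>R y) \<partial>lborel)" by (simp only: *[symmetric])
 qed
 also have "\<dots> = emeasure (dilation_kernel a \<beta>) S"
  by (subst kernel_emeasure) (auto simp: lborel.nn_integral_fst[symmetric])
 finally show "emeasure (distr (dilation_kernel a \<beta>) borel uminus) S = emeasure (dilation_kernel a \<beta>) S" .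
qed

lemma avg_continuous:
 assumes h: "test_fun UNIV h"
 shows "isCont (avg h x) t"
 unfolding isCont_def LIM_def
proof (intro allI impI)
 fix e :: real assume e: "e > 0"
 define I where "I = integral\<^sup>L lborel \<beta>"
 have I: "I >= 0" unfolding I_def by (intro Bochner_Integration.integral_nonneg \<beta>_nonneg)
 obtain d where d: "d > 0" "\<And>z w. norm (z - w) < d ==> \<bar>h z - h w\<bar> < e / (I + 1)"
  using test_fun_uniformly_continuous[OF h] e I
  unfolding uniformly_continuous_on_def dist_norm real_norm_def
  by (metis UNIV_I add_nonneg_pos divide_pos_pos zero_less_one)
 obtain C where C: "\<And>y. \<bar>h y\<bar> <= C" using test_fun_bounded[OF h] by blast
 have [measurable]: "h \<in> borel_measurable borel" using smooth_borel[OF test_fun_smooth[OF h]] .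
 have ii: "integrable lborel (\<lambda>y. \<beta> y * h (x - s *\<^sub>R y))" for s
  by (rule profile_integrable[of _ C]) (use C in auto)
 have "\<bar>avg h x s - avg h x t\<bar> < e" if s: "\<bar>s - t\<bar> < d" for s
 proof -
  have "\<bar>avg h x s - avg h x t\<bar> = \<bar>\<integral>y. \<beta> y * h (x - s *\<^sub>R y) - \<beta> y * h (x - t *\<^sub>R y) \<partial>lborel\<bar>"
   unfolding avg_def using ii by simp
  also have "\<dots> <= (LBINT y. \<beta> y * (e / (I + 1)))"
  proof (rule order_trans[OF integral_abs_bound] integral_mono)+
   show "integrable lborel (\<lambda>y. \<bar>\<beta> y * h (x - s *\<^sub>R y) - \<beta> y * h (x - t *\<^sub>R y)\<bar>)"
    using ii by (intro integrable_abs Bochner_Integration.integrable_diff)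
   show "integrable lborel (\<lambda>y. \<beta> y * (e / (I + 1)))" using \<beta>_integrable by simp
   fix y
   show "\<bar>\<beta> y * h (x - s *\<^sub>R y) - \<beta> y * h (x - t *\<^sub>R y)\<bar> <= \<beta> y * (e / (I + 1))"
   proof (cases "y \<in> cball 0 1")
    case True
    have "(x - s *\<^sub>R y) - (x - t *\<^sub>R y) = (t - s) *\<^sub>R y" by (simp add: algebra_simps)
    then have "norm ((x - s *\<^sub>R y) - (x - t *\<^sub>R y)) = \<bar>t - s\<bar> * norm y" by simp
    also have "\<dots> <= \<bar>t - s\<bar>" using True by (simp add: mult_left_le)
    also have "\<dots> < d" using s by simp
    finally have "\<bar>h (x - s *\<^sub>R y) - h (x - t *\<^sub>R y)\<bar> < e / (I + 1)" by (rule d(2))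
    then show ?thesis unfolding right_diff_distrib[symmetric] abs_mult
     using \<beta>_nonneg[of y] by (metis abs_of_nonneg less_imp_le mult_left_mono)
   qed (simp add: \<beta>_outside)
  qed
  also have "\<dots> = I * e / (I + 1)" by (simp add: I_def)
  also have "\<dots> < e" using e I by (simp add: field_simps)
  finally show ?thesis .
 qed
 then show "\<exists>d>0. \<forall>s. s \<noteq> t \<and> dist s t < d --> dist (avg h x s) (avg h x t) < e"
  using d(1) by (auto simp: dist_real_def)
qed

lemma avg_DERIV:
 assumes h: "test_fun UNIV h"
 shows "(avg h x has_field_derivative
  (LBINT y. \<beta> y * (\<Sum>b\<in>Basis. - (y \<bullet> b) * pdiff b h (x - t *\<^sub>R y)))) (at t)" (is "(_ has_field_derivative ?D) _")
 unfolding DERIV_def LIM_def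
proof (intro allI impI)
 fix e :: real assume e: "e > 0"
 define I where "I = integral\<^sup>L lborel \<beta>"
 have I: "I >= 0" unfolding I_def by (intro Bochner_Integration.integral_nonneg \<beta>_nonneg)
 have "e / (I + 1) > 0" using e I by simp
 from test_fun_uniform_derivative[OF h this]
 obtain d where d: "d > 0"
  "\<And>z k. norm k < d ==> \<bar>h (z + k) - h z - (\<Sum>b\<in>Basis. (k \<bullet> b) * pdiff b h z)\<bar> <= (e / (I+1)) * norm k"
  by blast
 obtain C where C: "\<And>y. \<bar>h y\<bar> <= C" using test_fun_bounded[OF h] by blast
 have [measurable]: "h \<in> borel_measurable borel" "\<And>b. b \<in> Basis ==> pdiff b h \<in> borel_measurable borel"
  using smooth_borel[OF test_fun_smooth[OF h]] smooth_borel[OF smooth_pdiff[OF test_fun_smooth[OF h]]] by auto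
 have ii: "integrable lborel (\<lambda>y. \<beta> y * h (x - s *\<^sub>R y))" for s
  by (rule profile_integrable[of _ C]) (use C in auto)
 have jb: "integrable lborel (\<lambda>y. \<beta> y * (- (y \<bullet> b) * pdiff b h (x - t *\<^sub>R y)))" if b: "b \<in> Basis" for b
 proof -
  obtain C' where C': "\<And>y. \<bar>pdiff b h y\<bar> <= C'" using test_fun_bounded[OF test_fun_pdiff[OF h b]] by blast
  show ?thesis
  proof (rule compact_support_integrable[where K="cball 0 1"])
   show "(\<lambda>y. \<beta> y * (- (y \<bullet> b) * pdiff b h (x - t *\<^sub>R y))) \<in> borel_measurable borel" using b by measurable
   show "\<bar>\<beta> y * (- (y \<bullet> b) * pdiff b h (x - t *\<^sub>R y))\<bar> <= B * (1 * C')" for y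
   proof (cases "y \<in> cball 0 1")
    case True
    then have "\<bar>- (y \<bullet> b)\<bar> <= 1" using Basis_le_norm[OF b, of y] by simp
    then show ?thesis unfolding abs_mult
     using \<beta>_nonneg[of y] \<beta>_bound[of y] C'[of "x - t *\<^sub>R y"] by (intro mult_mono) auto
   next
    case False
    then show ?thesis using \<beta>_nonneg[of y] \<beta>_bound[of y] C'[of 0] \<beta>_outside[OF False] by simp
   qed
  qed (auto simp: \<beta>_outside)
 qed
 have j: "integrable lborel (\<lambda>y. \<beta> y * (\<Sum>b\<in>Basis. - (y \<bullet> b) * pdiff b h (x - t *\<^sub>R y)))"
  unfolding sum_distrib_left by (intro Bochner_Integration.integrable_sum jb)
 have "\<bar>(avg h x (t + s) - avg h x t) / s - ?D\<bar> < e" if s: "s \<noteq> 0" "\<bar>s\<bar> < d" for s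
 proof -
  have "\<bar>avg h x (t + s) - avg h x t - s * ?D\<bar> =
   \<bar>\<integral>y. \<beta> y * h (x - (t + s) *\<^sub>R y) - \<beta> y * h (x - t *\<^sub>R y) - s * (\<beta> y * (\<Sum>b\<in>Basis. - (y \<bullet> b) * pdiff b h (x - t *\<^sub>R y))) \<partial>lborel\<bar>"
   unfolding avg_def using ii j by simp
  also have "\<dots> <= (LBINT y. \<beta> y * (e / (I + 1) * \<bar>s\<bar>))"
  proof (rule order_trans[OF integral_abs_bound] integral_mono)+
   show "integrable lborel (\<lambda>y. \<bar>\<beta> y * h (x - (t + s) *\<^sub>R y) - \<beta> y * h (x - t *\<^sub>R y) - s * (\<beta> y * (\<Sum>b\<in>Basis. - (y \<bullet> b) * pdiff b h (x - t *\<^sub>R y)))\<bar>)"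
    using ii j by (intro integrable_abs Bochner_Integration.integrable_diff integrable_mult_right)
   show "integrable lborel (\<lambda>y. \<beta> y * (e / (I + 1) * \<bar>s\<bar>))" using \<beta>_integrable by simp
   fix y
   show "\<bar>\<beta> y * h (x - (t + s) *\<^sub>R y) - \<beta> y * h (x - t *\<^sub>R y) - s * (\<beta> y * (\<Sum>b\<in>Basis. - (y \<bullet> b) * pdiff b h (x - t *\<^sub>R y)))\<bar>
     <= \<beta> y * (e / (I + 1) * \<bar>s\<bar>)"
   proof (cases "y \<in> cball 0 1")
    case True
    let ?k = "- (s *\<^sub>R y)"
    have nk: "norm ?k <= \<bar>s\<bar>" using True by (simp add: mult_left_le)
    then have "\<bar>h ((x - t *\<^sub>R y) + ?k) - h (x - t *\<^sub>R y) - (\<Sum>b\<in>Basis. (?k \<bullet> b) * pdiff b h (x - t *\<^sub>R y))\<bar> <= (e / (I+1)) * norm ?k"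
     using s by (intro d(2)) linarith
    also have "\<dots> <= (e / (I+1)) * \<bar>s\<bar>" using nk e I by (intro mult_left_mono) auto
    finally have 1: "\<bar>h ((x - t *\<^sub>R y) + ?k) - h (x - t *\<^sub>R y) - (\<Sum>b\<in>Basis. (?k \<bullet> b) * pdiff b h (x - t *\<^sub>R y))\<bar> <= (e / (I+1)) * \<bar>s\<bar>" .
    have 2: "(x - t *\<^sub>R y) + ?k = x - (t + s) *\<^sub>R y" by (simp add: algebra_simps)
    have 3: "(\<Sum>b\<in>Basis. (?k \<bullet> b) * pdiff b h (x - t *\<^sub>R y)) = s * (\<Sum>b\<in>Basis. - (y \<bullet> b) * pdiff b h (x - t *\<^sub>R y))"
     by (simp add: sum_distrib_left mult_ac)
    have "\<beta> y * h (x - (t + s) *\<^sub>R y) - \<beta> y * h (x - t *\<^sub>R y) - s * (\<beta> y * (\<Sum>b\<in>Basis. - (y \<bullet> b) * pdiff b h (x - t *\<^sub>R y)))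
     = \<beta> y * (h (x - (t + s) *\<^sub>R y) - h (x - t *\<^sub>R y) - s * (\<Sum>b\<in>Basis. - (y \<bullet> b) * pdiff b h (x - t *\<^sub>R y)))"
     by (simp only: right_diff_distrib mult.left_commute)
    then show ?thesis using 1[unfolded 2 3] \<beta>_nonneg[of y] by (simp only: abs_mult abs_of_nonneg mult_left_mono)
   qed (simp add: \<beta>_outside)
  qed
  also have "\<dots> = I * (e / (I + 1) * \<bar>s\<bar>)" by (simp add: I_def)
  finally have "\<bar>avg h x (t + s) - avg h x t - s * ?D\<bar> / \<bar>s\<bar> <= I * (e / (I + 1))"
   using s by (simp add: field_simps)
  moreover have "I * (e / (I + 1)) < e" using e I by (simp add: field_simps)
  moreover have "(avg h x (t + s) - avg h x t) / s - ?D = (avg h x (t + s) - avg h x t - s * ?D) / s"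
   using s by (simp add: field_simps)
  ultimately show ?thesis by (simp add: abs_divide)
 qed
 then show "\<exists>d>0. \<forall>s. s \<noteq> 0 \<and> dist s 0 < d --> dist ((avg h x (t + s) - avg h x t) / s) ?D < e"
  using d(1) by (auto simp: dist_real_def)
qed

end

lemma integral_pos_ball:
 fixes f :: "'a::euclidean_space => real"
 assumes "integrable lborel f" "\<And>x. 0 <= f x" "\<And>x. x \<in> ball 0 r ==> 0 < f x" "r > 0"
 shows "integral\<^sup>L lborel f > 0"
proof -
 have "integral\<^sup>L lborel f \<noteq> 0"
 proof
  assume "integral\<^sup>L lborel f = 0"
  then have "AE x in lborel. f x = 0" using assms(1,2) by (subst (asm) integral_nonneg_eq_0_iff_AE) auto
  then have "AE x in lborel. x \<notin> ball (0::'a) r" by eventually_elim (use assms(3) in fastforce)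
  then have "ball (0::'a) r \<in> null_sets lborel" by (subst (asm) AE_iff_null_sets[symmetric]) auto
  then show False using assms(4) emeasure_ball[of r "0::'a"] unit_ball_vol_pos[of "real DIM('a)"]
   by (auto simp: null_sets_def)
 qed
 moreover have "integral\<^sup>L lborel f >= 0" using assms(2) by (intro Bochner_Integration.integral_nonneg)
 ultimately show ?thesis by simp
qed

lemma integrable_sandwich:
 fixes f h :: "'a::euclidean_space => real"
 assumes "integrable lborel h" "f \<in> borel_measurable borel" "\<And>x. 0 <= f x" "\<And>x. f x <= h x"
 shows "integrable lborel f"
 by (rule Bochner_Integration.integrable_bound[OF assms(1)])
  (use assms(2) order_trans[OF assms(3,4)] assms(3,4) in auto)

section \<open>The paraboloid profile and the two kernels built from it\<close>

definition paraboloid :: "'a::euclidean_space => real" where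
 "paraboloid y = max 0 (1 - (norm y)\<^sup>2)"

definition paraboloid_mass :: "'a::euclidean_space itself => real" where
 "paraboloid_mass _ = integral\<^sup>L lborel (paraboloid :: 'a => real)"

definition rho :: "'a::euclidean_space => real" where
 "rho y = paraboloid y / paraboloid_mass TYPE('a)"

text \<open>Chosen so that the gradient of \<open>psi\<close> at \<open>y\<close> is \<open>- rho y\<close> times \<open>y\<close>.\<close>

definition psi :: "'a::euclidean_space => real" where
 "psi y = (paraboloid y)\<^sup>2 / (4 * paraboloid_mass TYPE('a))"

text \<open>With k(t) = 1 - (t/R)^m, \<open>weightN\<close> is - k' and \<open>weightP\<close> is t
  k on [0, R]. Integrating the t-derivative of k(t) times \<open>avgN h x t\<close> gives
  \<open>averaging_identity\<close>: k(0) = 1 leaves - h(x), and k(R) = 0 removes the outer boundary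
  term. The exponent stays free: 2 makes \<open>kP\<close> comparable with \<open>kN\<close>, and
  the dimension plus one gives \<open>kN\<close> a bounded density.\<close>

definition weightN :: "real => nat => real => real" where
 "weightN R m t = indicator {0..R} t * (real m * t ^ (m - 1) / R ^ m)"

definition weightP :: "real => nat => real => real" where
 "weightP R m t = indicator {0..R} t * (t * (1 - (t / R) ^ m))"

definition kN :: "real => nat => 'a::euclidean_space measure" where
 "kN R m = dilation_kernel (weightN R m) rho"

definition kP :: "real => nat => 'a::euclidean_space measure" where
 "kP R m = dilation_kernel (weightP R m) psi"

lemma paraboloid_facts:
 "continuous_on UNIV (paraboloid :: 'a::euclidean_space => real)" "0 <= paraboloid (y::'a)" "paraboloid y <= 1"
 "y \<notin> cball 0 1 ==> paraboloid y = 0" "paraboloid (- y) = paraboloid y" "y \<in> ball 0 1 ==> 0 < paraboloid y"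
proof -
 show "continuous_on UNIV (paraboloid :: 'a => real)"
  unfolding paraboloid_def[abs_def] by (intro continuous_intros)
 show "y \<notin> cball 0 1 ==> paraboloid y = 0"
  using power_mono[of 1 "norm y" 2] by (simp add: paraboloid_def)
 show "y \<in> ball 0 1 ==> 0 < paraboloid y"
  using power_strict_mono[of "norm y" 1 2] by (simp add: paraboloid_def)
qed (auto simp: paraboloid_def)

lemma paraboloid_borel [measurable]: "paraboloid \<in> borel_measurable borel"
 by (intro borel_measurable_continuous_onI paraboloid_facts)

lemma paraboloid_integrable: "integrable lborel paraboloid"
proof (rule compact_support_integrable[where K="cball 0 1"])
 show "\<bar>paraboloid x\<bar> <= 1" for x :: 'a using paraboloid_facts(2,3)[of x] by simp
qed (auto simp: paraboloid_facts)

lemma paraboloid_mass_pos: "paraboloid_mass TYPE('a::euclidean_space) > 0"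
 unfolding paraboloid_mass_def
 by (rule integral_pos_ball[of _ 1]) (auto simp: paraboloid_facts paraboloid_integrable)

lemma rho_borel [measurable]: "rho \<in> borel_measurable borel" "psi \<in> borel_measurable borel"
 unfolding rho_def[abs_def] psi_def[abs_def] by measurable

lemma paraboloid_sq_le: "(paraboloid y)\<^sup>2 <= paraboloid y"
 using paraboloid_facts(2,3)[of y] by (simp add: power2_eq_square mult_left_le)

lemma kernel_data_N: "R > 0 ==> m >= 1 ==>
  kernel_data (weightN R m) (rho :: 'a => real) R (real m / R) (1 / paraboloid_mass TYPE('a::euclidean_space))"
proof unfold_locales
 assume R: "R > 0" "m >= 1"
 show "weightN R m \<in> borel_measurable borel" unfolding weightN_def[abs_def] by measurable
 show "0 <= weightN R m t" for t using R by (auto simp: weightN_def indicator_def)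
 show "weightN R m t <= real m / R" for t
 proof (cases "t \<in> {0..R}")
  case True
  then have "real m * t ^ (m - 1) / R ^ m <= real m * R ^ (m - 1) / R ^ m"
   using R by (intro divide_right_mono mult_left_mono power_mono) auto
  also have "\<dots> = real m / R" using R by (cases m) auto
  finally show ?thesis using True by (simp add: weightN_def)
 qed (use R in \<open>auto simp: weightN_def\<close>)
 show "t \<notin> {0..R} ==> weightN R m t = 0" for t by (simp add: weightN_def)
 show "0 <= rho y" "rho y <= 1 / paraboloid_mass TYPE('a)" "y \<notin> cball 0 1 ==> rho y = 0" "rho (- y) = rho y" for y :: 'a
  using paraboloid_facts(2-5)[of y] paraboloid_mass_pos[where 'a='a]
  by (auto simp: rho_def divide_right_mono)
qed auto

lemma kernel_data_P: "R > 0 ==> m >= 1 ==>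
  kernel_data (weightP R m) (psi :: 'a => real) R R (1 / (4 * paraboloid_mass TYPE('a::euclidean_space)))"
proof unfold_locales
 assume R: "R > 0" "m >= 1"
 have p: "0 <= (t / R) ^ m \<and> (t / R) ^ m <= 1" if "t \<in> {0..R}" for t
  using that R by (intro conjI power_le_one) auto
 show "weightP R m \<in> borel_measurable borel" unfolding weightP_def[abs_def] by measurable
 show "0 <= weightP R m t" for t using p[of t] by (auto simp: weightP_def indicator_def)
 show "weightP R m t <= R" for t
 proof (cases "t \<in> {0..R}")
  case True
  then have "t * (1 - (t / R) ^ m) <= R * 1" using p[OF True] by (intro mult_mono) auto
  then show ?thesis using True by (simp add: weightP_def)
 qed (use R in \<open>auto simp: weightP_def\<close>)
 show "t \<notin> {0..R} ==> weightP R m t = 0" for t by (simp add: weightP_def)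
 show "0 <= psi y" "psi y <= 1 / (4 * paraboloid_mass TYPE('a))" "y \<notin> cball 0 1 ==> psi y = 0" "psi (- y) = psi y" for y :: 'a
  using paraboloid_facts(2-5)[of y] paraboloid_mass_pos[where 'a='a] paraboloid_sq_le[of y]
  by (auto simp: psi_def divide_right_mono)
qed auto

text \<open>Squaring removes the kink of the paraboloid at the unit sphere, so \<open>psi\<close>
  can be integrated by parts; the factor 1/4 in \<open>psi\<close> cancels the two factors 2 of the
  chain rule.\<close>

lemma psi_has_derivative: "(psi has_derivative (\<lambda>h. - (y \<bullet> h) * rho y)) (at (y::'a::euclidean_space))"
proof -
 have s: "((\<lambda>t. (max 0 t)\<^sup>2) has_field_derivative 2 * max 0 t) (at t)" for t :: real
 proof -
  consider "t > 0" | "t < 0" | "t = 0" by linarith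
  then show ?thesis
  proof cases
   case 1
   have "((\<lambda>t. t\<^sup>2) has_field_derivative 2 * max 0 t) (at t)"
    using 1 by (auto intro!: derivative_eq_intros)
   then show ?thesis
    by (rule has_field_derivative_transform_within_open[of _ _ _ "{0<..}"]) (use 1 in auto)
  next
   case 2
   have "((\<lambda>t. 0) has_field_derivative 2 * max 0 t) (at t)" using 2 by simp
   then show ?thesis
    by (rule has_field_derivative_transform_within_open[of _ _ _ "{..<0}"]) (use 2 in auto)
  next
   case 3
   have "((\<lambda>h. (max 0 h)\<^sup>2 / h) \<longlongrightarrow> 0) (at (0::real))"
   proof (rule Lim_null_comparison)
    show "\<forall>\<^sub>F h in at 0. norm ((max 0 h)\<^sup>2 / h) <= \<bar>h\<bar>"
     by (rule always_eventually) (auto simp: max_def power2_eq_square)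
    show "((\<lambda>h::real. \<bar>h\<bar>) \<longlongrightarrow> 0) (at 0)" by (auto intro!: tendsto_eq_intros)
   qed
   then show ?thesis using 3 by (simp add: DERIV_def)
  qed
 qed
 have n: "((\<lambda>y. 1 - (norm y)\<^sup>2) has_derivative (\<lambda>h. - (2 * (y \<bullet> h)))) (at y)"
  unfolding power2_norm_eq_inner by (auto intro!: derivative_eq_intros simp: inner_commute)
 have "((\<lambda>y. (max 0 (1 - (norm y)\<^sup>2))\<^sup>2) has_derivative (\<lambda>h. 2 * max 0 (1 - (norm y)\<^sup>2) * (- (2 * (y \<bullet> h))))) (at y)"
  using has_derivative_compose[OF n s[of "1 - (norm y)\<^sup>2", unfolded has_field_derivative_def]] .
 then have "((\<lambda>y. (1 / (4 * paraboloid_mass TYPE('a))) * (max 0 (1 - (norm y)\<^sup>2))\<^sup>2) has_derivative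
  (\<lambda>h. (1 / (4 * paraboloid_mass TYPE('a))) * (2 * max 0 (1 - (norm y)\<^sup>2) * (- (2 * (y \<bullet> h)))))) (at y)"
  by (rule has_derivative_mult_right)
 moreover have "psi = (\<lambda>y::'a. (1 / (4 * paraboloid_mass TYPE('a))) * (max 0 (1 - (norm y)\<^sup>2))\<^sup>2)"
  by (simp add: psi_def[abs_def] paraboloid_def)
 moreover have "(\<lambda>h. (1 / (4 * paraboloid_mass TYPE('a))) * (2 * max 0 (1 - (norm y)\<^sup>2) * (- (2 * (y \<bullet> h)))))
   = (\<lambda>h. - (y \<bullet> h) * rho y)"
  by (intro ext) (simp add: rho_def paraboloid_def)
 ultimately show ?thesis by simp
qed

lemma psi_pdiff: "pdiff b psi = (\<lambda>y. - (y \<bullet> b) * rho y)"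
 by (intro ext pdiff_eq[OF psi_has_derivative])

abbreviation "avgN \<equiv> kernel_data.avg rho"
abbreviation "avgP \<equiv> kernel_data.avg psi"

text \<open>\<open>avg\<close> depends on the profile alone, so any admissible radius and exponent
  may serve to unfold it.\<close>

lemma avg_eq: "avgN f x t = (LBINT y. rho y * f (x - t *\<^sub>R y))" "avgP f x t = (LBINT y. psi y * f (x - t *\<^sub>R y))"
 using kernel_data.avg_def[OF kernel_data_N[of 1 1]] kernel_data.avg_def[OF kernel_data_P[of 1 1]] by auto

lemma rho_integral: "integral\<^sup>L lborel (rho :: 'a::euclidean_space => real) = 1"
proof -
 have "integral\<^sup>L lborel (rho :: 'a => real) = paraboloid_mass TYPE('a) / paraboloid_mass TYPE('a)"
  unfolding rho_def[abs_def] by (subst integral_divide_zero) (simp only: paraboloid_mass_def)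
 then show ?thesis using paraboloid_mass_pos[where 'a='a] by simp
qed

lemma affine_smooth_comp:
 fixes x :: "'a::euclidean_space"
 assumes h: "smooth h" and b: "b \<in> Basis"
 shows "(\<lambda>y. h (x - t *\<^sub>R y)) differentiable (at y)" "pdiff b (\<lambda>y. h (x - t *\<^sub>R y)) = (\<lambda>y. - t * pdiff b h (x - t *\<^sub>R y))"
proof -
 have d: "((\<lambda>y. h (x - t *\<^sub>R y)) has_derivative (\<lambda>k. \<Sum>i\<in>Basis. ((- (t *\<^sub>R k)) \<bullet> i) * pdiff i h (x - t *\<^sub>R y))) (at y)" for y
  by (rule has_derivative_compose[of "\<lambda>y. x - t *\<^sub>R y" _ _ _ h])
   (auto intro!: derivative_eq_intros smooth_has_derivative h)
 show "(\<lambda>y. h (x - t *\<^sub>R y)) differentiable (at y)" using d differentiable_def by blast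
 show "pdiff b (\<lambda>y. h (x - t *\<^sub>R y)) = (\<lambda>y. - t * pdiff b h (x - t *\<^sub>R y))"
 proof
  fix y
  have "pdiff b (\<lambda>y. h (x - t *\<^sub>R y)) y = (\<Sum>i\<in>Basis. ((- (t *\<^sub>R b)) \<bullet> i) * pdiff i h (x - t *\<^sub>R y))"
   by (rule pdiff_eq[OF d])
  also have "\<dots> = (\<Sum>i\<in>Basis. if i = b then - t * pdiff i h (x - t *\<^sub>R y) else 0)"
   by (intro sum.cong refl) (auto simp: inner_Basis b)
  also have "\<dots> = - t * pdiff b h (x - t *\<^sub>R y)" using b by simp
  finally show "pdiff b (\<lambda>y. h (x - t *\<^sub>R y)) y = - t * pdiff b h (x - t *\<^sub>R y)" .
 qed
qed

text \<open>Differentiating in t brings down the factor - y, and - y times \<open>rho y\<close> is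
  the gradient of \<open>psi\<close>. One integration by parts moves that gradient on to h, where
  the chain rule supplies the factor t.\<close>

lemma avgN_DERIV:
 assumes h: "test_fun UNIV h"
 shows "(avgN h x has_field_derivative t * avgP (laplacian h) x t) (at t)"
proof -
 have sm: "smooth h" using test_fun_smooth[OF h] .
 have parts: "(LBINT y. pdiff b psi y * pdiff b h (x - t *\<^sub>R y)) =
   - (LBINT y. psi y * (- t * pdiff b (pdiff b h) (x - t *\<^sub>R y)))"
  "integrable lborel (\<lambda>y. psi y * (- t * pdiff b (pdiff b h) (x - t *\<^sub>R y)))"
  "integrable lborel (\<lambda>y. pdiff b psi y * pdiff b h (x - t *\<^sub>R y))" if b: "b \<in> Basis" for b
 proof -
  note sb = smooth_pdiff[OF sm b]
  have c: "continuous_on UNIV (\<lambda>y. - t * pdiff b (pdiff b h) (x - t *\<^sub>R y))"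
   by (intro continuous_intros continuous_on_compose2[OF smooth_continuous[OF smooth_pdiff[OF sb b], of UNIV]]) auto
  have c2: "continuous_on UNIV (pdiff b (psi :: 'a => real))"
   unfolding psi_pdiff rho_def by (intro continuous_intros paraboloid_facts) (use paraboloid_mass_pos[where 'a='a] in auto)
  have "compact (cball (0::'a) 1)" by simp
  have z: "psi y = 0" if "y \<notin> cball 0 1" for y :: 'a
   using that by (simp add: psi_def paraboloid_facts)
  have d: "psi differentiable (at y)" for y :: 'a using psi_has_derivative differentiable_def by blast
  note * = integral_by_parts[of psi "\<lambda>y. pdiff b h (x - t *\<^sub>R y)" b "cball 0 1", unfolded affine_smooth_comp(2)[OF sb b],
    OF d affine_smooth_comp(1)[OF sb b] c2 c _ z]
  show "(LBINT y. pdiff b psi y * pdiff b h (x - t *\<^sub>R y)) =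
    - (LBINT y. psi y * (- t * pdiff b (pdiff b h) (x - t *\<^sub>R y)))" by (rule *(1)) auto
  show "integrable lborel (\<lambda>y. psi y * (- t * pdiff b (pdiff b h) (x - t *\<^sub>R y)))" by (rule *(2)) auto
  show "integrable lborel (\<lambda>y. pdiff b psi y * pdiff b h (x - t *\<^sub>R y))" by (rule *(3)) auto
 qed
 have "(LBINT y. rho y * (\<Sum>b\<in>Basis. - (y \<bullet> b) * pdiff b h (x - t *\<^sub>R y)))
   = (LBINT y. (\<Sum>b\<in>Basis. pdiff b psi y * pdiff b h (x - t *\<^sub>R y)))"
  by (simp add: psi_pdiff sum_distrib_left mult_ac)
 also have "\<dots> = (\<Sum>b\<in>Basis. - (LBINT y. psi y * (- t * pdiff b (pdiff b h) (x - t *\<^sub>R y))))"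
  by (subst Bochner_Integration.integral_sum) (auto simp: parts(1) intro!: parts(3) sum.cong)
 also have "\<dots> = - (LBINT y. (\<Sum>b\<in>Basis. psi y * (- t * pdiff b (pdiff b h) (x - t *\<^sub>R y))))"
  by (subst Bochner_Integration.integral_sum) (rule parts(2), assumption, simp only: sum_negf)
 also have "(\<lambda>y. \<Sum>b\<in>Basis. psi y * (- t * pdiff b (pdiff b h) (x - t *\<^sub>R y))) = (\<lambda>y. (- t) * (psi y * laplacian h (x - t *\<^sub>R y)))"
  by (intro ext) (simp add: laplacian_def sum_distrib_left mult_ac sum_negf)
 also have "- (LBINT y. (- t) * (psi y * laplacian h (x - t *\<^sub>R y))) = t * avgP (laplacian h) x t"
  by (simp add: avg_eq)
 finally have e: "(LBINT y. rho y * (\<Sum>b\<in>Basis. - (y \<bullet> b) * pdiff b h (x - t *\<^sub>R y))) = t * avgP (laplacian h) x t" .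
 show ?thesis using kernel_data.avg_DERIV[OF kernel_data_N[of 1 1] h, of x t] unfolding e by simp
qed

lemma averaging_identity:
 assumes h: "test_fun UNIV h" and R: "R > 0" "m >= 1"
 shows "conv (kP R m) (laplacian h) x = conv (kN R m) h x - h x"
proof -
 interpret N: kernel_data "weightN R m" "rho :: 'a => real" R "real m / R" "1 / paraboloid_mass TYPE('a)" by (rule kernel_data_N) fact+
 interpret P: kernel_data "weightP R m" "psi :: 'a => real" R R "1 / (4 * paraboloid_mass TYPE('a))" by (rule kernel_data_P) fact+
 define F where "F t = (1 - (t / R) ^ m) * avgN h x t" for t
 define F' where "F' t = (1 - (t / R) ^ m) * (t * avgP (laplacian h) x t) - (real m * t ^ (m - 1) / R ^ m) * avgN h x t" for t
 have D: "(F has_field_derivative F' t) (at t)" for t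
  unfolding F_def F'_def using R
  by (auto intro!: derivative_eq_intros avgN_DERIV[OF h] simp: power_divide)
 have C: "isCont F' t" for t
  unfolding F'_def using R
  by (intro continuous_intros N.avg_continuous[OF h] P.avg_continuous[OF test_fun_laplacian[OF h]]) auto
 have "(LBINT t. F' t * indicator {0..R} t) = F R - F 0"
  by (rule integral_FTC_Icc_real) (use R D C in auto)
 also have "F R = 0" using R by (simp add: F_def)
 also have "F 0 = h x" using R rho_integral[where 'a='a] by (simp add: F_def avg_eq power_0_left)
 finally have 1: "(LBINT t. F' t * indicator {0..R} t) = - h x" by simp
 obtain C1 where C1: "\<And>y. \<bar>h y\<bar> <= C1" using test_fun_bounded[OF h] by blast
 obtain C2 where C2: "\<And>y. \<bar>laplacian h y\<bar> <= C2" using test_fun_bounded[OF test_fun_laplacian[OF h]] by blast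
 note mh = smooth_borel[OF test_fun_smooth[OF h]] and ml = smooth_borel[OF test_fun_smooth[OF test_fun_laplacian[OF h]]]
 have e: "F' t * indicator {0..R} t = weightP R m t * avgP (laplacian h) x t - weightN R m t * avgN h x t" for t
  by (auto simp: F'_def weightP_def weightN_def indicator_def)
 have "(LBINT t. F' t * indicator {0..R} t) = conv (kP R m) (laplacian h) x - conv (kN R m) h x"
  unfolding e kP_def kN_def P.conv_kernel(1)[OF ml C2] N.conv_kernel(1)[OF mh C1]
  by (rule Bochner_Integration.integral_diff[OF P.conv_kernel(2)[OF ml C2] N.conv_kernel(2)[OF mh C1]])
 then show ?thesis using 1 by simp
qed

lemma weightN_integral: "R > 0 ==> m >= 1 ==> integral\<^sup>L lborel (weightN R m) = 1"
proof -
 assume R: "R > 0" "m >= 1"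
 have "(LBINT t. (real m * t ^ (m - 1) / R ^ m) * indicator {0..R} t) = R ^ m / R ^ m - 0 ^ m / R ^ m"
  using R by (intro integral_FTC_Icc_real) (auto intro!: derivative_eq_intros continuous_intros)
 also have "\<dots> = 1" using R by simp
 also have "(\<lambda>t. (real m * t ^ (m - 1) / R ^ m) * indicator {0..R} t) = weightN R m"
  by (intro ext) (simp only: weightN_def mult.commute)
 finally show ?thesis .
qed

lemma weightP_integral:
 assumes R: "R > 0" "m >= 1"
 shows "integral\<^sup>L lborel (weightP R m) = R\<^sup>2 * (1 / 2 - 1 / (real m + 2))"
proof -
 have "(LBINT t. (t * (1 - (t / R) ^ m)) * indicator {0..R} t) =
  (R\<^sup>2 / 2 - R ^ (m + 2) / ((real m + 2) * R ^ m)) - (0\<^sup>2 / 2 - 0 ^ (m + 2) / ((real m + 2) * R ^ m))"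
  using R by (intro integral_FTC_Icc_real)
   (auto intro!: derivative_eq_intros continuous_intros simp: power_divide divide_simps add_nonneg_eq_0_iff, cases m, auto simp: algebra_simps)
 also have "\<dots> = R\<^sup>2 * (1 / 2 - 1 / (real m + 2))" using R by (simp add: power_add power2_eq_square divide_simps) (simp add: algebra_simps)
 also have "(\<lambda>t. (t * (1 - (t / R) ^ m)) * indicator {0..R} t) = weightP R m"
  by (intro ext) (simp only: weightP_def mult.commute)
 finally show ?thesis .
qed

lemma psi_integral: "0 < integral\<^sup>L lborel (psi :: 'a::euclidean_space => real)" "integral\<^sup>L lborel (psi :: 'a => real) <= 1"
proof -
 interpret P: kernel_data "weightP 1 1" "psi :: 'a => real" 1 1 "1 / (4 * paraboloid_mass TYPE('a))" by (rule kernel_data_P) auto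
 show "0 < integral\<^sup>L lborel (psi :: 'a => real)"
 proof (rule integral_pos_ball[of _ 1])
  show "0 < psi x" if "x \<in> ball 0 1" for x :: 'a
   using paraboloid_facts(6)[OF that] paraboloid_mass_pos[where 'a='a] by (simp add: psi_def)
 qed (auto simp: P.\<beta>_integrable P.\<beta>_nonneg)
 interpret N: kernel_data "weightN 1 1" "rho :: 'a => real" 1 1 "1 / paraboloid_mass TYPE('a)" using kernel_data_N[of 1 1, where 'a='a] by simp
 have "psi y <= rho y" for y :: 'a
 proof -
  have "psi y <= paraboloid y / (4 * paraboloid_mass TYPE('a))" unfolding psi_def
   using paraboloid_sq_le paraboloid_mass_pos[where 'a='a] by (intro divide_right_mono) auto
  also have "\<dots> <= rho y" unfolding rho_def
   using paraboloid_facts(2)[of y] paraboloid_mass_pos[where 'a='a] by (intro divide_left_mono) auto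
  finally show ?thesis .
 qed
 then have "integral\<^sup>L lborel (psi :: 'a => real) <= integral\<^sup>L lborel (rho :: 'a => real)"
  by (intro integral_mono P.\<beta>_integrable N.\<beta>_integrable)
 then show "integral\<^sup>L lborel (psi :: 'a => real) <= 1" by (simp add: rho_integral)
qed

lemma kN_mass: "R > 0 ==> m >= 1 ==> measure (kN R m) UNIV = 1"
 unfolding kN_def by (simp add: kernel_data.mass_kernel[OF kernel_data_N] weightN_integral rho_integral)

lemma kP_mass:
 assumes "R > 0" "m >= 1"
 shows "0 < measure (kP R m) (UNIV :: 'a::euclidean_space set)" "measure (kP R m) (UNIV :: 'a set) <= R\<^sup>2"
proof -
 have e: "measure (kP R m) (UNIV :: 'a set) = (R\<^sup>2 * (1 / 2 - 1 / (real m + 2))) * integral\<^sup>L lborel (psi :: 'a => real)"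
  unfolding kP_def by (simp add: kernel_data.mass_kernel[OF kernel_data_P[OF assms]] weightP_integral[OF assms])
 have p: "0 < 1 / 2 - 1 / (real m + 2)" "1 / 2 - 1 / (real m + 2) <= 1" using assms(2) by (auto simp: divide_simps)
 show "0 < measure (kP R m) (UNIV :: 'a set)" unfolding e using p assms psi_integral(1) by (intro mult_pos_pos) auto
 have "(R\<^sup>2 * (1 / 2 - 1 / (real m + 2))) * integral\<^sup>L lborel (psi :: 'a => real) <= (R\<^sup>2 * 1) * 1"
  using p psi_integral[where 'a='a] by (intro mult_mono) auto
 then show "measure (kP R m) (UNIV :: 'a set) <= R\<^sup>2" unfolding e by simp
qed

text \<open>The factors compare separately: \<open>psi\<close> lies below \<open>rho\<close>, and t
  (1 - (t/R)^2) lies below R^2 times the weight 2t/R^2. Hence \<open>kN\<close> minus L times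
  \<open>kP\<close> preserves positivity once L R^2 <= 1, which makes the iteration in
  \<open>perron\<close> monotone.\<close>

lemma kP_le_kN:
 assumes R: "R > 0" and [measurable]: "f \<in> borel_measurable borel" and b: "\<And>y. 0 <= f y" "\<And>y. f y <= C"
 shows "conv (kP R 2) f x <= R\<^sup>2 * conv (kN R 2) f x"
proof -
 interpret N: kernel_data "weightN R 2" "rho :: 'a => real" R "real 2 / R" "1 / paraboloid_mass TYPE('a)" by (rule kernel_data_N) (use R in auto)
 interpret P: kernel_data "weightP R 2" "psi :: 'a => real" R R "1 / (4 * paraboloid_mass TYPE('a))" by (rule kernel_data_P) (use R in auto)
 have b': "\<bar>f y\<bar> <= C" for y using b[of y] by simp
 have a1: "avgP f x t <= avgN f x t" for t
  unfolding avg_eq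
 proof (rule integral_mono)
  show "integrable lborel (\<lambda>y. psi y * f (x - t *\<^sub>R y))" by (rule P.profile_integrable[of _ C]) (use b' in auto)
  show "integrable lborel (\<lambda>y. rho y * f (x - t *\<^sub>R y))" by (rule N.profile_integrable[of _ C]) (use b' in auto)
  fix y :: 'a
  have "psi y <= paraboloid y / (4 * paraboloid_mass TYPE('a))" unfolding psi_def
   using paraboloid_sq_le paraboloid_mass_pos[where 'a='a] by (intro divide_right_mono) auto
  also have "\<dots> <= rho y" unfolding rho_def
   using paraboloid_facts(2)[of y] paraboloid_mass_pos[where 'a='a] by (intro divide_left_mono) auto
  finally show "psi y * f (x - t *\<^sub>R y) <= rho y * f (x - t *\<^sub>R y)" using b by (intro mult_right_mono)
 qed
 have a0: "0 <= avgP f x t" for t unfolding avg_eq by (intro Bochner_Integration.integral_nonneg mult_nonneg_nonneg P.\<beta>_nonneg b)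
 have "(LBINT t. weightP R 2 t * avgP f x t) <= (LBINT t. R\<^sup>2 * (weightN R 2 t * avgN f x t))"
 proof (rule integral_mono)
  show "integrable lborel (\<lambda>t. weightP R 2 t * avgP f x t)" by (rule P.conv_kernel(2)[of _ C]) (use b' in auto)
  show "integrable lborel (\<lambda>t. R\<^sup>2 * (weightN R 2 t * avgN f x t))"
   by (intro integrable_mult_right N.conv_kernel(2)[of _ C]) (use b' in auto)
  fix t
  have "weightP R 2 t <= R\<^sup>2 * weightN R 2 t"
  proof (cases "t \<in> {0..R}")
   case True
   then have "t * (1 - (t / R)\<^sup>2) <= t * 1" by (intro mult_left_mono) auto
   also have "\<dots> <= 2 * t" using True by simp
   finally show ?thesis using True R by (simp add: weightP_def weightN_def)
  qed (auto simp: weightP_def weightN_def)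
  then have "weightP R 2 t * avgP f x t <= (R\<^sup>2 * weightN R 2 t) * avgN f x t"
   using a0 a1 N.a_nonneg by (intro mult_mono) auto
  then show "weightP R 2 t * avgP f x t <= R\<^sup>2 * (weightN R 2 t * avgN f x t)" by (simp only: mult.assoc)
 qed
 then show ?thesis unfolding kP_def kN_def using P.conv_kernel(1)[of f C x] N.conv_kernel(1)[of f C x] b' by simp
qed

lemma avg_substitution:
 fixes x :: "'a::euclidean_space"
 assumes t: "t > 0" and [measurable]: "f \<in> borel_measurable borel" "\<beta> \<in> borel_measurable borel"
 shows "t ^ DIM('a) * (LBINT y. \<beta> y * f (x - t *\<^sub>R y)) = (\<integral>z. \<beta> ((1 / t) *\<^sub>R (x - z)) * f z \<partial>lborel)"
 using lborel_integral_affine(2)[of "- t" "\<lambda>z. \<beta> ((1 / t) *\<^sub>R (x - z)) * f z" x] t by simp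

text \<open>The Jacobian t^(-n) of the dilation by t is cancelled exactly by the factor t^n in
  \<open>weightN R (n + 1)\<close>, so each t in [0, R] contributes at most a constant over R^(n+1).
  This is the source of the local upper bounds and, as R grows, of the Liouville property.\<close>

lemma kN_density_bound:
 fixes f :: "'a::euclidean_space => real"
 defines "n \<equiv> DIM('a)"
 assumes R: "R > 0" and [measurable]: "f \<in> borel_measurable borel" and b: "\<And>y. 0 <= f y" "\<And>y. f y <= C" and i: "integrable lborel f"
 shows "conv (kN R (n + 1)) f x <= (real (n + 1) / paraboloid_mass TYPE('a)) / R ^ n * integral\<^sup>L lborel f"
proof -
 interpret N: kernel_data "weightN R (n + 1)" "rho :: 'a => real" R "real (n + 1) / R" "1 / paraboloid_mass TYPE('a)" by (rule kernel_data_N) (use R in auto)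
 have b': "\<bar>f y\<bar> <= C" for y using b[of y] by simp
 have I: "integral\<^sup>L lborel f >= 0" by (intro Bochner_Integration.integral_nonneg b)
 define K where "K = real (n + 1) / R ^ (n + 1) * ((1 / paraboloid_mass TYPE('a)) * integral\<^sup>L lborel f)"
 have K: "K >= 0" unfolding K_def using I R paraboloid_mass_pos[where 'a='a] by simp
 have "(LBINT t. weightN R (n + 1) t * avgN f x t) <= (LBINT t. K * indicator {0..R} t)"
 proof (rule integral_mono)
  show "integrable lborel (\<lambda>t. weightN R (n + 1) t * avgN f x t)" by (rule N.conv_kernel(2)[of _ C]) (use b' in auto)
  fix t
  show "weightN R (n + 1) t * avgN f x t <= K * indicator {0..R} t"
  proof (cases "t > 0 \<and> t <= R")
   case True
   have "t ^ n * avgN f x t = (\<integral>z. rho ((1 / t) *\<^sub>R (x - z)) * f z \<partial>lborel)"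
    unfolding avg_eq n_def by (rule avg_substitution) (use True in auto)
   also have "\<dots> <= (\<integral>z. (1 / paraboloid_mass TYPE('a)) * f z \<partial>lborel)"
   proof (rule integral_mono)
    show "integrable lborel (\<lambda>z. rho ((1 / t) *\<^sub>R (x - z)) * f z)"
     by (rule integrable_sandwich[OF integrable_mult_right[OF i, of "1 / paraboloid_mass TYPE('a)"]])
      (auto intro!: mult_nonneg_nonneg mult_right_mono N.\<beta>_nonneg N.\<beta>_bound b simp del: times_divide_eq_left)
    show "rho ((1 / t) *\<^sub>R (x - z)) * f z <= (1 / paraboloid_mass TYPE('a)) * f z" for z
     by (intro mult_right_mono N.\<beta>_bound b)
   qed (use i in auto)
   finally have s: "t ^ n * avgN f x t <= (1 / paraboloid_mass TYPE('a)) * integral\<^sup>L lborel f" by simp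
   have "weightN R (n + 1) t * avgN f x t = real (n + 1) / R ^ (n + 1) * (t ^ n * avgN f x t)"
    using True by (simp add: weightN_def)
   also have "\<dots> <= K" unfolding K_def using s R by (intro mult_left_mono) auto
   finally show ?thesis using True by simp
  next
   case False
   then have "weightN R (n + 1) t = 0" by (cases "t = 0") (auto simp: weightN_def n_def indicator_def)
   then show ?thesis using K by (simp add: indicator_def)
  qed
 qed (auto intro!: integrable_mult_right integrable_real_indicator simp: emeasure_lborel_Icc_eq)
 also have "\<dots> = K * R" using R by simp
 also have "\<dots> = (real (n + 1) / paraboloid_mass TYPE('a)) / R ^ n * integral\<^sup>L lborel f" using R by (simp add: K_def)
 finally show ?thesis unfolding kN_def using N.conv_kernel(1)[of f C x] b' by simp
qed

text \<open>Only dilation factors t in [4 r, 6 r] are used. For them |x - z| / t <= 3/4, so the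
  paraboloid is at least 1 - 9/16 = 7/16; and t / (8 r) <= 3/4, so the weight is at least 4 r times
  1/4. The factor \<open>2 * r\<^sup>2\<close> is this weight r times the length 2 r of the
  interval.\<close>

lemma kP_lower_bound:
 fixes f :: "'a::euclidean_space => real"
 assumes r: "r > 0" and [measurable]: "f \<in> borel_measurable borel" and b: "\<And>y. 0 <= f y" "\<And>y. f y <= C" and i: "integrable lborel f"
  and sp: "\<And>z. f z \<noteq> 0 ==> norm (x - z) <= 3 * r"
 shows "(2 * r\<^sup>2 * ((7/16)\<^sup>2 / (4 * paraboloid_mass TYPE('a))) / (6 * r) ^ DIM('a)) * integral\<^sup>L lborel f <= conv (kP (8 * r) 2) f x"
proof -
 let ?n = "DIM('a)" and ?c = "(7/16)\<^sup>2 / (4 * paraboloid_mass TYPE('a))"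
 interpret P: kernel_data "weightP (8 * r) 2" "psi :: 'a => real" "8 * r" "8 * r" "1 / (4 * paraboloid_mass TYPE('a))" by (rule kernel_data_P) (use r in auto)
 have b': "\<bar>f y\<bar> <= C" for y using b[of y] by simp
 have I: "integral\<^sup>L lborel f >= 0" by (intro Bochner_Integration.integral_nonneg b)
 have c0: "?c >= 0" using paraboloid_mass_pos[where 'a='a] by simp
 define K where "K = r * (?c / (6 * r) ^ ?n * integral\<^sup>L lborel f)"
 have "K * (2 * r) = (LBINT t. K * indicator {4 * r..6 * r} t)" using r by simp
 also have "\<dots> <= (LBINT t. weightP (8 * r) 2 t * avgP f x t)"
 proof (rule integral_mono)
  show "integrable lborel (\<lambda>t. weightP (8 * r) 2 t * avgP f x t)" by (rule P.conv_kernel(2)[of _ C]) (use b' in auto)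
  fix t
  have a0: "0 <= avgP f x t" unfolding avg_eq by (intro Bochner_Integration.integral_nonneg mult_nonneg_nonneg P.\<beta>_nonneg b)
  show "K * indicator {4 * r..6 * r} t <= weightP (8 * r) 2 t * avgP f x t"
  proof (cases "t \<in> {4 * r..6 * r}")
   case True
   then have t: "t > 0" "t <= 6 * r" "4 * r <= t" using r by auto
   have "?c * integral\<^sup>L lborel f = (\<integral>z. ?c * f z \<partial>lborel)" by simp
   also have "\<dots> <= (\<integral>z. psi ((1 / t) *\<^sub>R (x - z)) * f z \<partial>lborel)"
   proof (rule integral_mono)
    show "integrable lborel (\<lambda>z. psi ((1 / t) *\<^sub>R (x - z)) * f z)"
     by (rule integrable_sandwich[OF integrable_mult_right[OF i, of "1 / (4 * paraboloid_mass TYPE('a))"]])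
      (auto intro!: mult_nonneg_nonneg mult_right_mono P.\<beta>_nonneg P.\<beta>_bound b simp del: times_divide_eq_left)
    fix z
    show "?c * f z <= psi ((1 / t) *\<^sub>R (x - z)) * f z"
    proof (cases "f z = 0")
     case False
     have "norm ((1 / t) *\<^sub>R (x - z)) <= 3 / 4" unfolding norm_scaleR using sp[OF False] t by (simp add: field_simps)
     then have "(norm ((1 / t) *\<^sub>R (x - z)))\<^sup>2 <= (3 / 4)\<^sup>2" by (intro power_mono) auto
     then have "7/16 <= 1 - (norm ((1 / t) *\<^sub>R (x - z)))\<^sup>2" unfolding power2_eq_square[of "3/4"] by linarith
     then have "7/16 <= paraboloid ((1 / t) *\<^sub>R (x - z))" unfolding paraboloid_def by (rule max.coboundedI2)
     then have "(7/16)\<^sup>2 <= (paraboloid ((1 / t) *\<^sub>R (x - z)))\<^sup>2" by (intro power_mono) auto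
     then have "?c <= psi ((1 / t) *\<^sub>R (x - z))" unfolding psi_def
      using paraboloid_mass_pos[where 'a='a] by (intro divide_right_mono) auto
     then show ?thesis by (intro mult_right_mono b)
    qed simp
   qed (use i in auto)
   also have "\<dots> = t ^ ?n * avgP f x t"
    unfolding avg_eq by (rule avg_substitution[symmetric]) (use t in auto)
   also have "\<dots> <= (6 * r) ^ ?n * avgP f x t" using t a0 by (intro mult_right_mono power_mono) auto
   finally have q: "?c * integral\<^sup>L lborel f <= (6 * r) ^ ?n * avgP f x t" .
   have s: "?c / (6 * r) ^ ?n * integral\<^sup>L lborel f <= avgP f x t"
   proof -
    have D: "(6 * r) ^ ?n > 0" using r by simp
    have "c' / D * I' <= A'" if "c' * I' <= D * A'" "D > 0" for c' I' D A' :: real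
     using that by (simp add: divide_le_eq mult.commute)
    from this[OF q D] show ?thesis .
   qed
   have "(t / (8 * r))\<^sup>2 <= (3 / 4)\<^sup>2" using t r by (intro power_mono) (auto simp: field_simps)
   then have "1 / 4 <= 1 - (t / (8 * r))\<^sup>2" by (simp add: power2_eq_square)
   then have "(4 * r) * (1 / 4) <= t * (1 - (t / (8 * r))\<^sup>2)" using t r by (intro mult_mono) auto
   then have w: "r <= weightP (8 * r) 2 t" using t r by (simp add: weightP_def)
   have c1: "0 <= ?c / (6 * r) ^ ?n" by (intro divide_nonneg_nonneg c0) (use r in simp)
   have "K <= weightP (8 * r) 2 t * avgP f x t" unfolding K_def
    by (rule mult_mono[OF w s _ mult_nonneg_nonneg[OF c1 I]]) (rule P.a_nonneg)
   then show ?thesis using True by simp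
  qed (use a0 P.a_nonneg in auto)
 qed (auto intro!: integrable_mult_right integrable_real_indicator simp: emeasure_lborel_Icc_eq)
 finally have "K * (2 * r) <= conv (kP (8 * r) 2) f x" unfolding kP_def using P.conv_kernel(1)[of f C x] b' by simp
 moreover have "K * (2 * r) = (2 * r\<^sup>2 * ?c / (6 * r) ^ ?n) * integral\<^sup>L lborel f"
  by (simp add: K_def power2_eq_square mult_ac)
 ultimately show ?thesis by simp
qed

section \<open>Convolution of integrable functions\<close>

locale even_kernel = finite_borel \<nu> for \<nu> :: "'a::euclidean_space measure" +
 fixes R :: real
 assumes support: "AE y in \<nu>. y \<in> cball 0 R" and even: "distr \<nu> borel uminus = \<nu>" and R_nonneg: "0 <= R"
begin

lemma integral_even:
 assumes [measurable]: "f \<in> borel_measurable borel"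
 shows "(\<integral>y. f (x + y) \<partial>\<nu>) = conv \<nu> f x"
proof -
 have "(\<integral>y. f (x - y) \<partial>distr \<nu> borel uminus) = (\<integral>y. f (x + y) \<partial>\<nu>)"
  by (subst integral_distr) auto
 then show ?thesis by (simp add: conv_def even)
qed

lemma pair_swap: "pair_sigma_finite \<nu> lborel"
 by (intro pair_sigma_finite.intro sigma_finite_measure_axioms lborel.sigma_finite_measure_axioms)

lemma pair_integrable:
 fixes u p :: "'a => real"
 assumes u: "integrable lborel u" and [measurable]: "p \<in> borel_measurable borel" and p: "\<And>x. \<bar>p x\<bar> <= C"
 shows "integrable (\<nu> \<Otimes>\<^sub>M lborel) (\<lambda>(y, x). u (x - y) * p x)"
  and "integrable (\<nu> \<Otimes>\<^sub>M lborel) (\<lambda>(y, x). u x * p (x + y))"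
proof -
 interpret Q: pair_sigma_finite \<nu> "lborel :: 'a measure" by (rule pair_swap)
 have [measurable]: "u \<in> borel_measurable borel" using u by auto
 have C: "C >= 0" using order_trans[OF abs_ge_zero p] .
 have t: "integrable lborel (\<lambda>x. u (x - y))" "(LBINT x. \<bar>u (x - y)\<bar>) = (LBINT x. \<bar>u x\<bar>)" for y
  using lborel_integral_translate(4)[of u y] lborel_integral_translate(3)[of "\<lambda>x. \<bar>u x\<bar>" y] u by auto
 have i1: "integrable lborel (\<lambda>x. u (x - y) * p x)" for y
  by (rule Bochner_Integration.integrable_bound[OF integrable_mult_right[OF t(1)[of y], of C]])
   (auto simp: abs_mult C mult.commute intro!: mult_right_mono p)
 have i2: "integrable lborel (\<lambda>x. u x * p (x + y))" for y
  by (rule Bochner_Integration.integrable_bound[OF integrable_mult_right[OF u, of C]])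
   (auto simp: abs_mult C mult.commute[of C] intro!: mult_left_mono p)
 show "integrable (\<nu> \<Otimes>\<^sub>M lborel) (\<lambda>(y, x). u (x - y) * p x)"
 proof (rule Q.Fubini_integrable)
  show "integrable \<nu> (\<lambda>y. \<integral>x. norm (case (y, x) of (y, x) => u (x - y) * p x) \<partial>lborel)"
  proof (rule integrable_const_bound[of _ "C * (LBINT x. \<bar>u x\<bar>)"])
   have "(LBINT x. norm (u (x - y) * p x)) <= (LBINT x. C * \<bar>u (x - y)\<bar>)" for y
    using integrable_abs[OF i1[of y]] t(1)[of y]
    by (intro integral_mono) (auto simp: abs_mult mult.commute[of C] intro!: mult_left_mono p)
   then show "AE y in \<nu>. norm (LBINT x. norm (case (y, x) of (y, x) => u (x - y) * p x)) <= C * (LBINT x. \<bar>u x\<bar>)"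
    using t(2) by (auto simp: abs_of_nonneg Bochner_Integration.integral_nonneg)
  qed measurable
 qed (use i1 in auto)
 show "integrable (\<nu> \<Otimes>\<^sub>M lborel) (\<lambda>(y, x). u x * p (x + y))"
 proof (rule Q.Fubini_integrable)
  show "integrable \<nu> (\<lambda>y. \<integral>x. norm (case (y, x) of (y, x) => u x * p (x + y)) \<partial>lborel)"
  proof (rule integrable_const_bound[of _ "C * (LBINT x. \<bar>u x\<bar>)"])
   have "(LBINT x. norm (u x * p (x + y))) <= (LBINT x. C * \<bar>u x\<bar>)" for y
    using integrable_abs[OF i2[of y]] u
    by (intro integral_mono) (auto simp: abs_mult mult.commute[of C] intro!: mult_left_mono p)
   then show "AE y in \<nu>. norm (LBINT x. norm (case (y, x) of (y, x) => u x * p (x + y))) <= C * (LBINT x. \<bar>u x\<bar>)"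
    by (auto simp: abs_of_nonneg Bochner_Integration.integral_nonneg)
  qed measurable
 qed (use i2 in auto)
qed

lemma conv_borel [measurable]: "f \<in> borel_measurable borel ==> conv \<nu> f \<in> borel_measurable borel"
proof -
 assume [measurable]: "f \<in> borel_measurable borel"
 have "(\<lambda>x. \<integral>y. f (x - y) \<partial>\<nu>) \<in> borel_measurable borel" by measurable
 then show ?thesis by (simp add: conv_def[abs_def])
qed

lemma conv_L1:
 assumes u: "integrable lborel u"
 shows "integrable lborel (conv \<nu> u)" "AE x in lborel. integrable \<nu> (\<lambda>y. u (x - y))"
  "integral\<^sup>L lborel (conv \<nu> u) = measure \<nu> UNIV * integral\<^sup>L lborel u"
proof -
 interpret Q: pair_sigma_finite \<nu> "lborel :: 'a measure" by (rule pair_swap)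
 have [measurable]: "u \<in> borel_measurable borel" using u by auto
 have i: "integrable (\<nu> \<Otimes>\<^sub>M lborel) (\<lambda>(y, x). u (x - y))"
  using pair_integrable(1)[OF u, of "\<lambda>_. 1" 1] by (simp add: split_def)
 show "integrable lborel (conv \<nu> u)" using Q.integrable_snd[OF i] by (simp add: conv_def[abs_def])
 show "AE x in lborel. integrable \<nu> (\<lambda>y. u (x - y))" using Q.AE_integrable_snd[OF i] .
 have "integral\<^sup>L lborel (conv \<nu> u) = (\<integral>y. \<integral>x. u (x - y) \<partial>lborel \<partial>\<nu>)"
  using Q.Fubini_integral[OF i] by (simp add: conv_def[abs_def])
 also have "\<dots> = (\<integral>y. integral\<^sup>L lborel u \<partial>\<nu>)"
  by (intro Bochner_Integration.integral_cong refl lborel_integral_translate(3)) auto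
 also have "\<dots> = measure \<nu> UNIV * integral\<^sup>L lborel u" by simp
 finally show "integral\<^sup>L lborel (conv \<nu> u) = measure \<nu> UNIV * integral\<^sup>L lborel u" .
qed

text \<open>Fubini and a translation move the convolution to the other factor; the reflection that
  this produces is absorbed by evenness of the kernel.\<close>

lemma conv_dual:
 assumes u: "integrable lborel u" and [measurable]: "p \<in> borel_measurable borel" and p: "\<And>x. \<bar>p x\<bar> <= C"
 shows "(LBINT x. conv \<nu> u x * p x) = (LBINT x. u x * conv \<nu> p x)"
  and "integrable lborel (\<lambda>x. conv \<nu> u x * p x)" and "integrable lborel (\<lambda>x. u x * conv \<nu> p x)"
proof -
 interpret Q: pair_sigma_finite \<nu> "lborel :: 'a measure" by (rule pair_swap)
 have [measurable]: "u \<in> borel_measurable borel" using u by auto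
 note i = pair_integrable[OF u, of p C, OF _ p, simplified]
 have e1: "(\<integral>y. u (x - y) * p x \<partial>\<nu>) = conv \<nu> u x * p x" for x by (simp add: conv_def)
 have e2: "(\<integral>y. u x * p (x + y) \<partial>\<nu>) = u x * conv \<nu> p x" for x using integral_even[of p x] by simp
 have e3: "(LBINT x. u (x - y) * p x) = (LBINT x. u x * p (x + y))" for y
  using lborel_integral_translate(1)[of "\<lambda>x. u (x - y) * p x" y] by simp
 show "(LBINT x. conv \<nu> u x * p x) = (LBINT x. u x * conv \<nu> p x)"
  using Q.Fubini_integral[OF i(1)] Q.Fubini_integral[OF i(2)] unfolding e1 e2 e3 by simp
 show "integrable lborel (\<lambda>x. conv \<nu> u x * p x)" using Q.integrable_snd[OF i(1)] unfolding e1 .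
 show "integrable lborel (\<lambda>x. u x * conv \<nu> p x)" using Q.integrable_snd[OF i(2)] unfolding e2 .
qed

text \<open>The convolution of the indicator of a null set has integral equal to the mass of the
  kernel times 0, so from almost every x the kernel does not see the exceptional set. Hypotheses
  that hold almost everywhere may thus be used under a convolution integral, even though the kernel
  is only known as a measure.\<close>

lemma conv_AE:
 assumes "AE x in lborel. P x"
 shows "AE x in lborel. AE y in \<nu>. P (x - y)"
proof -
 obtain N where N: "N \<in> null_sets lborel" "{x. \<not> P x} \<subseteq> N"
  using assms by (auto elim!: AE_E simp: null_sets_def)
 then have [measurable]: "N \<in> sets borel" by auto
 have e0: "emeasure lborel N = 0" using N by auto
 have i: "integrable lborel (indicator N :: 'a => real)" using e0 by (intro integrable_real_indicator) auto
 have "integral\<^sup>L lborel (indicator N :: 'a => real) = 0" using e0 by (simp add: measure_def)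
 then have "integral\<^sup>L lborel (conv \<nu> (indicator N)) = 0" using conv_L1(3)[OF i] by simp
 moreover have nn: "0 <= conv \<nu> (indicator N) x" for x unfolding conv_def by (intro Bochner_Integration.integral_nonneg) auto
 ultimately have "AE x in lborel. conv \<nu> (indicator N) x = 0"
  using conv_L1(1)[OF i] by (subst (asm) integral_nonneg_eq_0_iff_AE) auto
 then show ?thesis
 proof eventually_elim
  case (elim x)
  have "integrable \<nu> (\<lambda>y. indicator N (x - y) :: real)" by (rule integrable_const_bound[of _ 1]) auto
  then have "AE y in \<nu>. indicator N (x - y) = (0::real)"
   using elim unfolding conv_def by (subst (asm) integral_nonneg_eq_0_iff_AE) auto
  then show ?case
  proof eventually_elim
   case (elim y)
   then have "x - y \<notin> N" by (auto simp: indicator_def split: if_splits)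
   then show ?case using N(2) by blast
  qed
 qed
qed

lemma conv_mono_AE:
 assumes "AE x in lborel. integrable \<nu> (\<lambda>y. u (x - y))" "AE x in lborel. integrable \<nu> (\<lambda>y. v (x - y))"
  and "AE x in lborel. u x <= v x"
 shows "AE x in lborel. conv \<nu> u x <= conv \<nu> v x"
 using assms(1,2) conv_AE[OF assms(3)]
 by eventually_elim (auto simp: conv_def intro!: integral_mono_AE)

lemma conv_abs_bound:
 assumes "f \<in> borel_measurable borel" "\<And>x. \<bar>f x\<bar> <= C"
 shows "\<bar>conv \<nu> f x\<bar> <= measure \<nu> UNIV * C"
proof -
 have "\<bar>conv \<nu> f x\<bar> <= (\<integral>y. \<bar>f (x - y)\<bar> \<partial>\<nu>)" unfolding conv_def by (rule integral_abs_bound)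
 also have "\<dots> <= (\<integral>y. C \<partial>\<nu>)"
  using conv_integrable[OF assms] by (intro integral_mono) (auto simp: assms)
 finally show ?thesis by simp
qed

lemma conv_nonneg: "(\<And>x. 0 <= f x) ==> 0 <= conv \<nu> f x"
 unfolding conv_def by (rule Bochner_Integration.integral_nonneg)

end

lemma even_kernel_N: "R > 0 ==> m >= 1 ==> even_kernel (kN R m) R"
 and even_kernel_P: "R > 0 ==> m >= 1 ==> even_kernel (kP R m) R"
 unfolding kN_def kP_def
 using kernel_data.finite_borel_kernel[OF kernel_data_N] kernel_data.kernel_support[OF kernel_data_N] kernel_data.kernel_even[OF kernel_data_N]
  kernel_data.finite_borel_kernel[OF kernel_data_P] kernel_data.kernel_support[OF kernel_data_P] kernel_data.kernel_even[OF kernel_data_P]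
 by (auto intro!: even_kernel.intro even_kernel_axioms.intro)

section \<open>Density of test functions and the fundamental lemma\<close>

lemma borel_inner_closed:
 assumes "A \<in> sets (borel :: 'a::euclidean_space measure)" "e > 0"
 obtains T where "closed T" "T \<subseteq> A" "emeasure lborel (A - T) < ennreal e"
proof -
 have "- A \<in> sets borel" using assms(1) by auto
 then obtain W where "open W" "- A \<subseteq> W" "emeasure lborel (W - - A) < ennreal e"
  using outer_regular_lborel[of "- A" e] assms(2) by blast
 moreover have "A - (- W) = W - - A" by auto
 ultimately show thesis by (intro that[of "- W"]) auto
qed

text \<open>The indicator of a bounded set is approximated by a cut-off function squeezed between a
  compact set inside and an open set outside of nearly the same measure; linearity and limits give
  the rest.\<close>

lemma test_fun_dense:
 assumes "integrable lborel (f :: 'a::euclidean_space => real)" "e > 0"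
 shows "\<exists>h. test_fun UNIV h \<and> (LBINT x. \<bar>f x - h x\<bar>) < e"
 using assms
proof (induct f arbitrary: e rule: integrable_induct)
 case (base A c)
 then have [measurable]: "A \<in> sets borel" by simp
 \<comment> \<open>Three errors of size d occur: cutting A down to a ball, and the measures of
   \<open>A' - T\<close> and \<open>G - A'\<close>. The factor 4 leaves the total strictly below
   e.\<close>
 define d where "d = e / (4 * (\<bar>c\<bar> + 1))"
 have d: "d > 0" using base(3) by (simp add: d_def)
 have fin: "emeasure lborel (A \<inter> cball 0 (real n)) < \<infinity>" for n
  by (rule le_less_trans[OF emeasure_mono base(2)]) auto
 have iA: "integrable lborel (indicator A :: 'a => real)" using base by (intro integrable_real_indicator) auto
 have "(\<lambda>n. LBINT x. (indicator A x - indicator (A \<inter> cball 0 (real n)) x :: real)) \<longlonglongrightarrow> integral\<^sup>L lborel (\<lambda>x::'a. 0::real)"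
 proof (rule integral_dominated_convergence[where w="indicator A"])
  show "AE x in lborel. (\<lambda>n. indicator A x - indicator (A \<inter> cball 0 (real n)) x :: real) \<longlonglongrightarrow> 0"
  proof (rule AE_I2)
   fix x :: 'a
   obtain n where n: "norm x <= real n" using real_arch_simple by blast
   then have "\<forall>\<^sub>F k in sequentially. (indicator A x - indicator (A \<inter> cball 0 (real k)) x :: real) = 0"
    unfolding eventually_sequentially by (intro exI[of _ n]) (auto simp: indicator_def)
   then show "(\<lambda>n. indicator A x - indicator (A \<inter> cball 0 (real n)) x :: real) \<longlonglongrightarrow> 0"
    by (rule tendsto_eventually)
  qed
 qed (use iA in \<open>auto simp: indicator_def\<close>)
 then have "\<forall>\<^sub>F n in sequentially. (LBINT x. (indicator A x - indicator (A \<inter> cball 0 (real n)) x :: real)) < d"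
  using d by (intro order_tendstoD) auto
 then obtain n where n: "(LBINT x. (indicator A x - indicator (A \<inter> cball 0 (real n)) x :: real)) < d"
  by (auto simp: eventually_sequentially)
 define A' where "A' = A \<inter> cball 0 (real n)"
 have A'[measurable]: "A' \<in> sets borel" by (simp add: A'_def)
 have fA': "emeasure lborel A' < \<infinity>" using fin by (simp add: A'_def)
 obtain T where T: "closed T" "T \<subseteq> A'" "emeasure lborel (A' - T) < ennreal d"
  using borel_inner_closed[OF A' d] by blast
 obtain G where G: "open G" "A' \<subseteq> G" "emeasure lborel (G - A') < ennreal d"
  using outer_regular_lborel[OF A' d] by blast
 have [measurable]: "T \<in> sets borel" "G \<in> sets borel" using T G by auto
 have "compact T" using T(1) bounded_subset[OF bounded_cball, of T 0 "real n"] T(2) by (auto simp: A'_def compact_eq_bounded_closed)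
 then obtain \<theta> :: "'a => real" and r where \<theta>: "test_fun G \<theta>" "\<And>x. 0 <= \<theta> x" "\<And>x. \<theta> x <= 1" "r > 0" "\<And>x. x \<in> enlarge r T ==> \<theta> x = 1"
  using cutoff_exists[OF _ G(1), of T] T(2) G(2) by blast
 have \<theta>T: "\<theta> x = 1" if "x \<in> T" for x using \<theta>(4,5) enlarge_superset[of r T] that by auto
 have \<theta>G: "\<theta> x = 0" if "x \<notin> G" for x using \<theta>(1) that not_tsupport unfolding test_fun_def by blast
 have i1: "integrable lborel (\<lambda>x. indicator (A' - T) x :: real)" "integrable lborel (\<lambda>x. indicator (G - A') x :: real)"
  "integrable lborel (\<lambda>x. indicator A' x :: real)"
  using T(3) G(3) fA' by (auto intro!: integrable_real_indicator simp: order_less_trans[OF _ ennreal_less_top])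
 have i\<theta>: "integrable lborel \<theta>" using test_fun_integrable[OF test_fun_UNIV[OF \<theta>(1)]] .
 have m1: "measure lborel (A' - T) < d" "measure lborel (G - A') < d"
  using T(3) G(3) d by (auto simp: measure_def enn2real_less_iff order_less_trans[OF _ ennreal_less_top])
 have "\<bar>indicator A x *\<^sub>R c - c * \<theta> x\<bar> <= \<bar>c\<bar> * ((indicator A x - indicator A' x) + (indicator (A' - T) x + indicator (G - A') x))" for x
 proof -
  have "\<bar>indicator A' x - \<theta> x\<bar> <= indicator (A' - T) x + indicator (G - A') x"
   using \<theta>(2,3)[of x] \<theta>T[of x] \<theta>G[of x] T(2) G(2) by (auto simp: indicator_def)
  then have "\<bar>indicator A x - \<theta> x\<bar> <= (indicator A x - indicator A' x) + (indicator (A' - T) x + indicator (G - A') x)"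
   by (auto simp: A'_def indicator_def split: if_splits)
  then have "\<bar>c\<bar> * \<bar>indicator A x - \<theta> x\<bar> <= \<bar>c\<bar> * ((indicator A x - indicator A' x) + (indicator (A' - T) x + indicator (G - A') x))"
   by (intro mult_left_mono) auto
  then show ?thesis by (simp add: abs_mult[symmetric] right_diff_distrib mult.commute)
 qed
 then have "(LBINT x. \<bar>indicator A x *\<^sub>R c - c * \<theta> x\<bar>) <=
   (LBINT x. \<bar>c\<bar> * ((indicator A x - indicator A' x) + (indicator (A' - T) x + indicator (G - A') x)))"
  using i1 iA i\<theta> by (intro integral_mono integrable_abs Bochner_Integration.integrable_diff integrable_mult_right) auto
 also have "\<dots> = \<bar>c\<bar> * ((LBINT x. indicator A x - indicator A' x) + (measure lborel (A' - T) + measure lborel (G - A')))"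
  using i1 iA by simp
 also have "\<dots> <= \<bar>c\<bar> * (d + (d + d))"
  using n m1 by (intro mult_left_mono add_mono) (auto simp: A'_def)
 also have "\<dots> = e * (3 * \<bar>c\<bar> / (4 * (\<bar>c\<bar> + 1)))" by (simp add: d_def)
 also have "\<dots> < e * 1" using base(3) by (intro mult_strict_left_mono) (auto simp: divide_simps)
 finally show ?case using test_fun_cmult[OF test_fun_UNIV[OF \<theta>(1)], of c] by auto
next
 case (add f g)
 obtain h1 h2 where h: "test_fun UNIV h1" "(LBINT x. \<bar>f x - h1 x\<bar>) < e / 2" "test_fun UNIV h2" "(LBINT x. \<bar>g x - h2 x\<bar>) < e / 2"
  using add(2)[of "e/2"] add(4)[of "e/2"] add(5) by auto
 note i = add(1,3) test_fun_integrable[OF h(1)] test_fun_integrable[OF h(3)]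
 have "(LBINT x. \<bar>(f x + g x) - (h1 x + h2 x)\<bar>) <= (LBINT x. \<bar>f x - h1 x\<bar> + \<bar>g x - h2 x\<bar>)"
  using i by (intro integral_mono) auto
 also have "\<dots> < e" using h i by simp
 finally show ?case using test_fun_add[OF h(1,3)] by blast
next
 case (lim f s)
 have [measurable]: "f \<in> borel_measurable borel" "\<And>i. s i \<in> borel_measurable borel" using lim by auto
 have "(\<lambda>i. LBINT x. \<bar>f x - s i x\<bar>) \<longlonglongrightarrow> integral\<^sup>L lborel (\<lambda>x::'a. 0::real)"
 proof (rule integral_dominated_convergence[where w="\<lambda>x. 3 * \<bar>f x\<bar>"])
  show "AE x in lborel. (\<lambda>i. \<bar>f x - s i x\<bar>) \<longlonglongrightarrow> 0"
  proof (rule AE_I2)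
   fix x show "(\<lambda>i. \<bar>f x - s i x\<bar>) \<longlonglongrightarrow> 0"
    using tendsto_rabs[OF tendsto_diff[OF tendsto_const[of "f x"] lim(3)[of x]]] by simp
  qed
  show "AE x in lborel. norm \<bar>f x - s i x\<bar> <= 3 * \<bar>f x\<bar>" for i
  proof (rule AE_I2)
   fix x show "norm \<bar>f x - s i x\<bar> <= 3 * \<bar>f x\<bar>" using lim(4)[of x i] by simp
  qed
 qed (use lim(5) in auto)
 then have "\<forall>\<^sub>F i in sequentially. (LBINT x. \<bar>f x - s i x\<bar>) < e / 2"
  using lim(6) by (intro order_tendstoD) auto
 then obtain i where i: "(LBINT x. \<bar>f x - s i x\<bar>) < e / 2" by (auto simp: eventually_sequentially)
 obtain h where h: "test_fun UNIV h" "(LBINT x. \<bar>s i x - h x\<bar>) < e / 2" using lim(2)[of "e/2" i] lim(6) by auto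
 note ii = lim(5) lim(1)[of i] test_fun_integrable[OF h(1)]
 have "(LBINT x. \<bar>f x - h x\<bar>) <= (LBINT x. \<bar>f x - s i x\<bar> + \<bar>s i x - h x\<bar>)"
  using ii by (intro integral_mono) auto
 also have "\<dots> < e" using h i ii by simp
 finally show ?case using h(1) by blast
qed

text \<open>In contrast to \<open>locL1\<close>, which only concerns restrictions to compact subsets
  and Lebesgue measure, this asks for Borel measurability on the whole space, so that functions can
  be convolved, composed and glued freely. \<open>borel_representative\<close> leads from one notion
  to the other.\<close>

definition loc_int :: "'a::euclidean_space set => ('a => real) => bool" where
 "loc_int U u \<longleftrightarrow> u \<in> borel_measurable borel \<and> (\<forall>K. compact K \<and> K \<subseteq> U --> set_integrable lborel K u)"

lemma loc_int_borel [measurable_dest]: "loc_int U u ==> u \<in> borel_measurable borel"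
 by (simp add: loc_int_def)

lemma loc_int_indicator: "loc_int U u ==> compact K ==> K \<subseteq> U ==> integrable lborel (\<lambda>x. indicator K x * u x)"
 by (simp add: loc_int_def set_integrable_def)

lemma loc_int_mult:
 assumes u: "loc_int U u" and K: "compact K" "K \<subseteq> U" and [measurable]: "p \<in> borel_measurable borel"
  and p: "\<And>x. \<bar>p x\<bar> <= C" "\<And>x. x \<notin> K ==> p x = 0"
 shows "integrable lborel (\<lambda>x. u x * p x)"
proof (rule Bochner_Integration.integrable_bound[OF integrable_mult_right[OF loc_int_indicator[OF u K], of C]])
 have [measurable]: "u \<in> borel_measurable borel" using u by (rule loc_int_borel)
 show "(\<lambda>x. u x * p x) \<in> borel_measurable lborel" by simp
 show "AE x in lborel. norm (u x * p x) <= norm (C * (indicator K x * u x))"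
 proof (rule AE_I2)
  fix x show "norm (u x * p x) <= norm (C * (indicator K x * u x))"
   using p(1)[of x] p(2)[of x] by (cases "x \<in> K") (auto simp: abs_mult mult.commute intro!: mult_right_mono)
 qed
qed

lemma loc_int_test: "loc_int U u ==> test_fun U p ==> integrable lborel (\<lambda>x. u x * p x)"
proof -
 assume u: "loc_int U u" and p: "test_fun U p"
 obtain K where K: "smooth p" "compact K" "K \<subseteq> U" "\<And>x. x \<notin> K ==> p x = 0" using test_funE[OF p] by metis
 obtain C where C: "\<And>x. \<bar>p x\<bar> <= C" using test_fun_bounded[OF p] by blast
 show ?thesis by (rule loc_int_mult[OF u K(2,3) smooth_borel[OF K(1)] C K(4)])
qed

text \<open>Cut-off functions shrinking to a compact K turn the tested inequality into a nonnegative
  integral of h over K. Applied to compact parts of {h < 0}, where the integrand is negative, this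
  makes each of them a null set, and inner regularity exhausts {h < 0} by such parts.\<close>

lemma fundamental_lemma:
 assumes U: "open U" and h: "loc_int U h"
  and t: "\<And>p. test_fun U p ==> (\<And>x. 0 <= p x) ==> 0 <= (LBINT x. h x * p x)"
 shows "AE x\<in>U in lborel. 0 <= h x"
proof -
 have [measurable]: "h \<in> borel_measurable borel" "U \<in> sets borel" using h U by (auto dest: loc_int_borel)
 have compact_nonneg: "0 <= (LBINT x. indicator K x * h x)" if K: "compact K" "K \<subseteq> U" for K
 proof -
  obtain r where r: "r > 0" "enlarge r K \<subseteq> U" using compact_enlarge_subset[OF K(1) U K(2)] by blast
  define W where "W n = (\<Union>x\<in>K. ball x (r / real (Suc n)))" for n
  have "\<exists>p. test_fun (W n) p \<and> (\<forall>x. 0 <= p x \<and> p x <= 1) \<and> (\<forall>x\<in>K. p x = 1)" for n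
  proof -
   have "open (W n)" "K \<subseteq> W n" using r(1) by (auto simp: W_def intro!: bexI)
   from cutoff_exists[OF K(1) this] obtain p s where
    "test_fun (W n) p" "\<And>x. 0 <= p x" "\<And>x. p x <= 1" "s > 0" "\<And>x. x \<in> enlarge s K ==> p x = 1" by blast
   then show ?thesis using enlarge_superset[of s K] by (intro exI[of _ p]) auto
  qed
  then obtain p where p: "\<And>n. test_fun (W n) (p n)" "\<And>n x. 0 <= p n x" "\<And>n x. p n x <= 1" "\<And>n x. x \<in> K ==> p n x = 1"
   by metis
  have pW: "p n x = 0" if "x \<notin> W n" for n x using p(1)[of n] that not_tsupport unfolding test_fun_def by blast
  have WL: "W n \<subseteq> enlarge r K" for n
  proof -
   have "ball x (r / real (Suc n)) \<subseteq> cball x r" for x :: 'a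
    using r(1) by (intro subset_trans[OF ball_subset_cball] subset_cball) (simp add: field_simps)
   then show ?thesis unfolding W_def enlarge_eq by blast
  qed
  have [measurable]: "\<And>n. p n \<in> borel_measurable borel" using smooth_borel[OF test_fun_smooth[OF p(1)]] .
  have lim: "(\<lambda>n. p n x) \<longlonglongrightarrow> indicator K x" for x
  proof (cases "x \<in> K")
   case False
   have "closed K" using K(1) by (rule compact_imp_closed)
   show ?thesis
   proof (cases "K = {}")
    case True then show ?thesis using pW by (simp add: W_def)
   next
    case ne: False
    have "infdist x K > 0" using False \<open>closed K\<close> ne by (simp add: infdist_pos_not_in_closed)
    then obtain n where n: "inverse (real (Suc n)) < infdist x K / r" using reals_Archimedean[of "infdist x K / r"] r(1) by auto
    have "x \<notin> W k" if "k >= n" for k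
    proof
     assume "x \<in> W k"
     then obtain y where y: "y \<in> K" "dist y x < r / real (Suc k)" by (auto simp: W_def)
     have "infdist x K <= dist x y" using y(1) by (rule infdist_le)
     also have "\<dots> < r / real (Suc k)" using y(2) by (simp add: dist_commute)
     also have "\<dots> <= r / real (Suc n)" using that r(1) by (intro divide_left_mono) auto
     also have "\<dots> < infdist x K" using n r(1) by (simp add: field_simps)
     finally show False .
    qed
    then have "\<forall>\<^sub>F k in sequentially. p k x = indicator K x"
     unfolding eventually_sequentially using pW False by (intro exI[of _ n]) auto
    then show ?thesis by (rule tendsto_eventually)
   qed
  qed (simp add: p(4))
  have L: "compact (enlarge r K)" by (rule compact_enlarge[OF K(1)])
  then have [measurable]: "enlarge r K \<in> sets borel" "K \<in> sets borel" using K(1) by (auto simp: compact_imp_closed)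
  have "(\<lambda>n. LBINT x. h x * p n x) \<longlonglongrightarrow> (LBINT x. indicator K x * h x)"
  proof (rule integral_dominated_convergence[where w="\<lambda>x. \<bar>indicator (enlarge r K) x * h x\<bar>"])
   show "integrable lborel (\<lambda>x. \<bar>indicator (enlarge r K) x * h x\<bar>)" using loc_int_indicator[OF h L r(2)] by (rule integrable_abs)
   show "AE x in lborel. (\<lambda>n. h x * p n x) \<longlonglongrightarrow> indicator K x * h x"
    using tendsto_mult_left[OF lim] by (auto simp: mult.commute)
   show "AE x in lborel. norm (h x * p n x) <= \<bar>indicator (enlarge r K) x * h x\<bar>" for n
   proof (rule AE_I2)
    fix x
    show "norm (h x * p n x) <= \<bar>indicator (enlarge r K) x * h x\<bar>"
     using p(2,3)[of n x] pW[of x n] subsetD[OF WL, of x n]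
     by (cases "x \<in> W n") (auto simp: abs_mult intro!: mult_left_le)
   qed
  qed auto
  moreover have "0 <= (LBINT x. h x * p n x)" for n
   by (rule t[OF test_fun_mono[OF p(1)] p(2)]) (use WL r(2) in blast)
  ultimately show ?thesis by (intro LIMSEQ_le_const) auto
 qed
 define A where "A = {x. x \<in> U \<and> h x < 0}"
 have A[measurable]: "A \<in> sets borel" unfolding A_def by measurable
 have small: "emeasure lborel A <= ennreal e" if e: "e > 0" for e
 proof -
  obtain T where T: "closed T" "T \<subseteq> A" "emeasure lborel (A - T) < ennreal e"
   using borel_inner_closed[OF A e] by blast
  have "T \<inter> cball 0 (real n) \<in> null_sets lborel" for n
  proof -
   let ?K = "T \<inter> cball 0 (real n)"
   have K: "compact ?K" "?K \<subseteq> U" using T(1,2) by (auto simp: A_def intro: closed_Int_compact)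
   then have [measurable]: "?K \<in> sets borel" by (simp add: compact_imp_closed)
   have i: "integrable lborel (\<lambda>x. indicator ?K x * h x)" by (rule loc_int_indicator[OF h K])
   have nn: "0 <= - (indicator ?K x * h x)" for x using T(2) by (auto simp: A_def indicator_def)
   have "0 <= (LBINT x. - (indicator ?K x * h x))" using nn by (rule Bochner_Integration.integral_nonneg)
   then have "(LBINT x. - (indicator ?K x * h x)) = 0" using compact_nonneg[OF K] i by simp
   then have "AE x in lborel. - (indicator ?K x * h x) = 0"
    using i nn by (subst (asm) integral_nonneg_eq_0_iff_AE) auto
   then have "AE x in lborel. x \<notin> ?K" by eventually_elim (use T(2) in \<open>auto simp: A_def indicator_def split: if_splits\<close>)
   then show ?thesis by (subst (asm) AE_iff_null_sets[symmetric]) auto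
  qed
  then have "(\<Union>n. T \<inter> cball 0 (real n)) \<in> null_sets lborel" by (intro null_sets_UN)
  moreover have "(\<Union>n. T \<inter> cball 0 (real n)) = T" using real_arch_simple by auto
  ultimately have "T \<in> null_sets lborel" by simp
  then have "emeasure lborel (A - T) = emeasure lborel A" by (intro emeasure_Diff_null_set) auto
  then show ?thesis using T(3) by simp
 qed
 have "emeasure lborel A <= 0"
 proof (rule ennreal_le_epsilon)
  fix e :: real assume "0 < e"
  from small[OF this] show "emeasure lborel A <= 0 + ennreal e" by (simp only: add_0)
 qed
 then have "A \<in> null_sets lborel" by auto
 then show ?thesis by (rule AE_I') (auto simp: A_def not_le)
qed

section \<open>Distributional Laplacians bounded from below\<close>

text \<open>The Laplacian of u is at least F in the sense of distributions. Supersolutions are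
  expressed by the same relation for their negatives, so that a single calculus of maxima, gluing
  and comparison serves both.\<close>

definition lapge :: "'a::euclidean_space set => ('a => real) => ('a => real) => bool" where
 "lapge U u F \<longleftrightarrow> loc_int U u \<and> loc_int U F \<and>
  (\<forall>p. test_fun U p \<and> (\<forall>x. 0 <= p x) --> (LBINT x. F x * p x) <= (LBINT x. u x * laplacian p x))"

lemma lapgeI:
 assumes "loc_int U u" "loc_int U F"
  "\<And>p. test_fun U p ==> (\<And>x. 0 <= p x) ==> (LBINT x. F x * p x) <= (LBINT x. u x * laplacian p x)"
 shows "lapge U u F"
 using assms unfolding lapge_def by blast

lemma lapgeD:
 assumes "lapge U u F"
 shows "loc_int U u" "loc_int U F"
  "test_fun U p ==> (\<And>x. 0 <= p x) ==> (LBINT x. F x * p x) <= (LBINT x. u x * laplacian p x)"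
 using assms unfolding lapge_def by blast+

lemma loc_intI:
 assumes "u \<in> borel_measurable borel" "\<And>K. compact K ==> K \<subseteq> U ==> integrable lborel (\<lambda>x. indicator K x * u x)"
 shows "loc_int U u"
 using assms by (simp add: loc_int_def set_integrable_def)

lemma loc_int_subset: "loc_int U u ==> W \<subseteq> U ==> loc_int W u"
 by (auto simp: loc_int_def)

lemma loc_int_bound:
 assumes "u \<in> borel_measurable borel" "loc_int U v" "AE x\<in>U in lborel. \<bar>u x\<bar> <= \<bar>v x\<bar>"
 shows "loc_int U u"
proof (rule loc_intI[OF assms(1)])
 fix K assume K: "compact K" "K \<subseteq> U"
 then have [measurable]: "K \<in> sets borel" by (simp add: compact_imp_closed)
 have [measurable]: "u \<in> borel_measurable borel" by fact
 show "integrable lborel (\<lambda>x. indicator K x * u x)"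
 proof (rule Bochner_Integration.integrable_bound[OF loc_int_indicator[OF assms(2) K]])
  show "AE x in lborel. norm (indicator K x * u x) <= norm (indicator K x * v x)"
   using assms(3) by eventually_elim (use K(2) in \<open>auto simp: indicator_def\<close>)
 qed auto
qed

lemma loc_int_cong:
 assumes "loc_int U v" "u \<in> borel_measurable borel" "AE x\<in>U in lborel. u x = v x"
 shows "loc_int U u"
 by (rule loc_int_bound[OF assms(2,1)]) (use assms(3) in eventually_elim, auto)

lemma loc_int_add: "loc_int U u ==> loc_int U v ==> loc_int U (\<lambda>x. u x + v x)"
 by (rule loc_intI) (auto dest: loc_int_borel simp: distrib_left intro!: Bochner_Integration.integrable_add loc_int_indicator)

lemma loc_int_cmult: "loc_int U u ==> loc_int U (\<lambda>x. c * u x)"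
proof (rule loc_intI)
 assume u: "loc_int U u"
 then show "(\<lambda>x. c * u x) \<in> borel_measurable borel" by (auto dest: loc_int_borel)
 show "integrable lborel (\<lambda>x. indicator K x * (c * u x))" if "compact K" "K \<subseteq> U" for K
  using integrable_mult_right[OF loc_int_indicator[OF u that], of c] by (simp add: mult_ac)
qed

lemma loc_int_uminus: "loc_int U u ==> loc_int U (\<lambda>x. - u x)"
 using loc_int_cmult[of U u "-1"] by simp

lemma loc_int_diff: "loc_int U u ==> loc_int U v ==> loc_int U (\<lambda>x. u x - v x)"
 using loc_int_add[of U u "\<lambda>x. - v x"] loc_int_uminus[of U v] by simp

lemma loc_int_abs: "loc_int U u ==> loc_int U (\<lambda>x. \<bar>u x\<bar>)"
 by (rule loc_int_bound[of _ U u]) (auto dest: loc_int_borel)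

lemma loc_int_between:
 assumes "u \<in> borel_measurable borel" "loc_int U l" "loc_int U v" "AE x\<in>U in lborel. l x <= u x \<and> u x <= v x"
 shows "loc_int U u"
 by (rule loc_int_bound[OF assms(1) loc_int_add[OF loc_int_abs[OF assms(2)] loc_int_abs[OF assms(3)]]])
  (use assms(4) in eventually_elim, auto)

lemma loc_int_max: "loc_int U u ==> loc_int U v ==> loc_int U (\<lambda>x. max (u x) (v x))"
 by (rule loc_int_bound[of _ U "\<lambda>x. \<bar>u x\<bar> + \<bar>v x\<bar>"]) (auto dest: loc_int_borel intro: loc_int_add loc_int_abs)

lemma loc_int_if:
 assumes "loc_int U u" "loc_int U v" "Measurable.pred borel P"
 shows "loc_int U (\<lambda>x. if P x then u x else v x)"
proof (rule loc_int_bound[OF _ loc_int_add[OF loc_int_abs[OF assms(1)] loc_int_abs[OF assms(2)]]])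
 have [measurable]: "Measurable.pred borel P" "u \<in> borel_measurable borel" "v \<in> borel_measurable borel"
  using assms by (auto dest: loc_int_borel)
 show "(\<lambda>x. if P x then u x else v x) \<in> borel_measurable borel" by measurable
qed auto

lemma loc_int_continuous: "continuous_on UNIV u ==> loc_int U u"
proof (rule loc_intI)
 assume c: "continuous_on UNIV u"
 then show "u \<in> borel_measurable borel" by (rule borel_measurable_continuous_onI)
 show "integrable lborel (\<lambda>x. indicator K x * u x)" if "compact K" "K \<subseteq> U" for K
  using borel_integrable_compact[OF that(1) continuous_on_subset[OF c]] by simp
qed

lemma loc_int_const: "loc_int U (\<lambda>_. c)"
 by (rule loc_int_continuous) auto

lemma loc_int_bounded:
 assumes "u \<in> borel_measurable borel" "AE x\<in>U in lborel. \<bar>u x\<bar> <= C"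
 shows "loc_int U u"
 by (rule loc_int_bound[OF assms(1) loc_int_const[of U C]]) (use assms(2) in eventually_elim, auto)

lemma loc_int_integrable: "integrable lborel u ==> loc_int U u"
 by (rule loc_intI) (use integrable_mult_indicator[of _ lborel u] in \<open>auto simp: compact_imp_closed\<close>)

lemma lapge_mono:
 assumes "lapge U u F" "loc_int U G" "AE x\<in>U in lborel. G x <= F x"
 shows "lapge U u G"
proof (rule lapgeI[OF lapgeD(1)[OF assms(1)] assms(2)])
 fix p assume p: "test_fun U p" "\<And>x. 0 <= p x"
 have "(LBINT x. G x * p x) <= (LBINT x. F x * p x)"
 proof (rule integral_mono_AE)
  show "AE x in lborel. G x * p x <= F x * p x" using assms(3)
  proof eventually_elim
   case (elim x)
   show ?case
   proof (cases "x \<in> U")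
    case False
    then have "p x = 0" using p(1) not_tsupport unfolding test_fun_def by blast
    then show ?thesis by simp
   qed (use elim p(2) in \<open>auto intro: mult_right_mono\<close>)
  qed
 qed (use loc_int_test[OF assms(2) p(1)] loc_int_test[OF lapgeD(2)[OF assms(1)] p(1)] in auto)
 also have "\<dots> <= (LBINT x. u x * laplacian p x)" by (rule lapgeD(3)[OF assms(1) p])
 finally show "(LBINT x. G x * p x) <= (LBINT x. u x * laplacian p x)" .
qed

lemma test_fun_zero_outside: "test_fun U p ==> x \<notin> U ==> p x = 0"
 using not_tsupport unfolding test_fun_def by blast

lemma lapge_cong:
 assumes "lapge U u F" "v \<in> borel_measurable borel" "G \<in> borel_measurable borel"
  "AE x\<in>U in lborel. v x = u x \<and> G x = F x"
 shows "lapge U v G"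
proof -
 have v: "loc_int U v" by (rule loc_int_cong[OF lapgeD(1)[OF assms(1)] assms(2)]) (use assms(4) in eventually_elim, auto)
 have G: "loc_int U G" by (rule loc_int_cong[OF lapgeD(2)[OF assms(1)] assms(3)]) (use assms(4) in eventually_elim, auto)
 show ?thesis
 proof (rule lapgeI[OF v G])
  fix p assume p: "test_fun U p" "\<And>x. 0 <= p x"
  note [measurable] = loc_int_borel[OF v] loc_int_borel[OF G] loc_int_borel[OF lapgeD(1)[OF assms(1)]] loc_int_borel[OF lapgeD(2)[OF assms(1)]]
   smooth_borel[OF test_fun_smooth[OF p(1)]] smooth_borel[OF test_fun_smooth[OF test_fun_laplacian[OF p(1)]]]
  have 1: "(LBINT x. G x * p x) = (LBINT x. F x * p x)"
   by (rule integral_cong_AE) (use assms(4) test_fun_zero_outside[OF p(1)] in \<open>auto elim!: eventually_mono\<close>)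
  have 2: "(LBINT x. v x * laplacian p x) = (LBINT x. u x * laplacian p x)"
   by (rule integral_cong_AE) (use assms(4) test_fun_zero_outside[OF test_fun_laplacian[OF p(1)]] in \<open>auto elim!: eventually_mono\<close>)
  show "(LBINT x. G x * p x) <= (LBINT x. v x * laplacian p x)"
   unfolding 1 2 by (rule lapgeD(3)[OF assms(1) p])
 qed
qed

lemma lapge_subset: "lapge U u F ==> W \<subseteq> U ==> lapge W u F"
 unfolding lapge_def using loc_int_subset test_fun_mono by blast

lemma lapge_add:
 assumes "lapge U u F" "lapge U v G"
 shows "lapge U (\<lambda>x. u x + v x) (\<lambda>x. F x + G x)"
proof (rule lapgeI)
 fix p assume p: "test_fun U p" "\<And>x. 0 <= p x"
 note i = loc_int_test[OF lapgeD(1)[OF assms(1)] test_fun_laplacian[OF p(1)]] loc_int_test[OF lapgeD(1)[OF assms(2)] test_fun_laplacian[OF p(1)]]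
  loc_int_test[OF lapgeD(2)[OF assms(1)] p(1)] loc_int_test[OF lapgeD(2)[OF assms(2)] p(1)]
 show "(LBINT x. (F x + G x) * p x) <= (LBINT x. (u x + v x) * laplacian p x)"
  using lapgeD(3)[OF assms(1) p] lapgeD(3)[OF assms(2) p] i by (simp add: distrib_right)
qed (use assms lapgeD in \<open>auto intro!: loc_int_add\<close>)

lemma lapge_cmult:
 assumes "lapge U u F" "c >= 0"
 shows "lapge U (\<lambda>x. c * u x) (\<lambda>x. c * F x)"
proof (rule lapgeI)
 fix p assume p: "test_fun U p" "\<And>x. 0 <= p x"
 show "(LBINT x. c * F x * p x) <= (LBINT x. c * u x * laplacian p x)"
  using mult_left_mono[OF lapgeD(3)[OF assms(1) p] assms(2)] by (simp add: mult.assoc)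
qed (use assms lapgeD in \<open>auto intro!: loc_int_cmult\<close>)

lemma lapge_smooth:
 assumes "smooth s"
 shows "lapge U s (laplacian s)"
proof (rule lapgeI)
 fix p assume p: "test_fun U p" "\<And>x. 0 <= p x"
 show "(LBINT x. laplacian s x * p x) <= (LBINT x. s x * laplacian p x)"
  using green_second[OF test_fun_UNIV[OF p(1)] assms] by (simp add: mult.commute)
qed (use assms in \<open>auto intro!: loc_int_continuous smooth_continuous laplacian_smooth\<close>)

lemma lapge_smooth_uminus: "smooth s ==> lapge U (\<lambda>x. - s x) (\<lambda>x. - laplacian s x)"
proof -
 assume s: "smooth s"
 have "laplacian (\<lambda>x. - s x) = (\<lambda>x. - laplacian s x)"
  using laplacian_cmult[OF s, of "-1"] by auto
 then show ?thesis using lapge_smooth[OF smooth_uminus[OF s], of U] by simp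
qed

lemma lapge_const: "lapge U (\<lambda>_::'a::euclidean_space. c) (\<lambda>_. 0)"
proof -
 have "laplacian (\<lambda>_::'a. c) = (\<lambda>_. 0)" by auto
 then show ?thesis using lapge_smooth[of "\<lambda>_. c" U] by simp
qed

text \<open>A partition of unity for two sets: on K, \<theta> lives in \<open>U1\<close> and 1 -
  \<theta> in \<open>U2\<close>.\<close>

lemma compact_cover_split:
 assumes "compact K" "open U1" "open U2" "K \<subseteq> U1 \<union> U2"
 obtains K1 K2 \<theta> where "compact K1" "K1 \<subseteq> U1" "compact K2" "K2 \<subseteq> U2" "K \<subseteq> K1 \<union> K2"
  "test_fun U1 \<theta>" "\<And>x. 0 <= \<theta> x" "\<And>x. \<theta> x <= 1" "\<And>x. x \<in> K ==> x \<notin> K2 ==> \<theta> x = 1"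
proof -
 have c: "compact (K - U2)" using assms(1,3) by (simp add: compact_diff)
 have "K - U2 \<subseteq> U1" using assms(4) by blast
 obtain \<theta> :: "'a => real" and r where \<theta>: "test_fun U1 \<theta>" "\<And>x. 0 <= \<theta> x" "\<And>x. \<theta> x <= 1" "r > 0" "\<And>x. x \<in> enlarge r (K - U2) ==> \<theta> x = 1"
  using cutoff_exists[OF c assms(2) \<open>K - U2 \<subseteq> U1\<close>] by blast
 define W where "W = (\<Union>x\<in>K - U2. ball x r)"
 have W: "open W" "W \<subseteq> enlarge r (K - U2)" "K - U2 \<subseteq> W"
  using \<theta>(4) ball_subset_cball by (auto simp: W_def enlarge_eq)
 have "compact (tsupport \<theta>)" "tsupport \<theta> \<subseteq> U1" using \<theta>(1) by (auto simp: test_fun_def)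
 moreover have "W \<subseteq> tsupport \<theta>"
 proof
  fix x assume "x \<in> W"
  then have "\<theta> x = 1" using W(2) \<theta>(5) by blast
  then show "x \<in> tsupport \<theta>" using not_tsupport by fastforce
 qed
 ultimately show thesis
  using W \<theta> assms(1) by (intro that[of "tsupport \<theta>" "K - W" \<theta>]) (auto simp: compact_diff)
qed

text \<open>The relation is local, since a nonnegative test function splits into two nonnegative
  ones supported in \<open>U1\<close> and \<open>U2\<close>. This is how glued functions are
  verified later: on two overlapping open sets separately.\<close>

lemma lapge_union:
 assumes o: "open U1" "open U2" and l: "lapge U1 u F" "lapge U2 u F"
 shows "lapge (U1 \<union> U2) u F"
proof -
 have loc: "loc_int (U1 \<union> U2) v" if v: "loc_int U1 v" "loc_int U2 v" for v
 proof (rule loc_intI)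
  show [measurable]: "v \<in> borel_measurable borel" using v(1) by (rule loc_int_borel)
  fix K assume K: "compact K" "K \<subseteq> U1 \<union> U2"
  obtain K1 K2 where s: "compact K1" "K1 \<subseteq> U1" "compact K2" "K2 \<subseteq> U2" "K \<subseteq> K1 \<union> K2"
   using compact_cover_split[OF K(1) o K(2)] by metis
  have [measurable]: "K \<in> sets borel" using K by (simp add: compact_imp_closed)
  have "integrable lborel (\<lambda>x. \<bar>indicator K1 x * v x\<bar> + \<bar>indicator K2 x * v x\<bar>)"
   using loc_int_indicator[OF v(1) s(1,2)] loc_int_indicator[OF v(2) s(3,4)] by auto
  then show "integrable lborel (\<lambda>x. indicator K x * v x)"
   by (rule Bochner_Integration.integrable_bound) (use s(5) in \<open>auto simp: indicator_def\<close>)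
 qed
 show ?thesis
 proof (rule lapgeI)
  fix p assume p: "test_fun (U1 \<union> U2) p" "\<And>x. 0 <= p x"
  obtain K where K: "smooth p" "compact K" "K \<subseteq> U1 \<union> U2" "\<And>x. x \<notin> K ==> p x = 0" using test_funE[OF p(1)] by metis
  obtain K1 K2 \<theta> where s: "compact K2" "K2 \<subseteq> U2" "test_fun U1 \<theta>" "\<And>x. 0 <= \<theta> x" "\<And>x. \<theta> x <= 1"
    "\<And>x. x \<in> K ==> x \<notin> K2 ==> \<theta> x = 1"
   using compact_cover_split[OF K(2) o K(3)] by metis
  define p1 where "p1 x = \<theta> x * p x" for x
  define p2 where "p2 x = p x - p1 x" for x
  have t1: "test_fun U1 p1" unfolding p1_def by (rule test_fun_mult[OF s(3) K(1)])
  have sm: "smooth p1" "smooth p2" using test_fun_smooth[OF t1] smooth_diff[OF K(1) test_fun_smooth[OF t1]] by (auto simp: p2_def[abs_def])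
  have t2: "test_fun U2 p2"
  proof (rule test_funI[OF sm(2) s(1,2)])
   fix x assume "x \<notin> K2"
   then show "p2 x = 0" using s(6)[of x] K(4)[of x] by (cases "x \<in> K") (auto simp: p2_def p1_def)
  qed
  have n: "0 <= p1 x" "0 <= p2 x" for x using s(4,5)[of x] p(2)[of x] by (auto simp: p1_def p2_def mult_left_le_one_le)
  have e: "p = (\<lambda>x. p1 x + p2 x)" "laplacian p x = laplacian p1 x + laplacian p2 x" for x
  proof -
   show "p = (\<lambda>x. p1 x + p2 x)" by (auto simp: p2_def)
   then show "laplacian p x = laplacian p1 x + laplacian p2 x" using laplacian_add[OF sm, of x] by simp
  qed
  note i = loc_int_test[OF lapgeD(1)[OF l(1)] test_fun_laplacian[OF t1]] loc_int_test[OF lapgeD(1)[OF l(2)] test_fun_laplacian[OF t2]]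
   loc_int_test[OF lapgeD(2)[OF l(1)] t1] loc_int_test[OF lapgeD(2)[OF l(2)] t2]
  have "(LBINT x. F x * p x) = (LBINT x. F x * p1 x) + (LBINT x. F x * p2 x)"
   using i unfolding e(1) by (simp add: distrib_left)
  also have "\<dots> <= (LBINT x. u x * laplacian p1 x) + (LBINT x. u x * laplacian p2 x)"
   by (intro add_mono lapgeD(3)[OF l(1) t1 n(1)] lapgeD(3)[OF l(2) t2 n(2)])
  also have "\<dots> = (LBINT x. u x * laplacian p x)" using i unfolding e(2) by (simp add: distrib_left)
  finally show "(LBINT x. F x * p x) <= (LBINT x. u x * laplacian p x)" .
 qed (intro loc lapgeD(1)[OF l(1)] lapgeD(1)[OF l(2)] lapgeD(2)[OF l(1)] lapgeD(2)[OF l(2)])+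
qed

section \<open>Mean value inequalities\<close>

text \<open>The \<open>kP\<close> convolution of p is itself a nonnegative test function, and its
  Laplacian is the \<open>kN\<close> average of p minus p. Inserting it in the definition of
  \<open>lapge\<close> is the whole argument; only p has to be smooth.\<close>

lemma mean_value_dual:
 assumes l: "lapge U u F" and R: "R > 0" "m >= 1"
  and p: "smooth p" "compact K" "\<And>x. x \<notin> K ==> p x = 0" "\<And>x. 0 <= p x" and K: "enlarge R K \<subseteq> U"
 shows "(LBINT x. u x * p x) <= (LBINT x. u x * conv (kN R m) p x) - (LBINT x. F x * conv (kP R m) p x)"
  and "test_fun U p" "test_fun U (conv (kN R m) p)" "test_fun U (conv (kP R m) p)"
proof -
 interpret N: even_kernel "kN R m" R by (rule even_kernel_N[OF R])
 interpret P: even_kernel "kP R m" R by (rule even_kernel_P[OF R])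
 have pU: "test_fun UNIV p" by (rule test_funI[OF p(1,2)]) (use p(3) in auto)
 show tp: "test_fun U p" by (rule test_funI[OF p(1,2)]) (use p(3) K enlarge_superset[of R K] R in auto)
 show tN: "test_fun U (conv (kN R m) p)" by (rule N.test_fun_conv[OF p(1,2,3) N.support K])
 show tP: "test_fun U (conv (kP R m) p)" by (rule P.test_fun_conv[OF p(1,2,3) P.support K])
 have "laplacian (conv (kP R m) p) x = conv (kN R m) p x - p x" for x
  using P.laplacian_conv[OF pU] averaging_identity[OF pU R] by simp
 then have "(LBINT x. F x * conv (kP R m) p x) <= (LBINT x. u x * (conv (kN R m) p x - p x))"
  using lapgeD(3)[OF l tP P.conv_nonneg[OF p(4)]] by simp
 also have "\<dots> = (LBINT x. u x * conv (kN R m) p x) - (LBINT x. u x * p x)"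
  using loc_int_test[OF lapgeD(1)[OF l] tN] loc_int_test[OF lapgeD(1)[OF l] tp] by (simp add: right_diff_distrib)
 finally show "(LBINT x. u x * p x) <= (LBINT x. u x * conv (kN R m) p x) - (LBINT x. F x * conv (kP R m) p x)"
  by simp
qed

text \<open>Symmetry of the kernels moves the convolutions from p to the functions, and
  \<open>fundamental_lemma\<close> drops p. The indicator of L makes the functions integrable and is
  invisible from W, whose balls of radius R lie in L.\<close>

lemma mean_value_ae:
 assumes l: "lapge U u F" and R: "R > 0" "m >= 1" and L: "compact L" "L \<subseteq> U"
  and W: "open W" "\<And>x. x \<in> W ==> cball x R \<subseteq> L"
 shows "AE x in lborel. x \<in> W -->
  u x <= conv (kN R m) (\<lambda>x. indicator L x * u x) x - conv (kP R m) (\<lambda>x. indicator L x * F x) x"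
proof -
 interpret N: even_kernel "kN R m" R by (rule even_kernel_N[OF R])
 interpret P: even_kernel "kP R m" R by (rule even_kernel_P[OF R])
 define uL where "uL x = indicator L x * u x" for x
 define FL where "FL x = indicator L x * F x" for x
 have i: "integrable lborel uL" "integrable lborel FL"
  unfolding uL_def FL_def using loc_int_indicator[OF lapgeD(1)[OF l] L] loc_int_indicator[OF lapgeD(2)[OF l] L] by auto
 have WL: "W \<subseteq> L" using W(2) R by (auto simp: subset_iff)
 have lu: "loc_int W u" using lapgeD(1)[OF l] WL L by (auto intro: loc_int_subset)
 have "AE x\<in>W in lborel. 0 <= conv (kN R m) uL x - conv (kP R m) FL x - u x"
 proof (rule fundamental_lemma[OF W(1)])
  show "loc_int W (\<lambda>x. conv (kN R m) uL x - conv (kP R m) FL x - u x)"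
   by (intro loc_int_diff lu loc_int_integrable N.conv_L1 P.conv_L1 i)
  fix p assume p: "test_fun W p" "\<And>x. 0 <= p x"
  obtain K where K: "smooth p" "compact K" "K \<subseteq> W" "\<And>x. x \<notin> K ==> p x = 0" using test_funE[OF p(1)] by metis
  obtain C where C: "\<And>x. \<bar>p x\<bar> <= C" using test_fun_bounded[OF p(1)] by blast
  have KL: "enlarge R K \<subseteq> L" using W(2) K(3) by (auto simp: enlarge_eq)
  have KU: "enlarge R K \<subseteq> U" using KL L(2) by simp
  note mv = mean_value_dual[OF l R K(1,2,4) p(2) KU]
  have pb: "p \<in> borel_measurable borel" using smooth_borel[OF K(1)] .
  have oN: "conv (kN R m) p x = 0" if "x \<notin> L" for x
   by (rule conv_outside[OF N.support, of K]) (use that K(4) KL in auto)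
  have oP: "conv (kP R m) p x = 0" if "x \<notin> L" for x
   by (rule conv_outside[OF P.support, of K]) (use that K(4) KL in auto)
  have e1: "uL x * conv (kN R m) p x = u x * conv (kN R m) p x" for x
   using oN[of x] by (cases "x \<in> L") (auto simp: uL_def)
  have e2: "FL x * conv (kP R m) p x = F x * conv (kP R m) p x" for x
   using oP[of x] by (cases "x \<in> L") (auto simp: FL_def)
  note d1 = N.conv_dual[OF i(1) pb C, unfolded e1] and d2 = P.conv_dual[OF i(2) pb C, unfolded e2]
  have up: "integrable lborel (\<lambda>x. u x * p x)" by (rule loc_int_test[OF lu p(1)])
  have "(LBINT x. (conv (kN R m) uL x - conv (kP R m) FL x - u x) * p x)
   = (LBINT x. u x * conv (kN R m) p x) - (LBINT x. F x * conv (kP R m) p x) - (LBINT x. u x * p x)"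
   using d1 d2 up by (simp add: left_diff_distrib)
  then show "0 <= (LBINT x. (conv (kN R m) uL x - conv (kP R m) FL x - u x) * p x)"
   using mv(1) by simp
 qed
 then show ?thesis unfolding uL_def FL_def by eventually_elim auto
qed

text \<open>The error is measured relative to the mass of the kernel, because \<open>kP\<close> is
  not normalised: its mass is at most R^2 and tends to 0 with the radius.\<close>

lemma conv_approx_uniform:
 assumes h: "test_fun UNIV h" and "e > 0"
 shows "\<exists>d>0. \<forall>\<nu> R x. even_kernel \<nu> R \<and> R < d --> \<bar>conv \<nu> h x - measure \<nu> UNIV * h x\<bar> <= e * measure \<nu> UNIV"
proof -
 obtain d where d: "d > 0" "\<And>z w. norm (z - w) < d ==> \<bar>h z - h w\<bar> < e"
  using test_fun_uniformly_continuous[OF h] assms(2)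
  unfolding uniformly_continuous_on_def dist_norm real_norm_def by (metis UNIV_I)
 have "\<bar>conv \<nu> h x - measure \<nu> UNIV * h x\<bar> <= e * measure \<nu> UNIV" if k: "even_kernel \<nu> R" "R < d" for \<nu> R x
 proof -
  interpret even_kernel \<nu> R by fact
  note i = test_conv_integrable[OF h, of x]
  have "\<bar>conv \<nu> h x - measure \<nu> UNIV * h x\<bar> = \<bar>\<integral>y. h (x - y) - h x \<partial>\<nu>\<bar>"
   unfolding conv_def using i by simp
  also have "\<dots> <= (\<integral>y. \<bar>h (x - y) - h x\<bar> \<partial>\<nu>)" by (rule integral_abs_bound)
  also have "\<dots> <= (\<integral>y. e \<partial>\<nu>)"
  proof (rule integral_mono_AE)
   show "AE y in \<nu>. \<bar>h (x - y) - h x\<bar> <= e" using support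
    by eventually_elim (use k(2) in \<open>auto intro!: less_imp_le[OF d(2)]\<close>)
  qed (use i in auto)
  also have "\<dots> = e * measure \<nu> UNIV" by simp
  finally show ?thesis .
 qed
 then show ?thesis using d(1) by blast
qed

lemma conv_approx_L1:
 assumes f: "integrable lborel f" and e: "e > 0"
 shows "\<exists>d>0. \<forall>\<nu> R. even_kernel \<nu> R \<and> R < d --> (LBINT x. \<bar>conv \<nu> f x - measure \<nu> UNIV * f x\<bar>) <= e * measure \<nu> UNIV"
proof -
 obtain h where h: "test_fun UNIV h" "(LBINT x. \<bar>f x - h x\<bar>) < e / 3" using test_fun_dense[OF f, of "e/3"] e by auto
 obtain K where K: "smooth h" "compact K" "\<And>x. x \<notin> K ==> h x = 0" using test_funE[OF h(1)] by metis
 define L where "L = enlarge 1 K"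
 have L: "compact L" unfolding L_def by (rule compact_enlarge[OF K(2)])
 then have [measurable]: "L \<in> sets borel" by (simp add: compact_imp_closed)
 have fL: "emeasure lborel L < \<infinity>" using L compact_imp_bounded emeasure_bounded_finite by auto
 define v where "v = measure lborel L"
 have "v >= 0" by (simp add: v_def)
 obtain d where d: "d > 0" "\<And>\<nu> R x. even_kernel \<nu> R ==> R < d ==> \<bar>conv \<nu> h x - measure \<nu> UNIV * h x\<bar> <= (e / (3 * (v + 1))) * measure \<nu> UNIV"
  using conv_approx_uniform[OF h(1), of "e / (3 * (v + 1))"] e \<open>v >= 0\<close> by auto
 have "(LBINT x. \<bar>conv \<nu> f x - measure \<nu> UNIV * f x\<bar>) <= e * measure \<nu> UNIV"
  if k: "even_kernel \<nu> R" "R < min d 1" for \<nu> R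
 proof -
  interpret even_kernel \<nu> R by fact
  define M where "M = measure \<nu> UNIV"
  have M: "M >= 0" by (simp add: M_def)
  note ih = test_fun_integrable[OF h(1)]
  define q where "q x = \<bar>f x - h x\<bar>" for x
  have iq: "integrable lborel q" unfolding q_def using f ih by auto
  have out: "conv \<nu> h x = 0" if "x \<notin> L" for x
   by (rule conv_outside[OF support K(3)]) (use that k(2) enlarge_mono[of K K R 1] in \<open>auto simp: L_def\<close>)
  have h0: "h x = 0" if "x \<notin> L" for x using that K(3) enlarge_superset[of 1 K] by (auto simp: L_def)
  have "AE x in lborel. \<bar>conv \<nu> f x - M * f x\<bar> <= conv \<nu> q x + (e / (3 * (v + 1))) * M * indicator L x + M * q x"
   using conv_L1(2)[OF f] conv_L1(2)[OF iq]
  proof eventually_elim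
   case (elim x)
   have ihx: "integrable \<nu> (\<lambda>y. h (x - y))" by (rule test_conv_integrable[OF h(1)])
   have "\<bar>conv \<nu> f x - conv \<nu> h x\<bar> = \<bar>\<integral>y. f (x - y) - h (x - y) \<partial>\<nu>\<bar>"
    unfolding conv_def using elim(1) ihx by simp
   also have "\<dots> <= conv \<nu> q x" unfolding conv_def q_def by (rule integral_abs_bound)
   finally have 1: "\<bar>conv \<nu> f x - conv \<nu> h x\<bar> <= conv \<nu> q x" .
   have 2: "\<bar>conv \<nu> h x - M * h x\<bar> <= (e / (3 * (v + 1))) * M * indicator L x"
    using d(2)[OF k(1), of x] k(2) out[of x] h0[of x] by (cases "x \<in> L") (auto simp: M_def)
   have 3: "\<bar>M * h x - M * f x\<bar> = M * q x" using M by (simp add: q_def right_diff_distrib[symmetric] abs_mult abs_minus_commute)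
   show ?case using 1 2 3 by linarith
  qed
  then have "(LBINT x. \<bar>conv \<nu> f x - M * f x\<bar>) <= (LBINT x. conv \<nu> q x + (e / (3 * (v + 1))) * M * indicator L x + M * q x)"
   using conv_L1(1)[OF f] conv_L1(1)[OF iq] f iq fL by (intro integral_mono_AE) auto
  also have "\<dots> = M * integral\<^sup>L lborel q + (e / (3 * (v + 1))) * M * v + M * integral\<^sup>L lborel q"
   using conv_L1(1,3)[OF iq] iq fL by (simp add: v_def M_def)
  also have "\<dots> <= M * (e / 3) + M * (e / 3) + M * (e / 3)"
  proof (intro add_mono)
   show "M * integral\<^sup>L lborel q <= M * (e / 3)" using h(2) M by (intro mult_left_mono) (auto simp: q_def[abs_def])
   then show "M * integral\<^sup>L lborel q <= M * (e / 3)" .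
   have "v / (v + 1) <= 1" using \<open>v >= 0\<close> by simp
   then have "(M * (e / 3)) * (v / (v + 1)) <= M * (e / 3) * 1" using M e by (intro mult_left_mono) auto
   then show "(e / (3 * (v + 1))) * M * v <= M * (e / 3)" by (simp add: mult_ac)
  qed
  finally show ?thesis by (simp add: M_def mult_ac)
 qed
 then show ?thesis using d(1) by (intro exI[of _ "min d 1"]) auto
qed

section \<open>Kato's inequality and comparison\<close>

text \<open>The pointwise mean value inequality passes to maxima; dividing by the mass of the kernel
 \<open>kP\<close> and letting the radius tend to 0 recovers a distributional inequality.\<close>

lemma lapge_max:
 assumes l1: "lapge U u F" and l2: "lapge U v H" and U: "open U"
 shows "lapge U (\<lambda>x. max (u x) (v x)) (\<lambda>x. if u x > v x then F x else H x)"
proof -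
 note [measurable] = loc_int_borel[OF lapgeD(1)[OF l1]] loc_int_borel[OF lapgeD(2)[OF l1]]
  loc_int_borel[OF lapgeD(1)[OF l2]] loc_int_borel[OF lapgeD(2)[OF l2]]
 define w where "w x = max (u x) (v x)" for x
 define G where "G x = (if u x > v x then F x else H x)" for x
 have lw: "loc_int U w" unfolding w_def by (intro loc_int_max lapgeD(1)[OF l1] lapgeD(1)[OF l2])
 have lG: "loc_int U G" unfolding G_def
  by (intro loc_int_if lapgeD(2)[OF l1] lapgeD(2)[OF l2]) measurable
 note [measurable] = loc_int_borel[OF lw] loc_int_borel[OF lG]
 have "lapge U w G"
 proof (rule lapgeI[OF lw lG])
  fix p assume p: "test_fun U p" "\<And>x. 0 <= p x"
  obtain K where K: "smooth p" "compact K" "K \<subseteq> U" "\<And>x. x \<notin> K ==> p x = 0" using test_funE[OF p(1)] by metis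
  obtain C where C: "\<And>x. \<bar>p x\<bar> <= C" using test_fun_bounded[OF p(1)] by blast
  have C0: "C >= 0" using order_trans[OF abs_ge_zero C] .
  note [measurable] = smooth_borel[OF K(1)]
  have pU: "test_fun UNIV p" by (rule test_fun_UNIV[OF p(1)])
  obtain r where r: "r > 0" "enlarge r K \<subseteq> U" using compact_enlarge_subset[OF K(2) U K(3)] by blast
  define L where "L = enlarge r K"
  have L: "compact L" "L \<subseteq> U" using compact_enlarge[OF K(2)] r by (auto simp: L_def)
  then have [measurable]: "L \<in> sets borel" by (simp add: compact_imp_closed)
  define W where "W = (\<Union>x\<in>K. ball x (r/2))"
  have W: "open W" "K \<subseteq> W" using r(1) by (auto simp: W_def)
  define R where "R n = r / (2 * real (Suc n))" for n
  have R: "R n > 0" "R n <= r / 2" for n using r(1) by (auto simp: R_def field_simps)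
  have WL: "cball x (R n) \<subseteq> L" if xW: "x \<in> W" for x n
  proof
   fix z assume z: "z \<in> cball x (R n)"
   obtain y where y: "y \<in> K" "dist y x < r / 2" using xW by (auto simp: W_def)
   have "dist y z <= dist y x + dist x z" by (rule dist_triangle)
   also have "\<dots> <= r" using y(2) z R(2)[of n] by (simp add: field_simps)
   finally show "z \<in> L" using y(1) by (auto simp: L_def enlarge_eq)
  qed
  have R0: "R \<longlonglongrightarrow> 0"
  proof -
   have "(\<lambda>n. (r / 2) * inverse (real (Suc n))) \<longlonglongrightarrow> (r / 2) * 0"
    by (intro tendsto_mult_left LIMSEQ_inverse_real_of_nat)
   then show ?thesis by (simp add: R_def[abs_def] field_simps)
  qed
  have evR: "\<exists>N. \<forall>n\<ge>N. R n < d" if "d > 0" for d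
   using order_tendstoD(2)[OF R0 that] by (simp add: eventually_sequentially)
  define M where "M n = measure (kP (R n) 2) (UNIV :: 'a set)" for n
  have M: "M n > 0" for n unfolding M_def by (rule kP_mass(1)[OF R(1)]) simp
  define uL vL wL FL HL where "uL x = indicator L x * u x" and "vL x = indicator L x * v x" and
   "wL x = indicator L x * w x" and "FL x = indicator L x * F x" and "HL x = indicator L x * H x" for x
  have i: "integrable lborel uL" "integrable lborel vL" "integrable lborel wL" "integrable lborel FL" "integrable lborel HL"
   unfolding uL_def vL_def wL_def FL_def HL_def
   using lapgeD(1,2)[OF l1] lapgeD(1,2)[OF l2] lw L by (auto intro: loc_int_indicator)
  \<comment> \<open>p is split according to which function realises the maximum. The two parts are
    bounded but only Borel, so the averages of F and H have to converge in L1, whereas for the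
    Laplacian of p uniform convergence is available.\<close>
  define p1 p2 where "p1 x = (if u x > v x then p x else 0)" and "p2 x = (if u x > v x then 0 else p x)" for x
  have [measurable]: "p1 \<in> borel_measurable borel" "p2 \<in> borel_measurable borel" unfolding p1_def p2_def by measurable
  have pb: "\<bar>p1 x\<bar> <= C" "\<bar>p2 x\<bar> <= C" for x using C[of x] C0 by (auto simp: p1_def p2_def)
  let ?A = "\<lambda>n. (LBINT x. wL x * conv (kP (R n) 2) (laplacian p) x)"
  let ?B = "\<lambda>n. (LBINT x. conv (kP (R n) 2) FL x * p1 x)"
  let ?C = "\<lambda>n. (LBINT x. conv (kP (R n) 2) HL x * p2 x)"
  \<comment> \<open>At each point the mean value inequality of the larger function is used, and its
    \<open>kN\<close> average is at most that of the maximum. Testing with p and moving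
    \<open>kN\<close> back to p leaves a convolution of the Laplacian with
    \<open>kP\<close>.\<close>
  have ineq: "?B n + ?C n <= ?A n" for n
  proof -
   interpret N: even_kernel "kN (R n) 2" "R n" by (rule even_kernel_N[OF R(1)]) simp
   interpret P: even_kernel "kP (R n) 2" "R n" by (rule even_kernel_P[OF R(1)]) simp
   have mono: "AE x in lborel. conv (kN (R n) 2) uL x <= conv (kN (R n) 2) wL x" "AE x in lborel. conv (kN (R n) 2) vL x <= conv (kN (R n) 2) wL x"
    using i by (auto intro!: N.conv_mono_AE N.conv_L1 simp: uL_def vL_def wL_def w_def indicator_def)
   have mv1: "AE x\<in>W in lborel. u x <= conv (kN (R n) 2) uL x - conv (kP (R n) 2) FL x"
    unfolding uL_def[abs_def] FL_def[abs_def] by (rule mean_value_ae[OF l1 R(1) _ L W(1) WL]) auto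
   have mv2: "AE x\<in>W in lborel. v x <= conv (kN (R n) 2) vL x - conv (kP (R n) 2) HL x"
    unfolding vL_def[abs_def] HL_def[abs_def] by (rule mean_value_ae[OF l2 R(1) _ L W(1) WL]) auto
   have "AE x in lborel. wL x * p x <= conv (kN (R n) 2) wL x * p x - (conv (kP (R n) 2) FL x * p1 x + conv (kP (R n) 2) HL x * p2 x)"
    using mv1 mv2 mono
   proof eventually_elim
    case (elim x)
    show ?case
    proof (cases "x \<in> K")
     case True
     then have x: "x \<in> W" "wL x = w x" using W(2) enlarge_superset[of r K] r(1) by (auto simp: wL_def L_def)
     have "w x <= conv (kN (R n) 2) wL x - (if u x > v x then conv (kP (R n) 2) FL x else conv (kP (R n) 2) HL x)"
      using elim x(1) by (auto simp: w_def max_def)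
     then have "w x * p x <= (conv (kN (R n) 2) wL x - (if u x > v x then conv (kP (R n) 2) FL x else conv (kP (R n) 2) HL x)) * p x"
      using p(2) by (intro mult_right_mono)
     then show ?thesis unfolding x(2) by (auto simp: p1_def p2_def left_diff_distrib)
    qed (use K(4) in \<open>auto simp: p1_def p2_def\<close>)
   qed
   moreover note dN = N.conv_dual[OF i(3) smooth_borel[OF K(1)] C]
   moreover have iw: "integrable lborel (\<lambda>x. wL x * p x)"
    using loc_int_test[OF loc_int_integrable[OF i(3)] pU] .
   moreover note d1 = P.conv_dual(2)[OF i(4) _ pb(1)] and d2 = P.conv_dual(2)[OF i(5) _ pb(2)]
   ultimately have "(LBINT x. wL x * p x) <= (LBINT x. conv (kN (R n) 2) wL x * p x - (conv (kP (R n) 2) FL x * p1 x + conv (kP (R n) 2) HL x * p2 x))"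
    by (intro integral_mono_AE) auto
   also have "\<dots> = (LBINT x. wL x * conv (kN (R n) 2) p x) - (?B n + ?C n)"
    using dN d1 d2 by simp
   finally have "?B n + ?C n <= (LBINT x. wL x * conv (kN (R n) 2) p x) - (LBINT x. wL x * p x)" by simp
   also have "\<dots> = ?A n"
    using dN(3) iw averaging_identity[OF pU R(1), of 2] by (simp add: right_diff_distrib)
   finally show ?thesis .
  qed
  have limA: "(\<lambda>n. ?A n / M n) \<longlonglongrightarrow> (LBINT x. wL x * laplacian p x)"
  proof (rule LIMSEQ_I)
   fix e :: real assume e: "e > 0"
   define I where "I = (LBINT x. \<bar>wL x\<bar>)"
   have I: "I >= 0" by (simp add: I_def)
   note lp = test_fun_laplacian[OF pU]
   obtain d where d: "d > 0" "\<And>\<nu> R x. even_kernel \<nu> R ==> R < d ==> \<bar>conv \<nu> (laplacian p) x - measure \<nu> UNIV * laplacian p x\<bar> <= (e / (I + 1)) * measure \<nu> UNIV"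
    using conv_approx_uniform[OF lp, of "e / (I + 1)"] e I by auto
   obtain n0 where n0: "\<And>n. n >= n0 ==> R n < d" using evR[OF d(1)] by blast
   have "norm (?A n / M n - (LBINT x. wL x * laplacian p x)) < e" if "n >= n0" for n
   proof -
    have ek: "even_kernel (kP (R n) 2 :: 'a measure) (R n)" by (rule even_kernel_P[OF R(1)]) simp
    interpret P: even_kernel "kP (R n) 2 :: 'a measure" "R n" by (rule ek)
    obtain C' where C': "\<And>x. \<bar>laplacian p x\<bar> <= C'" using test_fun_bounded[OF lp] by blast
    note i1 = P.conv_dual(3)[OF i(3) smooth_borel[OF test_fun_smooth[OF lp]] C']
    have i2: "integrable lborel (\<lambda>x. wL x * laplacian p x)" by (rule loc_int_test[OF loc_int_integrable[OF i(3)] lp])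
    have "?A n - M n * (LBINT x. wL x * laplacian p x) = (LBINT x. wL x * conv (kP (R n) 2) (laplacian p) x - M n * (wL x * laplacian p x))"
     using i1 i2 by simp
    also have "\<bar>\<dots>\<bar> <= (LBINT x. ((e / (I + 1)) * M n) * \<bar>wL x\<bar>)"
    proof (rule order_trans[OF integral_abs_bound] integral_mono)+
     show "integrable lborel (\<lambda>x. \<bar>wL x * conv (kP (R n) 2) (laplacian p) x - M n * (wL x * laplacian p x)\<bar>)" using i1 i2 by auto
     show "integrable lborel (\<lambda>x. (e / (I + 1)) * M n * \<bar>wL x\<bar>)" using i(3) by auto
     fix x
     have "\<bar>wL x * conv (kP (R n) 2) (laplacian p) x - M n * (wL x * laplacian p x)\<bar> = \<bar>conv (kP (R n) 2) (laplacian p) x - M n * laplacian p x\<bar> * \<bar>wL x\<bar>"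
      by (simp add: abs_mult[symmetric] algebra_simps)
     also have "\<dots> <= ((e / (I + 1)) * M n) * \<bar>wL x\<bar>"
      unfolding M_def by (intro mult_right_mono d(2)[OF ek n0[OF that]]) auto
     finally show "\<bar>wL x * conv (kP (R n) 2) (laplacian p) x - M n * (wL x * laplacian p x)\<bar> <= (e / (I + 1)) * M n * \<bar>wL x\<bar>" .
    qed
    also have "\<dots> = (e * (I / (I + 1))) * M n" by (simp add: I_def)
    also have "\<dots> < e * M n" using e I M[of n] by (intro mult_strict_right_mono) (auto simp: field_simps)
    finally have "\<bar>?A n - M n * (LBINT x. wL x * laplacian p x)\<bar> < e * M n" .
    moreover have "?A n / M n - (LBINT x. wL x * laplacian p x) = (?A n - M n * (LBINT x. wL x * laplacian p x)) / M n"
     using M[of n] by (simp add: field_simps)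
    ultimately show ?thesis using M[of n] by (simp add: abs_divide divide_less_eq)
   qed
   then show "\<exists>n0. \<forall>n\<ge>n0. norm (?A n / M n - (LBINT x. wL x * laplacian p x)) < e" by blast
  qed
  have limB: "(\<lambda>n. (LBINT x. conv (kP (R n) 2) f x * q x) / M n) \<longlonglongrightarrow> (LBINT x. f x * q x)"
   if f: "integrable lborel f" and [measurable]: "q \<in> borel_measurable borel" and q: "\<And>x. \<bar>q x\<bar> <= C" for f q :: "'a => real"
  proof (rule LIMSEQ_I)
   fix e :: real assume e: "e > 0"
   have e': "e / (2 * (C + 1)) > 0" using e C0 by simp
   obtain d where d: "d > 0" "\<And>\<nu> R. even_kernel \<nu> R ==> R < d ==> (LBINT x. \<bar>conv \<nu> f x - measure \<nu> UNIV * f x\<bar>) <= (e / (2 * (C + 1))) * measure \<nu> UNIV"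
    using conv_approx_L1[OF f e'] by blast
   obtain n0 where n0: "\<And>n. n >= n0 ==> R n < d" using evR[OF d(1)] by blast
   have "norm ((LBINT x. conv (kP (R n) 2) f x * q x) / M n - (LBINT x. f x * q x)) < e" if "n >= n0" for n
   proof -
    have ek: "even_kernel (kP (R n) 2 :: 'a measure) (R n)" by (rule even_kernel_P[OF R(1)]) simp
    interpret P: even_kernel "kP (R n) 2 :: 'a measure" "R n" by (rule ek)
    have [measurable]: "f \<in> borel_measurable borel" using f by auto
    note i1 = P.conv_dual(2)[OF f _ q]
    have i2: "integrable lborel (\<lambda>x. f x * q x)"
     by (rule Bochner_Integration.integrable_bound[OF integrable_mult_right[OF f, of C]])
      (auto simp: abs_mult C0 mult.commute[of C] intro!: mult_left_mono q)
    have "(LBINT x. conv (kP (R n) 2) f x * q x) - M n * (LBINT x. f x * q x) = (LBINT x. conv (kP (R n) 2) f x * q x - M n * (f x * q x))"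
     using i1 i2 by simp
    also have "\<bar>\<dots>\<bar> <= (LBINT x. C * \<bar>conv (kP (R n) 2) f x - M n * f x\<bar>)"
    proof (rule order_trans[OF integral_abs_bound] integral_mono)+
     show "integrable lborel (\<lambda>x. \<bar>conv (kP (R n) 2) f x * q x - M n * (f x * q x)\<bar>)" using i1 i2 by auto
     show "integrable lborel (\<lambda>x. C * \<bar>conv (kP (R n) 2) f x - M n * f x\<bar>)" using P.conv_L1(1)[OF f] f by auto
     fix x
     have "\<bar>conv (kP (R n) 2) f x * q x - M n * (f x * q x)\<bar> = \<bar>q x\<bar> * \<bar>conv (kP (R n) 2) f x - M n * f x\<bar>"
      by (simp add: abs_mult[symmetric] algebra_simps)
     also have "\<dots> <= C * \<bar>conv (kP (R n) 2) f x - M n * f x\<bar>" by (intro mult_right_mono q) auto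
     finally show "\<bar>conv (kP (R n) 2) f x * q x - M n * (f x * q x)\<bar> <= C * \<bar>conv (kP (R n) 2) f x - M n * f x\<bar>" .
    qed
    also have "\<dots> <= C * ((e / (2 * (C + 1))) * M n)"
     using mult_left_mono[OF d(2)[OF ek n0[OF that]] C0] by (simp only: M_def integral_mult_right_zero)
    also have "\<dots> = (e * (C / (2 * (C + 1)))) * M n" by simp
    also have "\<dots> < (e * 1) * M n" using e C0 M[of n] by (intro mult_strict_right_mono mult_strict_left_mono) (auto simp: divide_less_eq)
    finally have "\<bar>(LBINT x. conv (kP (R n) 2) f x * q x) - M n * (LBINT x. f x * q x)\<bar> < e * M n" by simp
    moreover have "(LBINT x. conv (kP (R n) 2) f x * q x) / M n - (LBINT x. f x * q x) = ((LBINT x. conv (kP (R n) 2) f x * q x) - M n * (LBINT x. f x * q x)) / M n"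
     using M[of n] by (simp add: field_simps)
    ultimately show ?thesis using M[of n] by (simp add: abs_divide divide_less_eq)
   qed
   then show "\<exists>n0. \<forall>n\<ge>n0. norm ((LBINT x. conv (kP (R n) 2) f x * q x) / M n - (LBINT x. f x * q x)) < e" by blast
  qed
  have "(\<lambda>n. ?B n / M n + ?C n / M n) \<longlonglongrightarrow> (LBINT x. FL x * p1 x) + (LBINT x. HL x * p2 x)"
   using pb i by (intro tendsto_add limB) auto
  moreover have "?B n / M n + ?C n / M n <= ?A n / M n" for n
   using ineq[of n] M[of n] by (simp add: add_divide_distrib[symmetric] divide_right_mono)
  ultimately have le: "(LBINT x. FL x * p1 x) + (LBINT x. HL x * p2 x) <= (LBINT x. wL x * laplacian p x)"
   by (intro LIMSEQ_le[OF _ limA]) auto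
  have lo: "laplacian p x = 0" if "x \<notin> K" for x
   by (rule laplacian_outside[OF compact_imp_closed[OF K(2)]]) (use K(4) that in auto)
  have KL: "K \<subseteq> L" unfolding L_def using r(1) by (intro enlarge_superset) simp
  have ii: "integrable lborel (\<lambda>x. f x * q x)" if "integrable lborel f" "q \<in> borel_measurable borel" "\<And>x. \<bar>q x\<bar> <= C" for f q :: "'a => real"
   by (rule Bochner_Integration.integrable_bound[OF integrable_mult_right[OF that(1), of C]])
    (use that C0 borel_measurable_integrable[OF that(1)] in \<open>auto simp: abs_mult mult.commute[of C] intro!: mult_left_mono\<close>)
  have "(LBINT x. G x * p x) = (LBINT x. FL x * p1 x + HL x * p2 x)"
   using KL K(4) by (intro Bochner_Integration.integral_cong refl) (auto simp: G_def FL_def HL_def p1_def p2_def indicator_def)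
  also have "\<dots> = (LBINT x. FL x * p1 x) + (LBINT x. HL x * p2 x)"
   by (intro Bochner_Integration.integral_add ii i pb) auto
  also note le
  also have "(LBINT x. wL x * laplacian p x) = (LBINT x. w x * laplacian p x)"
  proof (intro Bochner_Integration.integral_cong refl)
   fix x
   show "wL x * laplacian p x = w x * laplacian p x"
    using lo[of x] KL
    by (cases "x \<in> K") (auto simp: wL_def)
  qed
  finally show "(LBINT x. G x * p x) <= (LBINT x. w x * laplacian p x)" .
 qed
 then show ?thesis unfolding w_def G_def .
qed

lemma kN_density_bound_test:
 "\<exists>C>0. \<forall>R>0. \<forall>p x. test_fun UNIV p \<and> (\<forall>x. 0 <= p x) -->
  conv (kN R (DIM('a) + 1)) p x <= C / R ^ DIM('a) * integral\<^sup>L lborel (p :: 'a::euclidean_space => real)"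
proof (intro exI[of _ "real (DIM('a) + 1) / paraboloid_mass TYPE('a)"] conjI allI impI)
 show "real (DIM('a) + 1) / paraboloid_mass TYPE('a) > 0" using paraboloid_mass_pos[where 'a='a] by simp
 fix R :: real and p :: "'a => real" and x
 assume R: "R > 0" and p: "test_fun UNIV p \<and> (\<forall>x. 0 <= p x)"
 then obtain C where "\<And>x. \<bar>p x\<bar> <= C" using test_fun_bounded by blast
 then have "\<And>x. p x <= C" using abs_le_D1 by blast
 then show "conv (kN R (DIM('a) + 1)) p x <= real (DIM('a) + 1) / paraboloid_mass TYPE('a) / R ^ DIM('a) * integral\<^sup>L lborel p"
  using p by (intro kN_density_bound[OF R]) (auto intro: smooth_borel test_fun_smooth test_fun_integrable)
qed

text \<open>A Liouville property: the integral of w p is at most that of w times the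
  \<open>kN\<close> average of p, and this average is bounded by a multiple of R^(-n). Letting R
  grow leaves 0.\<close>

lemma subharmonic_integrable_nonpos:
 assumes l: "lapge UNIV w (\<lambda>_. 0)" and i: "integrable lborel w"
 shows "AE x in lborel. w x <= (0::real)"
proof -
 have "AE x\<in>UNIV in lborel. 0 <= - w x"
 proof (rule fundamental_lemma)
  show "loc_int UNIV (\<lambda>x. - w x)" by (intro loc_int_uminus loc_int_integrable i)
  fix p :: "'a => real" assume p: "test_fun UNIV p" "\<And>x. 0 <= p x"
  obtain K where K: "smooth p" "compact K" "\<And>x. x \<notin> K ==> p x = 0" using test_funE[OF p(1)] by metis
  obtain C where C: "C > 0" "\<And>R x. R > 0 ==> conv (kN R (DIM('a) + 1)) p x <= C / R ^ DIM('a) * integral\<^sup>L lborel p"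
   using kN_density_bound_test[where 'a='a] p by blast
  define I where "I = (LBINT x. \<bar>w x\<bar>)"
  define J where "J = integral\<^sup>L lborel p"
  have "(LBINT x. w x * p x) <= (C * J * I) * inverse (real (Suc n)) ^ DIM('a)" for n
  proof -
   define R where "R = real (Suc n)"
   have R: "R > 0" by (simp add: R_def)
   interpret N: even_kernel "kN R (DIM('a) + 1)" R by (rule even_kernel_N[OF R]) simp
   note mv = mean_value_dual[OF l R _ K(1,2,3) p(2), of "DIM('a) + 1"]
   have "(LBINT x. w x * p x) <= (LBINT x. w x * conv (kN R (DIM('a) + 1)) p x)" using mv(1) by simp
   also have "\<dots> <= (LBINT x. (C / R ^ DIM('a) * J) * \<bar>w x\<bar>)"
   proof (rule integral_mono)
    show "integrable lborel (\<lambda>x. w x * conv (kN R (DIM('a) + 1)) p x)" using loc_int_test[OF lapgeD(1)[OF l] mv(3)] by simp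
    show "integrable lborel (\<lambda>x. C / R ^ DIM('a) * J * \<bar>w x\<bar>)" using i by auto
    fix x
    have "w x * conv (kN R (DIM('a) + 1)) p x <= \<bar>w x\<bar> * conv (kN R (DIM('a) + 1)) p x"
     using N.conv_nonneg[OF p(2)] by (intro mult_right_mono) auto
    also have "\<dots> <= \<bar>w x\<bar> * (C / R ^ DIM('a) * J)" unfolding J_def by (intro mult_left_mono C(2) R) auto
    finally show "w x * conv (kN R (DIM('a) + 1)) p x <= C / R ^ DIM('a) * J * \<bar>w x\<bar>" by (simp add: mult.commute)
   qed
   also have "\<dots> = (C * J * I) * inverse (real (Suc n)) ^ DIM('a)" by (simp add: I_def R_def divide_inverse power_inverse)
   finally show ?thesis .
  qed
  moreover have "(\<lambda>n. (C * J * I) * inverse (real (Suc n)) ^ DIM('a)) \<longlonglongrightarrow> (C * J * I) * 0 ^ DIM('a)"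
   by (intro tendsto_intros LIMSEQ_inverse_real_of_nat)
  ultimately have "(LBINT x. w x * p x) <= (C * J * I) * 0 ^ DIM('a)" by (intro LIMSEQ_le_const) auto
  then show "0 <= (LBINT x. - w x * p x)" by (simp add: power_0_left)
 qed auto
 then show ?thesis by eventually_elim auto
qed

text \<open>By Kato's inequality the positive part of u - v is subharmonic. It vanishes off K, so
  its extension by 0 is integrable and subharmonic on the whole space, and the Liouville property
  applies. Boundary data thus enter only as an inequality off a compact set.\<close>

lemma comparison:
 assumes U: "open U" and l1: "lapge U u F" and l2: "lapge U (\<lambda>x. - v x) (\<lambda>x. - H x)" and K: "compact K" "K \<subseteq> U"
  and out: "AE x\<in>U in lborel. x \<notin> K --> u x <= v x"
  and FH: "AE x\<in>U in lborel. u x > v x --> F x >= H x"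
 shows "AE x\<in>U in lborel. u x <= v x"
proof -
 have [measurable]: "K \<in> sets borel" using K by (simp add: compact_imp_closed)
 have l: "lapge U (\<lambda>x. u x - v x) (\<lambda>x. F x - H x)" using lapge_add[OF l1 l2] by simp
 have lm: "lapge U (\<lambda>x. max (u x - v x) 0) (\<lambda>x. if u x - v x > 0 then F x - H x else 0)"
  by (rule lapge_max[OF l lapge_const U])
 have l0: "lapge U (\<lambda>x. max (u x - v x) 0) (\<lambda>x. 0)"
  by (rule lapge_mono[OF lm loc_int_const]) (use FH in eventually_elim, auto)
 have [measurable]: "(\<lambda>x. u x - v x) \<in> borel_measurable borel" using lapgeD(1)[OF l] by (rule loc_int_borel)
 define w where "w x = indicator K x * max (u x - v x) 0" for x
 have "lapge (U \<union> - K) w (\<lambda>x. 0)"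
 proof (rule lapge_union[OF U])
  show "open (- K)" using K(1) by (simp add: compact_imp_closed open_Compl)
  show "lapge U w (\<lambda>x. 0)"
   by (rule lapge_cong[OF l0]) (auto simp: w_def[abs_def] intro!: eventually_mono[OF out])
  show "lapge (- K) w (\<lambda>x. 0)"
   by (rule lapge_cong[OF lapge_const[of _ 0]]) (auto simp: w_def[abs_def])
 qed
 moreover have "U \<union> - K = UNIV" using K(2) by auto
 ultimately have "lapge UNIV w (\<lambda>x. 0)" by simp
 moreover have "integrable lborel w" unfolding w_def by (rule loc_int_indicator[OF lapgeD(1)[OF l0] K])
 ultimately have "AE x in lborel. w x <= 0" by (rule subharmonic_integrable_nonpos)
 then show ?thesis using out by eventually_elim (auto simp: w_def indicator_def split: if_splits)
qed

text \<open>On U \<inter> W the new function is a maximum, and on U - C it equals u almost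
  everywhere, as b is below u off C. These open sets cover U, and locality gives the
  inequality.\<close>

lemma lapge_glue:
 assumes o: "open U" "open W" and C: "closed C" "C \<subseteq> W"
  and l1: "lapge U u F" and l2: "lapge (U \<inter> W) b H" and W[measurable]: "b \<in> borel_measurable borel" "H \<in> borel_measurable borel"
  and out: "AE x\<in>U \<inter> W in lborel. x \<notin> C --> b x <= u x"
 shows "lapge U (\<lambda>x. if x \<in> W then max (u x) (b x) else u x) (\<lambda>x. if x \<in> W \<and> u x < b x then H x else F x)"
  (is "lapge U ?v ?G")
proof -
 note [measurable] = loc_int_borel[OF lapgeD(1)[OF l1]] loc_int_borel[OF lapgeD(2)[OF l1]]
 have [measurable]: "W \<in> sets borel" using o by auto
 have m: "?v \<in> borel_measurable borel" "?G \<in> borel_measurable borel" by measurable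
 have "lapge (U \<inter> W) (\<lambda>x. max (b x) (u x)) (\<lambda>x. if b x > u x then H x else F x)"
  by (rule lapge_max[OF l2 lapge_subset[OF l1]]) (use o in auto)
 then have "lapge (U \<inter> W) ?v ?G" by (rule lapge_cong[OF _ m]) (auto simp: max.commute)
 moreover have "lapge (U - C) ?v ?G"
  by (rule lapge_cong[OF lapge_subset[OF l1, of "U - C"] m]) (use out in \<open>auto elim!: eventually_mono\<close>)
 ultimately have "lapge ((U \<inter> W) \<union> (U - C)) ?v ?G" using o C by (intro lapge_union) auto
 moreover have "(U \<inter> W) \<union> (U - C) = U" using C by auto
 ultimately show ?thesis by simp
qed

text \<open>The dual mean value inequality with exponent \<open>DIM('a) + 1\<close>: the averaged
  test function is at most C0 / R^n times the integral of p, and the mass of \<open>kP\<close>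
  contributes at most R^2. Since C0 depends on the dimension alone, all data are quantified
  inside.\<close>

lemma local_upper_bound:
 "\<exists>C0>0. \<forall>U (w::'a::euclidean_space => real) c R L W. lapge U w (\<lambda>_. - c) --> c >= 0 --> R > 0 --> compact L --> L \<subseteq> U --> open W -->
  (\<forall>x\<in>W. cball x R \<subseteq> L) -->
  (AE x\<in>W in lborel. w x <= C0 / R ^ DIM('a) * (LBINT x. indicator L x * \<bar>w x\<bar>) + c * R\<^sup>2)"
proof -
 obtain C0 where C0: "C0 > 0" "\<And>R x p. R > 0 ==> test_fun UNIV p ==> (\<And>x. 0 <= p x) ==>
   conv (kN R (DIM('a) + 1)) p x <= C0 / R ^ DIM('a) * integral\<^sup>L lborel (p::'a => real)"
  using kN_density_bound_test[where 'a='a] by blast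
 show ?thesis
 proof (rule exI[of _ C0], intro conjI allI impI C0(1))
  fix U :: "'a set" and w c R L W
  assume l: "lapge U w (\<lambda>_. - c)" and c: "c >= 0" and R: "R > 0" and L: "compact L" "L \<subseteq> U" and W: "open W" "\<forall>x\<in>W. cball x R \<subseteq> L"
  let ?m = "DIM('a) + 1"
  interpret N: even_kernel "kN R ?m" R by (rule even_kernel_N[OF R]) simp
  interpret P: even_kernel "kP R ?m" R by (rule even_kernel_P[OF R]) simp
  have [measurable]: "L \<in> sets borel" using L by (simp add: compact_imp_closed)
  define I where "I = (LBINT x. indicator L x * \<bar>w x\<bar>)"
  have iL: "integrable lborel (\<lambda>x. indicator L x * \<bar>w x\<bar>)" by (rule loc_int_indicator[OF loc_int_abs[OF lapgeD(1)[OF l]] L])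
  have WL: "W \<subseteq> L" using W(2) R by (auto simp: subset_iff)
  have lw: "loc_int W w" using lapgeD(1)[OF l] WL L by (auto intro: loc_int_subset)
  have "AE x\<in>W in lborel. 0 <= (C0 / R ^ DIM('a) * I + c * R\<^sup>2) - w x"
  proof (rule fundamental_lemma[OF W(1)])
   show "loc_int W (\<lambda>x. (C0 / R ^ DIM('a) * I + c * R\<^sup>2) - w x)" by (intro loc_int_diff loc_int_const lw)
   fix p assume p: "test_fun W p" "\<And>x. 0 <= p x"
   obtain K where K: "smooth p" "compact K" "K \<subseteq> W" "\<And>x. x \<notin> K ==> p x = 0" using test_funE[OF p(1)] by metis
   have KL: "enlarge R K \<subseteq> L" using W(2) K(3) by (auto simp: enlarge_eq)
   note mv = mean_value_dual[OF l R _ K(1,2,4) p(2) order_trans[OF KL L(2)], of ?m]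
   note pU = test_fun_UNIV[OF p(1)]
   define J where "J = integral\<^sup>L lborel p"
   have ip: "integrable lborel p" by (rule test_fun_integrable[OF pU])
   have J: "J >= 0" unfolding J_def by (rule Bochner_Integration.integral_nonneg[OF p(2)])
   have "(LBINT x. w x * conv (kN R ?m) p x) <= (LBINT x. (C0 / R ^ DIM('a) * J) * (indicator L x * \<bar>w x\<bar>))"
   proof (rule integral_mono)
    show "integrable lborel (\<lambda>x. w x * conv (kN R ?m) p x)" using loc_int_test[OF lapgeD(1)[OF l] mv(3)] by simp
    show "integrable lborel (\<lambda>x. C0 / R ^ DIM('a) * J * (indicator L x * \<bar>w x\<bar>))" using iL by auto
    fix x
    show "w x * conv (kN R ?m) p x <= C0 / R ^ DIM('a) * J * (indicator L x * \<bar>w x\<bar>)"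
    proof (cases "x \<in> L")
     case True
     have "w x * conv (kN R ?m) p x <= \<bar>w x\<bar> * conv (kN R ?m) p x"
      using N.conv_nonneg[OF p(2)] by (intro mult_right_mono) auto
     also have "\<dots> <= \<bar>w x\<bar> * (C0 / R ^ DIM('a) * J)" unfolding J_def by (intro mult_left_mono C0(2) R pU p(2)) auto
     finally show ?thesis using True by (simp add: mult.commute)
    next
     case False
     have "conv (kN R ?m) p x = 0" by (rule conv_outside[OF N.support, of K]) (use K(4) False KL in auto)
     then show ?thesis using False by simp
    qed
   qed
   also have "\<dots> = (C0 / R ^ DIM('a) * J) * I" by (simp add: I_def)
   finally have a1: "(LBINT x. w x * conv (kN R ?m) p x) <= (C0 / R ^ DIM('a) * J) * I" .
   have "c * (LBINT x. conv (kP R ?m) p x) = c * (measure (kP R ?m) (UNIV :: 'a set) * J)" using P.conv_L1(3)[OF ip] by (simp add: J_def)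
   also have "\<dots> <= c * (R\<^sup>2 * J)" using kP_mass(2)[OF R, of ?m, where 'a='a] c J by (intro mult_left_mono mult_right_mono) auto
   finally have a2: "c * (LBINT x. conv (kP R ?m) p x) <= c * (R\<^sup>2 * J)" .
   have "(LBINT x. w x * p x) <= (C0 / R ^ DIM('a) * J) * I + c * (R\<^sup>2 * J)" using mv(1) a1 a2 by simp
   moreover have "(LBINT x. ((C0 / R ^ DIM('a) * I + c * R\<^sup>2) - w x) * p x) = (C0 / R ^ DIM('a) * I + c * R\<^sup>2) * J - (LBINT x. w x * p x)"
    using ip loc_int_test[OF lw p(1)] by (simp add: left_diff_distrib J_def)
   ultimately show "0 <= (LBINT x. ((C0 / R ^ DIM('a) * I + c * R\<^sup>2) - w x) * p x)"
    by (simp add: algebra_simps)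
  qed
  then show "AE x\<in>W in lborel. w x <= C0 / R ^ DIM('a) * (LBINT x. indicator L x * \<bar>w x\<bar>) + c * R\<^sup>2"
   unfolding I_def by eventually_elim auto
 qed
qed

section \<open>The Keller--Osserman bound\<close>

text \<open>Lindelof's theorem reduces the null sets of uncountably many neighbourhoods to countably
  many.\<close>

lemma AE_open_cover:
 fixes P :: "'a::euclidean_space => bool"
 assumes "\<And>x. x \<in> W ==> \<exists>V. open V \<and> x \<in> V \<and> (AE y in lborel. y \<in> V --> P y)"
 shows "AE y in lborel. y \<in> W --> P y"
proof -
 define \<F> where "\<F> = {V. open V \<and> (AE y in lborel. y \<in> V --> P y)}"
 obtain \<G> where G: "\<G> \<subseteq> \<F>" "countable \<G>" "\<Union>\<G> = \<Union>\<F>"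
  using Lindelof[of \<F>] by (auto simp: \<F>_def)
 have "AE y in lborel. \<forall>V\<in>\<G>. y \<in> V --> P y"
  using G(1,2) by (subst AE_ball_countable) (auto simp: \<F>_def)
 moreover have "W \<subseteq> \<Union>\<G>" unfolding G(3) using assms by (auto simp: \<F>_def)
 ultimately show ?thesis by (auto elim!: eventually_mono)
qed

lemma ennreal_inverse_antimono:
 fixes x y :: ennreal
 assumes le: "x <= y"
 shows "inverse y <= inverse x"
proof (cases "x = 0 \<or> y = top")
 case False
 then obtain s where y: "y = ennreal s" "0 <= s" by (cases y rule: ennreal_cases) auto
 then obtain r where x: "x = ennreal r" "0 <= r" using le by (cases x rule: ennreal_cases) (auto simp: top_unique)
 have "0 < r" "r <= s" using x y le False by (auto simp: less_eq_real_def)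
 then show ?thesis using x y by (auto simp: inverse_ennreal intro!: ennreal_leI le_imp_inverse_le)
qed auto

locale ko_nonlinearity =
 fixes g :: "real => real"
 assumes g_cont: "continuous_on UNIV g" and g_mono: "mono g" and g_0: "0 <= g 0" and g_KO: "keller_osserman g"
begin

abbreviation subsol :: "'a::euclidean_space set \<Rightarrow> ('a \<Rightarrow> real) \<Rightarrow> bool" where
  "subsol U u \<equiv> lapge U u (\<lambda>x. g (u x))"

abbreviation supersol :: "'a::euclidean_space set \<Rightarrow> ('a \<Rightarrow> real) \<Rightarrow> ('a \<Rightarrow> real) \<Rightarrow> bool" where
  "supersol U f v \<equiv> lapge U (\<lambda>x. - v x) (\<lambda>x. - (g (v x) - f x))"

lemma g_borel [measurable]: "g \<in> borel_measurable borel"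
 by (rule borel_measurable_continuous_onI[OF g_cont])

lemma g_le: "s <= t ==> g s <= g t"
 using g_mono by (rule monoD)

lemma g_nonneg: "0 <= t ==> 0 <= g t"
 using g_le[of 0 t] g_0 by simp

lemma primitive_bounds: "t >= 0 ==> integral {0..t} g <= t * g t"
proof -
 assume t: "t >= 0"
 have i: "g integrable_on {0..t}" using g_cont by (intro integrable_continuous_real) (auto intro: continuous_on_subset)
 have "integral {0..t} g <= integral {0..t} (\<lambda>_. g t)"
  by (rule integral_le[OF i]) (auto intro: g_le)
 then show ?thesis using t by simp
qed

text \<open>Up to the factor sqrt(8 n), with n the dimension, this is the width of the layer in
  which \<open>ko_step\<close> lowers the bound 2^(i+2) to 2^(i+1). Summability of these widths is
  the dyadic form of the Keller--Osserman condition.\<close>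

definition dyadic :: "nat => real" where
 "dyadic i = sqrt (2 ^ (i + 1) / g (2 ^ i))"

text \<open>On (2^i, 2^(i+1)] the primitive of g is at most 2^(i+1) g(2^(i+1)), so the
  Keller--Osserman integrand is at least the constant \<open>c (Suc i)\<close> there, and the sum of
  these constants times 2^i is finite. A zero of g at 2^(i+1) would make the constant infinite. The
  index starts at 1 because the condition is applied on [1, \<infinity>).\<close>

lemma dyadic_facts: "0 < g (2 ^ Suc i)" "summable (\<lambda>i. dyadic (Suc i))"
proof -
 define f where "f t = inverse (ennreal (sqrt (integral {0..t} g)))" for t
 define c where "c i = inverse (ennreal (sqrt (2 ^ i * g (2 ^ i))))" for i :: nat
 define S where "S n t = (\<Sum>i<n. c (Suc i) * indicator {2 ^ i<..2 ^ Suc i} t)" for n :: nat and t :: real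
 have cf: "c (Suc i) <= f t" if "2 ^ i < t" "t <= 2 ^ Suc i" for i and t :: real
 proof -
  have t: "0 <= t" using that(1) zero_le_power[of "2::real" i] by linarith
  have "integral {0..t} g <= t * g t" by (rule primitive_bounds[OF t])
  also have "\<dots> <= 2 ^ Suc i * g (2 ^ Suc i)" using that t by (intro mult_mono g_le g_nonneg) auto
  finally have "ennreal (sqrt (integral {0..t} g)) <= ennreal (sqrt (2 ^ Suc i * g (2 ^ Suc i)))" by (intro ennreal_leI real_sqrt_le_mono)
  then show ?thesis unfolding c_def f_def by (rule ennreal_inverse_antimono)
 qed
 have S: "S n t <= (if t \<in> {1<..2 ^ n} then f t else 0)" for n t
 proof (induct n)
  case (Suc n)
  have p: "(2::real) ^ n <= 2 ^ Suc n" "1 <= (2::real) ^ n" by auto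
  have "S (Suc n) t = S n t + c (Suc n) * indicator {2 ^ n<..2 ^ Suc n} t" by (simp add: S_def)
  then have e: "S (Suc n) t = S n t + (if 2 ^ n < t \<and> t <= 2 ^ Suc n then c (Suc n) else 0)" by (simp add: indicator_def)
  show ?case
  proof (cases "t > 2 ^ n")
   case True
   then have z: "S n t = 0" using Suc by auto
   have t: "1 < t" using True p(2) by (rule order.strict_trans1[rotated])
   show ?thesis
   proof (cases "t <= 2 ^ Suc n")
    case le: True
    then show ?thesis using cf[OF True le] t unfolding e z by (simp only: True le t greaterThanAtMost_iff simp_thms if_True add_0)
   next
    case False
    then show ?thesis unfolding e z by (simp only: False simp_thms if_False add_0 greaterThanAtMost_iff order_refl)
   qed
  next
   case False
   then have "t <= 2 ^ Suc n" using p by linarith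
   have "S (Suc n) t = S n t" unfolding e using False by (simp only: simp_thms if_False add_0_right)
   also have "\<dots> <= (if t \<in> {1<..2 ^ n} then f t else 0)" by (rule Suc)
   also have "\<dots> <= (if t \<in> {1<..2 ^ Suc n} then f t else 0)"
    using \<open>t <= 2 ^ Suc n\<close> by (simp only: greaterThanAtMost_iff split: if_split) auto
   finally show ?thesis .
  qed
 qed (simp add: S_def)
 have "(\<integral>\<^sup>+ t\<in>{1..}. f t \<partial>lborel) < top" using g_KO unfolding keller_osserman_def f_def by auto
 then obtain B where B: "B >= 0" "(\<integral>\<^sup>+ t\<in>{1..}. f t \<partial>lborel) = ennreal B" by (cases "\<integral>\<^sup>+ t\<in>{1..}. f t \<partial>lborel") auto
 have sum_le: "(\<Sum>i<n. c (Suc i) * ennreal (2 ^ i)) <= ennreal B" for n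
 proof -
  have "(\<Sum>i<n. c (Suc i) * ennreal (2 ^ i)) = (\<integral>\<^sup>+ t. S n t \<partial>lborel)"
   unfolding S_def by (subst nn_integral_sum) (auto simp: nn_integral_cmult intro!: sum.cong)
  also have "\<dots> <= (\<integral>\<^sup>+ t\<in>{1..}. f t \<partial>lborel)"
  proof (rule nn_integral_mono)
   fix t show "S n t <= f t * indicator {1..} t" using S[of n t] by (auto split: if_splits)
  qed
  finally show ?thesis using B by simp
 qed
 have gpos: "0 < g (2 ^ Suc i)" for i
 proof (rule ccontr)
  assume "\<not> ?thesis"
  then have "g (2 ^ Suc i) = 0" using g_nonneg[of "2 ^ Suc i"] by auto
  then have "c (Suc i) = top" by (simp add: c_def)
  moreover have "c (Suc i) * ennreal (2 ^ i) <= (\<Sum>i<Suc i. c (Suc i) * ennreal (2 ^ i))" by (intro member_le_sum) auto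
  ultimately have "top * ennreal (2 ^ i) <= ennreal B" using sum_le[of "Suc i"] by simp
  moreover have "top * ennreal (2 ^ i) = top" by (subst ennreal_top_mult) (auto simp: ennreal_eq_0_iff not_le)
  ultimately show False by (simp add: top_unique)
 qed
 show "0 < g (2 ^ Suc i)" by (rule gpos)
 have ci: "c (Suc i) * ennreal (2 ^ i) = ennreal (2 ^ i / sqrt (2 ^ Suc i * g (2 ^ Suc i)))" for i
  using gpos[of i] by (simp add: c_def inverse_ennreal ennreal_mult[symmetric] divide_inverse mult.commute)
 have de: "dyadic (Suc i) = 2 * sqrt 2 * (2 ^ i / sqrt (2 ^ Suc i * g (2 ^ Suc i)))" for i
 proof -
  have p: "(2::real) ^ Suc i > 0" by simp
  have "2 * sqrt 2 * (2 ^ i / sqrt (2 ^ Suc i * g (2 ^ Suc i))) = sqrt 2 * (2 ^ Suc i / (sqrt (2 ^ Suc i) * sqrt (g (2 ^ Suc i))))"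
   by (simp add: real_sqrt_mult)
  also have "2 ^ Suc i / (sqrt (2 ^ Suc i) * sqrt (g (2 ^ Suc i))) = sqrt (2 ^ Suc i) / sqrt (g (2 ^ Suc i))"
   using real_sqrt_mult_self[of "2 ^ Suc i"] p gpos[of i] by (simp add: divide_simps del: power_Suc)
  finally show ?thesis unfolding dyadic_def by (simp add: real_sqrt_mult real_sqrt_divide)
 qed
 have "(\<Sum>i<n. 2 ^ i / sqrt (2 ^ Suc i * g (2 ^ Suc i))) <= B" for n
 proof -
  have "ennreal (\<Sum>i<n. 2 ^ i / sqrt (2 ^ Suc i * g (2 ^ Suc i))) <= ennreal B"
   using sum_le[of n] gpos unfolding ci by (subst (asm) sum_ennreal) (auto simp: less_imp_le)
  then show ?thesis using B(1) by simp
 qed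
 then have "summable (\<lambda>i. 2 ^ i / sqrt (2 ^ Suc i * g (2 ^ Suc i)))"
  using gpos by (intro summableI_nonneg_bounded[where x=B]) (auto simp: less_imp_le)
 then show "summable (\<lambda>i. dyadic (Suc i))" unfolding de by (rule summable_mult)
qed

text \<open>As \<open>dyadic\<close> tends to 0, eventually 2^(i+2) < g(2^(i+1)): g grows at least
  linearly along the powers of 2.\<close>

lemma g_unbounded: "\<exists>t>0. g t >= C"
proof -
 have "(\<lambda>i. dyadic (Suc i)) \<longlonglongrightarrow> 0" using dyadic_facts(2) by (rule summable_LIMSEQ_zero)
 then have "\<forall>\<^sub>F i in sequentially. dyadic (Suc i) < 1" by (rule order_tendstoD) simp
 moreover obtain i0 where "C <= 2 ^ i0" using real_arch_pow[of 2 C] by (auto intro: less_imp_le)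
 then have "\<forall>\<^sub>F i in sequentially. C <= 2 ^ i"
  unfolding eventually_sequentially by (intro exI[of _ i0]) (auto intro: order_trans power_increasing)
 ultimately have "\<forall>\<^sub>F i in sequentially. dyadic (Suc i) < 1 \<and> C <= 2 ^ i" by (rule eventually_conj)
 then obtain i where i: "dyadic (Suc i) < 1" "C <= 2 ^ i" by (auto simp: eventually_sequentially)
 then have "2 ^ (Suc i + 1) / g (2 ^ Suc i) < 1" by (simp add: dyadic_def)
 then have "2 ^ (Suc i + 1) < g (2 ^ Suc i)" using dyadic_facts(1)[of i] by (simp add: divide_less_eq)
 moreover have "(2::real) ^ i <= 2 ^ (Suc i + 1)" by (intro power_increasing) auto
 ultimately have "C <= g (2 ^ Suc i)" using i(2) by linarith
 then show ?thesis by (intro exI[of _ "2 ^ Suc i"]) auto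
qed

text \<open>The comparison function Q = M/2 + A |y - x|^2 has Laplacian 2 n A = g(M/2)/2, while
  wherever w > Q >= M/2 one has F >= g(M/2) - c >= g(M/2)/2. The radius d is fixed by A d^2 = 2 M:
  near the boundary of the ball Q exceeds 2 M, and within d/2 it is at most M.\<close>

lemma ko_step:
 fixes w F :: "'a::euclidean_space => real"
 assumes l: "lapge (ball x0 s) w F" and F: "AE x\<in>ball x0 s in lborel. w x > 0 --> F x >= g (w x) - c"
  and M: "M > 0" "g (M / 2) > 0" "g (M / 2) >= 2 * c"
  and w: "AE x\<in>ball x0 s in lborel. w x <= 2 * M"
 shows "AE x\<in>ball x0 (s - sqrt (8 * real DIM('a) * M / g (M / 2))) in lborel. w x <= M"
proof (rule AE_open_cover)
 define n where "n = real DIM('a)"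
 have n: "n > 0" by (simp add: n_def)
 define d where "d = sqrt (8 * n * M / g (M / 2))"
 define A where "A = g (M / 2) / (4 * n)"
 have A: "A > 0" using M n by (simp add: A_def)
 have d: "d > 0" "A * d\<^sup>2 = 2 * M" using M n by (auto simp: d_def A_def)
 fix x assume "x \<in> ball x0 (s - sqrt (8 * real DIM('a) * M / g (M / 2)))"
 then have x: "dist x0 x + d < s" by (simp add: d_def n_def)
 have sub: "ball x d \<subseteq> ball x0 s"
 proof
  fix y assume "y \<in> ball x d"
  then show "y \<in> ball x0 s" using x dist_triangle[of x0 y x] by simp
 qed
 define Q where "Q y = M / 2 + A * (norm (y - x))\<^sup>2" for y
 have sm: "smooth (\<lambda>y. A * (norm (y - x))\<^sup>2)" by (intro smooth_cmult smooth_norm_sq)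
 have sQ: "smooth Q" unfolding Q_def by (intro smooth_add smooth_const sm)
 have lQ: "laplacian Q y = g (M / 2) / 2" for y
 proof -
  have "laplacian Q y = A * (2 * n)" unfolding Q_def n_def
   using laplacian_add[OF smooth_const sm, of "M / 2" y] laplacian_cmult[OF smooth_norm_sq, of A x y] laplacian_norm_sq[of x y] by simp
  then show ?thesis using n by (simp add: A_def)
 qed
 have "AE y in lborel. y \<in> ball x d --> w y <= Q y"
 proof (rule comparison[OF open_ball lapge_subset[OF l sub]])
  show "lapge (ball x d) (\<lambda>y. - Q y) (\<lambda>y. - laplacian Q y)" by (rule lapge_smooth_uminus[OF sQ])
  \<comment> \<open>A radius below d keeps the exceptional set compact in the open ball; at 9d/10
    already Q >= M/2 + 0.81 * 2 M > 2 M.\<close>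
  show "compact (cball x (9 / 10 * d))" "cball x (9 / 10 * d) \<subseteq> ball x d" using d by auto
  show "AE y in lborel. y \<in> ball x d --> y \<notin> cball x (9 / 10 * d) --> w y <= Q y"
   using w
  proof eventually_elim
   case (elim y)
   show ?case
   proof (intro impI)
    assume y: "y \<in> ball x d" "y \<notin> cball x (9 / 10 * d)"
    then have "(9 / 10 * d)\<^sup>2 <= (norm (y - x))\<^sup>2" using d by (intro power_mono) (auto simp: dist_norm norm_minus_commute)
    then have "A * (9 / 10 * d)\<^sup>2 <= A * (norm (y - x))\<^sup>2" using A by (intro mult_left_mono) auto
    moreover have "A * (9 / 10 * d)\<^sup>2 = 81 / 100 * (A * d\<^sup>2)" by (simp add: power2_eq_square)
    moreover have "w y <= 2 * M" using elim y(1) sub by auto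
    ultimately show "w y <= Q y" unfolding Q_def d(2) using M(1) by linarith
   qed
  qed
  show "AE y in lborel. y \<in> ball x d --> Q y < w y --> laplacian Q y <= F y"
   using F
  proof eventually_elim
   case (elim y)
   show ?case
   proof (intro impI)
    assume y: "y \<in> ball x d" "Q y < w y"
    have "M / 2 <= Q y" using A by (simp add: Q_def)
    then have "M / 2 <= w y" "w y > 0" using y(2) M(1) by linarith+
    then have "g (M / 2) <= g (w y)" "F y >= g (w y) - c" using elim y(1) sub by (auto intro: g_le)
    then show "laplacian Q y <= F y" unfolding lQ using M(3) by linarith
   qed
  qed
 qed
 then have "AE y in lborel. y \<in> ball x (d / 2) --> w y <= M"
 proof eventually_elim
  case (elim y)
  show ?case
  proof
   assume y: "y \<in> ball x (d / 2)"
   then have "(norm (y - x))\<^sup>2 <= (d / 2)\<^sup>2" by (intro power_mono) (auto simp: dist_norm norm_minus_commute)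
   then have "A * (norm (y - x))\<^sup>2 <= A * (d / 2)\<^sup>2" using A by (intro mult_left_mono) auto
   also have "\<dots> = (A * d\<^sup>2) / 4" by (simp add: power2_eq_square)
   finally have "Q y <= M" unfolding Q_def d(2) by simp
   moreover have "y \<in> ball x d" using y d(1) by simp
   ultimately show "w y <= M" using elim by auto
  qed
 qed
 then show "\<exists>V. open V \<and> x \<in> V \<and> (AE y in lborel. y \<in> V --> w y <= M)"
  using d(1) by (intro exI[of _ "ball x (d / 2)"]) auto
qed

text \<open>\<open>local_upper_bound\<close> provides a finite bound on the ball of radius 3r/2 that
  depends on w. From a level above it, \<open>ko_step\<close> descends to \<open>M 0\<close>. The
  number of steps depends on w, but the layers consumed have total width at most r/2, so the final
  bound is the same for all w.\<close>

lemma ko_bound: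
 assumes r: "r > 0" and c: "c >= 0"
 shows "\<exists>M. \<forall>x0 (w :: 'a::euclidean_space => real) F. lapge (ball x0 (2 * r)) w F -->
  (AE x\<in>ball x0 (2 * r) in lborel. w x > 0 --> F x >= g (w x) - c) -->
  (AE x\<in>ball x0 r in lborel. w x <= M)"
proof -
 define n where "n = real DIM('a)"
 have n: "n > 0" by (simp add: n_def)
 have "(\<lambda>k. \<Sum>i. dyadic (Suc (i + k))) \<longlonglongrightarrow> 0"
  using suminf_exist_split2[OF dyadic_facts(2)] by simp
 moreover have "r / (2 * sqrt (8 * n)) > 0" using r n by simp
 ultimately have "\<forall>\<^sub>F k in sequentially. (\<Sum>i. dyadic (Suc (i + k))) < r / (2 * sqrt (8 * n))" by (rule order_tendstoD(2))
 then obtain k1 where k1: "\<And>k. k >= k1 ==> (\<Sum>i. dyadic (Suc (i + k))) < r / (2 * sqrt (8 * n))" by (auto simp: eventually_sequentially)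
 obtain t where t: "t > 0" "g t >= 2 * c" using g_unbounded by blast
 obtain k2 where k2: "t < 2 ^ k2" using real_arch_pow[of 2 t] by auto
 \<comment> \<open>From \<open>k1\<close> on, the remaining layers fit into r/2; from
   \<open>k2\<close> on, the levels exceed t, where g is at least 2 c.\<close>
 define k where "k = max k1 k2"
 define M where "M j = (2::real) ^ (Suc (Suc (j + k)))" for j
 define S where "S j = (\<Sum>i<j. sqrt (8 * n) * dyadic (Suc (i + k)))" for j
 have Mh: "M j / 2 = 2 ^ Suc (j + k)" for j by (simp add: M_def)
 have dj: "sqrt (8 * real DIM('a) * M j / g (M j / 2)) = sqrt (8 * n) * dyadic (Suc (j + k))" for j
  unfolding Mh dyadic_def real_sqrt_mult[symmetric] by (simp add: n_def M_def)
 have gM: "g (M j / 2) > 0" "g (M j / 2) >= 2 * c" "M j > 0" for j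
 proof -
  show "g (M j / 2) > 0" unfolding Mh by (rule dyadic_facts(1))
  have "(2::real) ^ k2 <= 2 ^ Suc (j + k)" by (rule power_increasing) (auto simp: k_def)
  then have "t <= 2 ^ Suc (j + k)" using k2 by linarith
  then show "g (M j / 2) >= 2 * c" unfolding Mh using t(2) g_le order_trans by blast
  show "M j > 0" by (simp add: M_def)
 qed
 have dn: "0 <= dyadic i" for i unfolding dyadic_def by (simp add: g_nonneg)
 have S: "S j <= r / 2" for j
 proof -
  have sm: "summable (\<lambda>i. dyadic (Suc (i + k)))" using summable_ignore_initial_segment[OF dyadic_facts(2), of k] by simp
  have "(\<Sum>i<j. dyadic (Suc (i + k))) <= (\<Sum>i. dyadic (Suc (i + k)))" by (rule sum_le_suminf[OF sm]) (auto simp: dn)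
  also have "\<dots> <= r / (2 * sqrt (8 * n))" using k1[of k] by (simp add: k_def)
  finally have "sqrt (8 * n) * (\<Sum>i<j. dyadic (Suc (i + k))) <= sqrt (8 * n) * (r / (2 * sqrt (8 * n)))" using n by (intro mult_left_mono) auto
  also have "\<dots> = r / 2" using n by simp
  finally show ?thesis by (simp add: S_def sum_distrib_left)
 qed
 have "AE x\<in>ball x0 r in lborel. w x <= M 0"
  if l: "lapge (ball x0 (2 * r)) w F" and F: "AE x\<in>ball x0 (2 * r) in lborel. w x > 0 --> F x >= g (w x) - c"
  for x0 :: 'a and w F
 proof -
  have lp: "lapge (ball x0 (2 * r)) (\<lambda>x. max (w x) 0) (\<lambda>_. - c)"
  proof (rule lapge_mono[OF lapge_max[OF l lapge_const] loc_int_const])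
   show "AE x\<in>ball x0 (2 * r) in lborel. - c <= (if 0 < w x then F x else 0)"
    using F
   proof eventually_elim
    case (elim x) then show ?case using c g_nonneg[of "w x"] by (cases "w x > 0") auto
   qed
  qed auto
  obtain C0 where C0: "AE x\<in>ball x0 (3/2 * r) in lborel. max (w x) 0 <= C0"
  proof -
   obtain C1 where C1: "\<forall>U (w::'a => real) c R L W. lapge U w (\<lambda>_. - c) --> c >= 0 --> R > 0 --> compact L --> L \<subseteq> U --> open W -->
    (\<forall>x\<in>W. cball x R \<subseteq> L) -->
    (AE x\<in>W in lborel. w x <= C1 / R ^ DIM('a) * (LBINT x. indicator L x * \<bar>w x\<bar>) + c * R\<^sup>2)"
    using local_upper_bound[where 'a='a] by blast
   have "cball x (r / 4) \<subseteq> cball x0 (7/4 * r)" if "x \<in> ball x0 (3/2 * r)" for x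
   proof
    fix y assume "y \<in> cball x (r / 4)"
    then show "y \<in> cball x0 (7/4 * r)" using that dist_triangle[of x0 y x] by simp
   qed
   moreover have "cball x0 (7/4 * r) \<subseteq> ball x0 (2 * r)" "r / 4 > 0" using r by auto
   ultimately show thesis
    using C1[rule_format, OF lp c, of "r / 4" "cball x0 (7/4 * r)" "ball x0 (3/2 * r)"] by (intro that) (blast intro: compact_cball open_ball)
  qed
  obtain J where J: "C0 <= M J"
  proof -
   obtain J where "C0 < 2 ^ J" using real_arch_pow[of 2 C0] by auto
   moreover have "(2::real) ^ J <= M J" unfolding M_def by (intro power_increasing) auto
   ultimately show thesis using that[of J] by simp
  qed
  \<comment> \<open>Descending induction on the level, with i counting the steps done; at i = J the
    radius is r + S 0 = r and the bound \<open>M 0\<close>.\<close>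
  have "AE x\<in>ball x0 (r + S (J - i)) in lborel. w x <= M (J - i)" if "i <= J" for i
   using that
  proof (induct i)
   case 0
   have "ball x0 (r + S J) \<subseteq> ball x0 (3/2 * r)" using S[of J] by (intro subset_ball) simp
   then show ?case using C0 J by (auto elim!: eventually_mono)
  next
   case (Suc i)
   define j where "j = J - Suc i"
   have j: "J - i = Suc j" using Suc(2) by (simp add: j_def)
   have sub: "ball x0 (r + S (Suc j)) \<subseteq> ball x0 (2 * r)" using S[of "Suc j"] r by (intro subset_ball) simp
   have "AE x\<in>ball x0 (r + S (Suc j)) in lborel. w x <= 2 * M j"
    using Suc unfolding j by (simp add: M_def)
   moreover have "AE x\<in>ball x0 (r + S (Suc j)) in lborel. w x > 0 --> F x >= g (w x) - c"
    using F by eventually_elim (use sub in blast)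
   ultimately have "AE x\<in>ball x0 (r + S (Suc j) - sqrt (8 * real DIM('a) * M j / g (M j / 2))) in lborel. w x <= M j"
    using ko_step[OF lapge_subset[OF l sub] _ gM(3) gM(1) gM(2)] by blast
   moreover have "r + S (Suc j) - sqrt (8 * real DIM('a) * M j / g (M j / 2)) = r + S j" unfolding dj by (simp add: S_def)
   ultimately have "AE x\<in>ball x0 (r + S j) in lborel. w x <= M j" by (simp only:)
   then show ?case unfolding j_def .
  qed
  from this[of J] show ?thesis by (simp add: S_def)
 qed
 then show ?thesis by blast
qed

end

section \<open>Monotone iteration on the whole space\<close>

text \<open>Integrability sits on the test function and boundedness on u and F, the reverse of
  \<open>mean_value_ae\<close>; this is the form suited to an iteration on the whole space.\<close>

lemma mean_value_bounded:
 assumes l: "lapge UNIV u F" and b: "\<And>x. \<bar>u x\<bar> <= C" "\<And>x. \<bar>F x\<bar> <= C" and R: "R > 0" "m >= 1"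
 shows "AE x in lborel. u x <= conv (kN R m) u x - conv (kP R m) F x"
proof -
 interpret N: even_kernel "kN R m" R by (rule even_kernel_N[OF R])
 interpret P: even_kernel "kP R m" R by (rule even_kernel_P[OF R])
 note [measurable] = loc_int_borel[OF lapgeD(1)[OF l]] loc_int_borel[OF lapgeD(2)[OF l]]
 have "AE x\<in>UNIV in lborel. 0 <= conv (kN R m) u x - conv (kP R m) F x - u x"
 proof (rule fundamental_lemma)
  show "loc_int UNIV (\<lambda>x. conv (kN R m) u x - conv (kP R m) F x - u x)"
   using N.conv_abs_bound[of u C] P.conv_abs_bound[of F C] b
   by (intro loc_int_diff lapgeD(1)[OF l] loc_int_bounded[where C="measure (kN R m) UNIV * C"] loc_int_bounded[where C="measure (kP R m) UNIV * C"]) auto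
  fix p :: "'a => real" assume p: "test_fun UNIV p" "\<And>x. 0 <= p x"
  obtain K where K: "smooth p" "compact K" "\<And>x. x \<notin> K ==> p x = 0" using test_funE[OF p(1)] by metis
  note mv = mean_value_dual(1)[OF l R K p(2) subset_UNIV]
  note ip = test_fun_integrable[OF p(1)]
  note d1 = N.conv_dual[OF ip, of u C, OF _ b(1)] and d2 = P.conv_dual[OF ip, of F C, OF _ b(2)]
  have up: "integrable lborel (\<lambda>x. u x * p x)" by (rule loc_int_test[OF lapgeD(1)[OF l] p(1)])
  have "(LBINT x. (conv (kN R m) u x - conv (kP R m) F x - u x) * p x) =
    (LBINT x. p x * conv (kN R m) u x) - (LBINT x. p x * conv (kP R m) F x) - (LBINT x. u x * p x)"
   using d1(3) d2(3) up by (simp add: left_diff_distrib mult.commute[of "p _"])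
  then show "0 <= (LBINT x. (conv (kN R m) u x - conv (kP R m) F x - u x) * p x)"
   using mv d1(1) d2(1) by (simp add: mult.commute)
 qed auto
 then show ?thesis by eventually_elim auto
qed

text \<open>The equation with right-hand side a(x, u) becomes the fixed point problem u = N u - P
  a(u). As N - L P is positive for small R, the map preserves order although a increases, and
  iteration from the subsolution b climbs to the least solution. The delicate point is to undo the
  averaging: the defect \<Lambda> of the limit vanishes on every \<open>?P q\<close>, and p differs
  from \<open>pos p\<close> by such a function, so \<Lambda> does not change along the iterates of
  \<open>pos\<close>, whose L1 norms and those of their Laplacians decay geometrically.\<close>

lemma perron:
 fixes a :: "'a::euclidean_space => real => real"
 assumes L: "L > 0" and b[measurable]: "b \<in> borel_measurable borel" and bb: "\<And>x. c0 <= b x" "\<And>x. b x <= C0"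
  and am: "\<And>v. v \<in> borel_measurable borel ==> (\<lambda>x. a x (v x)) \<in> borel_measurable borel"
  and ab: "\<And>x t. c0 <= t ==> t <= C0 ==> \<bar>a x t\<bar> <= A"
  and aL: "\<And>x s t. c0 <= s ==> s <= t ==> t <= C0 ==> 0 <= a x t - a x s \<and> a x t - a x s <= L * (t - s)"
  and sub: "lapge UNIV b (\<lambda>x. a x (b x))" and sup: "\<And>x. 0 <= a x C0"
 shows "\<exists>u. u \<in> borel_measurable borel \<and> (\<forall>x. c0 <= u x \<and> u x <= C0) \<and> (AE x in lborel. b x <= u x) \<and>
  (\<forall>p. test_fun UNIV p --> (LBINT x. u x * laplacian p x) = (LBINT x. a x (u x) * p x)) \<and>
  (\<forall>v. v \<in> borel_measurable borel \<and> (\<forall>x. c0 <= v x \<and> v x <= C0) \<and> (AE x in lborel. b x <= v x) \<and>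
    lapge UNIV (\<lambda>x. - v x) (\<lambda>x. - a x (v x)) --> (AE x in lborel. u x <= v x))"
proof -
 \<comment> \<open>Any R with L R^2 < 1 serves; it makes \<open>pos\<close> positivity preserving
   and the contraction factor \<kappa> nonnegative.\<close>
 define R where "R = 1 / sqrt (L + 1)"
 have R: "R > 0" "L * R\<^sup>2 < 1" using L by (auto simp: R_def power_divide)
 interpret N: even_kernel "kN R 2 :: 'a measure" R by (rule even_kernel_N[OF R(1)]) simp
 interpret P: even_kernel "kP R 2 :: 'a measure" R by (rule even_kernel_P[OF R(1)]) simp
 let ?N = "conv (kN R 2 :: 'a measure)" and ?P = "conv (kP R 2 :: 'a measure)"
 define D where "D = max (max \<bar>c0\<bar> \<bar>C0\<bar>) A"
 have range_bound: "\<bar>v x\<bar> <= D" "\<bar>a x (v x)\<bar> <= D" if "\<And>x. c0 <= v x" "\<And>x. v x <= C0" for v and x :: 'a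
  using that[of x] ab[of "v x" x] by (auto simp: D_def)
 define pos where "pos f x = ?N f x - L * ?P f x" for f x
 have pos_nonneg: "0 <= pos f x" if "f \<in> borel_measurable borel" "\<And>x. 0 <= f x" "\<And>x. f x <= C" for f x C
 proof -
  have "L * ?P f x <= L * (R\<^sup>2 * ?N f x)" using kP_le_kN[OF R(1) that] L by (intro mult_left_mono) auto
  also have "\<dots> <= 1 * ?N f x" using N.conv_nonneg[of f x, OF that(2)] R(2) by (simp only: mult.assoc[symmetric]) (intro mult_right_mono, auto)
  finally show ?thesis by (simp add: pos_def)
 qed
 define T0 where "T0 v x = ?N v x - ?P (\<lambda>x. a x (v x)) x" for v x
 \<comment> \<open>Clipping to [c0, C0] keeps the iterates in the range where a is controlled;
   \<open>fixed\<close> shows that it is inactive in the limit.\<close>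
 define T where "T v x = max c0 (min C0 (T0 v x))" for v x
 have cC: "c0 <= C0" using bb[of undefined] by linarith
 have T_range: "c0 <= T v x" "T v x <= C0" for v x using cC by (auto simp: T_def)
 have T_borel: "T v \<in> borel_measurable borel" "T0 v \<in> borel_measurable borel" if "v \<in> borel_measurable borel" for v
  using that am[OF that] unfolding T_def[abs_def] T0_def[abs_def] by auto
 have T0_mono: "AE x in lborel. T0 v x <= T0 w x"
  if v: "v \<in> borel_measurable borel" "\<And>x. c0 <= v x" "\<And>x. v x <= C0" and w: "w \<in> borel_measurable borel" "\<And>x. c0 <= w x" "\<And>x. w x <= C0"
   and le: "AE x in lborel. v x <= w x" for v w
 proof -
  define d where "d x = max 0 (w x - v x)" for x
  have [measurable]: "v \<in> borel_measurable borel" "w \<in> borel_measurable borel" using v w by auto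
  have dm: "d \<in> borel_measurable borel" unfolding d_def by measurable
  have db: "0 <= d x" "d x <= C0 - c0" "\<bar>d x\<bar> <= C0 - c0" for x using v(2,3)[of x] w(2,3)[of x] by (auto simp: d_def)
  note rv = range_bound[of v, OF v(2,3)] and rw = range_bound[of w, OF w(2,3)]
  show ?thesis using N.conv_AE[OF le] P.conv_AE[OF le]
  proof eventually_elim
   case (elim x)
   note iN = N.conv_integrable[of v D x, OF v(1) rv(1)] N.conv_integrable[of w D x, OF w(1) rw(1)] N.conv_integrable[of d "C0 - c0" x, OF dm db(3)]
   note iP = P.conv_integrable[of "\<lambda>x. a x (v x)" D x, OF am[OF v(1)] rv(2)] P.conv_integrable[of "\<lambda>x. a x (w x)" D x, OF am[OF w(1)] rw(2)]
    P.conv_integrable[of d "C0 - c0" x, OF dm db(3)]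
   have 1: "?N w x - ?N v x = ?N d x"
   proof -
    have "?N d x = (\<integral>y. w (x - y) - v (x - y) \<partial>kN R 2)"
     unfolding conv_def by (rule integral_cong_AE) (use iN elim(1) in \<open>auto simp: d_def elim!: eventually_mono\<close>)
    then show ?thesis unfolding conv_def using iN by simp
   qed
   have "?P (\<lambda>x. a x (w x)) x - ?P (\<lambda>x. a x (v x)) x = (\<integral>y. a (x - y) (w (x - y)) - a (x - y) (v (x - y)) \<partial>kP R 2)"
    unfolding conv_def using iP by simp
   also have "\<dots> <= (\<integral>y. L * d (x - y) \<partial>kP R 2)"
   proof (rule integral_mono_AE)
    show "AE y in kP R 2. a (x - y) (w (x - y)) - a (x - y) (v (x - y)) <= L * d (x - y)"
     using elim(2)
    proof eventually_elim
     case (elim y)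
     then show ?case using aL[OF v(2)[of "x - y"] elim w(3)[of "x - y"], of "x - y"] by (auto simp: d_def)
    qed
   qed (use iP in auto)
   also have "\<dots> = L * ?P d x" by (simp add: conv_def)
   finally show ?case using 1 pos_nonneg[OF dm db(1,2), of x] unfolding T0_def pos_def by linarith
  qed
 qed
 have T0_b: "AE x in lborel. b x <= T0 b x"
  unfolding T0_def using mean_value_bounded[OF sub, of D R 2] range_bound[of b, OF bb] R by simp
 have T0_super: "AE x in lborel. T0 v x <= v x"
  if v: "v \<in> borel_measurable borel" "\<And>x. c0 <= v x" "\<And>x. v x <= C0" and l: "lapge UNIV (\<lambda>x. - v x) (\<lambda>x. - a x (v x))" for v
 proof -
  have "AE x in lborel. - v x <= ?N (\<lambda>x. - v x) x - ?P (\<lambda>x. - a x (v x)) x"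
   using mean_value_bounded[OF l, of D R 2] range_bound[of v, OF v(2,3)] R by simp
  then show ?thesis by eventually_elim (simp add: T0_def conv_def)
 qed
 have T0_C0: "T0 (\<lambda>_. C0) x <= C0" for x
 proof -
  have "?N (\<lambda>_. C0) x = C0" by (simp add: conv_def kN_mass[OF R(1)])
  moreover have "0 <= ?P (\<lambda>x. a x C0) x" by (rule P.conv_nonneg[OF sup])
  ultimately show ?thesis by (simp add: T0_def)
 qed
 define w where "w j = (T ^^ j) b" for j
 have w0: "w 0 = b" and wS: "w (Suc j) = T (w j)" for j by (auto simp: w_def)
 have wr: "w j \<in> borel_measurable borel" "c0 <= w j x" "w j x <= C0" for j x
  by (induct j) (auto simp: w0 wS bb T_range T_borel)
 have [measurable]: "\<And>j. w j \<in> borel_measurable borel" by (rule wr)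
 have w_inc: "AE x in lborel. w j x <= w (Suc j) x" for j
 proof (induct j)
  case 0
  show ?case using T0_b by eventually_elim (use bb in \<open>auto simp: w0 wS T_def le_max_iff_disj\<close>)
 next
  case (Suc j)
  have "AE x in lborel. T0 (w j) x <= T0 (w (Suc j)) x" by (rule T0_mono[OF wr wr Suc])
  then show ?case unfolding wS T_def by eventually_elim (intro max.mono min.mono order_refl)
 qed
 define u where "u x = (SUP j. w j x)" for x
 have bdd: "bdd_above (range (\<lambda>j. w j x))" for x by (rule bdd_aboveI[of _ C0]) (auto simp: wr)
 have u_borel[measurable]: "u \<in> borel_measurable borel" unfolding u_def by (rule borel_measurable_cSUP) (auto simp: bdd)
 have ur: "c0 <= u x" "u x <= C0" for x
  unfolding u_def using cSUP_upper[OF UNIV_I bdd, of 0 x] bb(1)[of x] by (auto simp: w0 intro!: cSUP_least wr)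
 have "AE x in lborel. \<forall>j. w j x <= w (Suc j) x" using w_inc by (simp add: AE_all_countable)
 then have w_lim: "AE x in lborel. (\<lambda>j. w j x) \<longlonglongrightarrow> u x"
 proof eventually_elim
  case (elim x)
  have "incseq (\<lambda>j. w j x)" using elim by (auto intro: incseq_SucI)
  then show ?case unfolding u_def using bdd[of x] by (rule LIMSEQ_incseq_SUP[rotated])
 qed
 have bu: "AE x in lborel. b x <= u x"
  unfolding u_def using cSUP_upper[OF UNIV_I bdd, of 0] by (auto simp: w0)
 have aw: "AE x in lborel. (\<lambda>j. a x (w j x)) \<longlonglongrightarrow> a x (u x)"
  using w_lim
 proof eventually_elim
  case (elim x)
  have le: "w j x <= u x" for j unfolding u_def by (rule cSUP_upper[OF UNIV_I bdd])
  have "(\<lambda>j. a x (u x) - L * (u x - w j x)) \<longlonglongrightarrow> a x (u x) - L * (u x - u x)" by (intro tendsto_intros elim)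
  then have l1: "(\<lambda>j. a x (u x) - L * (u x - w j x)) \<longlonglongrightarrow> a x (u x)" by simp
  show ?case
  proof (rule tendsto_sandwich[OF _ _ l1 tendsto_const[of "a x (u x)"]])
   show "\<forall>\<^sub>F j in sequentially. a x (u x) - L * (u x - w j x) <= a x (w j x)" "\<forall>\<^sub>F j in sequentially. a x (w j x) <= a x (u x)"
    using aL[OF wr(2) le ur(2)] by (auto intro!: always_eventually simp: algebra_simps)
  qed
 qed
 note ru = range_bound[of u, OF ur]
 have T_lim: "AE x in lborel. (\<lambda>j. T0 (w j) x) \<longlonglongrightarrow> T0 u x"
  using N.conv_AE[OF w_lim] P.conv_AE[OF aw]
 proof eventually_elim
  case (elim x)
  note rw = range_bound[of "w j" for j, OF wr(2,3)]
  have "(\<lambda>j. ?N (w j) x) \<longlonglongrightarrow> ?N u x" unfolding conv_def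
   by (rule integral_dominated_convergence[where w="\<lambda>_. D"]) (use elim(1) rw in auto)
  moreover have "(\<lambda>j. ?P (\<lambda>x. a x (w j x)) x) \<longlonglongrightarrow> ?P (\<lambda>x. a x (u x)) x" unfolding conv_def
   by (rule integral_dominated_convergence[where w="\<lambda>_. D"])
    (use elim(2) rw am[OF u_borel] am[OF wr(1)] in \<open>auto intro!: measurable_compose[of "\<lambda>y. x - y" _ borel]\<close>)
  ultimately show ?case unfolding T0_def by (rule tendsto_diff)
 qed
 have fixed: "AE x in lborel. u x = T0 u x"
 proof -
  have "AE x in lborel. T0 u x <= T0 (\<lambda>_. C0) x" by (rule T0_mono) (use ur cC in auto)
  moreover have "AE x in lborel. T0 b x <= T0 u x" by (rule T0_mono) (use ur bb bu in auto)
  ultimately show ?thesis using w_lim T_lim T0_b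
  proof eventually_elim
   case (elim x)
   have "(\<lambda>j. w (Suc j) x) \<longlonglongrightarrow> u x" using elim(3) by (rule LIMSEQ_Suc)
   moreover have "(\<lambda>j. w (Suc j) x) \<longlonglongrightarrow> max c0 (min C0 (T0 u x))" unfolding wS T_def by (intro tendsto_max tendsto_min tendsto_const elim(4))
   ultimately have "u x = max c0 (min C0 (T0 u x))" by (rule LIMSEQ_unique)
   moreover have "T0 u x <= C0" "c0 <= T0 u x" using elim(1,2,5) T0_C0[of x] bb(1)[of x] by linarith+
   ultimately show ?case by simp
  qed
 qed
 have au[measurable]: "(\<lambda>x. a x (u x)) \<in> borel_measurable borel" by (rule am[OF u_borel])
 have lu: "loc_int UNIV u" "loc_int UNIV (\<lambda>x. a x (u x))" by (rule loc_int_bounded[where C=D]; use ru in simp)+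
 define \<Lambda> where "\<Lambda> p = (LBINT x. u x * laplacian p x) - (LBINT x. a x (u x) * p x)" for p
 define \<kappa> where "\<kappa> = 1 - L * measure (kP R 2) (UNIV :: 'a set)"
 have \<kappa>: "0 <= \<kappa>" "\<kappa> < 1"
 proof -
  have "L * measure (kP R 2) (UNIV :: 'a set) <= L * R\<^sup>2" using kP_mass(2)[OF R(1), of 2, where 'a='a] L by (intro mult_left_mono) auto
  then show "0 <= \<kappa>" using R(2) by (simp add: \<kappa>_def)
  show "\<kappa> < 1" using kP_mass(1)[OF R(1), of 2, where 'a='a] L by (simp add: \<kappa>_def)
 qed
 have pos_test: "test_fun UNIV (pos p)" if p: "test_fun UNIV p" for p
 proof -
  obtain K where K: "smooth p" "compact K" "\<And>x. x \<notin> K ==> p x = 0" using test_funE[OF p] by metis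
  show ?thesis unfolding pos_def[abs_def]
   by (intro test_fun_diff test_fun_cmult N.test_fun_conv[OF K N.support] P.test_fun_conv[OF K P.support]) auto
 qed
 have pos_lap: "laplacian (pos p) = pos (laplacian p)" if p: "test_fun UNIV p" for p
  unfolding pos_def[abs_def]
  by (intro ext) (simp add: laplacian_diff laplacian_cmult smooth_cmult N.smooth_conv[OF p] P.smooth_conv[OF p] N.laplacian_conv[OF p] P.laplacian_conv[OF p])
 have pos_L1: "(LBINT x. \<bar>pos p x\<bar>) <= \<kappa> * (LBINT x. \<bar>p x\<bar>)" if p: "test_fun UNIV p" for p
 proof -
  have [measurable]: "p \<in> borel_measurable borel" by (rule smooth_borel[OF test_fun_smooth[OF p]])
  note ip = test_fun_integrable[OF p]
  have ia: "integrable lborel (\<lambda>x. \<bar>p x\<bar>)" using ip by auto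
  obtain C where C: "\<And>x. \<bar>p x\<bar> <= C" using test_fun_bounded[OF p] by blast
  have "\<bar>pos p x\<bar> <= pos (\<lambda>x. \<bar>p x\<bar>) x" for x
  proof -
   have i: "integrable (kN R 2) (\<lambda>y. p (x - y))" "integrable (kP R 2) (\<lambda>y. p (x - y))"
    "integrable (kN R 2) (\<lambda>y. \<bar>p (x - y)\<bar>)" "integrable (kP R 2) (\<lambda>y. \<bar>p (x - y)\<bar>)"
    using N.test_conv_integrable[OF p, of x] P.test_conv_integrable[OF p, of x] by auto
   have "0 <= pos (\<lambda>x. \<bar>p x\<bar> + p x) x"
   proof (rule pos_nonneg[of _ "2 * C"])
    show "0 <= \<bar>p y\<bar> + p y" "\<bar>p y\<bar> + p y <= 2 * C" for y using C[of y] by linarith+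
   qed measurable
   moreover have "0 <= pos (\<lambda>x. \<bar>p x\<bar> - p x) x"
   proof (rule pos_nonneg[of _ "2 * C"])
    show "0 <= \<bar>p y\<bar> - p y" "\<bar>p y\<bar> - p y <= 2 * C" for y using C[of y] by linarith+
   qed measurable
   ultimately show ?thesis using i by (simp add: pos_def conv_def algebra_simps)
  qed
  then have "(LBINT x. \<bar>pos p x\<bar>) <= (LBINT x. pos (\<lambda>x. \<bar>p x\<bar>) x)"
   using test_fun_integrable[OF pos_test[OF p]] N.conv_L1(1)[OF ia] P.conv_L1(1)[OF ia]
   by (intro integral_mono integrable_abs) (auto simp: pos_def[of "\<lambda>x. \<bar>p x\<bar>"])
  also have "\<dots> = \<kappa> * (LBINT x. \<bar>p x\<bar>)"
   using N.conv_L1(1,3)[OF ia] P.conv_L1(1,3)[OF ia] by (simp add: pos_def \<kappa>_def kN_mass[OF R(1)] algebra_simps)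
  finally show ?thesis .
 qed
 \<comment> \<open>The Laplacian of \<open>?P p\<close> is \<open>?N p - p\<close>, so the fixed
   point equation paired with p is exactly the differential equation tested with
   \<open>?P p\<close>.\<close>
 have \<Lambda>_P: "\<Lambda> (?P p) = 0" if p: "test_fun UNIV p" for p
 proof -
  note ip = test_fun_integrable[OF p]
  have e: "laplacian (?P p) x = ?N p x - p x" for x using P.laplacian_conv[OF p] averaging_identity[OF p R(1), of 2] by simp
  note d1 = N.conv_dual[OF ip u_borel ru(1)] and d2 = P.conv_dual[OF ip au ru(2)]
  have up: "integrable lborel (\<lambda>x. u x * p x)" by (rule loc_int_test[OF lu(1) p])
  have "(LBINT x. u x * laplacian (?P p) x) = (LBINT x. ?N p x * u x) - (LBINT x. u x * p x)"
   unfolding e using d1(2) up by (simp add: right_diff_distrib mult.commute[of _ "u _"])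
  also have "\<dots> = (LBINT x. p x * (?N u x - u x))"
   using d1 up by (simp add: right_diff_distrib mult.commute)
  also have "\<dots> = (LBINT x. p x * ?P (\<lambda>x. a x (u x)) x)"
   by (rule integral_cong_AE) (use fixed smooth_borel[OF test_fun_smooth[OF p]] in \<open>auto simp: T0_def elim!: eventually_mono\<close>)
  also have "\<dots> = (LBINT x. a x (u x) * ?P p x)" using d2(1) by (simp add: mult.commute)
  finally show ?thesis by (simp add: \<Lambda>_def)
 qed
 have \<Lambda>_diff: "\<Lambda> (\<lambda>x. p x - q x) = \<Lambda> p - \<Lambda> q" if p: "test_fun UNIV p" and q: "test_fun UNIV q" for p q
  using loc_int_test[OF lu(1) test_fun_laplacian[OF p]] loc_int_test[OF lu(1) test_fun_laplacian[OF q]] loc_int_test[OF lu(2) p] loc_int_test[OF lu(2) q]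
  by (simp add: \<Lambda>_def laplacian_diff test_fun_smooth[OF p] test_fun_smooth[OF q] right_diff_distrib)
 have \<Lambda>_pos: "\<Lambda> (pos p) = \<Lambda> p" if p: "test_fun UNIV p" for p
 proof -
  define q where "q x = laplacian p x - L * p x" for x
  have q: "test_fun UNIV q" unfolding q_def[abs_def] by (intro test_fun_diff test_fun_laplacian test_fun_cmult p)
  obtain K where K: "smooth q" "compact K" "\<And>x. x \<notin> K ==> q x = 0" using test_funE[OF q] by metis
  have tP: "test_fun UNIV (?P q)" by (rule P.test_fun_conv[OF K P.support]) auto
  have "?P q x = ?P (laplacian p) x - L * ?P p x" for x
   using P.test_conv_integrable[OF p, of x] P.test_conv_integrable[OF test_fun_laplacian[OF p], of x] by (simp add: conv_def q_def)
  \<comment> \<open>The averaging identity turns \<open>?P\<close> of the Laplacian of p into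
    \<open>?N p - p\<close>, and the terms with L cancel.\<close>
  then have "p = (\<lambda>x. pos p x - ?P q x)" using averaging_identity[OF p R(1), of 2] by (auto simp: pos_def)
  then have "\<Lambda> p = \<Lambda> (pos p) - \<Lambda> (?P q)" using \<Lambda>_diff[OF pos_test[OF p] tP] by simp
  then show ?thesis using \<Lambda>_P[OF q] by simp
 qed
 have sol: "\<Lambda> p = 0" if p: "test_fun UNIV p" for p
 proof -
  define q where "q n = (pos ^^ n) p" for n
  have q: "test_fun UNIV (q n)" "\<Lambda> (q n) = \<Lambda> p" "(LBINT x. \<bar>q n x\<bar>) <= \<kappa> ^ n * (LBINT x. \<bar>p x\<bar>)"
   "(LBINT x. \<bar>laplacian (q n) x\<bar>) <= \<kappa> ^ n * (LBINT x. \<bar>laplacian p x\<bar>)" for n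
  proof (induct n)
   case (Suc n)
   have e: "q (Suc n) = pos (q n)" by (simp add: q_def)
   show "test_fun UNIV (q (Suc n))" "\<Lambda> (q (Suc n)) = \<Lambda> p" unfolding e using pos_test[OF Suc(1)] \<Lambda>_pos[OF Suc(1)] Suc(2) by auto
   show "(LBINT x. \<bar>q (Suc n) x\<bar>) <= \<kappa> ^ Suc n * (LBINT x. \<bar>p x\<bar>)"
    unfolding e using order_trans[OF pos_L1[OF Suc(1)] mult_left_mono[OF Suc(3) \<kappa>(1)]] by (simp add: mult.assoc)
   show "(LBINT x. \<bar>laplacian (q (Suc n)) x\<bar>) <= \<kappa> ^ Suc n * (LBINT x. \<bar>laplacian p x\<bar>)"
    unfolding e pos_lap[OF Suc(1)]
    using order_trans[OF pos_L1[OF test_fun_laplacian[OF Suc(1)]] mult_left_mono[OF Suc(4) \<kappa>(1)]] by (simp add: mult.assoc)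
  qed (use p in \<open>auto simp: q_def\<close>)
  define I where "I = D * ((LBINT x. \<bar>p x\<bar>) + (LBINT x. \<bar>laplacian p x\<bar>))"
  have D0: "D >= 0" by (auto simp: D_def)
  have bd: "\<bar>\<integral>x. v x * h x \<partial>lborel\<bar> <= D * (LBINT x. \<bar>h x\<bar>)" if h: "test_fun UNIV h" and v: "loc_int UNIV v" "\<And>x. \<bar>v x\<bar> <= D" for v h
  proof -
   have "\<bar>\<integral>x. v x * h x \<partial>lborel\<bar> <= (LBINT x. \<bar>v x * h x\<bar>)" by (rule integral_abs_bound)
   also have "\<dots> <= (LBINT x. D * \<bar>h x\<bar>)"
    using integrable_abs[OF loc_int_test[OF v(1) h]] test_fun_integrable[OF h]
    by (intro integral_mono) (auto simp: abs_mult intro!: mult_right_mono v)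
   finally show ?thesis by simp
  qed
  have "\<bar>\<Lambda> p\<bar> <= I * \<kappa> ^ n" for n
  proof -
   have "\<bar>\<Lambda> (q n)\<bar> <= D * (LBINT x. \<bar>laplacian (q n) x\<bar>) + D * (LBINT x. \<bar>q n x\<bar>)"
    unfolding \<Lambda>_def using bd[OF test_fun_laplacian[OF q(1)[of n]] lu(1) ru(1)] bd[OF q(1)[of n] lu(2) ru(2)] by linarith
   also have "\<dots> <= D * (\<kappa> ^ n * (LBINT x. \<bar>laplacian p x\<bar>)) + D * (\<kappa> ^ n * (LBINT x. \<bar>p x\<bar>))"
    by (intro add_mono mult_left_mono q D0)
   finally show ?thesis using q(2)[of n] by (simp add: I_def algebra_simps)
  qed
  moreover have "(\<lambda>n. I * \<kappa> ^ n) \<longlonglongrightarrow> I * 0" using \<kappa> by (intro tendsto_intros LIMSEQ_power_zero) auto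
  ultimately have "\<bar>\<Lambda> p\<bar> <= I * 0" by (intro LIMSEQ_le_const[of "\<lambda>n. I * \<kappa> ^ n"]) auto
  then show ?thesis by simp
 qed
 have minimal: "AE x in lborel. u x <= v x"
  if v: "v \<in> borel_measurable borel" "\<And>x. c0 <= v x" "\<And>x. v x <= C0" "AE x in lborel. b x <= v x" "lapge UNIV (\<lambda>x. - v x) (\<lambda>x. - a x (v x))" for v
 proof -
  have "AE x in lborel. w j x <= v x" for j
  proof (induct j)
   case 0 then show ?case using v(4) by (simp add: w0)
  next
   case (Suc j)
   show ?case using T0_mono[OF wr v(1,2,3) Suc] T0_super[OF v(1,2,3,5)]
    by eventually_elim (use v(2,3) in \<open>auto simp: wS T_def\<close>)
  qed
  then have "AE x in lborel. \<forall>j. w j x <= v x" by (simp add: AE_all_countable)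
  then show ?thesis by eventually_elim (auto simp: u_def intro!: cSUP_least)
 qed
 show ?thesis
 proof (intro exI[of _ u] conjI allI impI)
  show "(LBINT x. u x * laplacian p x) = (LBINT x. a x (u x) * p x)" if "test_fun UNIV p" for p
   using sol[OF that] by (simp add: \<Lambda>_def)
 qed (use ur bu minimal in auto)
qed

section \<open>The Dirichlet problem with obstacle data\<close>

context ko_nonlinearity begin

text \<open>The inf-convolution of g, frozen below - c, with slope k + 1. Only shifts to the left
  compete because g is nondecreasing. The result is nondecreasing, Lipschitz with constant k + 1 and
  increases to g with k.\<close>

definition lip :: "nat => real => real => real" where
 "lip k c t = (INF r\<in>{0..}. g (max (t - r) (- c)) + real (Suc k) * r)"

lemma lip_bdd: "bdd_below ((\<lambda>r. g (max (t - r) (- c)) + real (Suc k) * r) ` {0..})"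
proof (rule bdd_belowI2[of _ "g (- c)"])
 fix r :: real assume "r \<in> {0..}"
 then have "0 <= real (Suc k) * r" by simp
 then show "g (- c) <= g (max (t - r) (- c)) + real (Suc k) * r" using g_le[of "- c" "max (t - r) (- c)"] by linarith
qed

lemma lip_le: "r >= 0 ==> lip k c t <= g (max (t - r) (- c)) + real (Suc k) * r"
 unfolding lip_def by (rule cINF_lower[OF lip_bdd]) simp

lemma le_lip: "(\<And>r. r >= 0 ==> z <= g (max (t - r) (- c)) + real (Suc k) * r) ==> z <= lip k c t"
 unfolding lip_def by (rule cINF_greatest) auto

lemma lip_le_g: "lip k c t <= g (max t (- c))"
 using lip_le[of 0 k c t] by simp

lemma lip_ge: "g (- c) <= lip k c t"
proof (rule le_lip)
 fix r :: real assume "r >= 0"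
 then have "0 <= real (Suc k) * r" by simp
 then show "g (- c) <= g (max (t - r) (- c)) + real (Suc k) * r" using g_le[of "- c" "max (t - r) (- c)"] by linarith
qed

lemma lip_mono: "s <= t ==> lip k c s <= lip k c t"
proof (rule le_lip)
 fix r :: real assume "s <= t" "r >= 0"
 then show "lip k c s <= g (max (t - r) (- c)) + real (Suc k) * r"
  using lip_le[of r k c s] g_le[of "max (s - r) (- c)" "max (t - r) (- c)"] by fastforce
qed

lemma lip_lipschitz: "s <= t ==> lip k c t <= lip k c s + real (Suc k) * (t - s)"
proof -
 assume st: "s <= t"
 have "lip k c t - real (Suc k) * (t - s) <= lip k c s"
 proof (rule le_lip)
  fix r :: real assume "r >= 0"
  then show "lip k c t - real (Suc k) * (t - s) <= g (max (s - r) (- c)) + real (Suc k) * r"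
   using lip_le[of "r + (t - s)" k c t] st by (simp add: algebra_simps)
 qed
 then show ?thesis by simp
qed

lemma lip_Suc: "lip k c t <= lip (Suc k) c t"
proof (rule le_lip)
 fix r :: real assume "r >= 0"
 then show "lip k c t <= g (max (t - r) (- c)) + real (Suc (Suc k)) * r"
  using lip_le[of r k c t] by (simp add: algebra_simps)
qed

lemma lip_borel [measurable]: "lip k c \<in> borel_measurable borel"
 by (rule borel_measurable_mono) (auto simp: mono_def lip_mono)

text \<open>A lower bound independent of k, so that one constant is a supersolution for every
  approximation: after a shift by at most t/2 the value g(t/2) remains, and a longer shift is
  charged at least t/2.\<close>

lemma lip_lower: "t >= 0 ==> c >= 0 ==> min (g (t / 2)) (g (- c) + t / 2) <= lip k c t"
proof (rule le_lip)
 fix r :: real assume r: "r >= 0" and t: "t >= 0" "c >= 0"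
 show "min (g (t / 2)) (g (- c) + t / 2) <= g (max (t - r) (- c)) + real (Suc k) * r"
 proof (cases "r <= t / 2")
  case True
  then have "g (t / 2) <= g (max (t - r) (- c))" by (intro g_le max.coboundedI1) simp
  moreover have "0 <= real (Suc k) * r" using r by simp
  ultimately show ?thesis by linarith
 next
  case False
  have "1 * r <= real (Suc k) * r" using r by (intro mult_right_mono) auto
  then show ?thesis using False g_le[of "- c" "max (t - r) (- c)"] by linarith
 qed
qed

text \<open>The argument varies together with k. Shifts below d/2 are controlled by continuity of g,
  and longer ones cost more than g(t) - g(- c) once k is large.\<close>

lemma lip_tendsto:
 assumes s: "s \<longlonglongrightarrow> t" "\<And>k. - c <= s k"
 shows "(\<lambda>k. lip k c (s k)) \<longlonglongrightarrow> g t"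
proof -
 have gc: "isCont g t" using g_cont by (simp add: continuous_on_eq_continuous_at)
 have up: "(\<lambda>k. g (s k)) \<longlonglongrightarrow> g t" using s(1) gc by (rule isCont_tendsto_compose[rotated])
 show ?thesis
 proof (rule LIMSEQ_I)
  fix e :: real assume e: "e > 0"
  obtain d where d: "d > 0" "\<And>x. \<bar>x - t\<bar> < d ==> \<bar>g x - g t\<bar> < e / 2"
   using gc e unfolding continuous_at_eps_delta dist_real_def by (metis half_gt_zero)
  obtain k1 where k1: "\<And>k. k >= k1 ==> \<bar>s k - t\<bar> < d / 4" using LIMSEQ_D[OF s(1), of "d / 4"] d(1) by auto
  obtain k2 where k2: "\<And>k. k >= k2 ==> \<bar>g (s k) - g t\<bar> < e" using LIMSEQ_D[OF up e] by auto
  obtain k3 where k3: "(g t - g (- c)) / (d / 2) < real k3" using reals_Archimedean2 by blast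
  have "norm (lip k c (s k) - g t) < e" if k: "k >= max k1 (max k2 k3)" for k
  proof -
   have u: "lip k c (s k) <= g (s k)" using lip_le_g[of k c "s k"] s(2)[of k] by (simp add: max_def)
   have l: "g t - e / 2 <= lip k c (s k)"
   proof (rule le_lip)
    fix r :: real assume r: "r >= 0"
    show "g t - e / 2 <= g (max (s k - r) (- c)) + real (Suc k) * r"
    proof (cases "r < d / 2")
     case True
     have "\<bar>g (t - 3/4 * d) - g t\<bar> < e / 2" by (rule d(2)) (use d(1) in simp)
     then have "g t - e / 2 <= g (t - 3/4 * d)" by linarith
     also have "\<dots> <= g (max (s k - r) (- c))"
     proof (intro g_le max.coboundedI1)
      have "\<bar>s k - t\<bar> < d / 4" using k1 k by simp
      then show "t - 3 / 4 * d <= s k - r" using True by linarith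
     qed
     finally show ?thesis using r by (simp add: add_increasing2)
    next
     case False
     have "g t - g (- c) <= real k3 * (d / 2)" using k3 d(1) by (simp add: field_simps)
     also have "\<dots> <= real (Suc k) * r" using False k d(1) by (intro mult_mono) auto
     finally show ?thesis using g_le[of "- c" "max (s k - r) (- c)"] e by linarith
    qed
   qed
   show ?thesis using u l k2[of k] k e by (auto simp: abs_less_iff)
  qed
  then show "\<exists>k0. \<forall>k\<ge>k0. norm (lip k c (s k) - g t) < e" by blast
 qed
qed

text \<open>Off \<open>B\<close> the solution is forced down to the subsolution \<open>b\<close> by a penalty, on \<open>B\<close> the
 nonlinearity is replaced by Lipschitz functions increasing to \<open>g\<close>. The solutions then decrease
 along the approximation.\<close>

lemma dirichlet:
 fixes b h f :: "'a::euclidean_space => real"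
 assumes B: "closed B" and bh: "lapge UNIV b h" and c: "\<And>x. \<bar>b x\<bar> <= c" "\<And>x. \<bar>h x\<bar> <= c"
  and f[measurable]: "f \<in> borel_measurable borel" and f_bounds: "\<And>x. 0 <= f x" "\<And>x. f x <= c"
  and gb: "AE x\<in>B in lborel. g (b x) <= h x"
 shows "\<exists>u C. u \<in> borel_measurable borel \<and> (\<forall>x. \<bar>u x\<bar> <= C) \<and> (AE x in lborel. b x <= u x) \<and> (AE x in lborel. x \<notin> B --> u x = b x) \<and>
  lapge UNIV u (\<lambda>x. if x \<in> B then g (u x) - f x else h x) \<and>
  supersol (interior B) f u"
proof -
 note [measurable] = loc_int_borel[OF lapgeD(1)[OF bh]] loc_int_borel[OF lapgeD(2)[OF bh]]
 have [measurable]: "B \<in> sets borel" using B by auto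
 have c0: "c >= 0" using order_trans[OF abs_ge_zero c(1)] .
 have cb: "- c <= b x" "b x <= c" "- c <= h x" "h x <= c" for x using c[of x] by (auto simp: abs_le_iff)
 define a where "a k x t = (if x \<in> B then lip k c t - f x else h x + real (Suc k) * (t - b x))" for k x t
 obtain t0 where t0: "t0 > 0" "g t0 >= c" using g_unbounded by blast
 \<comment> \<open>C0 is a constant supersolution for all k: on B, \<open>lip_lower\<close> gives
   \<open>lip k c C0\<close> >= c >= f, and off B the penalty is at least C0 - b >= c, which
   outweighs h >= - c.\<close>
 define C0 where "C0 = 2 * max t0 (c + \<bar>g (- c)\<bar>)"
 have C0: "C0 >= 0" "C0 / 2 >= t0" "C0 / 2 >= c + \<bar>g (- c)\<bar>" "C0 >= 2 * c" using t0(1) c0 by (auto simp: C0_def)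
 have supC: "0 <= a k x C0" for k x
 proof (cases "x \<in> B")
  case True
  have "c <= g (C0 / 2)" using t0(2) g_le[OF C0(2)] by linarith
  then have "c <= lip k c C0" using lip_lower[OF C0(1) c0, of k] C0(3) by linarith
  then show ?thesis using True f_bounds(2)[of x] by (simp add: a_def)
 next
  case False
  have "1 * (C0 - b x) <= real (Suc k) * (C0 - b x)" using cb(2)[of x] C0(4) c0 by (intro mult_right_mono) auto
  then show ?thesis using False cb(2,3)[of x] C0(4) by (simp add: a_def)
 qed
 have aL: "0 <= a k x t - a k x s \<and> a k x t - a k x s <= real (Suc k) * (t - s)" if "s <= t" for k x s t
  using lip_mono[OF that, of k c] lip_lipschitz[OF that, of k c] that by (auto simp: a_def algebra_simps)
 have abd: "\<bar>a k x t\<bar> <= \<bar>g (- c)\<bar> + \<bar>g C0\<bar> + 2 * c + real (Suc k) * (C0 + 2 * c)" if t: "- c <= t" "t <= C0" for k x t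
 proof -
  have 1: "\<bar>real (Suc k) * (t - b x)\<bar> <= real (Suc k) * (C0 + 2 * c)"
   unfolding abs_mult using t cb[of x] C0 c0 by (intro mult_mono) auto
  have "lip k c t <= g C0" using lip_le_g[of k c t] t g_le[of "max t (- c)" C0] by auto
  then have 2: "\<bar>lip k c t\<bar> <= \<bar>g (- c)\<bar> + \<bar>g C0\<bar>" using lip_ge[of c k t] by (auto simp: abs_le_iff)
  have 3: "0 <= real (Suc k) * (C0 + 2 * c)" using C0 c0 by simp
  show ?thesis using 1 2 3 f_bounds[of x] cb[of x] c0 unfolding a_def by (simp del: of_nat_Suc split: if_split) linarith
 qed
 have am: "(\<lambda>x. a k x (v x)) \<in> borel_measurable borel" if [measurable]: "v \<in> borel_measurable borel" for v k
  unfolding a_def by measurable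
 have subb: "lapge UNIV b (\<lambda>x. a k x (b x))" for k
 proof (rule lapge_mono[OF bh])
  show "loc_int UNIV (\<lambda>x. a k x (b x))"
   by (rule loc_int_bounded[OF am]) (use abd[of "b _"] cb C0 c0 in \<open>auto intro!: AE_I2 simp: order_trans[OF cb(2)]\<close>)
  show "AE x\<in>UNIV in lborel. a k x (b x) <= h x"
   using gb
  proof eventually_elim
   case (elim x)
   show ?case using elim lip_le_g[of k c "b x"] cb(1)[of x] f_bounds(1)[of x] by (auto simp: a_def max_def split: if_splits)
  qed
 qed
 define Q where "Q k u \<longleftrightarrow> u \<in> borel_measurable borel \<and> (\<forall>x. - c <= u x \<and> u x <= C0) \<and> (AE x in lborel. b x <= u x) \<and>
  (\<forall>p. test_fun UNIV p --> (LBINT x. u x * laplacian p x) = (LBINT x. a k x (u x) * p x)) \<and>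
  (\<forall>v. v \<in> borel_measurable borel \<and> (\<forall>x. - c <= v x \<and> v x <= C0) \<and> (AE x in lborel. b x <= v x) \<and>
    lapge UNIV (\<lambda>x. - v x) (\<lambda>x. - a k x (v x)) --> (AE x in lborel. u x <= v x))" for k u
 have "\<exists>u. Q k u" for k
  unfolding Q_def
 proof (rule perron[where L="real (Suc k)" and A="\<bar>g (- c)\<bar> + \<bar>g C0\<bar> + 2 * c + real (Suc k) * (C0 + 2 * c)"])
  show "b x <= C0" for x using cb(2)[of x] C0(4) c0 by linarith
 qed (use cb abd aL subb supC am in auto)
 then obtain u where Q: "\<And>k. Q k (u k)" by metis
 have u: "\<And>k. u k \<in> borel_measurable borel" "\<And>k x. - c <= u k x" "\<And>k x. u k x <= C0" "\<And>k. AE x in lborel. b x <= u k x"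
   "\<And>k p. test_fun UNIV p ==> (LBINT x. u k x * laplacian p x) = (LBINT x. a k x (u k x) * p x)"
   "\<And>k v. v \<in> borel_measurable borel ==> (\<And>x. - c <= v x) ==> (\<And>x. v x <= C0) ==> (AE x in lborel. b x <= v x) ==>
    lapge UNIV (\<lambda>x. - v x) (\<lambda>x. - a k x (v x)) ==> (AE x in lborel. u k x <= v x)"
  using Q unfolding Q_def by blast+
 note [measurable] = u(1)
 define D where "D = max C0 c"
 have uD: "\<bar>u k x\<bar> <= D" for k x using u(2,3)[of k x] by (auto simp: D_def)
 have lu: "loc_int UNIV (u k)" for k by (rule loc_int_bounded[where C=D]) (use uD in auto)
 have la: "loc_int UNIV (\<lambda>x. a k x (u j x))" for k j
  by (rule loc_int_bounded[OF am, where C="\<bar>g (- c)\<bar> + \<bar>g C0\<bar> + 2 * c + real (Suc k) * (C0 + 2 * c)"])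
   (use abd[OF u(2,3)] u(1) in \<open>auto simp del: of_nat_Suc\<close>)
 \<comment> \<open>Above b the right-hand side increases with k, through \<open>lip\<close> on B and
   through the penalty off B. So \<open>u k\<close> is a supersolution for the index k + 1, and the
   minimality of \<open>u (Suc k)\<close> applies.\<close>
 have dec: "AE x in lborel. u (Suc k) x <= u k x" for k
 proof (rule u(6))
  show "lapge UNIV (\<lambda>x. - u k x) (\<lambda>x. - a (Suc k) x (u k x))"
  proof (rule lapgeI[OF loc_int_uminus[OF lu] loc_int_uminus[OF la]])
   fix p :: "'a => real" assume p: "test_fun UNIV p" "\<And>x. 0 <= p x"
   have "(LBINT x. a k x (u k x) * p x) <= (LBINT x. a (Suc k) x (u k x) * p x)"
   proof (rule integral_mono_AE[OF loc_int_test[OF la p(1)] loc_int_test[OF la p(1)]])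
    show "AE x in lborel. a k x (u k x) * p x <= a (Suc k) x (u k x) * p x"
     using u(4)[of k]
    proof eventually_elim
     case (elim x)
     then have "a k x (u k x) <= a (Suc k) x (u k x)"
      using lip_Suc[of k c "u k x"] by (auto simp: a_def algebra_simps)
     then show ?case using p(2) by (intro mult_right_mono)
    qed
   qed
   then show "(LBINT x. - a (Suc k) x (u k x) * p x) <= (LBINT x. - u k x * laplacian p x)"
    using u(5)[OF p(1), of k] by simp
  qed
 qed (use u in auto)
 define U where "U x = (INF k. u k x)" for x
 have bdd: "bdd_below (range (\<lambda>k. u k x))" for x by (rule bdd_belowI[of _ "- c"]) (auto simp: u)
 have U_borel[measurable]: "U \<in> borel_measurable borel" unfolding U_def by (rule borel_measurable_cINF) (auto simp: bdd)
 have Ur: "- c <= U x" "U x <= C0" for x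
  unfolding U_def using cINF_lower[OF bdd UNIV_I, of x 0] u(3)[of 0 x] by (auto intro!: cINF_greatest u(2))
 have UD: "\<bar>U x\<bar> <= D" for x using Ur[of x] by (auto simp: D_def)
 have "AE x in lborel. \<forall>k. u (Suc k) x <= u k x" using dec by (simp add: AE_all_countable)
 then have lim: "AE x in lborel. (\<lambda>k. u k x) \<longlonglongrightarrow> U x"
 proof eventually_elim
  case (elim x)
  have "decseq (\<lambda>k. u k x)" using elim by (auto intro: decseq_SucI)
  then show ?case unfolding U_def using bdd[of x] by (rule LIMSEQ_decseq_INF[rotated])
 qed
 have bU: "AE x in lborel. b x <= U x"
 proof -
  have "AE x in lborel. \<forall>k. b x <= u k x" using u(4) by (simp add: AE_all_countable)
  then show ?thesis by eventually_elim (auto simp: U_def intro!: cINF_greatest)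
 qed
 have conv_u: "(\<lambda>k. LBINT x. u k x * q x) \<longlonglongrightarrow> (LBINT x. U x * q x)" if q: "test_fun UNIV q" for q
 proof (rule integral_dominated_convergence[where w="\<lambda>x. D * \<bar>q x\<bar>"])
  have [measurable]: "q \<in> borel_measurable borel" by (rule smooth_borel[OF test_fun_smooth[OF q]])
  show "(\<lambda>x. U x * q x) \<in> borel_measurable lborel" "\<And>k. (\<lambda>x. u k x * q x) \<in> borel_measurable lborel" by measurable
  show "integrable lborel (\<lambda>x. D * \<bar>q x\<bar>)" using test_fun_integrable[OF q] by auto
  show "AE x in lborel. (\<lambda>k. u k x * q x) \<longlonglongrightarrow> U x * q x" using lim by eventually_elim (intro tendsto_intros)
  show "AE x in lborel. norm (u k x * q x) <= D * \<bar>q x\<bar>" for k using uD by (auto simp: abs_mult intro!: mult_right_mono)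
 qed
 define F where "F x = (if x \<in> B then g (U x) - f x else h x)" for x
 define Fk where "Fk k x = (if x \<in> B then lip k c (u k x) - f x else h x)" for k x
 define E where "E = \<bar>g (- c)\<bar> + \<bar>g C0\<bar> + 2 * c"
 have FkE: "\<bar>Fk k x\<bar> <= E" for k x
 proof -
  have "lip k c (u k x) <= g C0" using lip_le_g[of k c "u k x"] u(2,3)[of k x] g_le[of "max (u k x) (- c)" C0] by auto
  then have "\<bar>lip k c (u k x)\<bar> <= \<bar>g (- c)\<bar> + \<bar>g C0\<bar>" using lip_ge[of c k "u k x"] by (auto simp: abs_le_iff)
  then show ?thesis using f_bounds[of x] cb[of x] c0 by (auto simp: Fk_def E_def)
 qed
 have FE: "\<bar>F x\<bar> <= E" for x
 proof -
  have "g (- c) <= g (U x)" "g (U x) <= g C0" using Ur[of x] by (auto intro: g_le)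
  then show ?thesis using f_bounds[of x] cb[of x] c0 by (auto simp: F_def E_def)
 qed
 have [measurable]: "F \<in> borel_measurable borel" "\<And>k. Fk k \<in> borel_measurable borel" unfolding F_def[abs_def] Fk_def[abs_def] by measurable
 have lF: "loc_int UNIV F" by (rule loc_int_bounded[where C=E]) (use FE in auto)
 have lFk: "loc_int UNIV (Fk k)" for k by (rule loc_int_bounded[where C=E]) (use FkE in auto)
 have conv_F: "(\<lambda>k. LBINT x. Fk k x * q x) \<longlonglongrightarrow> (LBINT x. F x * q x)" if q: "test_fun UNIV q" for q
 proof (rule integral_dominated_convergence[where w="\<lambda>x. E * \<bar>q x\<bar>"])
  have [measurable]: "q \<in> borel_measurable borel" by (rule smooth_borel[OF test_fun_smooth[OF q]])
  show "(\<lambda>x. F x * q x) \<in> borel_measurable lborel" "\<And>k. (\<lambda>x. Fk k x * q x) \<in> borel_measurable lborel" by measurable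
  show "integrable lborel (\<lambda>x. E * \<bar>q x\<bar>)" using test_fun_integrable[OF q] by auto
  show "AE x in lborel. (\<lambda>k. Fk k x * q x) \<longlonglongrightarrow> F x * q x" using lim
  proof eventually_elim
   case (elim x)
   have "(\<lambda>k. Fk k x) \<longlonglongrightarrow> F x"
    using lip_tendsto[OF elim u(2)] by (cases "x \<in> B") (auto simp: Fk_def F_def intro!: tendsto_intros)
   then show ?case by (intro tendsto_intros)
  qed
  show "AE x in lborel. norm (Fk k x * q x) <= E * \<bar>q x\<bar>" for k using FkE by (auto simp: abs_mult intro!: mult_right_mono)
 qed
 have eqk: "(LBINT x. u k x * laplacian p x) = (LBINT x. Fk k x * p x) + real (Suc k) * (LBINT x. indicator (- B) x * (u k x - b x) * p x)"
  if p: "test_fun UNIV p" for p k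
 proof -
  have lb: "loc_int UNIV (\<lambda>x. indicator (- B) x * (u k x - b x))"
   by (rule loc_int_bound[OF _ loc_int_diff[OF lu[of k] lapgeD(1)[OF bh]]]) (auto simp: indicator_def)
  have "a k x (u k x) * p x = Fk k x * p x + real (Suc k) * (indicator (- B) x * (u k x - b x) * p x)" for x
   by (auto simp: a_def Fk_def indicator_def algebra_simps)
  then show ?thesis using u(5)[OF p, of k] loc_int_test[OF lFk[of k] p] loc_int_test[OF lb p] by simp
 qed
 have pen_nonneg: "0 <= (LBINT x. indicator (- B) x * (u k x - b x) * p x)" if p: "\<And>x. 0 <= p x" for p k
  using u(4)[of k] by (intro integral_nonneg_AE) (auto elim!: eventually_mono intro!: mult_nonneg_nonneg p)
 have lapU: "lapge UNIV U F"
 proof (rule lapgeI[OF _ lF])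
  show "loc_int UNIV U" by (rule loc_int_bounded[where C=D]) (use UD in auto)
  fix p :: "'a => real" assume p: "test_fun UNIV p" "\<And>x. 0 <= p x"
  have "(LBINT x. Fk k x * p x) <= (LBINT x. u k x * laplacian p x)" for k
   using eqk[OF p(1), of k] pen_nonneg[OF p(2), of k] by simp
  then show "(LBINT x. F x * p x) <= (LBINT x. U x * laplacian p x)"
   by (intro LIMSEQ_le[OF conv_F[OF p(1)] conv_u[OF test_fun_laplacian[OF p(1)]]]) auto
 qed
 have lapB: "supersol (interior B) f U"
 proof (rule lapgeI)
  show "loc_int (interior B) (\<lambda>x. - U x)" using loc_int_uminus[OF lapgeD(1)[OF lapU]] by (rule loc_int_subset) auto
  have "loc_int (interior B) F" using lF by (rule loc_int_subset) auto
  then show "loc_int (interior B) (\<lambda>x. - (g (U x) - f x))"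
   by (rule loc_int_cong[OF loc_int_uminus]) (auto simp: F_def dest: subsetD[OF interior_subset])
  fix p :: "'a => real" assume p: "test_fun (interior B) p" "\<And>x. 0 <= p x"
  have z: "p x = 0" if "x \<notin> B" for x using test_fun_zero_outside[OF p(1)] that interior_subset by blast
  have e0: "indicator (- B) x * (u k x - b x) * p x = 0" for k x using z[of x] by (cases "x \<in> B") auto
  then have e: "(LBINT x. u k x * laplacian p x) = (LBINT x. Fk k x * p x)" for k
   using eqk[OF test_fun_UNIV[OF p(1)], of k] unfolding e0 by simp
  have "(LBINT x. U x * laplacian p x) = (LBINT x. F x * p x)"
   using LIMSEQ_unique[OF conv_u[OF test_fun_laplacian[OF test_fun_UNIV[OF p(1)]], unfolded e] conv_F[OF test_fun_UNIV[OF p(1)]]] .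
  moreover have "F x * p x = (g (U x) - f x) * p x" for x using z by (auto simp: F_def)
  ultimately show "(LBINT x. - (g (U x) - f x) * p x) <= (LBINT x. - U x * laplacian p x)" by (simp del: minus_diff_eq)
 qed
 \<comment> \<open>Every other term of the tested equation stays bounded in k, so dividing by k + 1
   shows that the integral of u - b over the complement of B tends to 0.\<close>
 have off: "AE x\<in>- B in lborel. 0 <= b x - U x"
 proof (rule fundamental_lemma)
  show "open (- B)" using B by auto
  have lbU: "loc_int UNIV (\<lambda>x. b x - U x)" by (intro loc_int_diff lapgeD(1)[OF bh] lapgeD(1)[OF lapU])
  then show "loc_int (- B) (\<lambda>x. b x - U x)" by (rule loc_int_subset) auto
  fix p :: "'a => real" assume p: "test_fun (- B) p" "\<And>x. 0 <= p x"
  note pU = test_fun_UNIV[OF p(1)]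
  have z: "p x = 0" if "x \<in> B" for x using test_fun_zero_outside[OF p(1)] that by auto
  have e: "indicator (- B) x * (u k x - b x) * p x = u k x * p x - b x * p x" for x k using z[of x] by (auto simp: indicator_def algebra_simps)
  have bp: "integrable lborel (\<lambda>x. b x * p x)" by (rule loc_int_test[OF lapgeD(1)[OF bh] pU])
  have Up: "integrable lborel (\<lambda>x. U x * p x)" by (rule loc_int_test[OF lapgeD(1)[OF lapU] pU])
  define X where "X k = (LBINT x. u k x * p x) - (LBINT x. b x * p x)" for k
  have X: "X k = (LBINT x. indicator (- B) x * (u k x - b x) * p x)" for k
   unfolding e X_def using loc_int_test[OF lu[of k] pU] bp by simp
  have l1: "X \<longlonglongrightarrow> (LBINT x. U x * p x) - (LBINT x. b x * p x)"
   unfolding X_def by (intro tendsto_diff conv_u[OF pU] tendsto_const)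
  have "(\<lambda>k. ((LBINT x. u k x * laplacian p x) - (LBINT x. Fk k x * p x)) * inverse (real (Suc k))) \<longlonglongrightarrow>
    ((LBINT x. U x * laplacian p x) - (LBINT x. F x * p x)) * 0"
   by (intro tendsto_mult tendsto_diff conv_u[OF test_fun_laplacian[OF pU]] conv_F[OF pU] LIMSEQ_inverse_real_of_nat)
  moreover have "((LBINT x. u k x * laplacian p x) - (LBINT x. Fk k x * p x)) * inverse (real (Suc k)) = X k" for k
   unfolding eqk[OF pU, of k] X[symmetric] by (simp add: field_simps del: of_nat_Suc)
  ultimately have "X \<longlonglongrightarrow> 0" by simp
  then have "(LBINT x. U x * p x) - (LBINT x. b x * p x) = 0" using LIMSEQ_unique[OF l1] by blast
  then show "0 <= (LBINT x. (b x - U x) * p x)" using bp Up by (simp add: left_diff_distrib)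
 qed
 have "AE x in lborel. x \<notin> B --> U x = b x" using off bU by eventually_elim auto
 then show ?thesis
  using U_borel UD bU lapU lapB unfolding F_def by blast
qed

end

section \<open>The minimal solution above a subsolution\<close>

lemma laplacian_local:
 assumes "smooth f" "smooth h" "open W" "\<And>x. x \<in> W ==> f x = h x" "x \<in> W"
 shows "laplacian f x = laplacian h x"
proof -
 have "laplacian (\<lambda>x. f x - h x) x = 0"
  by (rule laplacian_outside[of "- W"]) (use assms in auto)
 then show ?thesis using laplacian_diff[OF assms(1,2), of x] by simp
qed

section \<open>Local solutions and a local bound by a potential\<close>

context ko_nonlinearity begin

text \<open>Kato's inequality with the constant 0. It brings functions whose right-hand side is
  controlled only where they are positive into the form that \<open>local_upper_bound\<close>
  accepts.\<close>

lemma subsolution_pos_part: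
 assumes "lapge U w F" "open U" "AE x\<in>U in lborel. w x > 0 --> F x >= - c" "c >= 0"
 shows "lapge U (\<lambda>x. max (w x) 0) (\<lambda>_. - c)"
proof (rule lapge_mono[OF lapge_max[OF assms(1) lapge_const assms(2)] loc_int_const])
 show "AE x\<in>U in lborel. - c <= (if w x > 0 then F x else 0)"
  using assms(3) by eventually_elim (use assms(4) in auto)
qed

text \<open>\<open>dirichlet\<close> asks for bounded data on the whole space, whereas V is merely
  locally integrable and lives on \<Omega>. The replacement is b = max(q, V), where q is a
  paraboloid s on W and the constant C + 1 > V far from B. On W, s lies below every competitor v >=
  V; so there u = b <= v off B, and \<open>comparison\<close> extends this to B.\<close>

lemma local_solution:
 fixes V f :: "'a::euclidean_space => real"
 assumes o: "open \<Omega>" and V: "subsol \<Omega> V" and BD: "compact B" "compact D" "B \<subseteq> interior D" "D \<subseteq> \<Omega>"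
  and f[measurable]: "f \<in> borel_measurable borel" and f_bounds: "\<And>x. 0 <= f x" "\<And>x. f x <= c"
 shows "\<exists>u W. open W \<and> B \<subseteq> W \<and> u \<in> borel_measurable borel \<and> (AE x\<in>W in lborel. V x <= u x) \<and>
  lapge (interior B) u (\<lambda>x. g (u x) - f x) \<and> supersol (interior B) f u \<and>
  (\<forall>v f'. supersol (interior D) f' v \<and> (AE x\<in>interior D in lborel. V x <= v x \<and> 0 <= f' x) \<and>
    (AE x\<in>B in lborel. f x <= f' x) --> (AE x\<in>W in lborel. u x <= v x))"
proof -
 obtain C1 where C1: "\<forall>U (w::'a => real) c R L W. lapge U w (\<lambda>_. - c) --> c >= 0 --> R > 0 --> compact L --> L \<subseteq> U --> open W -->
  (\<forall>x\<in>W. cball x R \<subseteq> L) -->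
  (AE x\<in>W in lborel. w x <= C1 / R ^ DIM('a) * (LBINT x. indicator L x * \<bar>w x\<bar>) + c * R\<^sup>2)" and C1p: "C1 > 0"
  using local_upper_bound[where 'a='a] by blast
 note [measurable] = loc_int_borel[OF lapgeD(1)[OF V]]
 have iD: "interior D \<subseteq> D" by (rule interior_subset)
 define E where "E = interior D"
 have E: "open E" "E \<subseteq> D" "B \<subseteq> E" "E \<subseteq> \<Omega>" using BD iD by (auto simp: E_def)
 then have [measurable]: "E \<in> sets borel" by auto
 obtain C where C: "C >= 0" "AE x\<in>E in lborel. V x <= C"
 proof -
  have l: "lapge \<Omega> (\<lambda>x. max (V x) 0) (\<lambda>_. - 0)"
   by (rule subsolution_pos_part[OF V o]) (use g_nonneg in auto)
  obtain r where r: "r > 0" "enlarge r D \<subseteq> \<Omega>" using compact_enlarge_subset[OF BD(2) o BD(4)] by blast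
  define C' where "C' = C1 / r ^ DIM('a) * (LBINT x. indicator (enlarge r D) x * \<bar>max (V x) 0\<bar>) + 0 * r\<^sup>2"
  have "\<forall>x\<in>E. cball x r \<subseteq> enlarge r D" using E(2) by (auto simp: enlarge_eq)
  then have "AE x\<in>E in lborel. max (V x) 0 <= C'"
   unfolding C'_def using C1[rule_format, OF l order_refl r(1) compact_enlarge[OF BD(2)] r(2) E(1)] by blast
  then have "AE x\<in>E in lborel. V x <= max C' 0" by eventually_elim auto
  then show thesis by (intro that[of "max C' 0"]) auto
 qed
 obtain R where R: "R > 0" "enlarge (2 * R) B \<subseteq> E"
 proof -
  obtain r where "r > 0" "enlarge r B \<subseteq> E" using compact_enlarge_subset[OF BD(1) E(1) E(3)] by blast
  then show thesis by (intro that[of "r / 2"]) auto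
 qed
 define L where "L = enlarge (2 * R) B"
 have L: "compact L" "L \<subseteq> E" unfolding L_def using compact_enlarge[OF BD(1)] R by auto
 then have [measurable]: "L \<in> sets borel" by (simp add: compact_imp_closed)
 define W where "W = (\<Union>x\<in>B. ball x R)"
 have W: "open W" "B \<subseteq> W" "W \<subseteq> enlarge R B" using R(1) by (auto simp: W_def enlarge_eq)
 have WL: "\<forall>x\<in>W. cball x R \<subseteq> L"
 proof
  fix x assume "x \<in> W"
  then have "cball x R \<subseteq> enlarge R (enlarge R B)" using W(3) by (auto simp: enlarge_eq[of R "enlarge R B"])
  then show "cball x R \<subseteq> L" using enlarge_enlarge[of R R B] R(1) by (auto simp: L_def)
 qed
 have WE: "W \<subseteq> E" using WL L(2) R(1) by (auto simp: subset_iff)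
 \<comment> \<open>A lower bound - j1 on W for all competitors at once: since v >= V, the negative
   part of v is at most |V|, so its mean over L is controlled by V alone.\<close>
 define j1 where "j1 = C1 / R ^ DIM('a) * (LBINT x. indicator L x * \<bar>V x\<bar>) + g 0 * R\<^sup>2"
 have super_bound: "AE x\<in>W in lborel. - j1 <= v x"
  if v: "supersol E f' v" "AE x\<in>E in lborel. V x <= v x \<and> 0 <= f' x" for v f'
 proof -
  have l: "lapge E (\<lambda>x. max (- v x) 0) (\<lambda>_. - g 0)"
  proof (rule subsolution_pos_part[OF v(1) E(1) _ g_0])
   show "AE x\<in>E in lborel. 0 < - v x --> - g 0 <= - (g (v x) - f' x)"
    using v(2)
   proof eventually_elim
    case (elim x)
    then show ?case using g_le[of "v x" 0] by auto
   qed
  qed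
  have iV: "integrable lborel (\<lambda>x. indicator L x * \<bar>V x\<bar>)"
   by (rule loc_int_indicator[OF loc_int_abs[OF lapgeD(1)[OF V]] L(1)]) (use L(2) E in auto)
  have iv: "integrable lborel (\<lambda>x. indicator L x * \<bar>max (- v x) 0\<bar>)"
   by (rule loc_int_indicator[OF loc_int_abs[OF lapgeD(1)[OF l]] L])
  have "(LBINT x. indicator L x * \<bar>max (- v x) 0\<bar>) <= (LBINT x. indicator L x * \<bar>V x\<bar>)"
   by (rule integral_mono_AE[OF iv iV]) (use v(2) L(2) in \<open>auto elim!: eventually_mono simp: indicator_def\<close>)
  then have "C1 / R ^ DIM('a) * (LBINT x. indicator L x * \<bar>max (- v x) 0\<bar>) + g 0 * R\<^sup>2 <= j1"
   unfolding j1_def using C1p R(1) by (intro add_right_mono mult_left_mono) auto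
  then show ?thesis using C1[rule_format, OF l g_0 R(1) L W(1)] WL by (auto elim!: eventually_mono)
 qed
 have "j1 >= 0" unfolding j1_def using C1p R(1) g_0 by (intro add_nonneg_nonneg mult_nonneg_nonneg Bochner_Integration.integral_nonneg) auto
 obtain \<theta> :: "'a => real" and r where \<theta>: "test_fun E \<theta>" "\<And>x. 0 <= \<theta> x" "\<And>x. \<theta> x <= 1" "r > 0" "\<And>x. x \<in> enlarge r (enlarge R B) ==> \<theta> x = 1"
 proof -
  have "enlarge R B \<subseteq> E" using enlarge_mono[of B B R "2 * R"] R by auto
  then show thesis using cutoff_exists[OF compact_enlarge[OF BD(1)] E(1)] that by metis
 qed
 have \<theta>W: "\<theta> x = 1" if "x \<in> W" for x
  using \<theta>(5)[of x] enlarge_superset[of r "enlarge R B"] \<theta>(4) W(3) that by auto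
 obtain \<rho> where \<rho>: "\<And>x. x \<in> W ==> norm x <= \<rho>"
 proof -
  have "bounded W" using L(1) WL R(1) by (intro bounded_subset[OF compact_imp_bounded[OF L(1)]]) (auto simp: subset_iff)
  then show thesis using that unfolding bounded_iff by blast
 qed
 \<comment> \<open>The paraboloid s has Laplacian g 0 and is shifted below - j1 on W. There s <= 0,
   so g(s) <= g 0 and s is a subsolution.\<close>
 define A where "A = g 0 / (2 * real DIM('a))"
 have A: "A >= 0" "A * (2 * real DIM('a)) = g 0" using g_0 by (auto simp: A_def)
 define j where "j = j1 + A * \<rho>\<^sup>2"
 define s where "s x = A * (norm (x - 0))\<^sup>2 - j" for x :: 'a
 have ss: "smooth s" unfolding s_def by (intro smooth_diff smooth_cmult smooth_norm_sq smooth_const)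
 have ls: "laplacian s x = g 0" for x
  unfolding s_def using laplacian_diff[OF smooth_cmult[OF smooth_norm_sq[of 0], of A] smooth_const, of j x]
   laplacian_cmult[OF smooth_norm_sq[of 0], of A x] laplacian_norm_sq[of 0 x] A(2) by simp
 have sW: "s x <= - j1" if "x \<in> W" for x
 proof -
  have "(norm x)\<^sup>2 <= \<rho>\<^sup>2" using \<rho>[OF that] by (intro power_mono) auto
  then show ?thesis using mult_left_mono[OF _ A(1), of "(norm x)\<^sup>2" "\<rho>\<^sup>2"] by (simp add: s_def j_def)
 qed
 define q0 where "q0 x = \<theta> x * (s x - (C + 1))" for x
 have q0: "test_fun E q0" unfolding q0_def by (rule test_fun_mult(1)[OF \<theta>(1)]) (intro smooth_diff ss smooth_const)
 define q where "q x = (C + 1) + q0 x" for x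
 have sq: "smooth q" unfolding q_def by (intro smooth_add smooth_const test_fun_smooth[OF q0])
 have lq: "laplacian q x = laplacian q0 x" for x
  unfolding q_def using laplacian_add[OF smooth_const test_fun_smooth[OF q0]] by simp
 have qW: "q x = s x" "laplacian q x = g 0" if "x \<in> W" for x
 proof -
  have e: "q x = s x" if "x \<in> W" for x using \<theta>W[OF that] by (simp add: q_def q0_def)
  then show "q x = s x" using that .
  show "laplacian q x = g 0" using laplacian_local[OF sq ss W(1) e that] ls by simp
 qed
 obtain Q where Q: "\<And>x. \<bar>q0 x\<bar> <= Q" using test_fun_bounded[OF q0] by blast
 obtain Q' where Q': "\<And>x. \<bar>laplacian q0 x\<bar> <= Q'" using test_fun_bounded[OF test_fun_laplacian[OF q0]] by blast
 have [measurable]: "q \<in> borel_measurable borel" "laplacian q \<in> borel_measurable borel" using smooth_borel sq laplacian_smooth by blast+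
 \<comment> \<open>V <= C is known almost everywhere only; the minimum makes the bound hold
   everywhere, as \<open>dirichlet\<close> asks.\<close>
 define V' where "V' x = min (V x) C" for x
 have [measurable]: "V' \<in> borel_measurable borel" unfolding V'_def by measurable
 have VV': "AE x\<in>E in lborel. V' x = V x" using C(2) by eventually_elim (auto simp: V'_def)
 have lV': "subsol E V'"
  by (rule lapge_cong[OF lapge_subset[OF V E(4)]]) (use VV' in \<open>auto elim!: eventually_mono\<close>)
 define b where "b x = (if x \<in> E then max (q x) (V' x) else q x)" for x
 define h where "h x = (if x \<in> E \<and> q x < V' x then g (V' x) else laplacian q x)" for x
 have bh: "lapge UNIV b h"
  unfolding b_def h_def
 proof (rule lapge_glue[of UNIV E "tsupport \<theta>"])
  show "closed (tsupport \<theta>)" by (simp add: tsupport_def)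
  show "tsupport \<theta> \<subseteq> E" using \<theta>(1) by (simp add: test_fun_def)
  show "lapge UNIV q (laplacian q)" by (rule lapge_smooth[OF sq])
  show "subsol (UNIV \<inter> E) V'" using lV' by simp
  show "AE x\<in>UNIV \<inter> E in lborel. x \<notin> tsupport \<theta> --> V' x <= q x"
   using C(1) by (auto simp: V'_def q_def q0_def not_tsupport)
 qed (use E in auto)
 define c' where "c' = max c (max (C + 1 + Q) (max Q' (\<bar>g (- (C + 1 + Q))\<bar> + \<bar>g C\<bar>)))"
 have qb: "\<bar>q x\<bar> <= C + 1 + Q" for x using Q[of x] C(1) by (auto simp: q_def)
 have Q0: "Q >= 0" using order_trans[OF abs_ge_zero Q] .
 have bb: "\<bar>b x\<bar> <= c'" for x
 proof -
  have "V' x <= C" by (simp add: V'_def)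
  then have "\<bar>b x\<bar> <= C + 1 + Q" using qb[of x] Q0 unfolding b_def by (auto simp: abs_le_iff max_def)
  then show ?thesis by (simp add: c'_def)
 qed
 have hb: "\<bar>h x\<bar> <= c'" for x
 proof (cases "x \<in> E \<and> q x < V' x")
  case True
  have "- (C + 1 + Q) <= V' x" "V' x <= C" using True qb[of x] by (auto simp: V'_def abs_le_iff)
  then have "g (- (C + 1 + Q)) <= g (V' x)" "g (V' x) <= g C" by (auto intro: g_le)
  then have "\<bar>g (V' x)\<bar> <= \<bar>g (- (C + 1 + Q))\<bar> + \<bar>g C\<bar>" by linarith
  then show ?thesis using True unfolding h_def c'_def by (simp only: if_True simp_thms le_max_iff_disj)
 next
  case False
  then have "h x = laplacian q0 x" by (auto simp: h_def lq)
  then show ?thesis unfolding c'_def using Q'[of x] by (simp only: le_max_iff_disj simp_thms)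
 qed
 have gb: "AE x\<in>B in lborel. g (b x) <= h x"
 proof (rule AE_I2, rule impI)
  fix x assume x: "x \<in> B"
  then have xW: "x \<in> W" "x \<in> E" using W E by auto
  show "g (b x) <= h x"
  proof (cases "q x < V' x")
   case False
   have "q x <= 0" using qW(1)[OF xW(1)] sW[OF xW(1)] \<open>j1 >= 0\<close> by simp
   then have "g (q x) <= g 0" by (rule g_le)
   then show ?thesis using False xW qW(2)[OF xW(1)] by (simp add: b_def h_def max_def)
  qed (use xW in \<open>simp add: b_def h_def max_def\<close>)
 qed
 have fc: "f x <= c'" for x using f_bounds(2)[of x] by (simp add: c'_def)
 obtain u C2 where u: "u \<in> borel_measurable borel" "\<And>x. \<bar>u x\<bar> <= C2" "AE x in lborel. b x <= u x" "AE x in lborel. x \<notin> B --> u x = b x"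
  "lapge UNIV u (\<lambda>x. if x \<in> B then g (u x) - f x else h x)" "supersol (interior B) f u"
  using dirichlet[OF compact_imp_closed[OF BD(1)] bh bb hb f f_bounds(1) fc gb] that by blast
 note [measurable] = u(1)
 have le: "AE x\<in>W in lborel. V x <= u x"
  using u(3) VV' by eventually_elim (use WE in \<open>auto simp: b_def\<close>)
 have li: "lapge (interior B) u (\<lambda>x. g (u x) - f x)"
  by (rule lapge_cong[OF lapge_subset[OF u(5)]]) (auto dest: subsetD[OF interior_subset])
 have "AE x\<in>W in lborel. u x <= v x"
  if v: "supersol E f' v" "AE x\<in>E in lborel. V x <= v x \<and> 0 <= f' x" "AE x\<in>B in lborel. f x <= f' x" for v f'
 proof (rule comparison[OF W(1) lapge_subset[OF u(5)] lapge_subset[OF v(1) WE] BD(1) W(2)])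
  show "AE x\<in>W in lborel. x \<notin> B --> u x <= v x"
   using u(4) VV' v(2) super_bound[OF v(1,2)]
  proof eventually_elim
   case (elim x)
   show ?case
   proof (intro impI)
    assume x: "x \<in> W" "x \<notin> B"
    then have "u x = max (q x) (V x)" "V x <= v x" "- j1 <= v x" using elim WE by (auto simp: b_def)
    then show "u x <= v x" using qW(1)[OF x(1)] sW[OF x(1)] by simp
   qed
  qed
  show "AE x\<in>W in lborel. v x < u x --> g (v x) - f' x <= (if x \<in> B then g (u x) - f x else h x)"
   using u(4) VV' v(2,3) super_bound[OF v(1,2)]
  proof eventually_elim
   case (elim x)
   show ?case
   proof (intro impI)
    assume x: "x \<in> W" "v x < u x"
    have "x \<in> B"
    proof (rule ccontr)
     assume "x \<notin> B"
     then have "u x = max (q x) (V x)" "V x <= v x" "- j1 <= v x" using elim WE x by (auto simp: b_def)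
     then show False using qW(1)[OF x(1)] sW[OF x(1)] x(2) by simp
    qed
    then show "g (v x) - f' x <= (if x \<in> B then g (u x) - f x else h x)"
     using elim(4) g_le[of "v x" "u x"] x(2) by simp
   qed
  qed
 qed auto
 then show ?thesis
  using W u(1,6) le li unfolding E_def by (intro exI[of _ u] exI[of _ W]) blast
qed

text \<open>f has no pointwise bound and is absorbed by the potential P, the \<open>kP\<close>
  convolution of f cut to a neighbourhood of K: the Laplacian of - P is at least f - c, where c
  bounds the \<open>kN\<close> average. As P >= 0, g(w - P) <= g(w), so w - P satisfies the
  hypotheses of \<open>ko_bound\<close> with this c, and the bound P + M is the same for all
  w.\<close>

lemma ko_potential_bound:
 fixes f :: "'a::euclidean_space => real"
 assumes K: "compact K" and r: "r > 0" and f: "loc_int \<Omega> f" "\<And>x. 0 <= f x" and L: "enlarge (2 * r) K \<subseteq> \<Omega>"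
 shows "\<exists>Z. loc_int UNIV Z \<and> (\<forall>U w F. open U --> enlarge (2 * r) K \<subseteq> U --> lapge U w F --> (AE x\<in>U in lborel. F x >= g (w x) - f x) -->
   (AE x\<in>K in lborel. w x <= Z x))"
proof -
 define L where "L = enlarge (2 * r) K"
 have L: "compact L" "L \<subseteq> \<Omega>" using compact_enlarge[OF K] L by (auto simp: L_def)
 define fL where "fL x = indicator L x * f x" for x
 have i: "integrable lborel fL" unfolding fL_def by (rule loc_int_indicator[OF f(1) L])
 have fL0: "0 <= fL x" for x using f(2) by (simp add: fL_def)
 let ?m = "DIM('a) + 1"
 interpret N: even_kernel "kN r ?m :: 'a measure" r by (rule even_kernel_N[OF r]) simp
 interpret P: even_kernel "kP r ?m :: 'a measure" r by (rule even_kernel_P[OF r]) simp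
 obtain C0 where C0: "C0 > 0" "\<And>R x p. R > 0 ==> test_fun UNIV p ==> (\<And>x. 0 <= p x) ==>
   conv (kN R ?m) p x <= C0 / R ^ DIM('a) * integral\<^sup>L lborel (p::'a => real)"
  using kN_density_bound_test[where 'a='a] by blast
 define c where "c = C0 / r ^ DIM('a) * integral\<^sup>L lborel fL"
 have c: "c >= 0" unfolding c_def using C0 r fL0 by (intro mult_nonneg_nonneg Bochner_Integration.integral_nonneg) auto
 define P where "P = conv (kP r ?m) fL"
 have P0: "0 <= P x" for x unfolding P_def by (rule P.conv_nonneg[OF fL0])
 have lP: "loc_int UNIV P" unfolding P_def by (intro loc_int_integrable P.conv_L1 i)
 have lfL: "loc_int UNIV fL" by (rule loc_int_integrable[OF i])
 have lapP: "lapge UNIV (\<lambda>x. - P x) (\<lambda>x. fL x - c)"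
 proof (rule lapgeI[OF loc_int_uminus[OF lP] loc_int_diff[OF lfL loc_int_const]])
  fix p :: "'a => real" assume p: "test_fun UNIV p" "\<And>x. 0 <= p x"
  obtain B where B: "\<And>x. \<bar>p x\<bar> <= B" using test_fun_bounded[OF p(1)] by blast
  note lp = test_fun_laplacian[OF p(1)]
  obtain B' where B': "\<And>x. \<bar>laplacian p x\<bar> <= B'" using test_fun_bounded[OF lp] by blast
  note ip = test_fun_integrable[OF p(1)]
  note dP = P.conv_dual[OF i smooth_borel[OF test_fun_smooth[OF lp]] B'] and dN = N.conv_dual[OF i smooth_borel[OF test_fun_smooth[OF p(1)]] B]
  have fp: "integrable lborel (\<lambda>x. fL x * p x)" by (rule loc_int_test[OF lfL p(1)])
  have "(LBINT x. P x * laplacian p x) = (LBINT x. fL x * (conv (kN r ?m) p x - p x))"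
   unfolding P_def using dP(1) averaging_identity[OF p(1) r, of ?m] by simp
  also have "\<dots> = (LBINT x. fL x * conv (kN r ?m) p x) - (LBINT x. fL x * p x)"
   using dN(3) fp by (simp add: right_diff_distrib)
  also have "(LBINT x. fL x * conv (kN r ?m) p x) <= (LBINT x. fL x * (C0 / r ^ DIM('a) * integral\<^sup>L lborel p))"
  proof (rule integral_mono[OF dN(3)])
   show "fL x * conv (kN r ?m) p x <= fL x * (C0 / r ^ DIM('a) * integral\<^sup>L lborel p)" for x
    by (intro mult_left_mono C0(2) r p fL0)
  qed (use i in auto)
  also have "\<dots> = c * integral\<^sup>L lborel p" by (simp add: c_def)
  finally have "(LBINT x. P x * laplacian p x) <= c * integral\<^sup>L lborel p - (LBINT x. fL x * p x)" by simp
  then show "(LBINT x. (fL x - c) * p x) <= (LBINT x. - P x * laplacian p x)"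
   using fp ip by (simp add: left_diff_distrib)
 qed
 obtain M where M: "\<forall>x0 (w :: 'a => real) F. lapge (ball x0 (2 * r)) w F -->
  (AE x\<in>ball x0 (2 * r) in lborel. w x > 0 --> F x >= g (w x) - c) -->
  (AE x\<in>ball x0 r in lborel. w x <= M)"
  using ko_bound[OF r c, where 'a='a] by blast
 show ?thesis
 proof (intro exI[of _ "\<lambda>x. P x + M"] conjI allI impI)
  show "loc_int UNIV (\<lambda>x. P x + M)" by (intro loc_int_add lP loc_int_const)
  fix U w F assume U: "open U" "enlarge (2 * r) K \<subseteq> U" and w: "lapge U w F" "AE x\<in>U in lborel. F x >= g (w x) - f x"
  show "AE x\<in>K in lborel. w x <= P x + M"
  proof (rule AE_open_cover)
   fix x0 assume x0: "x0 \<in> K"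
   have sub: "ball x0 (2 * r) \<subseteq> L" using x0 ball_subset_cball by (auto simp: L_def enlarge_eq)
   have subU: "ball x0 (2 * r) \<subseteq> U" using sub U(2) by (auto simp: L_def)
   have l: "lapge (ball x0 (2 * r)) (\<lambda>x. w x + - P x) (\<lambda>x. F x + (fL x - c))"
    by (rule lapge_add[OF lapge_subset[OF w(1) subU] lapge_subset[OF lapP]]) auto
   have "AE x\<in>ball x0 r in lborel. w x + - P x <= M"
   proof (rule M[rule_format, OF l])
    show "AE x\<in>ball x0 (2 * r) in lborel. 0 < w x + - P x --> g (w x + - P x) - c <= F x + (fL x - c)"
     using w(2)
    proof eventually_elim
     case (elim x)
     show ?case
     proof (intro impI)
      assume x: "x \<in> ball x0 (2 * r)"
      then have "fL x = f x" using sub by (auto simp: fL_def)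
      moreover have "F x >= g (w x) - f x" using elim x subU by blast
      moreover have "g (w x + - P x) <= g (w x)" using P0[of x] by (intro g_le) simp
      ultimately show "g (w x + - P x) - c <= F x + (fL x - c)" by linarith
     qed
    qed
   qed
   then have "AE x\<in>ball x0 r in lborel. w x <= P x + M" by eventually_elim auto
   then show "\<exists>V. open V \<and> x0 \<in> V \<and> (AE x\<in>V in lborel. w x <= P x + M)"
    using r by (intro exI[of _ "ball x0 r"]) auto
  qed
 qed
qed

end

section \<open>Monotone limits and exhaustion of the domain\<close>

context ko_nonlinearity begin

definition solution :: "'a::euclidean_space set => ('a => real) => ('a => real) => bool" where
 "solution U f u \<longleftrightarrow> lapge U u (\<lambda>x. g (u x) - f x) \<and> supersol U f u"

lemma solution_eq:
 assumes "solution U f u" "test_fun U p" "\<And>x. 0 <= p x"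
 shows "(LBINT x. u x * laplacian p x) = (LBINT x. (g (u x) - f x) * p x)"
proof -
 have "(LBINT x. - (g (u x) - f x) * p x) <= (LBINT x. - u x * laplacian p x)"
  using assms lapgeD(3) unfolding solution_def by blast
 moreover have "(LBINT x. (g (u x) - f x) * p x) <= (LBINT x. u x * laplacian p x)"
  using assms lapgeD(3) unfolding solution_def by blast
 ultimately show ?thesis by (simp del: minus_diff_eq)
qed

definition monotone_weak_limit :: "'a::euclidean_space set => ('a => real) => (nat => 'a => real) => ('a => real) => bool" where
 "monotone_weak_limit \<Omega> V u U \<longleftrightarrow> loc_int \<Omega> U \<and> loc_int \<Omega> (\<lambda>x. g (U x)) \<and> (AE x\<in>\<Omega> in lborel. (\<lambda>n. u n x) \<longlonglongrightarrow> U x \<and> V x <= U x) \<and>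
  (\<forall>p. test_fun \<Omega> p \<and> (\<forall>x. 0 <= p x) --> (\<lambda>n. LBINT x. u n x * laplacian p x) \<longlonglongrightarrow> (LBINT x. U x * laplacian p x) \<and>
   (\<lambda>n. LBINT x. g (u n x) * p x) \<longlonglongrightarrow> (LBINT x. g (U x) * p x))"

text \<open>No growth bound on g is available to make g(U) locally integrable. Integrability comes
  from the equation: the integrals of g(u n) p are bounded by those of u n times the Laplacian of p,
  which converge by domination, and monotone convergence does the rest. The hypotheses start at an
  index N depending on the compact set, since along an exhaustion u n is controlled on its n-th
  member only.\<close>

lemma monotone_limit:
 fixes u :: "nat => 'a::euclidean_space => real"
 assumes o: "open \<Omega>" and um[measurable]: "\<And>n. u n \<in> borel_measurable borel" and lV: "loc_int \<Omega> V"
  and b: "\<And>K. compact K ==> K \<subseteq> \<Omega> ==> \<exists>Z N. loc_int UNIV Z \<and>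
   (AE x\<in>K in lborel. (\<forall>n\<ge>N. V x <= u n x \<and> u n x <= u (Suc n) x \<and> u n x <= Z x))"
  and s: "\<And>p. test_fun \<Omega> p ==> (\<And>x. 0 <= p x) ==> \<exists>N c. \<forall>n\<ge>N. integrable lborel (\<lambda>x. g (u n x) * p x) \<and>
   (LBINT x. g (u n x) * p x) <= (LBINT x. u n x * laplacian p x) + c"
 shows "\<exists>U. monotone_weak_limit \<Omega> V u U"
proof -
 note [measurable] = loc_int_borel[OF lV]
 obtain C where C: "\<And>n. compact (C n)" "\<And>n. C n \<subseteq> \<Omega>" "\<And>n. C n \<subseteq> interior (C (Suc n))" "\<Union>(range C) = \<Omega>"
   "\<And>K. compact K ==> K \<subseteq> \<Omega> ==> \<exists>N. \<forall>n\<ge>N. K \<subseteq> C n"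
  using open_Union_compact_subsets[OF o] by blast
 define U where "U x = lim (\<lambda>n. u n x)" for x
 have U_borel[measurable]: "U \<in> borel_measurable borel" unfolding U_def by measurable
 have limK: "\<exists>Z N. loc_int UNIV Z \<and> (AE x\<in>K in lborel. (\<lambda>n. u n x) \<longlonglongrightarrow> U x \<and> V x <= U x \<and> U x <= Z x \<and>
   (\<forall>n\<ge>N. V x <= u n x \<and> u n x <= u (Suc n) x \<and> u n x <= U x))" if K: "compact K" "K \<subseteq> \<Omega>" for K
 proof -
  obtain Z N where Z: "loc_int UNIV Z" "AE x\<in>K in lborel. (\<forall>n\<ge>N. V x <= u n x \<and> u n x <= u (Suc n) x \<and> u n x <= Z x)" using b[OF K] by blast
  have "AE x\<in>K in lborel. (\<lambda>n. u n x) \<longlonglongrightarrow> U x \<and> V x <= U x \<and> U x <= Z x \<and>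
   (\<forall>n\<ge>N. V x <= u n x \<and> u n x <= u (Suc n) x \<and> u n x <= U x)"
   using Z(2)
  proof eventually_elim
   case (elim x)
   show ?case
   proof
    assume x: "x \<in> K"
    have i: "V x <= u n x" "u n x <= u (Suc n) x" "u n x <= Z x" if "n >= N" for n using elim that x by auto
    have inc: "incseq (\<lambda>n. u (n + N) x)" by (rule incseq_SucI) (use i(2) in auto)
    have "\<exists>l. (\<lambda>n. u (n + N) x) \<longlonglongrightarrow> l"
     using incseq_convergent[OF inc, of "Z x"] i(3) by (metis le_add2)
    then obtain l where "(\<lambda>n. u (n + N) x) \<longlonglongrightarrow> l" by blast
    then have l: "(\<lambda>n. u n x) \<longlonglongrightarrow> l" by (rule LIMSEQ_offset)
    then have Ul: "U x = l" unfolding U_def by (rule limI)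
    have le: "u n x <= l" if "n >= N" for n
    proof -
     have "u ((n - N) + N) x <= l" by (rule incseq_le[OF inc LIMSEQ_ignore_initial_segment[OF l]])
     then show ?thesis using that by simp
    qed
    have "l <= Z x" by (rule LIMSEQ_le_const2[OF l]) (use i(3) in blast)
    then show "(\<lambda>n. u n x) \<longlonglongrightarrow> U x \<and> V x <= U x \<and> U x <= Z x \<and> (\<forall>n\<ge>N. V x <= u n x \<and> u n x <= u (Suc n) x \<and> u n x <= U x)"
     using l le i order_trans[OF i(1) le, of N] by (auto simp: Ul)
   qed
  qed
  then show ?thesis using Z(1) by blast
 qed
 have lU: "loc_int \<Omega> U"
 proof (rule loc_intI[OF U_borel])
  fix K assume K: "compact K" "K \<subseteq> \<Omega>"
  obtain Z N where Z: "loc_int UNIV Z" "AE x\<in>K in lborel. (\<lambda>n. u n x) \<longlonglongrightarrow> U x \<and> V x <= U x \<and> U x <= Z x \<and>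
   (\<forall>n\<ge>N. V x <= u n x \<and> u n x <= u (Suc n) x \<and> u n x <= U x)" using limK[OF K] by blast
  have "loc_int K U"
   by (rule loc_int_between[OF U_borel loc_int_subset[OF lV K(2)] loc_int_subset[OF Z(1)]]) (use Z(2) in \<open>auto elim!: eventually_mono\<close>)
  then show "integrable lborel (\<lambda>x. indicator K x * U x)" using loc_int_indicator K(1) by blast
 qed
 have key: "integrable lborel (\<lambda>x. g (U x) * p x) \<and> (\<lambda>n. LBINT x. u n x * laplacian p x) \<longlonglongrightarrow> (LBINT x. U x * laplacian p x) \<and>
   (\<lambda>n. LBINT x. g (u n x) * p x) \<longlonglongrightarrow> (LBINT x. g (U x) * p x)" if p: "test_fun \<Omega> p" "\<And>x. 0 <= p x" for p
 proof -
  obtain K where K: "smooth p" "compact K" "K \<subseteq> \<Omega>" "\<And>x. x \<notin> K ==> p x = 0" using test_funE[OF p(1)] by metis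
  have [measurable]: "p \<in> borel_measurable borel" "laplacian p \<in> borel_measurable borel"
   using smooth_borel K(1) laplacian_smooth by blast+
  have lo: "laplacian p x = 0" if "x \<notin> K" for x
   by (rule laplacian_outside[OF compact_imp_closed[OF K(2)]]) (use K(4) that in auto)
  obtain Z N0 where Z: "loc_int UNIV Z" "AE x\<in>K in lborel. (\<lambda>n. u n x) \<longlonglongrightarrow> U x \<and> V x <= U x \<and> U x <= Z x \<and>
   (\<forall>n\<ge>N0. V x <= u n x \<and> u n x <= u (Suc n) x \<and> u n x <= U x)" using limK[OF K(2,3)] by blast
  obtain N1 c where c: "\<forall>n\<ge>N1. integrable lborel (\<lambda>x. g (u n x) * p x) \<and> (LBINT x. g (u n x) * p x) <= (LBINT x. u n x * laplacian p x) + c"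
   using s[OF p] by blast
  let ?n = "\<lambda>i. i + max N0 N1"
  have ig: "integrable lborel (\<lambda>x. g (u (?n i) x) * p x)" for i using c by auto
  have l1: "(\<lambda>i. LBINT x. u (?n i) x * laplacian p x) \<longlonglongrightarrow> (LBINT x. U x * laplacian p x)"
  proof (rule integral_dominated_convergence[where w="\<lambda>x. (\<bar>V x\<bar> + \<bar>U x\<bar>) * \<bar>laplacian p x\<bar>"])
   have "integrable lborel (\<lambda>x. \<bar>V x * laplacian p x\<bar> + \<bar>U x * laplacian p x\<bar>)"
    using loc_int_test[OF lV test_fun_laplacian[OF p(1)]] loc_int_test[OF lU test_fun_laplacian[OF p(1)]] by auto
   then show "integrable lborel (\<lambda>x. (\<bar>V x\<bar> + \<bar>U x\<bar>) * \<bar>laplacian p x\<bar>)" by (simp add: abs_mult distrib_right)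
   show "AE x in lborel. (\<lambda>i. u (?n i) x * laplacian p x) \<longlonglongrightarrow> U x * laplacian p x"
    using Z(2)
   proof eventually_elim
    case (elim x)
    show ?case
    proof (cases "x \<in> K")
     case True
     then have "(\<lambda>i. u (?n i) x) \<longlonglongrightarrow> U x" using elim LIMSEQ_ignore_initial_segment by blast
     then show ?thesis by (intro tendsto_intros)
    qed (simp add: lo)
   qed
   show "AE x in lborel. norm (u (?n i) x * laplacian p x) <= (\<bar>V x\<bar> + \<bar>U x\<bar>) * \<bar>laplacian p x\<bar>" for i
    using Z(2)
   proof eventually_elim
    case (elim x)
    show ?case
    proof (cases "x \<in> K")
     case True
     then have "V x <= u (?n i) x" "u (?n i) x <= U x" using elim by auto
     then have "\<bar>u (?n i) x\<bar> <= \<bar>V x\<bar> + \<bar>U x\<bar>" by linarith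
     then show ?thesis by (simp add: abs_mult mult_right_mono)
    qed (simp add: lo)
   qed
  qed auto
  have mono: "AE x in lborel. mono (\<lambda>i. g (u (?n i) x) * p x)"
   using Z(2)
  proof eventually_elim
   case (elim x)
   show ?case
   proof (cases "x \<in> K")
    case True
    then show ?thesis using elim p(2) by (auto simp: mono_iff_le_Suc intro!: mult_right_mono g_le)
   qed (simp add: K(4) mono_def)
  qed
  have conv: "AE x in lborel. (\<lambda>i. g (u (?n i) x) * p x) \<longlonglongrightarrow> g (U x) * p x"
   using Z(2)
  proof eventually_elim
   case (elim x)
   show ?case
   proof (cases "x \<in> K")
    case True
    then have t: "(\<lambda>i. u (?n i) x) \<longlonglongrightarrow> U x" using elim LIMSEQ_ignore_initial_segment by blast
    have "isCont g (U x)" using g_cont by (simp add: continuous_on_eq_continuous_at)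
    from isCont_tendsto_compose[OF this t] show ?thesis by (intro tendsto_intros)
   qed (simp add: K(4))
  qed
  let ?I = "\<lambda>i. \<integral>x. g (u (?n i) x) * p x \<partial>lborel"
  have inc: "incseq ?I"
  proof (rule incseq_SucI, rule integral_mono_AE[OF ig ig])
   show "AE x in lborel. g (u (?n i) x) * p x <= g (u (?n (Suc i)) x) * p x" for i
    using mono by eventually_elim (auto dest: monoD[of _ i "Suc i"])
  qed
  obtain B where B: "\<forall>i. norm (LBINT x. u (?n i) x * laplacian p x) <= B"
   using convergent_imp_Bseq[OF convergentI[OF l1]] unfolding Bseq_def by blast
  have "?I i <= B + c" for i
  proof -
   have "N1 <= ?n i" by linarith
   then have "?I i <= (LBINT x. u (?n i) x * laplacian p x) + c" using c by blast
   then show ?thesis using B[rule_format, of i] by simp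
  qed
  from incseq_convergent[OF inc allI[OF this]] obtain L where L: "?I \<longlonglongrightarrow> L" by blast
  have iU: "integrable lborel (\<lambda>x. g (U x) * p x)" by (rule integrable_monotone_convergence[OF ig mono conv L]) measurable
  have "(LBINT x. g (U x) * p x) = L" by (rule integral_monotone_convergence[OF ig mono conv L]) measurable
  then show ?thesis using iU LIMSEQ_offset[OF l1] L LIMSEQ_offset[of "\<lambda>n. \<integral>x. g (u n x) * p x \<partial>lborel"] by blast
 qed
 have lg: "loc_int \<Omega> (\<lambda>x. g (U x))"
 proof (rule loc_intI)
  fix K assume K: "compact K" "K \<subseteq> \<Omega>"
  then have [measurable]: "K \<in> sets borel" by (simp add: compact_imp_closed)
  obtain \<theta> :: "'a => real" and r where \<theta>: "test_fun \<Omega> \<theta>" "\<And>x. 0 <= \<theta> x" "\<And>x. \<theta> x <= 1" "r > 0" "\<And>x. x \<in> enlarge r K ==> \<theta> x = 1"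
   using cutoff_exists[OF K(1) o K(2)] by blast
  have "integrable lborel (\<lambda>x. g (U x) * \<theta> x)" using key[OF \<theta>(1,2)] by blast
  then show "integrable lborel (\<lambda>x. indicator K x * g (U x))"
  proof (rule Bochner_Integration.integrable_bound)
   show "AE x in lborel. norm (indicator K x * g (U x)) <= norm (g (U x) * \<theta> x)"
    using \<theta>(4,5) enlarge_superset[of r K] by (intro AE_I2) (auto simp: indicator_def)
  qed measurable
 qed measurable
 have "AE x\<in>C n in lborel. (\<lambda>n. u n x) \<longlonglongrightarrow> U x \<and> V x <= U x" for n
  using limK[OF C(1,2)[of n]] by (auto elim!: eventually_mono)
 then have "AE x in lborel. \<forall>n. x \<in> C n --> (\<lambda>n. u n x) \<longlonglongrightarrow> U x \<and> V x <= U x" by (subst AE_all_countable) auto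
 then have "AE x\<in>\<Omega> in lborel. (\<lambda>n. u n x) \<longlonglongrightarrow> U x \<and> V x <= U x" using C(4) by (auto elim!: eventually_mono)
 then show ?thesis using lU lg key unfolding monotone_weak_limit_def by blast
qed

text \<open>The n-th local solution, with f cut at n, lies on \<open>C n\<close> below every
  admissible supersolution on the next set of the exhaustion, in particular below the next local
  solution. Hence the sequence increases, and its limit is below all competitors. These may solve
  with a larger right-hand side f', which yields minimality and monotonicity in f together.\<close>

lemma minimal_solution:
 fixes V f :: "'a::euclidean_space => real"
 assumes o: "open \<Omega>" and V: "subsol \<Omega> V" and f: "loc_int \<Omega> f" "\<And>x. 0 <= f x"
 shows "\<exists>u. solution \<Omega> f u \<and> (AE x\<in>\<Omega> in lborel. V x <= u x) \<and>
  (\<forall>v f'. supersol \<Omega> f' v \<and> (AE x\<in>\<Omega> in lborel. V x <= v x \<and> f x <= f' x)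
    --> (AE x\<in>\<Omega> in lborel. u x <= v x))"
proof -
 note [measurable] = loc_int_borel[OF lapgeD(1)[OF V]] loc_int_borel[OF f(1)]
 obtain C where C: "\<And>n. compact (C n)" "\<And>n. C n \<subseteq> \<Omega>" "\<And>n. C n \<subseteq> interior (C (Suc n))" "\<Union>(range C) = \<Omega>"
   "\<And>K. compact K ==> K \<subseteq> \<Omega> ==> \<exists>N. \<forall>n\<ge>N. K \<subseteq> C n"
  using open_Union_compact_subsets[OF o] by blast
 define fn where "fn n x = min (f x) (real n)" for n x
 have fn: "fn n \<in> borel_measurable borel" "0 <= fn n x" "fn n x <= real n" "fn n x <= f x" "fn n x <= fn (Suc n) x" for n x
  using f(2)[of x] unfolding fn_def by auto
 note [measurable] = fn(1)
 define Q where "Q n u \<longleftrightarrow> (\<exists>W. open W \<and> C n \<subseteq> W \<and> u \<in> borel_measurable borel \<and> (AE x\<in>W in lborel. V x <= u x) \<and>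
  lapge (interior (C n)) u (\<lambda>x. g (u x) - fn n x) \<and> supersol (interior (C n)) (fn n) u \<and>
  (\<forall>v f'. supersol (interior (C (Suc n))) f' v \<and> (AE x\<in>interior (C (Suc n)) in lborel. V x <= v x \<and> 0 <= f' x) \<and>
    (AE x\<in>C n in lborel. fn n x <= f' x) --> (AE x\<in>W in lborel. u x <= v x)))" for n u
 have "\<exists>u. Q n u" for n
  unfolding Q_def using local_solution[OF o V C(1) C(1) C(3) C(2) fn(1,2,3), of n] by blast
 then obtain u where Q: "\<And>n. Q n (u n)" by metis
 have um[measurable]: "\<And>n. u n \<in> borel_measurable borel" using Q unfolding Q_def by blast
 have Vu: "AE x\<in>C n in lborel. V x <= u n x" for n
 proof -
  obtain W where "C n \<subseteq> W" "AE x\<in>W in lborel. V x <= u n x" using Q[of n] unfolding Q_def by blast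
  then show ?thesis by (auto elim!: eventually_mono)
 qed
 have sol: "solution (interior (C n)) (fn n) (u n)" for n using Q[of n] unfolding Q_def solution_def by blast
 have min: "AE x\<in>C n in lborel. u n x <= v x"
  if "supersol (interior (C (Suc n))) f' v" "AE x\<in>interior (C (Suc n)) in lborel. V x <= v x \<and> 0 <= f' x"
   "AE x\<in>C n in lborel. fn n x <= f' x" for n v f'
 proof -
  obtain W where W: "C n \<subseteq> W" "\<forall>v f'. supersol (interior (C (Suc n))) f' v \<and> (AE x\<in>interior (C (Suc n)) in lborel. V x <= v x \<and> 0 <= f' x) \<and>
    (AE x\<in>C n in lborel. fn n x <= f' x) --> (AE x\<in>W in lborel. u n x <= v x)" using Q[of n] unfolding Q_def by blast
  have "AE x\<in>W in lborel. u n x <= v x" using W(2) that by blast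
  then show ?thesis using W(1) by (auto elim!: eventually_mono)
 qed
 have iC: "interior (C n) \<subseteq> C n" for n by (rule interior_subset)
 have inc: "AE x\<in>C n in lborel. u n x <= u (Suc n) x" for n
 proof (rule min[of n "u (Suc n)" "fn (Suc n)"])
  show "lapge (interior (C (Suc n))) (\<lambda>x. - u (Suc n) x) (\<lambda>x. - (g (u (Suc n) x) - fn (Suc n) x))"
   using sol[of "Suc n"] by (simp add: solution_def)
  show "AE x\<in>interior (C (Suc n)) in lborel. V x <= u (Suc n) x \<and> 0 <= fn (Suc n) x"
   using Vu[of "Suc n"] by eventually_elim (use iC fn(2) in blast)
 qed (use fn(5) in auto)
 have Cmono: "C m \<subseteq> C n" if "m <= n" for m n
  using that by (induct rule: dec_induct) (use C(3) iC in blast)+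
 have allinc: "AE x in lborel. \<forall>n. x \<in> C n --> V x <= u n x \<and> u n x <= u (Suc n) x"
  unfolding AE_all_countable
 proof
  fix n show "AE x\<in>C n in lborel. V x <= u n x \<and> u n x <= u (Suc n) x"
   using Vu[of n] inc[of n] by eventually_elim auto
 qed
 have bound: "\<exists>Z N. loc_int UNIV Z \<and> (AE x in lborel. \<forall>n\<ge>N. x \<in> K --> u n x <= Z x) \<and> K \<subseteq> interior (C N)" if K: "compact K" "K \<subseteq> \<Omega>" for K
 proof -
  obtain r where r: "r > 0" "enlarge r K \<subseteq> \<Omega>" using compact_enlarge_subset[OF K(1) o K(2)] by blast
  define L where "L = enlarge (2 * (r / 2)) K"
  have L: "compact L" "L \<subseteq> \<Omega>" using compact_enlarge[OF K(1)] r by (auto simp: L_def)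
  obtain N where N: "\<And>n. n >= N ==> L \<subseteq> C n" using C(5)[OF L] by blast
  obtain Z where Z: "loc_int UNIV Z" "\<forall>U w F. open U --> enlarge (2 * (r / 2)) K \<subseteq> U --> lapge U w F --> (AE x\<in>U in lborel. F x >= g (w x) - f x) -->
   (AE x\<in>K in lborel. w x <= Z x)"
   using ko_potential_bound[OF K(1) _ f, of "r / 2"] r by (auto simp: L_def)
  have "AE x\<in>K in lborel. u n x <= Z x" if "n >= Suc N" for n
  proof (rule Z(2)[rule_format])
   obtain m where m: "n = Suc m" "m >= N" using \<open>n >= Suc N\<close> by (cases n) auto
   show "enlarge (2 * (r / 2)) K \<subseteq> interior (C n)" using N[OF m(2)] C(3)[of m] by (auto simp: L_def m(1))
   show "lapge (interior (C n)) (u n) (\<lambda>x. g (u n x) - fn n x)" using sol[of n] by (simp add: solution_def)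
   show "AE x\<in>interior (C n) in lborel. g (u n x) - f x <= g (u n x) - fn n x" using fn(4) by simp
  qed simp
  then have "AE x in lborel. \<forall>n. n >= Suc N --> x \<in> K --> u n x <= Z x" by (subst AE_all_countable) auto
  moreover have "K \<subseteq> interior (C (Suc N))"
   using N[of N] C(3)[of N] enlarge_superset[of "2 * (r / 2)" K] r by (auto simp: L_def)
  ultimately show ?thesis using Z(1) by blast
 qed
 have lV: "loc_int \<Omega> V" by (rule lapgeD(1)[OF V])
 have tn: "\<exists>N. \<forall>n\<ge>N. test_fun (interior (C n)) p" if p: "test_fun \<Omega> p" for p
 proof -
  obtain K where K: "smooth p" "compact K" "K \<subseteq> \<Omega>" "\<And>x. x \<notin> K ==> p x = 0" using test_funE[OF p(1)] by metis
  obtain N where N: "K \<subseteq> interior (C N)" using bound[OF K(2,3)] by blast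
  show ?thesis by (intro exI[of _ N] allI impI test_funI[OF K(1,2) _ K(4)]) (use N interior_mono[OF Cmono] in blast)
 qed
 have eq: "integrable lborel (\<lambda>x. g (u n x) * p x) \<and>
   (LBINT x. g (u n x) * p x) = (LBINT x. u n x * laplacian p x) + (LBINT x. fn n x * p x)"
  if p: "test_fun (interior (C n)) p" "\<And>x. 0 <= p x" for n p
 proof -
  have "lapge (interior (C n)) (u n) (\<lambda>x. g (u n x) - fn n x)" using sol[of n] by (simp add: solution_def)
  note i1 = loc_int_test[OF lapgeD(2)[OF this] p(1)]
  have i2: "integrable lborel (\<lambda>x. fn n x * p x)"
   by (rule loc_int_test[OF loc_int_bounded p(1), of _ "real n"]) (use fn(2,3) in auto)
  have "integrable lborel (\<lambda>x. g (u n x) * p x)" using Bochner_Integration.integrable_add[OF i1 i2] by (simp add: algebra_simps)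
  then show ?thesis using solution_eq[OF sol p] i2 by (simp add: left_diff_distrib)
 qed
 have fnp: "(LBINT x. fn n x * p x) <= (LBINT x. f x * p x)" if p: "test_fun \<Omega> p" "\<And>x. 0 <= p x" for n p
  by (rule integral_mono[OF loc_int_test[OF loc_int_bounded p(1), of _ "real n"] loc_int_test[OF f(1) p(1)]]) (use fn(2,3,4) p(2) in \<open>auto intro: mult_right_mono\<close>)
 have "\<exists>U. monotone_weak_limit \<Omega> V u U"
 proof (rule monotone_limit[OF o um lV])
  fix K assume K: "compact K" "K \<subseteq> \<Omega>"
  obtain Z N where Z: "loc_int UNIV Z" "AE x in lborel. \<forall>n\<ge>N. x \<in> K --> u n x <= Z x" "K \<subseteq> interior (C N)" using bound[OF K] by blast
  have "AE x\<in>K in lborel. (\<forall>n\<ge>N. V x <= u n x \<and> u n x <= u (Suc n) x \<and> u n x <= Z x)"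
   using allinc Z(2) by eventually_elim (use Z(3) iC[of N] Cmono[of N] in blast)
  then show "\<exists>Z N. loc_int UNIV Z \<and> (AE x\<in>K in lborel. (\<forall>n\<ge>N. V x <= u n x \<and> u n x <= u (Suc n) x \<and> u n x <= Z x))" using Z(1) by blast
 next
  fix p :: "'a => real" assume p: "test_fun \<Omega> p" "\<And>x. 0 <= p x"
  obtain N where "\<forall>n\<ge>N. test_fun (interior (C n)) p" using tn[OF p(1)] by blast
  then show "\<exists>N c. \<forall>n\<ge>N. integrable lborel (\<lambda>x. g (u n x) * p x) \<and> (LBINT x. g (u n x) * p x) <= (LBINT x. u n x * laplacian p x) + c"
   using eq[OF _ p(2)] fnp[OF p] by (intro exI[of _ N] exI[of _ "\<integral>x. f x * p x \<partial>lborel"]) auto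
 qed
 then obtain U where lU: "loc_int \<Omega> U" and lg: "loc_int \<Omega> (\<lambda>x. g (U x))"
  and lim: "AE x\<in>\<Omega> in lborel. (\<lambda>n. u n x) \<longlonglongrightarrow> U x \<and> V x <= U x"
  and lp: "\<forall>p. test_fun \<Omega> p \<and> (\<forall>x. 0 <= p x) --> (\<lambda>n. LBINT x. u n x * laplacian p x) \<longlonglongrightarrow> (LBINT x. U x * laplacian p x) \<and>
   (\<lambda>n. LBINT x. g (u n x) * p x) \<longlonglongrightarrow> (LBINT x. g (U x) * p x)" unfolding monotone_weak_limit_def by (elim exE conjE)
 have [measurable]: "U \<in> borel_measurable borel" by (rule loc_int_borel[OF lU])
 have lgf: "loc_int \<Omega> (\<lambda>x. g (U x) - f x)" by (intro loc_int_diff lg f(1))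
 have eqU: "(LBINT x. (g (U x) - f x) * p x) = (LBINT x. U x * laplacian p x)" if p: "test_fun \<Omega> p" "\<And>x. 0 <= p x" for p
 proof -
  have [measurable]: "p \<in> borel_measurable borel" by (rule smooth_borel[OF test_fun_smooth[OF p(1)]])
  have ifp: "integrable lborel (\<lambda>x. f x * p x)" by (rule loc_int_test[OF f(1) p(1)])
  have l2: "(\<lambda>i. LBINT x. fn i x * p x) \<longlonglongrightarrow> (LBINT x. f x * p x)"
  proof (rule integral_dominated_convergence[where w="\<lambda>x. f x * p x", OF _ _ ifp])
   show "AE x in lborel. (\<lambda>i. fn i x * p x) \<longlonglongrightarrow> f x * p x"
   proof (rule AE_I2)
    fix x
    obtain m where "f x <= real m" using real_arch_simple by blast
    then have "\<forall>\<^sub>F i in sequentially. fn i x = f x"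
     unfolding eventually_sequentially fn_def by (intro exI[of _ m]) auto
    then show "(\<lambda>i. fn i x * p x) \<longlonglongrightarrow> f x * p x" by (intro tendsto_mult_right tendsto_eventually)
   qed
   show "AE x in lborel. norm (fn i x * p x) <= f x * p x" for i
    using fn(2,4) p(2) by (auto simp: abs_mult intro!: mult_right_mono)
  qed auto
  obtain N where N: "\<forall>n\<ge>N. test_fun (interior (C n)) p" using tn[OF p(1)] by blast
  have "(\<lambda>n. LBINT x. g (u n x) * p x) \<longlonglongrightarrow> (LBINT x. g (U x) * p x)" using lp p by blast
  moreover have "(\<lambda>n. LBINT x. g (u n x) * p x) \<longlonglongrightarrow> (LBINT x. U x * laplacian p x) + (LBINT x. f x * p x)"
  proof (rule Lim_transform_eventually[OF tendsto_add[OF _ l2]])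
   show "(\<lambda>n. LBINT x. u n x * laplacian p x) \<longlonglongrightarrow> (LBINT x. U x * laplacian p x)" using lp p by blast
   show "\<forall>\<^sub>F n in sequentially. (LBINT x. u n x * laplacian p x) + (LBINT x. fn n x * p x) = (LBINT x. g (u n x) * p x)"
    unfolding eventually_sequentially using N eq[OF _ p(2)] by (intro exI[of _ N]) auto
  qed
  ultimately have "(LBINT x. g (U x) * p x) = (LBINT x. U x * laplacian p x) + (LBINT x. f x * p x)" by (rule LIMSEQ_unique)
  then show ?thesis using loc_int_test[OF f(1) p(1)] loc_int_test[OF lg p(1)] by (simp add: left_diff_distrib)
 qed
 have "solution \<Omega> f U"
  unfolding solution_def
 proof
  show "lapge \<Omega> U (\<lambda>x. g (U x) - f x)" by (rule lapgeI[OF lU lgf]) (simp add: eqU)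
  show "supersol \<Omega> f U"
   by (rule lapgeI[OF loc_int_uminus[OF lU] loc_int_uminus[OF lgf]]) (simp add: eqU del: minus_diff_eq)
 qed
 moreover have "AE x\<in>\<Omega> in lborel. V x <= U x" using lim by (auto elim!: eventually_mono)
 moreover have "AE x\<in>\<Omega> in lborel. U x <= v x"
  if v: "supersol \<Omega> f' v" "AE x\<in>\<Omega> in lborel. V x <= v x \<and> f x <= f' x" for v f'
 proof -
  have sub: "interior (C n) \<subseteq> \<Omega>" for n using iC C(2) by blast
  have un: "AE x\<in>C n in lborel. u n x <= v x" for n
  proof (rule min[OF lapge_subset[OF v(1) sub]])
   show "AE x\<in>interior (C (Suc n)) in lborel. V x <= v x \<and> 0 <= f' x"
    using v(2) by eventually_elim (use sub f(2) order_trans in blast)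
   show "AE x\<in>C n in lborel. fn n x <= f' x"
    using v(2) by eventually_elim (use C(2) fn(4) order_trans in blast)
  qed
  then have un': "AE x in lborel. \<forall>n. x \<in> C n --> u n x <= v x" by (subst AE_all_countable) auto
  then show ?thesis using lim
  proof (eventually_elim, intro impI)
   fix x assume x: "\<forall>n. x \<in> C n --> u n x <= v x" "x \<in> \<Omega> --> (\<lambda>n. u n x) \<longlonglongrightarrow> U x \<and> V x <= U x" "x \<in> \<Omega>"
   then obtain m where m: "x \<in> C m" using C(4) by blast
   have "u n x <= v x" if "n >= m" for n using x(1) Cmono[OF that] m by blast
   then show "U x <= v x" using x by (intro LIMSEQ_le_const2[of "\<lambda>n. u n x"]) blast+
  qed
 qed
 ultimately show ?thesis by blast
qed

end

section \<open>Capacitary potentials\<close>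

text \<open>An antiderivative of a cut-off function that is 1 on [-1, 1] and vanishes off (-3, 3).
  Composing an admissible function with it preserves admissibility, does not raise the energy and
  bounds the function by 3, so the minimiser of the capacity can be taken bounded.\<close>

lemma smooth_truncation:
 obtains j :: "real => real" where "smooth j" "\<And>t. \<bar>j t\<bar> <= \<bar>t\<bar>" "\<And>t. \<bar>j t\<bar> <= 3" "\<And>t. t >= 1 ==> j t >= 1"
  "\<And>t. 0 <= pdiff 1 j t \<and> pdiff 1 j t <= 1"
proof -
 obtain \<kappa> :: "real => real" and r where \<kappa>: "test_fun (ball 0 3) \<kappa>" "\<And>x. 0 <= \<kappa> x" "\<And>x. \<kappa> x <= 1" "r > 0" "\<And>x. x \<in> enlarge r (cball 0 1) ==> \<kappa> x = 1"
 proof -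
  have "cball (0::real) 1 \<subseteq> ball 0 3" by auto
  then show ?thesis using cutoff_exists[OF compact_cball open_ball, of "0::real" 1 0 3] that by blast
 qed
 have \<kappa>1: "\<kappa> x = 1" if "\<bar>x\<bar> <= 1" for x
  using \<kappa>(5)[of x] enlarge_superset[of r "cball (0::real) 1"] \<kappa>(4) that by auto
 have \<kappa>0: "\<kappa> x = 0" if "\<bar>x\<bar> >= 3" for x
  using test_fun_zero_outside[OF \<kappa>(1), of x] that by auto
 have sm: "smooth \<kappa>" by (rule test_fun_smooth[OF \<kappa>(1)])
 have "\<exists>F. \<forall>x. (F has_vector_derivative \<kappa> x) (at x)"
 proof -
  have "isCont \<kappa> x" for x using smooth_continuous[OF sm, of UNIV] by (simp add: continuous_on_eq_continuous_at)
  then have "\<exists>F. \<forall>x::real. - \<infinity> < ereal x --> ereal x < \<infinity> --> (F has_vector_derivative \<kappa> x) (at x)"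
   by (intro einterval_antiderivative) auto
  then show ?thesis by auto
 qed
 then obtain F where "\<And>x. (F has_vector_derivative \<kappa> x) (at x)" by blast
 then have F: "(F has_field_derivative \<kappa> x) (at x)" for x by (simp add: has_real_derivative_iff_has_vector_derivative)
 define j where "j t = F t - F 0" for t
 have j: "(j has_field_derivative \<kappa> t) (at t)" for t
  unfolding j_def by (auto intro!: derivative_eq_intros F)
 have pj: "pdiff 1 j = \<kappa>" by (rule ext) (rule field_derivative_pdiff(2)[OF j])
 have smj: "smooth j"
 proof (rule smooth_coinduct[of _ "insert j {h. smooth h}"])
  show "h differentiable (at x)" if "h \<in> insert j {h. smooth h}" for h x
   using that field_derivative_pdiff(1)[OF j] smooth_differentiable by auto
  show "pdiff b h \<in> insert j {h. smooth h}" if "h \<in> insert j {h. smooth h}" "b \<in> Basis" for b :: real and h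
   using that pj sm smooth_pdiff[of h b] by auto
 qed simp
 have j0: "j 0 = 0" by (simp add: j_def)
 have mv: "\<exists>z. s < z \<and> z < t \<and> j t - j s = (t - s) * \<kappa> z" if "s < t" for s t
  using MVT2[OF that, of j \<kappa>] j by auto
 have mono: "j s <= j t" if st: "s <= t" for s t
 proof (cases "s = t")
  case False
  then obtain z where "j t - j s = (t - s) * \<kappa> z" using mv[of s t] st by auto
  moreover have "0 <= (t - s) * \<kappa> z" using st \<kappa>(2) by simp
  ultimately show ?thesis by simp
 qed simp
 have le: "\<bar>j t\<bar> <= \<bar>t\<bar>" for t
 proof (cases "t = 0")
  case False
  then obtain z where "j (max t 0) - j (min t 0) = (max t 0 - min t 0) * \<kappa> z" using mv[of "min t 0" "max t 0"] by (fastforce simp: min_def max_def)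
  then have "\<bar>j t\<bar> = \<bar>t\<bar> * \<kappa> z" using j0 mono[of 0 t] mono[of t 0] by (cases "t > 0") (auto simp: max_def min_def)
  then show ?thesis using \<kappa>(2,3)[of z] by (simp add: mult_left_le)
 qed (simp add: j0)
 have three: "\<bar>j t\<bar> <= 3" for t
 proof -
  consider "\<bar>t\<bar> <= 3" | "t > 3" | "t < - 3" by linarith
  then show ?thesis
  proof cases
   case 1 then show ?thesis using le[of t] by simp
  next
   case 2
   then obtain z where "3 < z" "j t - j 3 = (t - 3) * \<kappa> z" using mv[of 3 t] by auto
   then have "j t = j 3" using \<kappa>0[of z] by simp
   then show ?thesis using le[of 3] by simp
  next
   case 3
   then obtain z where "z < - 3" "j (-3) - j t = (- 3 - t) * \<kappa> z" using mv[of t "-3"] by auto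
   then have "j t = j (-3)" using \<kappa>0[of z] by simp
   then show ?thesis using le[of "-3"] by simp
  qed
 qed
 have one: "j t >= 1" if "t >= 1" for t
 proof -
  obtain z where "0 < z" "z < 1" "j 1 - j 0 = (1 - 0) * \<kappa> z" using mv[of 0 1] by auto
  then have "j 1 = 1" using \<kappa>1[of z] j0 by simp
  then show ?thesis using mono[OF that] by simp
 qed
 show thesis by (rule that[OF smj le three one]) (use pj \<kappa>(2,3) in auto)
qed

text \<open>For test functions this is the integral of grad p . grad q + p q after integration by
  parts. All derivatives sit on q, so the form still makes sense when p is only an almost everywhere
  limit of test functions.\<close>

definition energy_form :: "('a::euclidean_space => real) => ('a => real) => real" where
 "energy_form p q = (LBINT x. p x * (q x - laplacian q x))"

lemma energy_test: "test_fun UNIV q ==> test_fun UNIV (\<lambda>x. q x - laplacian q x)"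
 by (intro test_fun_diff test_fun_laplacian)

lemma test_test_integrable: "test_fun UNIV p ==> test_fun UNIV q ==> integrable lborel (\<lambda>x. p x * q x)"
 by (rule loc_int_test[OF loc_int_integrable[OF test_fun_integrable]])

lemma energy_form_add:
 assumes "test_fun UNIV p" "test_fun UNIV q" "test_fun UNIV w"
 shows "energy_form (\<lambda>x. p x + s * q x) w = energy_form p w + s * energy_form q w"
 using test_test_integrable[OF assms(1) energy_test[OF assms(3)]] test_test_integrable[OF assms(2) energy_test[OF assms(3)]]
 by (simp add: energy_form_def distrib_right mult.assoc)

lemma energy_form_commute:
 assumes "test_fun UNIV p" "test_fun UNIV q"
 shows "energy_form p q = energy_form q p"
 using green_second[OF assms(1) test_fun_smooth[OF assms(2)]]
  test_test_integrable[OF assms] test_test_integrable[OF assms(1) test_fun_laplacian[OF assms(2)]]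
  test_test_integrable[OF assms(2,1)] test_test_integrable[OF assms(2) test_fun_laplacian[OF assms(1)]]
 by (simp add: energy_form_def right_diff_distrib mult.commute)

lemma energy_eq:
 assumes p: "test_fun UNIV p"
 shows "energy_form p p = (LBINT x. grad_norm2 p x + (p x)\<^sup>2)" "integrable lborel (\<lambda>x. grad_norm2 p x + (p x)\<^sup>2)"
proof -
 have i: "integrable lborel (\<lambda>x. (p x)\<^sup>2)" using test_test_integrable[OF p p] by (simp add: power2_eq_square)
 have g: "integrable lborel (\<lambda>x. grad_norm2 p x)"
  unfolding grad_norm2_def power2_eq_square
  by (intro Bochner_Integration.integrable_sum test_test_integrable test_fun_pdiff p)
 show "integrable lborel (\<lambda>x. grad_norm2 p x + (p x)\<^sup>2)" using i g by simp
 have "(LBINT x. p x * laplacian p x) = - (LBINT x. grad_norm2 p x)"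
  using green_first[OF p test_fun_smooth[OF p]] by (simp add: grad_norm2_def[abs_def] power2_eq_square)
 then show "energy_form p p = (LBINT x. grad_norm2 p x + (p x)\<^sup>2)"
  using i g test_test_integrable[OF p p] test_test_integrable[OF p test_fun_laplacian[OF p]]
  by (simp add: energy_form_def right_diff_distrib power2_eq_square)
qed

lemma grad_norm2_nonneg: "0 <= grad_norm2 p x"
 unfolding grad_norm2_def by (intro sum_nonneg) simp

lemma energy_nonneg: "test_fun UNIV p ==> 0 <= energy_form p p"
 unfolding energy_eq(1) by (intro Bochner_Integration.integral_nonneg add_nonneg_nonneg grad_norm2_nonneg) simp

lemma energy_ge_L2: "test_fun UNIV p ==> (LBINT x. (p x)\<^sup>2) <= energy_form p p"
 unfolding energy_eq(1) using energy_eq(2)[of p] test_test_integrable[of p p]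
 by (intro integral_mono) (auto simp: grad_norm2_nonneg power2_eq_square)

lemma energy_add_sq:
 assumes "test_fun UNIV p" "test_fun UNIV q"
 shows "energy_form (\<lambda>x. p x + s * q x) (\<lambda>x. p x + s * q x) = energy_form p p + 2 * s * energy_form p q + s\<^sup>2 * energy_form q q"
proof -
 let ?w = "\<lambda>x. p x + s * q x"
 have w: "test_fun UNIV ?w" by (intro test_fun_add test_fun_cmult assms)
 have "energy_form ?w ?w = energy_form p ?w + s * energy_form q ?w" by (rule energy_form_add[OF assms w])
 also have "energy_form p ?w = energy_form p p + s * energy_form p q"
  using energy_form_add[OF assms assms(1), of s] energy_form_commute[OF w assms(1)] energy_form_commute[OF assms] by simp
 also have "energy_form q ?w = energy_form p q + s * energy_form q q"
  using energy_form_add[OF assms assms(2), of s] energy_form_commute[OF w assms(2)] by simp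
 finally show ?thesis by (simp add: algebra_simps power2_eq_square)
qed

definition admissible :: "'a::euclidean_space set => ('a => real) set" where
 "admissible E = {p. test_fun UNIV p \<and> (\<exists>G. open G \<and> E \<subseteq> G \<and> (\<forall>x\<in>G. 1 <= p x))}"

lemma cap12_le:
 assumes "p \<in> admissible E"
 shows "cap12 E <= ennreal (energy_form p p)"
proof -
 have p: "test_fun UNIV p" using assms by (simp add: admissible_def)
 have "cap12 E <= (\<integral>\<^sup>+ x. ennreal (grad_norm2 p x + (p x)\<^sup>2) \<partial>lebesgue)"
  unfolding cap12_def by (rule INF_lower) (use assms in \<open>auto simp: admissible_def test_fun_def\<close>)
 also have "\<dots> = (\<integral>\<^sup>+ x. ennreal (grad_norm2 p x + (p x)\<^sup>2) \<partial>lborel)"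
  by (rule nn_integral_completion)
 also have "\<dots> = ennreal (energy_form p p)"
  unfolding energy_eq(1)[OF p] by (rule nn_integral_eq_integral[OF energy_eq(2)[OF p]]) (simp add: grad_norm2_nonneg)
 finally show ?thesis .
qed

lemma admissible_truncate:
 assumes p: "p \<in> admissible E" and j: "smooth j" "\<And>t. \<bar>j t\<bar> <= \<bar>t\<bar>" "\<And>t. t >= 1 ==> j t >= 1" "\<And>t. 0 <= pdiff 1 j t \<and> pdiff 1 j t <= 1"
 shows "(\<lambda>x. j (p x)) \<in> admissible E" "energy_form (\<lambda>x. j (p x)) (\<lambda>x. j (p x)) <= energy_form p p"
proof -
 obtain G where G: "open G" "E \<subseteq> G" "\<And>x. x \<in> G ==> 1 <= p x" and pt: "test_fun UNIV p" using p by (auto simp: admissible_def)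
 obtain K where K: "smooth p" "compact K" "\<And>x. x \<notin> K ==> p x = 0" using test_funE[OF pt] by metis
 have j0: "j 0 = 0" using j(2)[of 0] by simp
 have jt: "test_fun UNIV (\<lambda>x. j (p x))"
  by (rule test_funI[OF smooth_comp[OF K(1) j(1)] K(2)]) (use K(3) j0 in auto)
 show "(\<lambda>x. j (p x)) \<in> admissible E" using jt G j(3) by (auto simp: admissible_def)
 have "grad_norm2 (\<lambda>x. j (p x)) x <= grad_norm2 p x" for x
  unfolding grad_norm2_def
 proof (rule sum_mono)
  fix b :: 'a
  have "pdiff b (\<lambda>x. j (p x)) x = pdiff 1 j (p x) * pdiff b p x"
   by (intro pdiff_comp smooth_differentiable K j)
  then have "(pdiff b (\<lambda>x. j (p x)) x)\<^sup>2 = (pdiff 1 j (p x))\<^sup>2 * (pdiff b p x)\<^sup>2" by (simp add: power_mult_distrib)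
  also have "\<dots> <= 1 * (pdiff b p x)\<^sup>2" using j(4)[of "p x"] by (intro mult_right_mono power_le_one) auto
  finally show "(pdiff b (\<lambda>x. j (p x)) x)\<^sup>2 <= (pdiff b p x)\<^sup>2" by simp
 qed
 moreover have "(j (p x))\<^sup>2 <= (p x)\<^sup>2" for x using j(2)[of "p x"] by (simp add: abs_le_square_iff)
 ultimately show "energy_form (\<lambda>x. j (p x)) (\<lambda>x. j (p x)) <= energy_form p p"
  unfolding energy_eq(1)[OF jt] energy_eq(1)[OF pt]
  by (intro integral_mono energy_eq(2) jt pt add_mono)
qed

text \<open>The parallelogram identity makes a minimising sequence Cauchy in L2, fast enough to
  converge almost everywhere. The functional that integrates w against p minus its Laplacian acts as
  the capacitary measure: it is nonnegative, vanishes on functions that vanish near E and is at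
  least the capacity on admissible functions. The three claims come from variations of the
  minimising sequence.\<close>

lemma capacity_minimizer:
 assumes ne: "admissible E \<noteq> {}"
 obtains w :: "'a::euclidean_space => real" where "w \<in> borel_measurable borel" "\<And>x. \<bar>w x\<bar> <= 3"
  "\<And>p. test_fun UNIV p ==> (\<And>x. 0 <= p x) ==> 0 <= (LBINT x. w x * (p x - laplacian p x))"
  "\<And>p G. test_fun UNIV p ==> open G ==> E \<subseteq> G ==> (\<And>x. x \<in> G ==> p x = 0) ==> (LBINT x. w x * (p x - laplacian p x)) = 0"
  "\<And>p. p \<in> admissible E ==> enn2real (cap12 E) <= (LBINT x. w x * (p x - laplacian p x))"
proof -
 obtain j :: "real => real" where j: "smooth j" "\<And>t. \<bar>j t\<bar> <= \<bar>t\<bar>" "\<And>t. \<bar>j t\<bar> <= 3" "\<And>t. t >= 1 ==> j t >= 1"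
  "\<And>t. 0 <= pdiff 1 j t \<and> pdiff 1 j t <= 1" using smooth_truncation by metis
 define c where "c = (INF p\<in>admissible E. energy_form p p)"
 have adt: "test_fun UNIV p" if "p \<in> admissible E" for p using that by (simp add: admissible_def)
 have bdd: "bdd_below ((\<lambda>p. energy_form p p) ` admissible E)" by (rule bdd_belowI2[of _ 0]) (use adt energy_nonneg in auto)
 have cle: "c <= energy_form p p" if "p \<in> admissible E" for p unfolding c_def by (rule cINF_lower[OF bdd that])
 have capc: "enn2real (cap12 E) <= c"
  unfolding c_def
 proof (rule cINF_greatest[OF ne])
  fix p assume p: "p \<in> admissible E"
  have "enn2real (cap12 E) <= enn2real (ennreal (energy_form p p))" by (rule enn2real_mono[OF cap12_le[OF p]]) simp
  then show "enn2real (cap12 E) <= energy_form p p" using energy_nonneg[OF adt[OF p]] by simp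
 qed
 \<comment> \<open>With 16^(-n), 2^n times the squared L2 increments is bounded by a geometric
   series of ratio 1/8, so \<open>\<Sum>n. a n x\<close> is finite almost everywhere.\<close>
 define \<epsilon> where "\<epsilon> n = (1 / 16 :: real) ^ n" for n
 have \<epsilon>: "\<epsilon> n > 0" "\<epsilon> (Suc n) <= \<epsilon> n" "\<epsilon> n <= 1" for n by (auto simp: \<epsilon>_def power_le_one)
 have \<epsilon>0: "\<epsilon> \<longlonglongrightarrow> 0" unfolding \<epsilon>_def by (intro LIMSEQ_power_zero) simp
 have "\<exists>p. p \<in> admissible E \<and> (\<forall>x. \<bar>p x\<bar> <= 3) \<and> energy_form p p <= c + \<epsilon> n" for n
 proof -
  have "c < c + \<epsilon> n" using \<epsilon>(1) by simp
  then obtain p where p: "p \<in> admissible E" "energy_form p p < c + \<epsilon> n"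
   unfolding c_def using cINF_less_iff[OF ne bdd] by blast
  show ?thesis using admissible_truncate[OF p(1) j(1,2,4,5)] p(2) j(3) by (intro exI[of _ "\<lambda>x. j (p x)"]) auto
 qed
 then obtain \<phi> where \<phi>: "\<And>n. \<phi> n \<in> admissible E" "\<And>n x. \<bar>\<phi> n x\<bar> <= 3" "\<And>n. energy_form (\<phi> n) (\<phi> n) <= c + \<epsilon> n" by metis
 have \<phi>t: "test_fun UNIV (\<phi> n)" for n by (rule adt[OF \<phi>(1)])
 have [measurable]: "\<phi> n \<in> borel_measurable borel" for n by (rule smooth_borel[OF test_fun_smooth[OF \<phi>t]])
 have half: "(\<lambda>x. (1/2) * \<phi> n x + (1/2) * \<phi> m x) \<in> admissible E" for n m
 proof -
  obtain G H where "open G" "E \<subseteq> G" "\<forall>x\<in>G. 1 <= \<phi> n x" "open H" "E \<subseteq> H" "\<forall>x\<in>H. 1 <= \<phi> m x"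
   using \<phi>(1)[of n] \<phi>(1)[of m] by (auto simp: admissible_def)
  then have "open (G \<inter> H) \<and> E \<subseteq> G \<inter> H \<and> (\<forall>x\<in>G \<inter> H. 1 <= (1/2) * \<phi> n x + (1/2) * \<phi> m x)" by fastforce
  then show ?thesis using test_fun_add[OF test_fun_cmult[OF \<phi>t[of n], of "1/2"] test_fun_cmult[OF \<phi>t[of m], of "1/2"]]
   unfolding admissible_def by blast
 qed
 have cauchy: "(LBINT x. (\<phi> (Suc n) x - \<phi> n x)\<^sup>2) <= 4 * \<epsilon> n" for n
 proof -
  let ?p = "\<phi> (Suc n)" and ?q = "\<phi> n"
  have e1: "energy_form (\<lambda>x. ?p x + (-1) * ?q x) (\<lambda>x. ?p x + (-1) * ?q x) = energy_form ?p ?p - 2 * energy_form ?p ?q + energy_form ?q ?q"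
   using energy_add_sq[OF \<phi>t[of "Suc n"] \<phi>t[of n], of "-1"] by simp
  let ?h = "\<lambda>x. (1/2) * ?p x + (1/2) * ?q x"
  have e2: "energy_form ?h ?h = energy_form (\<lambda>x. (1/2) * ?p x) (\<lambda>x. (1/2) * ?p x) + 2 * (1/2) * energy_form (\<lambda>x. (1/2) * ?p x) ?q + (1/2)\<^sup>2 * energy_form ?q ?q"
   by (rule energy_add_sq[OF test_fun_cmult[OF \<phi>t] \<phi>t])
  have lap: "laplacian (\<lambda>x. (1/2) * ?p x) x = (1/2) * laplacian ?p x" for x by (rule laplacian_cmult[OF test_fun_smooth[OF \<phi>t]])
  have e3: "energy_form (\<lambda>x. (1/2) * ?p x) (\<lambda>x. (1/2) * ?p x) = (1/4) * energy_form ?p ?p"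
  proof -
   have "(1/2) * ?p x * ((1/2) * ?p x - (1/2) * laplacian ?p x) = (1/4) * (?p x * (?p x - laplacian ?p x))" for x by (simp add: algebra_simps)
   then show ?thesis unfolding energy_form_def lap by (simp only: integral_mult_right_zero)
  qed
  have e4: "energy_form (\<lambda>x. (1/2) * ?p x) ?q = (1/2) * energy_form ?p ?q"
   by (simp add: energy_form_def)
  have "c <= energy_form ?h ?h" by (rule cle[OF half])
  then have "4 * c <= energy_form ?p ?p + 2 * energy_form ?p ?q + energy_form ?q ?q"
   unfolding e2 e3 e4 by (simp add: power2_eq_square)
  then have "energy_form (\<lambda>x. ?p x + (-1) * ?q x) (\<lambda>x. ?p x + (-1) * ?q x) <= 2 * energy_form ?p ?p + 2 * energy_form ?q ?q - 4 * c"
   unfolding e1 by linarith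
  also have "\<dots> <= 4 * \<epsilon> n" using \<phi>(3)[of n] \<phi>(3)[of "Suc n"] \<epsilon>(2)[of n] by linarith
  finally have "energy_form (\<lambda>x. ?p x + (-1) * ?q x) (\<lambda>x. ?p x + (-1) * ?q x) <= 4 * \<epsilon> n" .
  then show ?thesis
   using energy_ge_L2[OF test_fun_add[OF \<phi>t[of "Suc n"] test_fun_cmult[OF \<phi>t[of n], of "-1"]]] by simp
 qed
 have ae: "AE x in lborel. convergent (\<lambda>n. \<phi> n x)"
 proof -
  define a where "a n x = 2 ^ n * (\<phi> (Suc n) x - \<phi> n x)\<^sup>2" for n x
  have [measurable]: "a n \<in> borel_measurable borel" for n unfolding a_def by measurable
  have a0: "0 <= a n x" for n x by (simp add: a_def)
  have i: "integrable lborel (a n)" for n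
   unfolding a_def power2_eq_square using test_test_integrable[OF test_fun_diff[OF \<phi>t \<phi>t] test_fun_diff[OF \<phi>t \<phi>t]] by simp
  have le: "integral\<^sup>L lborel (a n) <= 4 * (1/8) ^ n" for n
  proof -
   have "integral\<^sup>L lborel (a n) <= 2 ^ n * (4 * \<epsilon> n)" unfolding a_def using cauchy[of n] by simp
   also have "\<dots> = 4 * (1/8) ^ n" by (simp add: \<epsilon>_def power_mult_distrib[symmetric])
   finally show ?thesis .
  qed
  have "(\<integral>\<^sup>+ x. (\<Sum>n. ennreal (a n x)) \<partial>lborel) = (\<Sum>n. \<integral>\<^sup>+ x. ennreal (a n x) \<partial>lborel)"
   by (rule nn_integral_suminf) auto
  also have "\<dots> = (\<Sum>n. ennreal (integral\<^sup>L lborel (a n)))"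
   by (intro suminf_cong nn_integral_eq_integral i) (simp add: a0)
  also have "\<dots> <= (\<Sum>n. ennreal (4 * (1/8) ^ n))" by (intro suminf_le ennreal_leI le) auto
  also have "\<dots> = ennreal (\<Sum>n. 4 * (1/8) ^ n)" by (rule suminf_ennreal2) (auto intro: summable_mult summable_geometric)
  finally have "(\<integral>\<^sup>+ x. (\<Sum>n. ennreal (a n x)) \<partial>lborel) \<noteq> \<infinity>" by (auto simp: top_unique)
  then have "AE x in lborel. (\<Sum>n. ennreal (a n x)) \<noteq> \<infinity>" by (intro nn_integral_PInf_AE) auto
  then show ?thesis
  proof eventually_elim
   case (elim x)
   have sa: "summable (\<lambda>n. a n x)" by (rule summable_suminf_not_top) (use a0 elim in auto)
   have "summable (\<lambda>n. (1/2) ^ n + a n x)" using sa by (intro summable_add summable_geometric) auto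
   moreover have "norm (\<phi> (Suc n) x - \<phi> n x) <= (1/2) ^ n + a n x" for n
   proof -
    define d where "d = \<bar>\<phi> (Suc n) x - \<phi> n x\<bar>"
    define t where "t = (2::real) ^ n"
    have t: "t > 0" by (simp add: t_def)
    \<comment> \<open>Either d <= 1/t, or t d >= 1 and then d <= t d^2. So the increments are
      summable wherever the weighted squares are.\<close>
    have "d <= 1 / t + t * d\<^sup>2"
    proof (cases "d <= 1 / t")
     case False
     then have "1 <= t * d" using t by (simp add: field_simps)
     then have "1 * d <= (t * d) * d" by (intro mult_right_mono) (auto simp: d_def)
     then show ?thesis using t by (simp add: power2_eq_square mult.assoc add_increasing)
    qed (use t in \<open>simp add: add_increasing2\<close>)
    then show ?thesis by (simp add: a_def d_def t_def power_one_over)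
   qed
   ultimately have "summable (\<lambda>n. \<phi> (Suc n) x - \<phi> n x)" by (rule summable_comparison_test'[where N = 0])
   then have "convergent (\<lambda>n. \<Sum>k<n. \<phi> (Suc k) x - \<phi> k x)" by (simp add: summable_iff_convergent)
   then have "convergent (\<lambda>n. \<phi> n x - \<phi> 0 x)" unfolding sum_lessThan_telescope[of "\<lambda>n. \<phi> n x"] .
   then obtain l where "(\<lambda>n. \<phi> n x - \<phi> 0 x) \<longlonglongrightarrow> l" by (auto simp: convergent_def)
   then have "(\<lambda>n. (\<phi> n x - \<phi> 0 x) + \<phi> 0 x) \<longlonglongrightarrow> l + \<phi> 0 x" by (intro tendsto_intros)
   then show ?case by (auto simp: convergent_def)
  qed
 qed
 define w where "w x = max (- 3) (min 3 (lim (\<lambda>n. \<phi> n x)))" for x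
 have [measurable]: "(\<lambda>x. lim (\<lambda>n. \<phi> n x)) \<in> borel_measurable borel" by (rule borel_measurable_lim_metric) simp
 have wb: "w \<in> borel_measurable borel" "\<bar>w x\<bar> <= 3" for x
  using borel_measurable_max[of "\<lambda>_. - 3" borel "\<lambda>x. min 3 (lim (\<lambda>n. \<phi> n x))"] by (auto simp: w_def[abs_def])
 have wl: "AE x in lborel. (\<lambda>n. \<phi> n x) \<longlonglongrightarrow> w x"
  using ae
 proof eventually_elim
  case (elim x)
  then have l: "(\<lambda>n. \<phi> n x) \<longlonglongrightarrow> lim (\<lambda>n. \<phi> n x)" by (simp add: convergent_LIMSEQ_iff)
  have "\<phi> n x <= 3" "- 3 <= \<phi> n x" for n using \<phi>(2)[of n x] by (auto simp: abs_le_iff)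
  then have "lim (\<lambda>n. \<phi> n x) <= 3" "- 3 <= lim (\<lambda>n. \<phi> n x)"
   using LIMSEQ_le_const2[OF l, of 3] LIMSEQ_le_const[OF l, of "-3"] by auto
  then have "w x = lim (\<lambda>n. \<phi> n x)" by (simp add: w_def)
  then show ?case using l by simp
 qed
 define \<mu> where "\<mu> p = (LBINT x. w x * (p x - laplacian p x))" for p
 have \<mu>: "(\<lambda>n. energy_form (\<phi> n) p) \<longlonglongrightarrow> \<mu> p" if p: "test_fun UNIV p" for p
  unfolding energy_form_def \<mu>_def
 proof (rule integral_dominated_convergence[where w="\<lambda>x. 3 * \<bar>p x - laplacian p x\<bar>"])
  have [measurable]: "p \<in> borel_measurable borel" "laplacian p \<in> borel_measurable borel"
   using smooth_borel test_fun_smooth[OF p] laplacian_smooth by blast+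
  note [measurable] = wb(1)
  show "(\<lambda>x. w x * (p x - laplacian p x)) \<in> borel_measurable lborel" "\<And>n. (\<lambda>x. \<phi> n x * (p x - laplacian p x)) \<in> borel_measurable lborel" by measurable
  show "integrable lborel (\<lambda>x. 3 * \<bar>p x - laplacian p x\<bar>)" using test_fun_integrable[OF energy_test[OF p]] by auto
  show "AE x in lborel. (\<lambda>n. \<phi> n x * (p x - laplacian p x)) \<longlonglongrightarrow> w x * (p x - laplacian p x)"
   using wl by eventually_elim (intro tendsto_intros)
  show "AE x in lborel. norm (\<phi> n x * (p x - laplacian p x)) <= 3 * \<bar>p x - laplacian p x\<bar>" for n
   using \<phi>(2) by (auto simp: abs_mult intro!: mult_right_mono)
 qed
 \<comment> \<open>The first variation: \<open>\<phi> n + s p\<close> has energy at least c, while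
   \<phi> n is minimal only up to \<epsilon> n.\<close>
 have var: "- \<epsilon> n - s\<^sup>2 * energy_form p p <= 2 * s * energy_form (\<phi> n) p"
  if p: "test_fun UNIV p" and a: "(\<lambda>x. \<phi> n x + s * p x) \<in> admissible E" for n s p
  using cle[OF a] \<phi>(3)[of n] unfolding energy_add_sq[OF \<phi>t p] by linarith
 have nonneg: "0 <= \<mu> p" if p: "test_fun UNIV p" and a: "\<And>n s. 0 < s ==> (\<lambda>x. \<phi> n x + s * p x) \<in> admissible E" for p
 proof -
  have "- (s / 2 * energy_form p p) <= \<mu> p" if s: "s > 0" for s
  proof -
   have "(\<lambda>n. - \<epsilon> n - s\<^sup>2 * energy_form p p) \<longlonglongrightarrow> - 0 - s\<^sup>2 * energy_form p p" by (intro tendsto_intros \<epsilon>0)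
   moreover have "(\<lambda>n. 2 * s * energy_form (\<phi> n) p) \<longlonglongrightarrow> 2 * s * \<mu> p" by (intro tendsto_intros \<mu> p)
   ultimately have "- 0 - s\<^sup>2 * energy_form p p <= 2 * s * \<mu> p"
    by (rule LIMSEQ_le) (use var[OF p a[OF s]] in blast)
   then have "s * (- (s / 2 * energy_form p p)) <= s * \<mu> p" by (simp add: power2_eq_square)
   then show ?thesis using s by (simp only: mult_le_cancel_left_pos)
  qed
  then have lb: "- (inverse (real (Suc n)) / 2 * energy_form p p) <= \<mu> p" for n by simp
  have "(\<lambda>n. - (inverse (real (Suc n)) / 2 * energy_form p p)) \<longlonglongrightarrow> - (0 / 2 * energy_form p p)"
   by (intro tendsto_intros LIMSEQ_inverse_real_of_nat) simp
  then have "- (0 / 2 * energy_form p p) <= \<mu> p" by (rule LIMSEQ_le_const2) (use lb in blast)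
  then show ?thesis by simp
 qed
 have adm: "(\<lambda>x. \<phi> n x + s * p x) \<in> admissible E" if p: "test_fun UNIV p" "open G" "E \<subseteq> G" "\<And>x. x \<in> G ==> 0 <= p x" "s > 0" for n s p G
 proof -
  obtain H where H: "open H" "E \<subseteq> H" "\<forall>x\<in>H. 1 <= \<phi> n x" using \<phi>(1)[of n] by (auto simp: admissible_def)
  have "1 <= \<phi> n x + s * p x" if "x \<in> G \<inter> H" for x
  proof -
   have "0 <= s * p x" using p(4)[of x] p(5) that by simp
   then show ?thesis using H(3) that by fastforce
  qed
  then show ?thesis
   using H p test_fun_add[OF \<phi>t[of n] test_fun_cmult[OF p(1), of s]] unfolding admissible_def by (intro CollectI conjI exI[of _ "G \<inter> H"]) auto
 qed
 show thesis
 proof (rule that[OF wb])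
  fix p :: "'a => real" assume p: "test_fun UNIV p" "\<And>x. 0 <= p x"
  show "0 <= (LBINT x. w x * (p x - laplacian p x))"
   using nonneg[OF p(1) adm[OF p(1) open_UNIV]] p(2) by (simp add: \<mu>_def)
 next
  fix p :: "'a => real" and G assume p: "test_fun UNIV p" "open G" "E \<subseteq> G" "\<And>x. x \<in> G ==> p x = 0"
  have 1: "0 <= \<mu> p" by (rule nonneg[OF p(1) adm[OF p(1-3)]]) (use p(4) in auto)
  let ?q = "\<lambda>x. (-1) * p x"
  have q: "test_fun UNIV ?q" by (rule test_fun_cmult[OF p(1)])
  have 2: "0 <= \<mu> ?q" by (rule nonneg[OF q adm[OF q p(2,3)]]) (use p(4) in auto)
  have "w x * (?q x - laplacian ?q x) = - (w x * (p x - laplacian p x))" for x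
   by (simp only: laplacian_cmult[OF test_fun_smooth[OF p(1)]]) (simp add: algebra_simps)
  then have "\<mu> ?q = - \<mu> p" unfolding \<mu>_def by (simp only: integral_minus)
  then show "(LBINT x. w x * (p x - laplacian p x)) = 0" using 1 2 by (simp add: \<mu>_def)
 next
  fix p assume pa: "p \<in> admissible E"
  note p = adt[OF pa]
  define D where "D = 2 * energy_form p p + 2 * (c + 1)"
  \<comment> \<open>Variation along the segment from \<phi> n to p, which stays admissible for 0 < s
    <= 1. The limit in n precedes the limit s to 0, because \<epsilon> n is divided by s.\<close>
  have key: "c - \<epsilon> n / (2 * s) - s / 2 * D <= energy_form (\<phi> n) p" if s: "0 < s" "s <= 1" for n s
  proof -
   let ?q = "\<lambda>x. p x + (-1) * \<phi> n x"
   have q: "test_fun UNIV ?q" by (intro test_fun_add p test_fun_cmult \<phi>t)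
   have "(\<lambda>x. \<phi> n x + s * ?q x) \<in> admissible E"
   proof -
    obtain G H where G: "open G" "E \<subseteq> G" "\<forall>x\<in>G. 1 <= \<phi> n x" "open H" "E \<subseteq> H" "\<forall>x\<in>H. 1 <= p x"
     using \<phi>(1)[of n] pa by (auto simp: admissible_def)
    have "1 <= \<phi> n x + s * ?q x" if "x \<in> G \<inter> H" for x
    proof -
     have "(1 - s) * 1 + s * 1 <= (1 - s) * \<phi> n x + s * p x" using G that s by (intro add_mono mult_left_mono) auto
     then show ?thesis by (simp add: algebra_simps)
    qed
    then show ?thesis using G test_fun_add[OF \<phi>t[of n] test_fun_cmult[OF q, of s]] unfolding admissible_def by (intro CollectI conjI exI[of _ "G \<inter> H"]) auto
   qed
   from var[OF q this] have v: "- \<epsilon> n - s\<^sup>2 * energy_form ?q ?q <= 2 * s * energy_form (\<phi> n) ?q" .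
   have e1: "energy_form (\<phi> n) ?q = energy_form (\<phi> n) p - energy_form (\<phi> n) (\<phi> n)"
    using energy_form_add[OF p \<phi>t[of n] \<phi>t[of n], of "-1"] energy_form_commute[OF q \<phi>t[of n]] energy_form_commute[OF p \<phi>t[of n]] by simp
   have "0 <= energy_form (\<lambda>x. p x + 1 * \<phi> n x) (\<lambda>x. p x + 1 * \<phi> n x)" by (intro energy_nonneg test_fun_add p test_fun_cmult \<phi>t)
   then have "- 2 * energy_form p (\<phi> n) <= energy_form p p + energy_form (\<phi> n) (\<phi> n)" unfolding energy_add_sq[OF p \<phi>t] by simp
   then have "energy_form ?q ?q <= 2 * energy_form p p + 2 * energy_form (\<phi> n) (\<phi> n)" unfolding energy_add_sq[OF p \<phi>t] by simp
   also have "\<dots> <= D" using \<phi>(3)[of n] \<epsilon>(3)[of n] by (simp add: D_def)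
   finally have "s\<^sup>2 * energy_form ?q ?q <= s\<^sup>2 * D" by (intro mult_left_mono) auto
   then have "- \<epsilon> n - s\<^sup>2 * D <= 2 * s * (energy_form (\<phi> n) p - energy_form (\<phi> n) (\<phi> n))" using v unfolding e1 by linarith
   also have "\<dots> <= 2 * s * (energy_form (\<phi> n) p - c)" using s cle[OF \<phi>(1)[of n]] by (intro mult_left_mono) auto
   finally have "(2 * s) * (- (\<epsilon> n / (2 * s)) - s / 2 * D) <= (2 * s) * (energy_form (\<phi> n) p - c)" using s by (simp add: algebra_simps power2_eq_square)
   then have "- (\<epsilon> n / (2 * s)) - s / 2 * D <= energy_form (\<phi> n) p - c" using s by (subst (asm) mult_le_cancel_left_pos) auto
   then show ?thesis by simp
  qed
  have lb: "c - s / 2 * D <= \<mu> p" if s: "0 < s" "s <= 1" for s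
  proof -
   have "(\<lambda>n. c - \<epsilon> n / (2 * s) - s / 2 * D) \<longlonglongrightarrow> c - 0 / (2 * s) - s / 2 * D" using s by (intro tendsto_intros \<epsilon>0) auto
   then have "c - 0 / (2 * s) - s / 2 * D <= \<mu> p" by (rule LIMSEQ_le[OF _ \<mu>[OF p]]) (use key[OF s] in blast)
   then show ?thesis by simp
  qed
  have "(\<lambda>n. c - inverse (real (Suc n)) / 2 * D) \<longlonglongrightarrow> c - 0 / 2 * D" by (intro tendsto_intros LIMSEQ_inverse_real_of_nat) simp
  moreover have "c - inverse (real (Suc n)) / 2 * D <= \<mu> p" for n by (rule lb) (auto simp: field_simps)
  ultimately have "c - 0 / 2 * D <= \<mu> p" by (intro LIMSEQ_le_const2) auto
  then show "enn2real (cap12 E) <= (LBINT x. w x * (p x - laplacian p x))" using capc by (simp add: \<mu>_def)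
 qed
qed

text \<open>The radius 9 r is the kernel radius 8 r plus the radius of the ball around E. The bound
  200 covers 3 + 3 + 192, from w, its \<open>kN\<close> average and its \<open>kP\<close> average,
  the mass of \<open>kP\<close> being at most 64. The power of r in the lower bound is
  r^(2-N).\<close>

definition capacitary_potential :: "real => 'a::euclidean_space => real => 'a set => ('a => real) => bool" where
 "capacitary_potential c \<sigma> r E p \<longleftrightarrow> p \<in> borel_measurable borel \<and> (\<forall>x. \<bar>p x\<bar> <= 200) \<and>
  (AE x in lborel. 0 <= p x) \<and> (AE x in lborel. x \<notin> cball \<sigma> (9 * r) --> p x = 0) \<and>
  (AE x\<in>ball \<sigma> r in lborel. c * (r\<^sup>2 / r ^ DIM('a)) * enn2real (cap12 E) <= p x) \<and>
  (\<forall>U. open U \<and> U \<inter> E = {} --> lapge U p (\<lambda>_. 0))"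

text \<open>p = w - N w + P w is the \<open>kP\<close> convolution of the measure \<mu> given by w
  minus its Laplacian. This makes p nonnegative, zero off the ball of radius 9 r, and with Laplacian
  N \<mu> - \<mu>, which is nonnegative off E. For the lower bound, \<open>?P q\<close> dominates a
  multiple of the cut-off \<theta> when q lives in the ball of radius r, since then all distances
  are at most 3 r; and \<mu> gives \<theta> at least the capacity.\<close>

lemma capacity_potential:
 "\<exists>c>0. \<forall>(\<sigma>::'a::euclidean_space) r E. 0 < r \<and> r <= 1 \<and> E \<subseteq> ball \<sigma> r --> (\<exists>p. capacitary_potential c \<sigma> r E p)"
proof (intro exI[of _ "2 * ((7/16)\<^sup>2 / (4 * paraboloid_mass TYPE('a))) / 6 ^ DIM('a)"] conjI allI impI)
 let ?c = "2 * ((7/16)\<^sup>2 / (4 * paraboloid_mass TYPE('a))) / 6 ^ DIM('a)"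
 show "0 < ?c" using paraboloid_mass_pos[where 'a='a] by simp
 fix \<sigma> :: 'a and r :: real and E :: "'a set"
 assume rE: "0 < r \<and> r <= 1 \<and> E \<subseteq> ball \<sigma> r"
 then have r: "0 < r" "r <= 1" and E: "E \<subseteq> ball \<sigma> r" by auto
 interpret N: even_kernel "kN (8 * r) 2 :: 'a measure" "8 * r" by (rule even_kernel_N) (use r in auto)
 interpret P: even_kernel "kP (8 * r) 2 :: 'a measure" "8 * r" by (rule even_kernel_P) (use r in auto)
 let ?N = "conv (kN (8 * r) 2 :: 'a measure)" and ?P = "conv (kP (8 * r) 2 :: 'a measure)"
 have R: "8 * r > 0" "(2::nat) >= 1" using r by auto
 have "cball \<sigma> r \<subseteq> ball \<sigma> (2 * r)" using r by auto
 from cutoff_exists[OF compact_cball open_ball this] obtain \<theta> :: "'a => real" and \<rho> where \<theta>: "test_fun (ball \<sigma> (2 * r)) \<theta>" "\<And>x. 0 <= \<theta> x"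
   "\<And>x. \<theta> x <= 1" "\<rho> > 0" "\<And>x. x \<in> enlarge \<rho> (cball \<sigma> r) ==> \<theta> x = 1" by blast
 have \<theta>1: "\<theta> x = 1" if "x \<in> ball \<sigma> r" for x
  by (intro \<theta>(5) subsetD[OF enlarge_superset]) (use \<theta>(4) that in auto)
 have \<theta>a: "\<theta> \<in> admissible E"
  unfolding admissible_def using \<theta>1 E test_fun_UNIV[OF \<theta>(1)] by (auto intro!: exI[of _ "ball \<sigma> r"])
 then have "admissible E \<noteq> {}" by auto
 from capacity_minimizer[OF this] obtain w :: "'a => real" where w[measurable]: "w \<in> borel_measurable borel" and wb: "\<And>x. \<bar>w x\<bar> <= 3"
  and w0: "\<And>p. test_fun UNIV p ==> (\<And>x. 0 <= p x) ==> 0 <= (LBINT x. w x * (p x - laplacian p x))"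
  and wz: "\<And>p G. test_fun UNIV p ==> open G ==> E \<subseteq> G ==> (\<And>x. x \<in> G ==> p x = 0) ==> (LBINT x. w x * (p x - laplacian p x)) = 0"
  and wc: "\<And>p. p \<in> admissible E ==> enn2real (cap12 E) <= (LBINT x. w x * (p x - laplacian p x))" by blast
 define \<mu> where "\<mu> q = (LBINT x. w x * (q x - laplacian q x))" for q
 have iw: "integrable lborel (\<lambda>x. w x * q x)" if "test_fun UNIV q" for q
  using loc_int_test[OF loc_int_bounded that, of w 3] wb by auto
 have \<mu>i: "integrable lborel (\<lambda>x. w x * (q x - laplacian q x))" if "test_fun UNIV q" for q
  by (intro iw test_fun_diff test_fun_laplacian that)
 have \<mu>_diff: "\<mu> (\<lambda>x. p x - k * q x) = \<mu> p - k * \<mu> q" if "test_fun UNIV p" "test_fun UNIV q" for p q k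
 proof -
  have "laplacian (\<lambda>x. p x - k * q x) x = laplacian p x - k * laplacian q x" for x
   using laplacian_diff[OF test_fun_smooth[OF that(1)] test_fun_smooth[OF test_fun_cmult[OF that(2)]]] laplacian_cmult[OF test_fun_smooth[OF that(2)]] by simp
  then have "w x * (p x - k * q x - laplacian (\<lambda>x. p x - k * q x) x) = w x * (p x - laplacian p x) - k * (w x * (q x - laplacian q x))" for x
   by (simp only:) (simp add: algebra_simps)
  then have "\<mu> (\<lambda>x. p x - k * q x) = (LBINT x. w x * (p x - laplacian p x) - k * (w x * (q x - laplacian q x)))"
   unfolding \<mu>_def by (simp only:)
  then show ?thesis unfolding \<mu>_def using \<mu>i[OF that(1)] \<mu>i[OF that(2)] by simp
 qed
 define p where "p x = w x - ?N w x + ?P w x" for x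
 have p[measurable]: "p \<in> borel_measurable borel" unfolding p_def[abs_def] by measurable
 have pb: "\<bar>p x\<bar> <= 200" for x
 proof -
  have "\<bar>?N w x\<bar> <= 3" using N.conv_abs_bound[of w 3 x] wb kN_mass[OF R, where 'a='a] by simp
  moreover have "\<bar>?P w x\<bar> <= (8 * r)\<^sup>2 * 3"
   using P.conv_abs_bound[of w 3 x] wb kP_mass(2)[OF R, where 'a='a] by auto
  moreover have "(8 * r)\<^sup>2 <= 8\<^sup>2" using r by (intro power_mono) auto
  ultimately show ?thesis unfolding p_def using wb[of x] by (simp add: abs_le_iff)
 qed
 have tN: "test_fun UNIV (?N q)" "test_fun UNIV (?P q)" if "test_fun UNIV q" for q
  using that by (auto elim!: test_funE intro!: N.test_fun_conv N.support P.test_fun_conv P.support)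
 have lapP: "laplacian (?P q) x = ?N q x - q x" if "test_fun UNIV q" for q x
  using P.laplacian_conv[OF that] averaging_identity[OF that R] by simp
 have dual: "(LBINT x. p x * q x) = \<mu> (?P q)" if q: "test_fun UNIV q" for q
 proof -
  note qi = test_fun_integrable[OF q]
  have [measurable]: "q \<in> borel_measurable borel" using qi by auto
  have n: "(LBINT x. ?N w x * q x) = (LBINT x. w x * ?N q x)" "integrable lborel (\<lambda>x. ?N w x * q x)"
   using N.conv_dual[OF qi w wb] by (simp_all add: mult.commute)
  have m: "(LBINT x. ?P w x * q x) = (LBINT x. w x * ?P q x)" "integrable lborel (\<lambda>x. ?P w x * q x)"
   using P.conv_dual[OF qi w wb] by (simp_all add: mult.commute)
  have "(LBINT x. p x * q x) = (LBINT x. w x * q x - ?N w x * q x + ?P w x * q x)"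
   by (simp add: p_def algebra_simps)
  also have "\<dots> = (LBINT x. w x * q x) - (LBINT x. w x * ?N q x) + (LBINT x. w x * ?P q x)"
   using n m iw[OF q] by simp
  also have "\<dots> = (LBINT x. w x * q x - w x * ?N q x + w x * ?P q x)"
   using iw[OF q] iw[OF tN(1)[OF q]] iw[OF tN(2)[OF q]] by simp
  also have "\<dots> = \<mu> (?P q)" unfolding \<mu>_def lapP[OF q] by (simp add: algebra_simps)
  finally show ?thesis .
 qed
 have lp: "loc_int U (\<lambda>x. k * p x + l)" for U k l
  using pb by (intro loc_int_add loc_int_const loc_int_cmult loc_int_bounded[OF p, of U 200]) auto
 have pos: "AE x in lborel. 0 <= p x"
  using fundamental_lemma[OF open_UNIV, of p] lp[of UNIV 1 0] dual w0[OF tN(2) P.conv_nonneg] by (simp add: \<mu>_def)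
 have zero: "AE x\<in>- cball \<sigma> (9 * r) in lborel. 0 <= - p x"
 proof (rule fundamental_lemma)
  show "loc_int (- cball \<sigma> (9 * r)) (\<lambda>x. - p x)" using lp[of _ "-1" 0] by simp
  fix q :: "'a => real" assume q: "test_fun (- cball \<sigma> (9 * r)) q" "\<And>x. 0 <= q x"
  have "?P q x = 0" if "x \<in> ball \<sigma> r" for x
  proof (rule conv_outside[OF P.support, of "- cball \<sigma> (9 * r)"])
   show "x \<notin> enlarge (8 * r) (- cball \<sigma> (9 * r))"
   proof
    assume "x \<in> enlarge (8 * r) (- cball \<sigma> (9 * r))"
    then obtain z where "9 * r < dist \<sigma> z" "dist z x <= 8 * r" by (force simp: enlarge_eq)
    then show False using that dist_triangle[of \<sigma> z x] by (simp add: dist_commute)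
   qed
  qed (use test_fun_zero_outside[OF q(1)] in auto)
  then have "\<mu> (?P q) = 0" unfolding \<mu>_def
   by (intro wz[OF tN(2)[OF test_fun_UNIV[OF q(1)]] open_ball E]) auto
  then show "0 <= (LBINT x. - p x * q x)" using dual[OF test_fun_UNIV[OF q(1)]] by simp
 qed auto
 have low: "AE x\<in>ball \<sigma> r in lborel. 0 <= 1 * p x + - (?c * (r\<^sup>2 / r ^ DIM('a)) * enn2real (cap12 E))"
 proof (rule fundamental_lemma[OF open_ball lp])
  fix q :: "'a => real" assume q: "test_fun (ball \<sigma> r) q" "\<And>x. 0 <= q x"
  note qU = test_fun_UNIV[OF q(1)]
  obtain C where C: "\<And>x. \<bar>q x\<bar> <= C" using test_fun_bounded[OF qU] by metis
  define k where "k = ?c * (r\<^sup>2 / r ^ DIM('a)) * integral\<^sup>L lborel q"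
  have k0: "k >= 0" unfolding k_def using paraboloid_mass_pos[where 'a='a] r q(2)
   by (intro mult_nonneg_nonneg Bochner_Integration.integral_nonneg) auto
  have "0 <= ?P q x - k * \<theta> x" for x
  proof (cases "x \<in> ball \<sigma> (2 * r)")
   case True
   have "k * \<theta> x <= k * 1" by (intro mult_left_mono \<theta> k0)
   also have "k * 1 = (2 * r\<^sup>2 * ((7/16)\<^sup>2 / (4 * paraboloid_mass TYPE('a))) / (6 * r) ^ DIM('a)) * integral\<^sup>L lborel q"
    unfolding k_def power_mult_distrib by (simp add: field_simps)
   also have "\<dots> <= ?P q x"
   proof (rule kP_lower_bound)
    show "q y <= C" for y using C[of y] by simp
    show "norm (x - z) <= 3 * r" if "q z \<noteq> 0" for z
    proof -
     have "z \<in> ball \<sigma> r" using test_fun_zero_outside[OF q(1)] that by auto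
     then show ?thesis using True dist_triangle[of x z \<sigma>] by (simp add: dist_norm norm_minus_commute)
    qed
   qed (use r q test_fun_integrable[OF qU] in auto)
   finally show ?thesis by simp
  next
   case False
   then show ?thesis using test_fun_zero_outside[OF \<theta>(1)] P.conv_nonneg[of q] q(2) by auto
  qed
  then have "0 <= \<mu> (\<lambda>x. ?P q x - k * \<theta> x)"
   unfolding \<mu>_def by (intro w0 test_fun_diff test_fun_cmult tN qU test_fun_UNIV[OF \<theta>(1)])
  then have "k * \<mu> \<theta> <= \<mu> (?P q)" using \<mu>_diff[OF tN(2)[OF qU] test_fun_UNIV[OF \<theta>(1)]] by simp
  moreover have "k * enn2real (cap12 E) <= k * \<mu> \<theta>" using wc[OF \<theta>a] k0 by (intro mult_left_mono) (simp add: \<mu>_def)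
  ultimately have "k * enn2real (cap12 E) <= (LBINT x. p x * q x)" using dual[OF qU] by simp
  moreover have "integrable lborel (\<lambda>x. p x * q x)" using loc_int_test[OF _ qU, of p] lp[of UNIV 1 0] by simp
  ultimately show "0 <= (LBINT x. (1 * p x + - (?c * (r\<^sup>2 / r ^ DIM('a)) * enn2real (cap12 E))) * q x)"
   using test_fun_integrable[OF qU] by (simp add: k_def algebra_simps)
 qed
 have sub: "lapge U p (\<lambda>_. 0)" if U: "open U" "U \<inter> E = {}" for U
 proof (rule lapgeI)
  show "loc_int U p" using lp[of U 1 0] by simp
  fix q :: "'a => real" assume q: "test_fun U q" "\<And>x. 0 <= q x"
  note qU = test_fun_UNIV[OF q(1)]
  have z: "\<mu> q = 0" unfolding \<mu>_def
  proof (rule wz[OF qU, of "- tsupport q"])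
   show "open (- tsupport q)" by (simp add: tsupport_def open_Compl)
   show "E \<subseteq> - tsupport q" using q(1) U(2) by (auto simp: test_fun_def)
  qed (use not_tsupport in auto)
  have "laplacian (?P q) = (\<lambda>x. ?N q x - q x)" using lapP[OF qU] by auto
  then have "?P (laplacian q) = (\<lambda>x. ?N q x - 1 * q x)" using P.laplacian_conv[OF qU] by simp
  then have "(LBINT x. p x * laplacian q x) = \<mu> (?N q) - 1 * \<mu> q"
   using dual[OF test_fun_laplacian[OF qU]] \<mu>_diff[OF tN(1)[OF qU] qU, of 1] by simp
  then show "(LBINT x. 0 * q x) <= (LBINT x. p x * laplacian q x)"
   using z w0[OF tN(1)[OF qU] N.conv_nonneg] q(2) by (simp add: \<mu>_def)
 qed (rule loc_int_const)
 show "\<exists>p. capacitary_potential ?c \<sigma> r E p"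
  unfolding capacitary_potential_def
 proof (intro exI[of _ p] conjI)
  show "AE x in lborel. x \<notin> cball \<sigma> (9 * r) --> p x = 0" using pos zero by eventually_elim auto
  show "AE x\<in>ball \<sigma> r in lborel. ?c * (r\<^sup>2 / r ^ DIM('a)) * enn2real (cap12 E) <= p x"
   using low by eventually_elim auto
 qed (use p pb pos sub in auto)
qed

section \<open>Barriers from the Wiener criterion\<close>

lemma cap12_mono: "A \<subseteq> B ==> cap12 A <= cap12 B"
 unfolding cap12_def by (rule INF_superset_mono) auto

lemma cap12_finite:
 assumes "bounded (E :: 'a::euclidean_space set)"
 shows "cap12 E < \<infinity>"
proof -
 obtain r where r: "E \<subseteq> ball 0 r" using bounded_subset_ballD[OF assms, of 0] by auto
 from cutoff_exists[OF compact_cball open_UNIV subset_UNIV, of 0 r] obtain \<theta> :: "'a => real" and \<rho>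
  where \<theta>: "test_fun UNIV \<theta>" "\<And>x. 0 <= \<theta> x" "\<And>x. \<theta> x <= 1" "\<rho> > 0" "\<And>x. x \<in> enlarge \<rho> (cball 0 r) ==> \<theta> x = 1" by blast
 have "\<theta> x = 1" if "x \<in> ball 0 r" for x
  by (intro \<theta>(5) subsetD[OF enlarge_superset]) (use \<theta>(4) that in auto)
 then have "\<theta> \<in> admissible E" using \<theta>(1) r by (auto simp: admissible_def intro!: exI[of _ "ball 0 r"])
 from cap12_le[OF this] show ?thesis by (rule le_less_trans) simp
qed

lemma powr_one_minus: "0 < s ==> s powr (1 - real n) = s / s ^ n"
 by (simp add: powr_diff powr_realpow)

text \<open>On (\<rho> (i+1), \<rho> i] the capacity is at most its value at the outer end and
  s^(1-N) at most its value at the inner end. So each decade contributes at most 10^N times the i-th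
  term to the Wiener integral, and radii above \<rho> 0 contribute a finite amount; bounded partial
  sums would make the integral finite.\<close>

lemma wiener_sum_unbounded:
 fixes \<sigma> :: "'a::euclidean_space"
 assumes r0: "0 < r0" "r0 <= 1"
  and W: "(\<integral>\<^sup>+ s\<in>{0<..1}. cap12 (ball \<sigma> s \<inter> A) * ennreal (s powr (1 - real DIM('a))) \<partial>lborel) = top"
 defines "\<rho> i \<equiv> r0 / 10 ^ Suc i"
 shows "\<exists>j. B < (\<Sum>i<j. (\<rho> i)\<^sup>2 / \<rho> i ^ DIM('a) * enn2real (cap12 (ball \<sigma> (\<rho> i) \<inter> A)))"
proof (rule ccontr)
 let ?N = "DIM('a)"
 define a where "a i = (\<rho> i)\<^sup>2 / \<rho> i ^ ?N * enn2real (cap12 (ball \<sigma> (\<rho> i) \<inter> A))" for i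
 have \<rho>: "0 < \<rho> i" "\<rho> (Suc i) = \<rho> i / 10" for i using r0 by (auto simp: \<rho>_def)
 have a0: "0 <= a i" for i unfolding a_def using \<rho>(1)[of i] by simp
 assume "\<not> ?thesis"
 then have B: "(\<Sum>i<j. a i) <= B" for j unfolding a_def by (auto simp: not_less)
 have fin: "cap12 (ball \<sigma> s \<inter> A) < \<infinity>" for s by (rule cap12_finite) auto
 have sp: "s powr (1 - real ?N) <= t / t ^ ?N" if "0 < t" "t <= s" for s t
  unfolding powr_one_minus[OF that(1), symmetric] using that by (intro powr_mono2') auto
 let ?h = "\<lambda>i s. ennreal (10 ^ ?N / \<rho> i * a i) * indicator {\<rho> (Suc i)<..\<rho> i} s"
 let ?k = "\<lambda>s::real. cap12 (ball \<sigma> 1 \<inter> A) * ennreal (\<rho> 0 / \<rho> 0 ^ ?N) * indicator {0..1} s"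
 have le: "cap12 (ball \<sigma> s \<inter> A) * ennreal (s powr (1 - real ?N)) * indicator {0<..1} s <= (\<Sum>i. ?h i s) + ?k s" for s
 proof -
  consider "s \<notin> {0<..1}" | "s \<in> {\<rho> 0<..1}" | "0 < s" "s <= \<rho> 0" by fastforce
  then show ?thesis
  proof cases
   case 2
   then have "cap12 (ball \<sigma> s \<inter> A) * ennreal (s powr (1 - real ?N)) <= cap12 (ball \<sigma> 1 \<inter> A) * ennreal (\<rho> 0 / \<rho> 0 ^ ?N)"
    by (intro mult_mono cap12_mono ennreal_leI sp \<rho>) auto
   then show ?thesis using 2 \<rho>(1)[of 0] by (auto simp: indicator_def intro: add_increasing)
  next
   case 3
   have "(\<lambda>i. r0 / 10 * (1 / 10) ^ Suc i) \<longlonglongrightarrow> r0 / 10 * 0" by (intro tendsto_intros LIMSEQ_Suc LIMSEQ_power_zero) auto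
   then have "eventually (\<lambda>i. r0 / 10 * (1 / 10) ^ Suc i < s) sequentially" using 3 by (auto simp: order_tendsto_iff)
   then obtain i where "r0 / 10 * (1 / 10) ^ Suc i < s" by (auto simp: eventually_sequentially)
   then have "\<rho> (Suc i) < s" by (simp add: \<rho>_def power_one_over)
   then have ex: "\<exists>i. \<rho> (Suc i) < s" by blast
   define i where "i = (LEAST i. \<rho> (Suc i) < s)"
   have i1: "\<rho> (Suc i) < s" unfolding i_def by (rule LeastI_ex[OF ex])
   have i2: "s <= \<rho> i"
   proof (cases i)
    case (Suc k)
    then show ?thesis using not_less_Least[of k "\<lambda>i. \<rho> (Suc i) < s"] i_def by (auto simp: not_less)
   qed (use 3 in simp)
   have "cap12 (ball \<sigma> s \<inter> A) * ennreal (s powr (1 - real ?N)) <= cap12 (ball \<sigma> (\<rho> i) \<inter> A) * ennreal (\<rho> (Suc i) / \<rho> (Suc i) ^ ?N)"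
    using i1 i2 by (intro mult_mono cap12_mono ennreal_leI sp \<rho>) auto
   also have "\<dots> = ennreal (enn2real (cap12 (ball \<sigma> (\<rho> i) \<inter> A)) * (\<rho> (Suc i) / \<rho> (Suc i) ^ ?N))"
    using fin[of "\<rho> i"] \<rho>(1)[of "Suc i"] by (subst ennreal_mult) (auto simp: less_top[symmetric])
   also have "\<dots> <= ennreal (10 ^ ?N / \<rho> i * a i)"
   proof (rule ennreal_leI)
    have "\<rho> (Suc i) / \<rho> (Suc i) ^ ?N = 10 ^ ?N / \<rho> i * ((\<rho> i)\<^sup>2 / \<rho> i ^ ?N) / 10"
     using \<rho>(1)[of i] by (simp add: \<rho>(2) power_divide power2_eq_square mult_ac)
    also have "\<dots> <= 10 ^ ?N / \<rho> i * ((\<rho> i)\<^sup>2 / \<rho> i ^ ?N)"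
     using divide_left_mono[of 1 10 "10 ^ ?N / \<rho> i * ((\<rho> i)\<^sup>2 / \<rho> i ^ ?N)"] \<rho>(1)[of i] by simp
    finally have "enn2real (cap12 (ball \<sigma> (\<rho> i) \<inter> A)) * (\<rho> (Suc i) / \<rho> (Suc i) ^ ?N)
      <= enn2real (cap12 (ball \<sigma> (\<rho> i) \<inter> A)) * (10 ^ ?N / \<rho> i * ((\<rho> i)\<^sup>2 / \<rho> i ^ ?N))" by (rule mult_left_mono) simp
    then show "enn2real (cap12 (ball \<sigma> (\<rho> i) \<inter> A)) * (\<rho> (Suc i) / \<rho> (Suc i) ^ ?N) <= 10 ^ ?N / \<rho> i * a i"
     by (simp only: a_def mult_ac)
   qed
   also have "\<dots> = ?h i s" using i1 i2 by (simp add: indicator_def)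
   also have "\<dots> <= (\<Sum>i. ?h i s)" using sum_le_suminf[of "\<lambda>i. ?h i s" "{i}"] by (simp del: sum_mult_indicator)
   finally show ?thesis by (auto simp: indicator_def intro: add_increasing2)
  qed simp
 qed
 have hi: "(\<integral>\<^sup>+ s. ?h i s \<partial>lborel) <= ennreal (10 ^ ?N * a i)" for i
 proof -
  have "(\<integral>\<^sup>+ s. ?h i s \<partial>lborel) = ennreal (10 ^ ?N / \<rho> i * a i) * ennreal (\<rho> i - \<rho> (Suc i))"
   using \<rho>[of i] by (simp add: nn_integral_cmult_indicator)
  also have "\<dots> <= ennreal (10 ^ ?N / \<rho> i * a i) * ennreal (\<rho> i)" using \<rho>(1)[of "Suc i"] by (intro mult_left_mono ennreal_leI) auto
  also have "\<dots> = ennreal (10 ^ ?N * a i)" using \<rho>(1)[of i] a0[of i] by (simp add: ennreal_mult[symmetric])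
  finally show ?thesis .
 qed
 have "top <= (\<integral>\<^sup>+ s. (\<Sum>i. ?h i s) + ?k s \<partial>lborel)" unfolding W[symmetric] by (rule nn_integral_mono) (rule le)
 also have "\<dots> = (\<Sum>i. \<integral>\<^sup>+ s. ?h i s \<partial>lborel) + (\<integral>\<^sup>+ s. ?k s \<partial>lborel)"
  by (subst nn_integral_add, simp, simp, subst nn_integral_suminf) auto
 also have "\<dots> <= (\<Sum>i. ennreal (10 ^ ?N * a i)) + cap12 (ball \<sigma> 1 \<inter> A) * ennreal (\<rho> 0 / \<rho> 0 ^ ?N)"
  by (intro add_mono suminf_le hi) (auto simp: nn_integral_cmult_indicator)
 also have "\<dots> < top"
 proof -
  have "summable a" using B by (intro summableI_nonneg_bounded[of a B] a0)
  then have "summable (\<lambda>i. 10 ^ ?N * a i)" by (rule summable_mult)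
  then have "(\<Sum>i. ennreal (10 ^ ?N * a i)) = ennreal (\<Sum>i. 10 ^ ?N * a i)" by (intro suminf_ennreal2) (use a0 in auto)
  then show ?thesis using fin[of 1] by (simp add: ennreal_mult_less_top)
 qed
 finally show False by simp
qed

text \<open>Starting from 1, the j-th step replaces \<omega> on the ball of radius 10 \<rho> j by
  its minimum with M j (1 - p j / 200). Beyond radius 9 \<rho> j, p j vanishes and the second entry
  is M j >= \<omega>, so the gluing leaves no seam. On the ball of radius \<rho> j = 10 \<rho> (j+1)
  the bound drops by the factor 1 - c a j / 200, and finitely many steps bring it below e.\<close>

lemma barrier:
 fixes \<sigma> :: "'a::euclidean_space"
 assumes U: "open U" and r0: "0 < r0" "r0 <= 1" and e: "e > 0"
  and W: "(\<integral>\<^sup>+ s\<in>{0<..1}. cap12 (ball \<sigma> s \<inter> - U) * ennreal (s powr (1 - real DIM('a))) \<partial>lborel) = top"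
 shows "\<exists>\<omega> d. d > 0 \<and> lapge U (\<lambda>x. - \<omega> x) (\<lambda>_. 0) \<and> (AE x in lborel. 0 <= \<omega> x \<and> \<omega> x <= (1::real)) \<and>
  (AE x in lborel. x \<notin> ball \<sigma> r0 --> \<omega> x = 1) \<and> (AE x\<in>U \<inter> ball \<sigma> d in lborel. \<omega> x <= e)"
proof -
 obtain c where c: "c > 0" and cp: "\<forall>(\<sigma>::'a) r E. 0 < r \<and> r <= 1 \<and> E \<subseteq> ball \<sigma> r --> (\<exists>p. capacitary_potential c \<sigma> r E p)"
  using capacity_potential[where 'a='a] by (elim exE conjE)
 define \<rho> where "\<rho> i = r0 / 10 ^ Suc i" for i
 define a where "a i = (\<rho> i)\<^sup>2 / \<rho> i ^ DIM('a) * enn2real (cap12 (ball \<sigma> (\<rho> i) \<inter> - U))" for i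
 define M where "M j = (\<Prod>i<j. 1 - c * a i / 200)" for j
 have \<rho>: "0 < \<rho> i" "\<rho> i <= 1" "10 * \<rho> (Suc i) = \<rho> i" "10 * \<rho> i <= r0" for i
 proof -
  have "r0 * 1 <= r0 * 10 ^ i" using r0 by (intro mult_left_mono) auto
  then show 1: "10 * \<rho> i <= r0" by (simp add: \<rho>_def field_simps)
  show "\<rho> i <= 1" using 1 r0 by simp
 qed (use r0 in \<open>auto simp: \<rho>_def\<close>)
 have a0: "0 <= a i" for i unfolding a_def using \<rho>(1)[of i] by simp
 have "\<exists>p. capacitary_potential c \<sigma> (\<rho> i) (ball \<sigma> (\<rho> i) \<inter> - U) p" for i by (rule cp[rule_format]) (use \<rho> in auto)
 from choice[OF allI[OF this]] obtain p where P: "\<forall>i. capacitary_potential c \<sigma> (\<rho> i) (ball \<sigma> (\<rho> i) \<inter> - U) (p i)" ..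
 then have [measurable]: "\<And>i. p i \<in> borel_measurable borel" and pb: "\<And>i x. \<bar>p i x\<bar> <= 200"
  and p0: "\<And>i. AE x in lborel. 0 <= p i x" and pz: "\<And>i. AE x in lborel. x \<notin> cball \<sigma> (9 * \<rho> i) --> p i x = 0"
  and pl: "\<And>i. AE x\<in>ball \<sigma> (\<rho> i) in lborel. c * a i <= p i x" and ps: "\<And>i. lapge U (p i) (\<lambda>_. 0)"
  using U unfolding capacitary_potential_def a_def mult.assoc by auto
 \<comment> \<open>Otherwise the lower bound on p i would exceed 200 on a ball. This keeps all
   factors of the product in [0, 1].\<close>
 have a1: "c * a i <= 200" for i
 proof (rule ccontr)
  assume n: "\<not> ?thesis"
  have "AE x in lborel. x \<notin> ball \<sigma> (\<rho> i)" using pl[of i]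
  proof (rule eventually_mono, intro notI)
   fix x assume "x \<in> ball \<sigma> (\<rho> i) --> c * a i <= p i x" "x \<in> ball \<sigma> (\<rho> i)"
   then show False using n pb[of i x] by auto
  qed
  then have "ball \<sigma> (\<rho> i) \<in> null_sets lborel" by (subst AE_iff_null_sets) auto
  then have "measure lborel (ball \<sigma> (\<rho> i)) = 0" by (simp add: null_sets_def measure_def)
  then show False using content_ball_pos[OF \<rho>(1)[of i], of \<sigma>] by simp
 qed
 have M01: "0 <= M j" "M j <= 1" for j
  unfolding M_def using a0 a1 c by (auto intro!: prod_nonneg prod_le_1)
 have "\<exists>\<omega>. lapge U (\<lambda>x. - \<omega> x) (\<lambda>_. 0) \<and> (AE x in lborel. 0 <= \<omega> x \<and> \<omega> x <= (1::real)) \<and>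
  (AE x in lborel. x \<notin> ball \<sigma> r0 --> \<omega> x = 1) \<and> (AE x\<in>U \<inter> ball \<sigma> (10 * \<rho> j) in lborel. \<omega> x <= M j)" for j
 proof (induction j)
  case 0
  show ?case by (rule exI[of _ "\<lambda>_. 1"]) (simp add: lapge_const M_def)
 next
  case (Suc j)
  then obtain \<omega> where w: "lapge U (\<lambda>x. - \<omega> x) (\<lambda>_. 0)" "AE x in lborel. 0 <= \<omega> x \<and> \<omega> x <= 1"
   "AE x in lborel. x \<notin> ball \<sigma> r0 --> \<omega> x = 1" "AE x\<in>U \<inter> ball \<sigma> (10 * \<rho> j) in lborel. \<omega> x <= M j" by blast
  let ?b = "\<lambda>x. M j / 200 * p j x + - M j"
  let ?v = "\<lambda>x. if x \<in> ball \<sigma> (10 * \<rho> j) then max (- \<omega> x) (?b x) else - \<omega> x"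
  have b: "lapge (U \<inter> ball \<sigma> (10 * \<rho> j)) ?b (\<lambda>_. 0)"
   using lapge_add[OF lapge_cmult[OF lapge_subset[OF ps Int_lower1], of "M j / 200"] lapge_const[of _ "- M j"]] M01(1)[of j]
   by (simp del: times_divide_eq_left)
  have "lapge U ?v (\<lambda>x. if x \<in> ball \<sigma> (10 * \<rho> j) \<and> - \<omega> x < ?b x then 0 else 0)"
  proof (rule lapge_glue[OF U open_ball closed_cball _ w(1) b])
   show "cball \<sigma> (9 * \<rho> j) \<subseteq> ball \<sigma> (10 * \<rho> j)" using \<rho>(1)[of j] by auto
   show "AE x\<in>U \<inter> ball \<sigma> (10 * \<rho> j) in lborel. x \<notin> cball \<sigma> (9 * \<rho> j) --> ?b x <= - \<omega> x"
    using pz[of j] w(4) by eventually_elim auto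
  qed measurable
  then have 1: "lapge U (\<lambda>x. - (- ?v x)) (\<lambda>_. 0)" by simp
  have 2: "AE x in lborel. 0 <= - ?v x \<and> - ?v x <= 1"
   using w(2) p0[of j]
  proof eventually_elim
   case (elim x)
   have "M j * (1 - p j x / 200) >= 0" using pb[of j x] M01(1)[of j] by (intro mult_nonneg_nonneg) auto
   then have "?b x <= 0" by (simp add: algebra_simps)
   then show ?case using elim by auto
  qed
  have 3: "AE x in lborel. x \<notin> ball \<sigma> r0 --> - ?v x = 1" using w(3) by eventually_elim (use \<rho>(4)[of j] in auto)
  have 4: "AE x\<in>U \<inter> ball \<sigma> (10 * \<rho> (Suc j)) in lborel. - ?v x <= M (Suc j)"
   using pl[of j]
  proof (eventually_elim, intro impI)
   fix x assume x: "x \<in> ball \<sigma> (\<rho> j) --> c * a j <= p j x" "x \<in> U \<inter> ball \<sigma> (10 * \<rho> (Suc j))"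
   then have "c * a j <= p j x" "x \<in> ball \<sigma> (10 * \<rho> j)" using \<rho>(1)[of j] by (auto simp: \<rho>(3))
   moreover from this have "M j * (1 - p j x / 200) <= M j * (1 - c * a j / 200)" using M01(1)[of j] by (intro mult_left_mono) auto
   moreover have "M (Suc j) = M j * (1 - c * a j / 200)" by (simp add: M_def)
   moreover have "M j * (1 - p j x / 200) = - ?b x" by (simp add: algebra_simps)
   ultimately show "- ?v x <= M (Suc j)" by auto
  qed
  show ?case by (rule exI[of _ "\<lambda>x. - ?v x"]) (intro conjI 1 2 3 4)
 qed
 moreover obtain j where "M j <= e"
 proof -
  obtain j where j: "200 / c * - ln e < (\<Sum>i<j. a i)"
   using wiener_sum_unbounded[OF r0 W] unfolding a_def \<rho>_def by blast
  have "M j <= (\<Prod>i<j. exp (- (c * a i / 200)))" unfolding M_def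
   using a1 exp_ge_add_one_self[of "- (c * a i / 200)" for i] by (intro prod_mono) (auto simp: divide_simps)
  also have "\<dots> = exp (- (c / 200 * (\<Sum>i<j. a i)))" by (simp add: exp_sum[symmetric] sum_negf sum_distrib_left)
  also have "\<dots> <= exp (ln e)" using j c by (simp add: field_simps)
  finally show thesis using e by (intro that) simp
 qed
 moreover have "10 * \<rho> j > 0" for j using \<rho>(1)[of j] by simp
 ultimately show ?thesis using eventually_mono[where F = "ae_filter lborel"] by (smt (verit, del_insts) eventually_mono order_trans)
qed

section \<open>Large solutions\<close>

text \<open>\<open>is_large\<close> with the comparison function eliminated and without the bounded
  sets; the two agree for compact boundary by \<open>is_large_iff\<close>.\<close>

definition ess_large :: "'a::euclidean_space set => ('a => real) => bool" where
 "ess_large U u \<longleftrightarrow> (\<forall>M. \<exists>d>0. AE x\<in>U in lborel. infdist x (frontier U) < d --> M <= u x)"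

lemma lapge_paraboloid:
 "lapge U (\<lambda>x::'a::euclidean_space. A * (norm (x - y))\<^sup>2 + B) (\<lambda>_. 2 * real DIM('a) * A)"
proof -
 have "laplacian (\<lambda>x. A * (norm (x - y))\<^sup>2 + B) x = 2 * real DIM('a) * A" for x
  using laplacian_add[OF smooth_cmult[OF smooth_norm_sq] smooth_const, of A y B x] laplacian_cmult[OF smooth_norm_sq, of A y x] laplacian_norm_sq[of y x] by simp
 then have "laplacian (\<lambda>x. A * (norm (x - y))\<^sup>2 + B) = (\<lambda>_. 2 * real DIM('a) * A)" by (rule ext)
 then show ?thesis
  using lapge_smooth[OF smooth_add[OF smooth_cmult[OF smooth_norm_sq] smooth_const], of U A y B] by (simp only:)
qed

section \<open>Large subsolutions and minimal large solutions\<close>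

context ko_nonlinearity
begin

text \<open>Where v < 0, g(v) - f <= g 0, so the negative part of v has Laplacian at least - g 0 and
  \<open>local_upper_bound\<close> applies to it.\<close>

lemma supersolution_lower_bound:
 fixes v :: "'a::euclidean_space => real"
 assumes U: "open U" and v: "supersol U f v" and f: "\<And>x. 0 <= f x" and K: "compact K" "K \<subseteq> U"
 shows "\<exists>C. AE x\<in>K in lborel. - C <= v x"
proof -
 obtain C1 where C1: "\<forall>U (w::'a => real) c R L W. lapge U w (\<lambda>_. - c) --> c >= 0 --> R > 0 --> compact L --> L \<subseteq> U --> open W -->
  (\<forall>x\<in>W. cball x R \<subseteq> L) -->
  (AE x\<in>W in lborel. w x <= C1 / R ^ DIM('a) * (LBINT x. indicator L x * \<bar>w x\<bar>) + c * R\<^sup>2)"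
  using local_upper_bound[where 'a='a] by blast
 obtain r where r: "r > 0" "enlarge r K \<subseteq> U" using compact_enlarge_subset[OF K(1) U K(2)] by blast
 have l: "lapge U (\<lambda>x. max (- v x) 0) (\<lambda>_. - g 0)"
 proof (rule subsolution_pos_part[OF v U])
  have "- g 0 <= - (g (v x) - f x)" if "- v x > 0" for x using g_le[of "v x" 0] f[of x] that by simp
  then show "AE x\<in>U in lborel. - v x > 0 --> - g 0 <= - (g (v x) - f x)" by blast
 qed (rule g_0)
 define W where "W = (\<Union>x\<in>K. ball x (r / 2))"
 have W: "open W" "K \<subseteq> W" unfolding W_def using r by auto
 have sub: "cball y (r / 2) \<subseteq> enlarge r K" if y: "y \<in> W" for y
 proof
  fix z assume "z \<in> cball y (r / 2)"
  moreover obtain x where "x \<in> K" "dist x y < r / 2" using y by (auto simp: W_def)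
  ultimately have "x \<in> K" "dist x z <= r" using dist_triangle[of x z y] by auto
  then show "z \<in> enlarge r K" by (auto simp: enlarge_eq)
 qed
 have "AE x\<in>W in lborel. max (- v x) 0 <= C1 / (r / 2) ^ DIM('a) * (LBINT x. indicator (enlarge r K) x * \<bar>max (- v x) 0\<bar>) + g 0 * (r / 2)\<^sup>2"
  by (rule C1[rule_format, OF l g_0 _ compact_enlarge[OF K(1)] r(2) W(1) sub]) (use r in auto)
 then have "AE x\<in>K in lborel. - (C1 / (r / 2) ^ DIM('a) * (LBINT x. indicator (enlarge r K) x * \<bar>max (- v x) 0\<bar>) + g 0 * (r / 2)\<^sup>2) <= v x"
  by eventually_elim (use W(2) in fastforce)
 then show ?thesis by blast
qed

text \<open>The barrier b comes with a constant lower bound h for its Laplacian, and h >= g(b) turns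
  it into a subsolution. The new nonlinear term lies between g(u) and max(g(u), h), hence is locally
  integrable.\<close>

lemma glue_subsolution:
 assumes o: "open U" "open W" and C: "closed C" "C \<subseteq> W" and u: "subsol U u"
  and b: "lapge (U \<inter> W) b (\<lambda>_. h)" and [measurable]: "b \<in> borel_measurable borel"
  and out: "AE x\<in>U \<inter> W in lborel. x \<notin> C --> b x <= u x" and h: "AE x\<in>U \<inter> W in lborel. g (b x) <= h"
 shows "lapge U (\<lambda>x. if x \<in> W then max (u x) (b x) else u x) (\<lambda>x. g (if x \<in> W then max (u x) (b x) else u x))" (is "lapge U ?v _")
proof (rule lapge_mono[OF lapge_glue[OF o C u b]])
 note [measurable] = loc_int_borel[OF lapgeD(1)[OF u]] loc_int_borel[OF lapgeD(2)[OF u]]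
 have [measurable]: "W \<in> sets borel" using o by auto
 have c: "AE x\<in>U in lborel. g (?v x) <= (if x \<in> W \<and> u x < b x then h else g (u x))"
  using h by eventually_elim (auto simp: max_def)
 then show "AE x\<in>U in lborel. g (?v x) <= (if x \<in> W \<and> u x < b x then h else g (u x))" .
 show "loc_int U (\<lambda>x. g (?v x))"
 proof (rule loc_int_between[OF _ lapgeD(2)[OF u] loc_int_max[OF lapgeD(2)[OF u] loc_int_const]])
  show "AE x\<in>U in lborel. g (u x) <= g (?v x) \<and> g (?v x) <= max (g (u x)) h"
   using c by eventually_elim (auto intro: g_le split: if_splits)
 qed measurable
qed (use out in auto)

text \<open>Near the boundary of U the large function exceeds the bound B of b, and off C the
  inequality is given; what remains is compact in U, so \<open>comparison\<close> applies.\<close>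

lemma large_dominates:
 assumes U: "open U" and W: "open W" and C: "compact C" "C \<subseteq> W" and b: "lapge (U \<inter> W) b H" and v: "lapge U (\<lambda>x. - v x) (\<lambda>x. - G x)"
  and large: "ess_large U v" and B: "AE x\<in>U \<inter> W in lborel. b x <= B"
  and out: "AE x\<in>U \<inter> W in lborel. x \<notin> C --> b x <= v x" and HG: "AE x\<in>U \<inter> W in lborel. b x > v x --> H x >= G x"
  and ne: "frontier U \<noteq> {}"
 shows "AE x\<in>U \<inter> W in lborel. b x <= v x"
proof -
 obtain d where d: "d > 0" "AE x\<in>U in lborel. infdist x (frontier U) < d --> B <= v x"
  using large unfolding ess_large_def by blast
 define K where "K = closure U \<inter> {x. d <= infdist x (frontier U)} \<inter> C"
 have "compact K" unfolding K_def
  by (intro closed_Int_compact closed_Int closed_Collect_le continuous_intros C) auto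
 moreover have "K \<subseteq> U"
 proof
  fix x assume x: "x \<in> K"
  then have "x \<notin> frontier U" using d(1) by (auto simp: K_def)
  then show "x \<in> U" using x interior_subset by (auto simp: K_def frontier_def)
 qed
 moreover have "AE x\<in>U \<inter> W in lborel. x \<notin> K --> b x <= v x"
  using d(2) B out
 proof (eventually_elim, intro impI)
  fix x assume x: "x \<in> U --> infdist x (frontier U) < d --> B <= v x" "x \<in> U \<inter> W --> b x <= B"
   "x \<in> U \<inter> W --> x \<notin> C --> b x <= v x" "x \<in> U \<inter> W" "x \<notin> K"
  have "x \<in> closure U" using x(4) closure_subset by blast
  then consider "x \<notin> C" | "infdist x (frontier U) < d" using x(5) unfolding K_def by fastforce
  then show "b x <= v x" using x by cases auto
 qed
 ultimately show ?thesis
  using C(2) HG U W by (intro comparison[OF _ b lapge_subset[OF v Int_lower1], of K]) (auto simp: K_def)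
qed

text \<open>At a boundary point \<sigma> the function n - a \<rho>^2 + a |x - \<sigma>|^2 - m
  \<omega> is at most n, has Laplacian at least g(n), lies below the current subsolution where
  \<omega> = 1 and is at least n - 2 near \<sigma>. Each modification of V is a gluing that
  \<open>large_dominates\<close> keeps below all large supersolutions above V; this invariant is
  \<open>dom\<close>.\<close>

lemma large_subsolution:
 fixes V :: "'a::euclidean_space => real"
 assumes o: "open \<Omega>" and fr: "frontier \<Omega> \<noteq> {}" "compact (frontier \<Omega>)" and wn: "wiener \<Omega>" and V: "subsol \<Omega> V"
 shows "\<exists>S. subsol \<Omega> S \<and> (AE x\<in>\<Omega> in lborel. V x <= S x) \<and> ess_large \<Omega> S \<and>
  (\<forall>v f. supersol \<Omega> f v \<and> (AE x\<in>\<Omega> in lborel. V x <= v x \<and> 0 <= f x) \<and> ess_large \<Omega> v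
    --> (AE x\<in>\<Omega> in lborel. S x <= v x))"
proof -
 let ?N = "real DIM('a)"
 define dom where "dom h \<longleftrightarrow> (\<forall>v f. supersol \<Omega> f v \<and> (AE x\<in>\<Omega> in lborel. V x <= v x \<and> 0 <= f x) \<and> ess_large \<Omega> v
    --> (AE x\<in>\<Omega> in lborel. h x <= v x))" for h
 have dom_glue: "dom (\<lambda>x. if x \<in> W then max (u x) (b x) else u x)"
  if u: "dom u" and W: "open W" and C: "compact C" "C \<subseteq> W" and b: "lapge (\<Omega> \<inter> W) b (\<lambda>_. H)" and B: "AE x\<in>\<Omega> \<inter> W in lborel. b x <= B"
   and out: "AE x\<in>\<Omega> \<inter> W in lborel. x \<notin> C --> b x <= u x" and H: "AE x\<in>\<Omega> \<inter> W in lborel. g (b x) <= H" for u W C b B H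
  unfolding dom_def
 proof (intro allI impI, elim conjE)
  fix v f assume v: "supersol \<Omega> f v" "AE x\<in>\<Omega> in lborel. V x <= v x \<and> 0 <= f x" "ess_large \<Omega> v"
  have uv: "AE x\<in>\<Omega> in lborel. u x <= v x" using u v unfolding dom_def by blast
  have "AE x\<in>\<Omega> \<inter> W in lborel. b x <= v x"
  proof (rule large_dominates[OF o W C b v(1,3) B _ _ fr(1)])
   show "AE x\<in>\<Omega> \<inter> W in lborel. x \<notin> C --> b x <= v x" using out uv by eventually_elim auto
   show "AE x\<in>\<Omega> \<inter> W in lborel. v x < b x --> g (v x) - f x <= H"
    using H v(2)
   proof (eventually_elim, intro impI)
    fix x assume x: "x \<in> \<Omega> \<inter> W --> g (b x) <= H" "x \<in> \<Omega> --> V x <= v x \<and> 0 <= f x" "x \<in> \<Omega> \<inter> W" "v x < b x"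
    then show "g (v x) - f x <= H" using g_le[of "v x" "b x"] by auto
   qed
  qed
  then show "AE x\<in>\<Omega> in lborel. (if x \<in> W then max (u x) (b x) else u x) <= v x" using uv by eventually_elim auto
 qed
 obtain V0 where V0: "solution \<Omega> (\<lambda>_. 0) V0" "AE x\<in>\<Omega> in lborel. V x <= V0 x" "dom V0"
  using minimal_solution[OF o V loc_int_const[of _ 0]] unfolding dom_def by auto
 have l0: "subsol \<Omega> V0" "lapge \<Omega> (\<lambda>x. - V0 x) (\<lambda>x. - (g (V0 x) - 0))" using V0(1) by (simp_all add: solution_def)
 obtain R where R: "frontier \<Omega> \<subseteq> ball 0 R" "R >= 1"
 proof -
  obtain R where "frontier \<Omega> \<subseteq> ball 0 R" using bounded_subset_ballD[OF compact_imp_bounded[OF fr(2)], of 0] by auto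
  then have "frontier \<Omega> \<subseteq> ball 0 (max R 1)" using subset_ball[of R "max R 1" 0] by auto
  then show thesis using that[of "max R 1"] by simp
 qed
 \<comment> \<open>V0 may be very negative near the boundary. In the annulus T, which is compact in
   \<Omega>, it is bounded below, so a sufficiently low paraboloid q with Laplacian g 0 >= g(q) lies
   below V0 there and can be glued in; the result V1 is at least - M on the whole ball.\<close>
 define T where "T = closure \<Omega> \<inter> (cball 0 (2 * R) - ball 0 R)"
 have T: "compact T" "T \<subseteq> \<Omega>"
 proof -
  show "compact T" unfolding T_def by (intro closed_Int_compact compact_diff) auto
  show "T \<subseteq> \<Omega>" using R(1) interior_subset[of \<Omega>] by (auto simp: T_def frontier_def)
 qed
 obtain C where C: "AE x\<in>T in lborel. - C <= V0 x" using supersolution_lower_bound[OF o l0(2) _ T] by auto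
 define A where "A = g 0 / (2 * ?N)"
 define M where "M = max (A * (2 * R)\<^sup>2) (A * (2 * R)\<^sup>2 + C)"
 define q where "q x = A * (norm (x - 0))\<^sup>2 + - M" for x :: 'a
 have A: "A >= 0" "2 * ?N * A = g 0" using g_0 by (auto simp: A_def)
 have qb: "q x <= 0" "q x <= - C" "- M <= q x" if "x \<in> ball 0 (2 * R)" for x
 proof -
  have "(norm x)\<^sup>2 <= (2 * R)\<^sup>2" using that by (intro power_mono) auto
  then have "A * (norm x)\<^sup>2 <= A * (2 * R)\<^sup>2" using A(1) by (rule mult_left_mono)
  then show "q x <= 0" "q x <= - C" unfolding q_def M_def by auto
  show "- M <= q x" using A(1) by (simp add: q_def)
 qed
 have [measurable]: "q \<in> borel_measurable borel" unfolding q_def by measurable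
 define V1 where "V1 x = (if x \<in> ball 0 (2 * R) then max (V0 x) (q x) else V0 x)" for x
 have q: "lapge (\<Omega> \<inter> ball 0 (2 * R)) q (\<lambda>_. g 0)" using lapge_paraboloid[of _ A "0::'a" "- M"] by (simp add: A(2) q_def[abs_def])
 have qo: "AE x\<in>\<Omega> \<inter> ball 0 (2 * R) in lborel. x \<notin> cball 0 R --> q x <= V0 x"
  using C by eventually_elim (use qb closure_subset in \<open>fastforce simp: T_def\<close>)
 have qg: "AE x\<in>\<Omega> \<inter> ball 0 (2 * R) in lborel. g (q x) <= g 0" using qb(1) g_le by auto
 have CR: "cball (0::'a) R \<subseteq> ball 0 (2 * R)" using R(2) by auto
 have l1: "subsol \<Omega> V1"
  unfolding V1_def by (rule glue_subsolution[OF o open_ball closed_cball CR l0(1) q _ qo qg]) measurable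
 have d1: "dom V1" unfolding V1_def
  by (rule dom_glue[OF V0(3) open_ball compact_cball CR q _ qo qg, of 0]) (use qb(1) in auto)
 have V1M: "- M <= V1 x" if "x \<in> ball 0 (2 * R)" for x using qb(3)[OF that] that by (auto simp: V1_def)
 have V01: "V0 x <= V1 x" for x by (auto simp: V1_def)
 note [measurable] = loc_int_borel[OF lapgeD(1)[OF l1]]
 define good where "good h \<longleftrightarrow> subsol \<Omega> h \<and> (\<forall>x. V1 x <= h x) \<and> dom h" for h
 have good_max: "good (\<lambda>x. max (h x) (k x))" if "good h" "good k" for h k
  unfolding good_def
 proof (intro conjI)
  have "g (max (h x) (k x)) = (if k x < h x then g (h x) else g (k x))" for x by (auto simp: max_def)
  then show "lapge \<Omega> (\<lambda>x. max (h x) (k x)) (\<lambda>x. g (max (h x) (k x)))"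
   using lapge_max[of \<Omega> h "\<lambda>x. g (h x)" k "\<lambda>x. g (k x)"] that o by (simp add: good_def)
  show "dom (\<lambda>x. max (h x) (k x))"
   unfolding dom_def
  proof (intro allI impI)
   fix v f assume "supersol \<Omega> f v \<and> (AE x\<in>\<Omega> in lborel. V x <= v x \<and> 0 <= f x) \<and> ess_large \<Omega> v"
   then have "AE x\<in>\<Omega> in lborel. h x <= v x" "AE x\<in>\<Omega> in lborel. k x <= v x"
    using that unfolding good_def dom_def by blast+
   then show "AE x\<in>\<Omega> in lborel. max (h x) (k x) <= v x" by eventually_elim auto
  qed
 qed (use that in \<open>auto simp: good_def le_max_iff_disj\<close>)
 have loc: "\<exists>h d. good h \<and> d > 0 \<and> (AE x\<in>\<Omega> \<inter> ball \<sigma> d in lborel. real n - 2 <= h x)" if \<sigma>: "\<sigma> \<in> frontier \<Omega>" for \<sigma> n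
 proof -
  define a where "a = g (real n) / (2 * ?N)"
  have a: "a >= 0" "2 * ?N * a = g (real n)" using g_nonneg[of "real n"] by (auto simp: a_def)
  \<comment> \<open>It makes a \<rho>^2 <= 1, so the paraboloid lowers the barrier by at most 1; the
    other unit in n - 2 is m \<omega> <= 1 near \<sigma>.\<close>
  define \<rho> where "\<rho> = 1 / (a + 1)"
  have \<rho>: "0 < \<rho>" "\<rho> <= 1" "a * \<rho>\<^sup>2 <= 1"
  proof -
   show r: "0 < \<rho>" "\<rho> <= 1" using a by (auto simp: \<rho>_def)
   have "a * \<rho> <= 1" using a by (simp add: \<rho>_def)
   then have "a * \<rho> * \<rho> <= 1 * 1" using r a by (intro mult_mono) auto
   then show "a * \<rho>\<^sup>2 <= 1" by (simp add: power2_eq_square mult.assoc)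
  qed
  \<comment> \<open>Where \<omega> = 1 this gives b <= n - m <= - M <= V1, as the gluing
    requires.\<close>
  define m where "m = real n + \<bar>M\<bar> + 1"
  have m: "m > 0" by (simp add: m_def)
  obtain \<omega> d where d: "d > 0" and w: "lapge \<Omega> (\<lambda>x. - \<omega> x) (\<lambda>_. 0)" "AE x in lborel. 0 <= \<omega> x \<and> \<omega> x <= (1::real)"
   "AE x in lborel. x \<notin> ball \<sigma> (\<rho> / 2) --> \<omega> x = 1" "AE x\<in>\<Omega> \<inter> ball \<sigma> d in lborel. \<omega> x <= 1 / m"
   using barrier[OF o, of "\<rho> / 2" "1 / m" \<sigma>] wn \<sigma> \<rho> m unfolding wiener_def by fastforce
  define W where "W = ball \<sigma> \<rho>"
  define b where "b x = m * (- \<omega> x) + (a * (norm (x - \<sigma>))\<^sup>2 + (real n - a * \<rho>\<^sup>2))" for x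
  have "lapge (\<Omega> \<inter> W) b (\<lambda>x. m * 0 + 2 * ?N * a)"
   unfolding b_def by (intro lapge_add lapge_cmult lapge_subset[OF w(1)] lapge_paraboloid) (use m in auto)
  then have lb: "lapge (\<Omega> \<inter> W) b (\<lambda>_. g (real n))" by (simp add: a(2))
  have [measurable]: "b \<in> borel_measurable borel" by (rule loc_int_borel[OF lapgeD(1)[OF lb]])
  have sq: "0 <= a * (norm (x - \<sigma>))\<^sup>2" "x \<in> W ==> a * (norm (x - \<sigma>))\<^sup>2 <= a * \<rho>\<^sup>2" for x
   using a by (auto simp: W_def dist_norm norm_minus_commute intro!: mult_left_mono power_mono)
  have W2: "W \<subseteq> ball 0 (2 * R)"
  proof
   fix x assume "x \<in> W"
   moreover have "norm \<sigma> < R" using \<sigma> R(1) by auto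
   ultimately show "x \<in> ball 0 (2 * R)" using norm_triangle_ineq2[of x \<sigma>] \<rho>(2) R(2) by (auto simp: W_def dist_norm norm_minus_commute)
  qed
  have bn: "AE x\<in>\<Omega> \<inter> W in lborel. b x <= real n"
   using w(2)
  proof (eventually_elim, intro impI)
   fix x assume x: "0 <= \<omega> x \<and> \<omega> x <= 1" "x \<in> \<Omega> \<inter> W"
   then have "0 <= m * \<omega> x" using m by auto
   then show "b x <= real n" using sq(2)[of x] x unfolding b_def by simp
  qed
  have out: "AE x\<in>\<Omega> \<inter> W in lborel. x \<notin> cball \<sigma> (\<rho> / 2) --> b x <= V1 x"
   using w(3)
  proof (eventually_elim, intro impI)
   fix x assume x: "x \<notin> ball \<sigma> (\<rho> / 2) --> \<omega> x = 1" "x \<in> \<Omega> \<inter> W" "x \<notin> cball \<sigma> (\<rho> / 2)"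
   then have "\<omega> x = 1" "- M <= V1 x" using V1M W2 by auto
   then show "b x <= V1 x" using sq(2)[of x] x(2) unfolding b_def m_def by simp
  qed
  have gb: "AE x\<in>\<Omega> \<inter> W in lborel. g (b x) <= g (real n)" using bn by eventually_elim (auto intro: g_le)
  let ?h = "\<lambda>x. if x \<in> W then max (V1 x) (b x) else V1 x"
  have cW: "cball \<sigma> (\<rho> / 2) \<subseteq> W" "open W" unfolding W_def using \<rho> by auto
  have "good ?h" unfolding good_def
   using glue_subsolution[OF o cW(2) closed_cball cW(1) l1 lb _ out gb] dom_glue[OF d1 cW(2) compact_cball cW(1) lb bn out gb] by auto
  moreover have "AE x\<in>\<Omega> \<inter> ball \<sigma> (min d \<rho>) in lborel. real n - 2 <= ?h x"
   using w(4)
  proof (eventually_elim, intro impI)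
   fix x assume x: "x \<in> \<Omega> \<inter> ball \<sigma> d --> \<omega> x <= 1 / m" "x \<in> \<Omega> \<inter> ball \<sigma> (min d \<rho>)"
   then have "m * \<omega> x <= 1" "x \<in> W" using m by (auto simp: field_simps W_def)
   then show "real n - 2 <= ?h x" using sq(1)[of x] \<rho>(3) by (simp add: b_def)
  qed
  ultimately show ?thesis using d \<rho>(1) by (intro exI[of _ ?h] exI[of _ "min d \<rho>"]) auto
 qed
 have "\<exists>h. good h \<and> (\<exists>\<delta>>0. AE x\<in>\<Omega> in lborel. infdist x (frontier \<Omega>) < \<delta> --> real n - 2 <= h x)" for n
 proof -
  obtain H D where HD: "\<And>\<sigma>. \<sigma> \<in> frontier \<Omega> ==> good (H \<sigma>) \<and> D \<sigma> > 0 \<and> (AE x\<in>\<Omega> \<inter> ball \<sigma> (D \<sigma>) in lborel. real n - 2 <= H \<sigma> x)"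
   using loc[of _ n] by metis
  have "frontier \<Omega> \<subseteq> (\<Union>\<sigma>\<in>frontier \<Omega>. ball \<sigma> (D \<sigma>))" using HD by fastforce
  \<comment> \<open>Compactness of the boundary passes from barriers at single points to a maximum
    of finitely many that is at least n - 2 within a uniform distance \<delta> of the
    boundary.\<close>
  from compactE_image[OF fr(2) open_ball this] obtain S where S: "S \<subseteq> frontier \<Omega>" "finite S" "frontier \<Omega> \<subseteq> (\<Union>\<sigma>\<in>S. ball \<sigma> (D \<sigma>))" by metis
  have "open (\<Union>\<sigma>\<in>S. ball \<sigma> (D \<sigma>))" by auto
  from compact_enlarge_subset[OF fr(2) this S(3)] obtain \<delta> where \<delta>: "\<delta> > 0" "enlarge \<delta> (frontier \<Omega>) \<subseteq> (\<Union>\<sigma>\<in>S. ball \<sigma> (D \<sigma>))" by metis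
  have "\<exists>h. good h \<and> (\<forall>\<sigma>\<in>S. AE x\<in>\<Omega> \<inter> ball \<sigma> (D \<sigma>) in lborel. real n - 2 <= h x)"
   using S(2,1)
  proof (induction S rule: finite_induct)
   case empty
   show ?case using l1 d1 by (auto simp: good_def)
  next
   case (insert \<sigma> S)
   then obtain h where h: "good h" "\<forall>\<sigma>\<in>S. AE x\<in>\<Omega> \<inter> ball \<sigma> (D \<sigma>) in lborel. real n - 2 <= h x" by auto
   have \<sigma>: "good (H \<sigma>)" "AE x\<in>\<Omega> \<inter> ball \<sigma> (D \<sigma>) in lborel. real n - 2 <= H \<sigma> x" using HD[of \<sigma>] insert.prems by auto
   have "\<forall>\<tau>\<in>insert \<sigma> S. AE x\<in>\<Omega> \<inter> ball \<tau> (D \<tau>) in lborel. real n - 2 <= max (h x) (H \<sigma> x)"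
   proof
    fix \<tau> assume "\<tau> \<in> insert \<sigma> S"
    then consider "\<tau> = \<sigma>" | "AE x\<in>\<Omega> \<inter> ball \<tau> (D \<tau>) in lborel. real n - 2 <= h x" using h(2) by blast
    then show "AE x\<in>\<Omega> \<inter> ball \<tau> (D \<tau>) in lborel. real n - 2 <= max (h x) (H \<sigma> x)"
     by cases (use \<sigma>(2) in \<open>auto elim!: eventually_mono\<close>)
   qed
   then show ?case using good_max[OF h(1) \<sigma>(1)] by blast
  qed
  then obtain h where h: "good h" "\<forall>\<sigma>\<in>S. AE x\<in>\<Omega> \<inter> ball \<sigma> (D \<sigma>) in lborel. real n - 2 <= h x" by blast
  have "AE x in lborel. \<forall>\<sigma>\<in>S. x \<in> \<Omega> \<inter> ball \<sigma> (D \<sigma>) --> real n - 2 <= h x" using h(2) S(2) by (intro AE_finite_allI) auto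
  then have "AE x\<in>\<Omega> in lborel. infdist x (frontier \<Omega>) < \<delta> --> real n - 2 <= h x"
  proof (eventually_elim, intro impI)
   fix x assume x: "\<forall>\<sigma>\<in>S. x \<in> \<Omega> \<inter> ball \<sigma> (D \<sigma>) --> real n - 2 <= h x" "x \<in> \<Omega>" "infdist x (frontier \<Omega>) < \<delta>"
   have "x \<in> enlarge \<delta> (frontier \<Omega>)" by (rule infdist_enlarge[OF frontier_closed fr(1) x(3)])
   then show "real n - 2 <= h x" using \<delta>(2) x(1,2) by blast
  qed
  then show ?thesis using h(1) \<delta>(1) by blast
 qed
 then obtain h where h: "\<And>n. good (h n)" "\<And>n. \<exists>\<delta>>0. AE x\<in>\<Omega> in lborel. infdist x (frontier \<Omega>) < \<delta> --> real n - 2 <= h n x" by metis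
 \<comment> \<open>Running maxima make the sequence increasing and keep each \<open>h n\<close>
   below it, so its limit inherits the bounds near the boundary for every n.\<close>
 define b where "b = rec_nat (h 0) (\<lambda>n b x. max (b x) (h (Suc n) x))"
 have b: "b 0 = h 0" "b (Suc n) = (\<lambda>x. max (b n x) (h (Suc n) x))" for n by (simp_all add: b_def)
 have bg: "good (b n)" for n by (induction n) (simp_all add: b h(1) good_max)
 have hb: "h n x <= b n x" "b n x <= b (Suc n) x" for n x by (cases n) (simp_all add: b)
 have lb: "subsol \<Omega> (b n)" and Vb: "V1 x <= b n x" and db: "dom (b n)" for n x using bg[of n] by (auto simp: good_def)
 have "\<exists>U. monotone_weak_limit \<Omega> V1 b U"
 proof (rule monotone_limit[OF o loc_int_borel[OF lapgeD(1)[OF lb]] lapgeD(1)[OF l1]])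
  fix K assume K: "compact K" "K \<subseteq> \<Omega>"
  obtain r where r: "r > 0" "enlarge r K \<subseteq> \<Omega>" using compact_enlarge_subset[OF K(1) o K(2)] by blast
  obtain Z where Z: "loc_int UNIV Z" "\<forall>U w F. open U --> enlarge (2 * (r / 2)) K \<subseteq> U --> lapge U w F --> (AE x\<in>U in lborel. F x >= g (w x) - 0) -->
   (AE x\<in>K in lborel. w x <= Z x)"
   using ko_potential_bound[OF K(1) _ loc_int_const[of \<Omega> 0], of "r / 2"] r by auto
  have "AE x\<in>K in lborel. b n x <= Z x" for n
   by (rule Z(2)[rule_format, OF o _ lb]) (use r in auto)
  then have "AE x in lborel. \<forall>n. x \<in> K --> b n x <= Z x" by (subst AE_all_countable) auto
  then have "AE x\<in>K in lborel. (\<forall>n\<ge>0. V1 x <= b n x \<and> b n x <= b (Suc n) x \<and> b n x <= Z x)"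
   by eventually_elim (use Vb hb(2) in auto)
  then show "\<exists>Z N. loc_int UNIV Z \<and> (AE x\<in>K in lborel. (\<forall>n\<ge>N. V1 x <= b n x \<and> b n x <= b (Suc n) x \<and> b n x <= Z x))" using Z(1) by blast
 next
  fix p :: "'a => real" assume p: "test_fun \<Omega> p" "\<And>x. 0 <= p x"
  show "\<exists>N c. \<forall>n\<ge>N. integrable lborel (\<lambda>x. g (b n x) * p x) \<and> (LBINT x. g (b n x) * p x) <= (LBINT x. b n x * laplacian p x) + c"
   using lapgeD(3)[OF lb p] loc_int_test[OF lapgeD(2)[OF lb] p(1)] by (intro exI[of _ 0]) auto
 qed
 then obtain U where lU: "loc_int \<Omega> U" "loc_int \<Omega> (\<lambda>x. g (U x))"
  and lim: "AE x\<in>\<Omega> in lborel. (\<lambda>n. b n x) \<longlonglongrightarrow> U x \<and> V1 x <= U x"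
  and lp: "\<forall>p. test_fun \<Omega> p \<and> (\<forall>x. 0 <= p x) --> (\<lambda>n. LBINT x. b n x * laplacian p x) \<longlonglongrightarrow> (LBINT x. U x * laplacian p x) \<and>
   (\<lambda>n. LBINT x. g (b n x) * p x) \<longlonglongrightarrow> (LBINT x. g (U x) * p x)" unfolding monotone_weak_limit_def by (elim exE conjE)
 have "subsol \<Omega> U"
 proof (rule lapgeI[OF lU])
  fix p :: "'a => real" assume p: "test_fun \<Omega> p" "\<And>x. 0 <= p x"
  show "(LBINT x. g (U x) * p x) <= (LBINT x. U x * laplacian p x)"
   by (rule LIMSEQ_le[of "\<lambda>n. \<integral>x. g (b n x) * p x \<partial>lborel" _ "\<lambda>n. \<integral>x. b n x * laplacian p x \<partial>lborel"]) (use lp p lapgeD(3)[OF lb p] in auto)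
 qed
 moreover have "AE x\<in>\<Omega> in lborel. V x <= U x"
  using lim V0(2)
 proof (eventually_elim, intro impI)
  fix x assume "x \<in> \<Omega> --> (\<lambda>n. b n x) \<longlonglongrightarrow> U x \<and> V1 x <= U x" "x \<in> \<Omega> --> V x <= V0 x" "x \<in> \<Omega>"
  then show "V x <= U x" using V01[of x] by auto
 qed
 moreover have "ess_large \<Omega> U" unfolding ess_large_def
 proof
  fix M
  obtain n where n: "M + 2 <= real n" using real_arch_simple by blast
  obtain \<delta> where \<delta>: "\<delta> > 0" "AE x\<in>\<Omega> in lborel. infdist x (frontier \<Omega>) < \<delta> --> real n - 2 <= h n x" using h(2) by blast
  have "AE x\<in>\<Omega> in lborel. infdist x (frontier \<Omega>) < \<delta> --> M <= U x"
   using \<delta>(2) lim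
  proof (eventually_elim, intro impI)
   fix x assume x: "x \<in> \<Omega> --> infdist x (frontier \<Omega>) < \<delta> --> real n - 2 <= h n x" "x \<in> \<Omega> --> (\<lambda>n. b n x) \<longlonglongrightarrow> U x \<and> V1 x <= U x"
    "x \<in> \<Omega>" "infdist x (frontier \<Omega>) < \<delta>"
   have "b n x <= U x" by (rule incseq_le[OF incseq_SucI]) (use x hb(2) in auto)
   then show "M <= U x" using x n hb(1)[of n x] by simp
  qed
  then show "\<exists>d>0. AE x\<in>\<Omega> in lborel. infdist x (frontier \<Omega>) < d --> M <= U x" using \<delta>(1) by blast
 qed
 moreover have "dom U" unfolding dom_def
 proof (intro allI impI)
  fix v f assume v: "supersol \<Omega> f v \<and> (AE x\<in>\<Omega> in lborel. V x <= v x \<and> 0 <= f x) \<and> ess_large \<Omega> v"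
  then have "AE x\<in>\<Omega> in lborel. b n x <= v x" for n using db[of n] unfolding dom_def by blast
  then have "AE x in lborel. \<forall>n. x \<in> \<Omega> --> b n x <= v x" by (subst AE_all_countable) auto
  then show "AE x\<in>\<Omega> in lborel. U x <= v x" using lim
   by eventually_elim (auto intro: LIMSEQ_le_const2)
 qed
 ultimately show ?thesis unfolding dom_def by blast
qed

text \<open>S lies below all large solutions above V and is itself large. So the minimal solution
  above S is large, and minimality above S is minimality among the large solutions above V.\<close>

lemma minimal_large_solution:
 fixes V f :: "'a::euclidean_space => real"
 assumes o: "open \<Omega>" and fr: "frontier \<Omega> \<noteq> {}" "compact (frontier \<Omega>)" and wn: "wiener \<Omega>" and V: "subsol \<Omega> V"
  and f: "loc_int \<Omega> f" "\<And>x. 0 <= f x"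
 shows "\<exists>u. solution \<Omega> f u \<and> ess_large \<Omega> u \<and> (AE x\<in>\<Omega> in lborel. V x <= u x) \<and>
  (\<forall>v. solution \<Omega> f v \<and> ess_large \<Omega> v \<and> (AE x\<in>\<Omega> in lborel. V x <= v x) --> (AE x\<in>\<Omega> in lborel. u x <= v x))"
proof -
 obtain S where S: "subsol \<Omega> S" "AE x\<in>\<Omega> in lborel. V x <= S x" "ess_large \<Omega> S"
  "\<forall>v f. supersol \<Omega> f v \<and> (AE x\<in>\<Omega> in lborel. V x <= v x \<and> 0 <= f x) \<and> ess_large \<Omega> v
    --> (AE x\<in>\<Omega> in lborel. S x <= v x)"
  using large_subsolution[OF o fr wn V] by blast
 obtain u where u: "solution \<Omega> f u" "AE x\<in>\<Omega> in lborel. S x <= u x"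
  "\<forall>v f'. supersol \<Omega> f' v \<and> (AE x\<in>\<Omega> in lborel. S x <= v x \<and> f x <= f' x)
    --> (AE x\<in>\<Omega> in lborel. u x <= v x)"
  using minimal_solution[OF o S(1) f] by blast
 have "ess_large \<Omega> u" unfolding ess_large_def
 proof
  fix M
  obtain d where d: "d > 0" "AE x\<in>\<Omega> in lborel. infdist x (frontier \<Omega>) < d --> M <= S x" using S(3) unfolding ess_large_def by blast
  have "AE x\<in>\<Omega> in lborel. infdist x (frontier \<Omega>) < d --> M <= u x"
   using d(2) u(2) by eventually_elim (use order_trans in blast)
  then show "\<exists>d>0. AE x\<in>\<Omega> in lborel. infdist x (frontier \<Omega>) < d --> M <= u x" using d(1) by blast
 qed
 moreover have "AE x\<in>\<Omega> in lborel. V x <= u x" using u(2) S(2) by eventually_elim (use order_trans in blast)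
 moreover have "AE x\<in>\<Omega> in lborel. u x <= v x"
  if v: "solution \<Omega> f v" "ess_large \<Omega> v" "AE x\<in>\<Omega> in lborel. V x <= v x" for v
 proof -
  have "AE x\<in>\<Omega> in lborel. V x <= v x \<and> 0 <= f x" using v(3) f(2) by auto
  then have "AE x\<in>\<Omega> in lborel. S x <= v x" using S(4) v unfolding solution_def by blast
  then have "AE x\<in>\<Omega> in lborel. S x <= v x \<and> f x <= f x" by auto
  then show ?thesis using u(3) v(1) unfolding solution_def by blast
 qed
 ultimately show ?thesis using u(1) by blast
qed

text \<open>On a bounded domain the paraboloid q with Laplacian g 0 can be chosen nonpositive, hence
  a subsolution. \<open>large_dominates\<close> puts it below every large solution, so the
  constraint of lying above it excludes no competitor.\<close>

lemma minimal_large_solution_bounded: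
 fixes f :: "'a::euclidean_space => real"
 assumes o: "open \<Omega>" and bd: "bounded \<Omega>" and fr: "frontier \<Omega> \<noteq> {}" and wn: "wiener \<Omega>" and f: "loc_int \<Omega> f" "\<And>x. 0 <= f x"
 shows "\<exists>u. solution \<Omega> f u \<and> ess_large \<Omega> u \<and>
  (\<forall>v. solution \<Omega> f v \<and> ess_large \<Omega> v --> (AE x\<in>\<Omega> in lborel. u x <= v x))"
proof -
 obtain R where R: "\<Omega> \<subseteq> ball 0 R" using bounded_subset_ballD[OF bd, of 0] by auto
 define A where "A = g 0 / (2 * real DIM('a))"
 define q where "q x = A * (norm (x - 0))\<^sup>2 + - (A * R\<^sup>2)" for x :: 'a
 have A: "A >= 0" "2 * real DIM('a) * A = g 0" using g_0 by (auto simp: A_def)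
 have [measurable]: "q \<in> borel_measurable borel" unfolding q_def by measurable
 have q: "lapge W q (\<lambda>_. g 0)" for W using lapge_paraboloid[of W A "0::'a" "- (A * R\<^sup>2)"] by (simp add: A(2) q_def[abs_def])
 have qb: "q x <= 0" if "x \<in> \<Omega>" for x
 proof -
  have "norm x < R" using that R by auto
  then have "A * (norm x)\<^sup>2 <= A * R\<^sup>2" using A(1) by (intro mult_left_mono power_mono) auto
  then show ?thesis by (simp add: q_def)
 qed
 have lq: "subsol \<Omega> q"
 proof (rule lapge_mono[OF q])
  have "\<bar>g (q x)\<bar> <= \<bar>g (- (A * R\<^sup>2))\<bar> + g 0" if "x \<in> \<Omega>" for x
   using g_le[of "- (A * R\<^sup>2)" "q x"] g_le[OF qb[OF that]] A(1) g_0 by (auto simp: q_def abs_le_iff)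
  then show "loc_int \<Omega> (\<lambda>x. g (q x))" by (intro loc_int_bounded[of _ _ "\<bar>g (- (A * R\<^sup>2))\<bar> + g 0"]) auto
 qed (use g_le qb in auto)
 have cf: "compact (frontier \<Omega>)" using bd by (rule compact_frontier_bounded)
 obtain u where u: "solution \<Omega> f u" "ess_large \<Omega> u"
  "\<forall>v. solution \<Omega> f v \<and> ess_large \<Omega> v \<and> (AE x\<in>\<Omega> in lborel. q x <= v x) --> (AE x\<in>\<Omega> in lborel. u x <= v x)"
  using minimal_large_solution[OF o fr cf wn lq f] by blast
 have "AE x\<in>\<Omega> in lborel. q x <= v x" if v: "solution \<Omega> f v" "ess_large \<Omega> v" for v
 proof -
  have "AE x\<in>\<Omega> \<inter> UNIV in lborel. q x <= v x"
  proof (rule large_dominates[OF o open_UNIV compact_cball[of 0 R] subset_UNIV q _ v(2) _ _ _ fr])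
   show "supersol \<Omega> f v" using v(1) by (simp add: solution_def)
   have "g (v x) - f x <= g 0" if "x \<in> \<Omega>" "v x < q x" for x
    using g_le[of "v x" 0] qb[OF that(1)] that(2) f(2)[of x] by auto
   then show "AE x\<in>\<Omega> \<inter> UNIV in lborel. v x < q x --> g (v x) - f x <= g 0" by auto
   show "AE x\<in>\<Omega> \<inter> UNIV in lborel. x \<notin> cball 0 R --> q x <= v x" using R by (intro AE_I2) force
  qed (use qb in auto)
  then show ?thesis by simp
 qed
 then show ?thesis using u by blast
qed

end

section \<open>Borel representatives\<close>

lemma locL1_measurable:
 assumes "open \<Omega>" "locL1 \<Omega> u"
 shows "(\<lambda>x. indicator \<Omega> x * u x) \<in> borel_measurable lebesgue"
proof -
 obtain C where C: "\<And>n. compact (C n)" "\<And>n. C n \<subseteq> \<Omega>" "\<And>n. C n \<subseteq> interior (C (Suc n))" "\<Union>(range C) = \<Omega>"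
   "\<And>K. compact K ==> K \<subseteq> \<Omega> ==> \<exists>N. \<forall>n\<ge>N. K \<subseteq> C n"
  using open_Union_compact_subsets[OF assms(1)] by blast
 show ?thesis
 proof (rule borel_measurable_LIMSEQ_real)
  show "(\<lambda>x. indicator (C n) x * u x) \<in> borel_measurable lebesgue" for n
   using assms(2) C(1,2)[of n] unfolding locL1_def set_integrable_def by fastforce
  fix x
  have "\<forall>\<^sub>F n in sequentially. indicator (C n) x * u x = indicator \<Omega> x * u x"
  proof (cases "x \<in> \<Omega>")
   case True
   then obtain N where "\<forall>n\<ge>N. {x} \<subseteq> C n" using C(5)[of "{x}"] by auto
   then show ?thesis using True unfolding eventually_sequentially by (intro exI[of _ N]) auto
  next
   case False
   then have "indicator (C n) x = (0::real)" for n using C(2)[of n] by (auto simp: indicator_def)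
   then show ?thesis using False by simp
  qed
  then show "(\<lambda>n. indicator (C n) x * u x) \<longlonglongrightarrow> indicator \<Omega> x * u x" by (rule tendsto_eventually)
 qed
qed

lemma locL1_loc_int:
 assumes "locL1 \<Omega> u" and [measurable]: "u' \<in> borel_measurable borel" and e: "AE x\<in>\<Omega> in lborel. u x = u' x"
 shows "loc_int \<Omega> u'"
proof (rule loc_intI[OF assms(2)])
 fix K assume K: "compact K" "K \<subseteq> \<Omega>"
 then have [measurable]: "K \<in> sets borel" by (simp add: compact_imp_closed)
 have i: "integrable lebesgue (\<lambda>x. indicator K x * u x)" using assms(1) K by (simp add: locL1_def set_integrable_def)
 have "integrable lebesgue (\<lambda>x. indicator K x * u' x)"
 proof (rule Bochner_Integration.integrable_bound[OF i])
  have "AE x in lborel. norm (indicator K x * u' x) <= norm (indicator K x * u x)"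
   using e by eventually_elim (use K in \<open>auto simp: indicator_def\<close>)
  then show "AE x in lebesgue. norm (indicator K x * u' x) <= norm (indicator K x * u x)" by (rule AE_completion)
 qed (rule measurable_completion, simp)
 then show "integrable lborel (\<lambda>x. indicator K x * u' x)" by (subst (asm) integrable_completion) simp_all
qed

lemma loc_int_locL1: "loc_int \<Omega> u ==> locL1 \<Omega> u"
proof -
 assume u: "loc_int \<Omega> u"
 note [measurable] = loc_int_borel[OF u]
 have "integrable lebesgue (\<lambda>x. indicator K x * u x)" if "compact K" "K \<subseteq> \<Omega>" for K
 proof -
  have [measurable]: "K \<in> sets borel" using that by (simp add: compact_imp_closed)
  show ?thesis using loc_int_indicator[OF u that] by (subst integrable_completion) simp_all
 qed
 then show ?thesis by (simp add: locL1_def set_integrable_def)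
qed

lemma borel_representative:
 assumes "open \<Omega>" "locL1 \<Omega> u"
 obtains u' where "loc_int \<Omega> u'" "AE x\<in>\<Omega> in lborel. u x = u' x"
proof -
 obtain u' where u': "u' \<in> borel_measurable lborel" "AE x in lborel. indicator \<Omega> x * u x = u' x"
  using completion_ex_borel_measurable_real[OF locL1_measurable[OF assms]] by auto
 from u'(2) have "AE x\<in>\<Omega> in lborel. u x = u' x" by eventually_elim auto
 then show thesis using u'(1) by (intro that locL1_loc_int[OF assms(2)]) auto
qed

lemma nonneg_representative:
 assumes "open \<Omega>" "nonneg_locL1 \<Omega> f"
 obtains f' where "loc_int \<Omega> f'" "\<And>x. 0 <= f' x" "AE x\<in>\<Omega> in lborel. f x = f' x"
proof -
 have f: "locL1 \<Omega> f" "AE x\<in>\<Omega> in lborel. 0 <= f x" using assms(2) by (auto simp: nonneg_locL1_def AE_completion_iff)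
 obtain f' where f': "loc_int \<Omega> f'" "AE x\<in>\<Omega> in lborel. f x = f' x" by (rule borel_representative[OF assms(1) f(1)])
 show thesis
  by (rule that[OF loc_int_max[OF f'(1) loc_int_const[of _ 0]]]) (use f'(2) f(2) in \<open>auto elim!: eventually_elim2\<close>)
qed

text \<open>Test functions and their Laplacians vanish off \<Omega>, so the values of u and f there
  do not matter and the Lebesgue integral over \<Omega> becomes an integral of Borel functions over
  the whole space.\<close>

lemma weak_form:
 assumes o: "open \<Omega>" and L: "locL1 \<Omega> u" "locL1 \<Omega> (\<lambda>x. g (u x))" "locL1 \<Omega> f" and L': "loc_int \<Omega> u'" "loc_int \<Omega> (\<lambda>x. g (u' x))" "loc_int \<Omega> f'"
  and e: "AE x\<in>\<Omega> in lborel. u x = u' x" "AE x\<in>\<Omega> in lborel. f x = f' x" and p: "test_fun \<Omega> p"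
 shows "(LINT x:\<Omega>|lebesgue. - u x * laplacian p x + g (u x) * p x - f x * p x)
  = (LBINT x. (g (u' x) - f' x) * p x) - (LBINT x. u' x * laplacian p x)"
proof -
 note [measurable] = loc_int_borel[OF L'(1)] loc_int_borel[OF L'(2)] loc_int_borel[OF L'(3)]
  smooth_borel[OF test_fun_smooth[OF p]] smooth_borel[OF laplacian_smooth[OF test_fun_smooth[OF p]]]
 let ?h = "\<lambda>x. indicator \<Omega> x * g (u x) * p x - indicator \<Omega> x * f x * p x - indicator \<Omega> x * u x * laplacian p x"
 let ?h' = "\<lambda>x. (g (u' x) - f' x) * p x - u' x * laplacian p x"
 have "(LINT x:\<Omega>|lebesgue. - u x * laplacian p x + g (u x) * p x - f x * p x) = (\<integral>x. ?h x \<partial>lebesgue)"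
  unfolding set_lebesgue_integral_def by (simp add: algebra_simps)
 also have "\<dots> = (\<integral>x. ?h' x \<partial>lebesgue)"
 proof (rule integral_cong_AE)
  have "p \<in> borel_measurable lebesgue" "laplacian p \<in> borel_measurable lebesgue" by (rule measurable_completion, simp)+
  then show "?h \<in> borel_measurable lebesgue" using locL1_measurable[OF o L(1)] locL1_measurable[OF o L(2)] locL1_measurable[OF o L(3)] by simp
  show "?h' \<in> borel_measurable lebesgue" by (rule measurable_completion) simp
  have "AE x in lborel. ?h x = ?h' x" using e
  proof eventually_elim
   case (elim x)
   then show ?case using test_fun_zero_outside[OF p, of x] test_fun_zero_outside[OF test_fun_laplacian[OF p], of x]
    by (cases "x \<in> \<Omega>") (auto simp: algebra_simps)
  qed
  then show "AE x in lebesgue. ?h x = ?h' x" by (rule AE_completion)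
 qed
 also have "\<dots> = (LBINT x. ?h' x)" by (rule integral_completion) simp
 also have "\<dots> = (LBINT x. (g (u' x) - f' x) * p x) - (LBINT x. u' x * laplacian p x)"
  by (rule Bochner_Integration.integral_diff[OF loc_int_test[OF loc_int_diff[OF L'(2,3)] p] loc_int_test[OF L'(1) test_fun_laplacian[OF p]]])
 finally show ?thesis .
qed

text \<open>For compact boundary the unit neighbourhood of the frontier is one bounded set that
  contains all points near it. The converse has to produce a function that is large everywhere from
  bounds that hold almost everywhere.\<close>

lemma is_large_iff:
 assumes fr: "compact (frontier \<Omega>)" "frontier \<Omega> \<noteq> {}" and o: "open \<Omega>" and e: "AE x\<in>\<Omega> in lborel. u x = u' x"
 shows "is_large \<Omega> u \<longleftrightarrow> ess_large \<Omega> u'"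
proof
 assume "is_large \<Omega> u"
 then obtain w where w: "AE x\<in>\<Omega> in lborel. w x <= u x"
  "\<And>K M. bounded K ==> \<exists>\<delta>>0. \<forall>x\<in>K \<inter> \<Omega>. infdist x (frontier \<Omega>) < \<delta> --> M <= w x"
  unfolding is_large_def ae_le_def AE_completion_iff by blast
 show "ess_large \<Omega> u'" unfolding ess_large_def
 proof
  fix M
  obtain \<delta> where \<delta>: "\<delta> > 0" "\<forall>x\<in>enlarge 1 (frontier \<Omega>) \<inter> \<Omega>. infdist x (frontier \<Omega>) < \<delta> --> M <= w x"
   using w(2)[OF compact_imp_bounded[OF compact_enlarge[OF fr(1)]], of 1 M] by blast
  have "AE x\<in>\<Omega> in lborel. infdist x (frontier \<Omega>) < min \<delta> 1 --> M <= u' x"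
   using w(1) e
  proof (eventually_elim, intro impI)
   fix x assume x: "x \<in> \<Omega> --> w x <= u x" "x \<in> \<Omega> --> u x = u' x" "x \<in> \<Omega>" "infdist x (frontier \<Omega>) < min \<delta> 1"
   have "x \<in> enlarge 1 (frontier \<Omega>)" using x(4) by (intro infdist_enlarge frontier_closed fr) simp
   then show "M <= u' x" using \<delta>(2) x by force
  qed
  then show "\<exists>d>0. AE x\<in>\<Omega> in lborel. infdist x (frontier \<Omega>) < d --> M <= u' x" using \<delta>(1) by (intro exI[of _ "min \<delta> 1"]) auto
 qed
next
 assume l: "ess_large \<Omega> u'"
 have "\<exists>d>0. AE x\<in>\<Omega> in lborel. infdist x (frontier \<Omega>) < d --> real n <= u' x" for n
  using l unfolding ess_large_def by blast
 then obtain d where d: "\<And>n. d n > 0" "\<And>n. AE x\<in>\<Omega> in lborel. infdist x (frontier \<Omega>) < d n --> real n <= u' x" by metis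
 define P where "P x \<longleftrightarrow> (\<forall>n. x \<in> \<Omega> --> infdist x (frontier \<Omega>) < d n --> real n <= u' x)" for x
 have P: "AE x in lborel. P x" unfolding P_def using d(2) by (subst AE_all_countable) auto
 \<comment> \<open>The countably many bounds fail on a null set only; there the reciprocal distance
   to the boundary takes over, which is large without altering the comparison with u.\<close>
 define w where "w x = (if P x then u' x else 1 / infdist x (frontier \<Omega>))" for x
 have "\<exists>\<delta>>0. \<forall>x\<in>K \<inter> \<Omega>. infdist x (frontier \<Omega>) < \<delta> --> M <= w x" for K M
 proof -
  obtain n where n: "M <= real n" using real_arch_simple by blast
  have "M <= w x" if x: "x \<in> \<Omega>" "infdist x (frontier \<Omega>) < min (d n) (1 / (\<bar>M\<bar> + 1))" for x
  proof (cases "P x")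
   case True
   then have "real n <= u' x" using x unfolding P_def by auto
   then show ?thesis using True n by (simp add: w_def)
  next
   case False
   have "x \<notin> frontier \<Omega>" using x(1) o by (simp add: frontier_def interior_open)
   then have "0 < infdist x (frontier \<Omega>)" using in_closed_iff_infdist_zero[OF frontier_closed fr(2)] infdist_nonneg[of x "frontier \<Omega>"] by fastforce
   moreover have "infdist x (frontier \<Omega>) * (\<bar>M\<bar> + 1) <= 1" using x(2) by (simp add: field_simps)
   ultimately have "\<bar>M\<bar> + 1 <= w x" using False by (simp add: w_def field_simps)
   then show ?thesis by linarith
  qed
  then show ?thesis using d(1)[of n] by (intro exI[of _ "min (d n) (1 / (\<bar>M\<bar> + 1))"]) auto
 qed
 moreover have "ae_le \<Omega> w u" unfolding ae_le_def AE_completion_iff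
  using P e by eventually_elim (auto simp: w_def)
 ultimately show "is_large \<Omega> u" unfolding is_large_def by blast
qed

section \<open>Translation to the notions of the theorem\<close>

context ko_nonlinearity
begin

lemma subsolution_representative:
 assumes o: "open \<Omega>" and V: "is_subsol \<Omega> g (\<lambda>_. 0) V"
 obtains V' where "subsol \<Omega> V'" "AE x\<in>\<Omega> in lborel. V x = V' x"
proof -
 have L: "locL1 \<Omega> V" "locL1 \<Omega> (\<lambda>x. g (V x))" using V by (auto simp: is_subsol_def)
 obtain V' where V': "loc_int \<Omega> V'" "AE x\<in>\<Omega> in lborel. V x = V' x" by (rule borel_representative[OF o L(1)])
 note [measurable] = loc_int_borel[OF V'(1)]
 have L': "loc_int \<Omega> (\<lambda>x. g (V' x))" by (rule locL1_loc_int[OF L(2)]) (use V'(2) in \<open>auto elim!: eventually_mono\<close>)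
 have "subsol \<Omega> V'"
 proof (rule lapgeI[OF V'(1) L'])
  fix p :: "'a => real" assume p: "test_fun \<Omega> p" "\<And>x. 0 <= p x"
  have "(LINT x:\<Omega>|lebesgue. - V x * laplacian p x + g (V x) * p x - 0 * p x) <= 0" using V p unfolding is_subsol_def by blast
  then show "(LBINT x. g (V' x) * p x) <= (LBINT x. V' x * laplacian p x)"
   using weak_form[OF o L loc_int_locL1[OF loc_int_const[of \<Omega> 0]] V'(1) L' loc_int_const[of \<Omega> 0] V'(2) _ p(1)] by simp
 qed
 then show thesis using V'(2) by (rule that)
qed

lemma solution_representative:
 assumes o: "open \<Omega>" and u: "is_sol \<Omega> g f u" and f: "locL1 \<Omega> f" "loc_int \<Omega> f'" "AE x\<in>\<Omega> in lborel. f x = f' x"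
 obtains u' where "solution \<Omega> f' u'" "AE x\<in>\<Omega> in lborel. u x = u' x"
proof -
 have L: "locL1 \<Omega> u" "locL1 \<Omega> (\<lambda>x. g (u x))" using u by (auto simp: is_sol_def)
 obtain u' where u': "loc_int \<Omega> u'" "AE x\<in>\<Omega> in lborel. u x = u' x" by (rule borel_representative[OF o L(1)])
 note [measurable] = loc_int_borel[OF u'(1)]
 have L': "loc_int \<Omega> (\<lambda>x. g (u' x))" by (rule locL1_loc_int[OF L(2)]) (use u'(2) in \<open>auto elim!: eventually_mono\<close>)
 have eq: "(LBINT x. (g (u' x) - f' x) * p x) = (LBINT x. u' x * laplacian p x)" if p: "test_fun \<Omega> p" for p
  using weak_form[OF o L f(1) u'(1) L' f(2) u'(2) f(3) p] u p unfolding is_sol_def by simp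
 have "solution \<Omega> f' u'" unfolding solution_def
  using loc_int_diff[OF L' f(2)] u'(1) by (auto intro!: lapgeI loc_int_uminus simp: eq simp del: minus_diff_eq)
 then show thesis using u'(2) by (rule that)
qed

text \<open>The relation \<open>solution\<close> is tested with nonnegative functions only. A signed
  p is the difference of p + B \<theta> and B \<theta>, both nonnegative for a bound B of |p| and a
  cut-off \<theta> that is 1 on a compact set carrying p.\<close>

lemma solution_is_sol:
 assumes o: "open \<Omega>" and u: "solution \<Omega> f' u" and f: "locL1 \<Omega> f" "loc_int \<Omega> f'" "AE x\<in>\<Omega> in lborel. f x = f' x"
 shows "is_sol \<Omega> g f u"
proof -
 have L: "loc_int \<Omega> u" "loc_int \<Omega> (\<lambda>x. g (u x) - f' x)" using u lapgeD unfolding solution_def by blast+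
 have "loc_int \<Omega> (\<lambda>x. g (u x))" using loc_int_add[OF L(2) f(2)] by simp
 note L' = L(1) this f(2)
 define \<Lambda> where "\<Lambda> p = (LBINT x. (g (u x) - f' x) * p x) - (LBINT x. u x * laplacian p x)" for p
 have \<Lambda>0: "\<Lambda> p = 0" if "test_fun \<Omega> p" "\<And>x. 0 <= p x" for p using solution_eq[OF u that] by (simp add: \<Lambda>_def)
 have \<Lambda>: "\<Lambda> p = 0" if p: "test_fun \<Omega> p" for p
 proof -
  obtain K where K: "smooth p" "compact K" "K \<subseteq> \<Omega>" "\<And>x. x \<notin> K ==> p x = 0" using test_funE[OF p] by metis
  obtain \<theta> :: "'a => real" and r where \<theta>: "test_fun \<Omega> \<theta>" "\<And>x. 0 <= \<theta> x" "\<And>x. \<theta> x <= 1" "r > 0" "\<And>x. x \<in> enlarge r K ==> \<theta> x = 1"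
   using cutoff_exists[OF K(2) o K(3)] by blast
  obtain B where B: "\<And>x. \<bar>p x\<bar> <= B" "B > 0" using test_fun_bounded[OF p] by metis
  have t: "test_fun \<Omega> (\<lambda>x. B * \<theta> x)" by (rule test_fun_cmult[OF \<theta>(1)])
  have "0 <= p x + B * \<theta> x" for x
  proof (cases "x \<in> K")
   case True
   then have "\<theta> x = 1" using \<theta>(4,5) enlarge_superset[of r K] by auto
   then show ?thesis using B(1)[of x] by (simp add: abs_le_iff)
  qed (use K(4) B(2) \<theta>(2) in simp)
  then have "\<Lambda> (\<lambda>x. p x + B * \<theta> x) = 0" by (intro \<Lambda>0 test_fun_add p t)
  moreover have "\<Lambda> (\<lambda>x. B * \<theta> x) = 0" using B(2) \<theta>(2) by (intro \<Lambda>0 t) auto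
  moreover have "\<Lambda> (\<lambda>x. p x + B * \<theta> x) = \<Lambda> p + \<Lambda> (\<lambda>x. B * \<theta> x)"
   unfolding \<Lambda>_def laplacian_add[OF test_fun_smooth[OF p] test_fun_smooth[OF t]] distrib_left
   using loc_int_test[OF L(2) p] loc_int_test[OF L(2) t] loc_int_test[OF L(1) test_fun_laplacian[OF p]] loc_int_test[OF L(1) test_fun_laplacian[OF t]] by simp
  ultimately show ?thesis by simp
 qed
 show ?thesis unfolding is_sol_def
  using weak_form[OF o loc_int_locL1[OF L'(1)] loc_int_locL1[OF L'(2)] f(1) L' _ f(3)] \<Lambda> loc_int_locL1[OF L'(1)] loc_int_locL1[OF L'(2)]
  by (auto simp: \<Lambda>_def)
qed

text \<open>The competitors solve with any f' above f: f' = f gives minimality, and f' larger gives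
  monotonicity of the minimal solution in f.\<close>

lemma minimal_sol_exists:
 assumes o: "open \<Omega>" and V: "is_subsol \<Omega> g (\<lambda>_. 0) V" and f: "nonneg_locL1 \<Omega> f"
 shows "\<exists>u. u \<in> UV \<Omega> V \<and> is_sol \<Omega> g f u \<and>
  (\<forall>f' v. nonneg_locL1 \<Omega> f' \<and> ae_le \<Omega> f f' \<and> v \<in> UV \<Omega> V \<and> is_sol \<Omega> g f' v --> ae_le \<Omega> u v)"
proof -
 obtain V' where V': "subsol \<Omega> V'" "AE x\<in>\<Omega> in lborel. V x = V' x" by (rule subsolution_representative[OF o V])
 obtain h where h: "loc_int \<Omega> h" "\<And>x. 0 <= h x" "AE x\<in>\<Omega> in lborel. f x = h x" using nonneg_representative[OF o f] by blast
 have fl: "locL1 \<Omega> f" using f by (simp add: nonneg_locL1_def)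
 obtain u where u: "solution \<Omega> h u" "AE x\<in>\<Omega> in lborel. V' x <= u x"
  "\<forall>v f'. supersol \<Omega> f' v \<and> (AE x\<in>\<Omega> in lborel. V' x <= v x \<and> h x <= f' x)
    --> (AE x\<in>\<Omega> in lborel. u x <= v x)" using minimal_solution[OF o V'(1) h(1,2)] by blast
 have s: "is_sol \<Omega> g f u" by (rule solution_is_sol[OF o u(1) fl h(1,3)])
 moreover have "AE x\<in>\<Omega> in lborel. V x <= u x" using V'(2) u(2) by eventually_elim auto
 then have "u \<in> UV \<Omega> V" using s by (simp add: UV_def is_sol_def AE_completion_iff)
 moreover have "ae_le \<Omega> u v" if v: "nonneg_locL1 \<Omega> f'" "ae_le \<Omega> f f'" "v \<in> UV \<Omega> V" "is_sol \<Omega> g f' v" for f' v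
 proof -
  obtain h' where h': "loc_int \<Omega> h'" "\<And>x. 0 <= h' x" "AE x\<in>\<Omega> in lborel. f' x = h' x" using nonneg_representative[OF o v(1)] by blast
  have "locL1 \<Omega> f'" using v(1) by (simp add: nonneg_locL1_def)
  then obtain v' where v': "solution \<Omega> h' v'" "AE x\<in>\<Omega> in lborel. v x = v' x"
   by (rule solution_representative[OF o v(4) _ h'(1,3)])
  have "AE x\<in>\<Omega> in lborel. f x <= f' x" "AE x\<in>\<Omega> in lborel. V x <= v x"
   using v(2,3) by (auto simp: ae_le_def UV_def AE_completion_iff)
  then have "AE x\<in>\<Omega> in lborel. V' x <= v' x \<and> h x <= h' x" using V'(2) h(3) h'(3) v'(2) by eventually_elim auto
  then have "AE x\<in>\<Omega> in lborel. u x <= v' x" using u(3) v'(1) unfolding solution_def by blast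
  then have "AE x\<in>\<Omega> in lborel. u x <= v x" using v'(2) by eventually_elim auto
  then show ?thesis by (simp add: ae_le_def AE_completion_iff)
 qed
 ultimately show ?thesis by blast
qed

text \<open>The disjunction lets one translation serve both classes of competitors. Inside, a
  competitor v is paired with a Borel representative v', because membership in C concerns v whereas
  the equation is available for v'.\<close>

lemma minimal_large_sol_exists:
 assumes o: "open \<Omega>" and fr: "frontier \<Omega> \<noteq> {}" "compact (frontier \<Omega>)" and f: "nonneg_locL1 \<Omega> f"
  and T: "C = UV \<Omega> V \<and> is_subsol \<Omega> g (\<lambda>_. 0) V \<or> C = UNIV \<and> bounded \<Omega>" and w: "wiener \<Omega>"
 shows "\<exists>u. min_large_sol_in \<Omega> g f C u"
proof -
 obtain h where h: "loc_int \<Omega> h" "\<And>x. 0 <= h x" "AE x\<in>\<Omega> in lborel. f x = h x" using nonneg_representative[OF o f] by blast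
 have fl: "locL1 \<Omega> f" using f by (simp add: nonneg_locL1_def)
 have "\<exists>u. u \<in> C \<and> solution \<Omega> h u \<and> ess_large \<Omega> u \<and>
  (\<forall>v v'. v \<in> C \<and> (AE x\<in>\<Omega> in lborel. v x = v' x) \<and> solution \<Omega> h v' \<and> ess_large \<Omega> v' --> (AE x\<in>\<Omega> in lborel. u x <= v' x))"
  using T
 proof (elim disjE conjE)
  assume C: "C = UV \<Omega> V" and V: "is_subsol \<Omega> g (\<lambda>_. 0) V"
  obtain V' where V': "subsol \<Omega> V'" "AE x\<in>\<Omega> in lborel. V x = V' x" by (rule subsolution_representative[OF o V])
  obtain u where u: "solution \<Omega> h u" "ess_large \<Omega> u" "AE x\<in>\<Omega> in lborel. V' x <= u x"
   "\<forall>v. solution \<Omega> h v \<and> ess_large \<Omega> v \<and> (AE x\<in>\<Omega> in lborel. V' x <= v x) --> (AE x\<in>\<Omega> in lborel. u x <= v x)"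
   using minimal_large_solution[OF o fr w V'(1) h(1,2)] by blast
  have "AE x\<in>\<Omega> in lborel. V x <= u x" using u(3) V'(2) by eventually_elim auto
  then have "u \<in> C" using loc_int_locL1[OF lapgeD(1), of \<Omega> u] u(1) unfolding solution_def C by (auto simp: UV_def AE_completion_iff)
  moreover have "AE x\<in>\<Omega> in lborel. u x <= v' x"
   if v: "v \<in> C" "AE x\<in>\<Omega> in lborel. v x = v' x" "solution \<Omega> h v'" "ess_large \<Omega> v'" for v v'
  proof -
   have "AE x\<in>\<Omega> in lborel. V x <= v x" using v(1) by (simp add: C UV_def AE_completion_iff)
   then have "AE x\<in>\<Omega> in lborel. V' x <= v' x" using v(2) V'(2) by eventually_elim auto
   then show ?thesis using u(4) v(3,4) by blast
  qed
  ultimately show ?thesis using u(1,2) by blast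
 next
  assume "C = UNIV" "bounded \<Omega>"
  then show ?thesis using minimal_large_solution_bounded[OF o _ fr(1) w h(1,2)] by blast
 qed
 then obtain u where u: "u \<in> C" "solution \<Omega> h u" "ess_large \<Omega> u"
  "\<forall>v v'. v \<in> C \<and> (AE x\<in>\<Omega> in lborel. v x = v' x) \<and> solution \<Omega> h v' \<and> ess_large \<Omega> v' --> (AE x\<in>\<Omega> in lborel. u x <= v' x)"
  by blast
 have "ae_le \<Omega> u v" if v: "v \<in> C" "is_sol \<Omega> g f v" "is_large \<Omega> v" for v
 proof -
  obtain v' where v': "solution \<Omega> h v'" "AE x\<in>\<Omega> in lborel. v x = v' x" by (rule solution_representative[OF o v(2) fl h(1,3)])
  then have "AE x\<in>\<Omega> in lborel. u x <= v' x" using u(4) v(1,3) is_large_iff[OF fr(2,1) o v'(2)] by blast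
  then have "AE x\<in>\<Omega> in lborel. u x <= v x" using v'(2) by eventually_elim auto
  then show ?thesis by (simp add: ae_le_def AE_completion_iff)
 qed
 then show ?thesis
  using u(1,3) solution_is_sol[OF o u(2) fl h(1,3)] is_large_iff[OF fr(2,1) o, of u u] unfolding min_large_sol_in_def large_sol_def by auto
qed

end

theorem mainTheorem3:
  fixes \<Omega> :: "'a::euclidean_space set" and g :: "real \<Rightarrow> real" and V :: "'a \<Rightarrow> real"
  assumes "DIM('a) \<ge> 2"
    and "open \<Omega>" and "connected \<Omega>" and "\<Omega> \<noteq> {}"
    and "frontier \<Omega> \<noteq> {}" and "compact (frontier \<Omega>)"
    and "continuous_on UNIV g" and "mono g" and "0 \<le> g 0"
    and "keller_osserman g"
    and "is_subsol \<Omega> g (\<lambda>_. 0) V"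
  shows "(\<exists>Vf. (\<forall>f. nonneg_locL1 \<Omega> f \<longrightarrow> min_sol_in \<Omega> g f (UV \<Omega> V) (Vf f)) \<and>
              (\<forall>f1 f2. nonneg_locL1 \<Omega> f1 \<longrightarrow> nonneg_locL1 \<Omega> f2 \<longrightarrow> ae_le \<Omega> f1 f2
                   \<longrightarrow> ae_le \<Omega> (Vf f1) (Vf f2)))
       \<and> (wiener \<Omega> \<longrightarrow> (\<forall>f. nonneg_locL1 \<Omega> f \<longrightarrow>
              (\<exists>u. large_sol \<Omega> g f u) \<and> (\<exists>u. min_large_sol_in \<Omega> g f (UV \<Omega> V) u)))
       \<and> (bounded \<Omega> \<and> wiener \<Omega> \<longrightarrow> (\<forall>f. nonneg_locL1 \<Omega> f \<longrightarrow>
              (\<exists>u. min_large_sol_in \<Omega> g f UNIV u)))"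
proof -
 interpret ko_nonlinearity g by unfold_locales fact+
 note ex = minimal_large_sol_exists[OF assms(2,5,6)]
 \<comment> \<open>The condition on f stands under the existential quantifier, so that choice gives
   one map \<open>Vf\<close> defined on all functions; both claims of the first part then speak
   about the same map.\<close>
 have "\<forall>f. \<exists>u. nonneg_locL1 \<Omega> f --> u \<in> UV \<Omega> V \<and> is_sol \<Omega> g f u \<and>
  (\<forall>f' v. nonneg_locL1 \<Omega> f' \<and> ae_le \<Omega> f f' \<and> v \<in> UV \<Omega> V \<and> is_sol \<Omega> g f' v --> ae_le \<Omega> u v)"
  using minimal_sol_exists[OF assms(2,11)] by blast
 from choice[OF this] obtain Vf where Vf: "\<And>f. nonneg_locL1 \<Omega> f ==> Vf f \<in> UV \<Omega> V \<and> is_sol \<Omega> g f (Vf f) \<and>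
  (\<forall>f' v. nonneg_locL1 \<Omega> f' \<and> ae_le \<Omega> f f' \<and> v \<in> UV \<Omega> V \<and> is_sol \<Omega> g f' v --> ae_le \<Omega> (Vf f) v)" by blast
 have "ae_le \<Omega> f f" for f :: "'a => real" by (simp add: ae_le_def)
 then have "min_sol_in \<Omega> g f (UV \<Omega> V) (Vf f)" if "nonneg_locL1 \<Omega> f" for f using Vf[OF that] that unfolding min_sol_in_def by blast
 moreover have "ae_le \<Omega> (Vf f1) (Vf f2)" if "nonneg_locL1 \<Omega> f1" "nonneg_locL1 \<Omega> f2" "ae_le \<Omega> f1 f2" for f1 f2
  using Vf[OF that(1)] Vf[OF that(2)] that by blast
 moreover have "\<exists>u. min_large_sol_in \<Omega> g f (UV \<Omega> V) u" if "wiener \<Omega>" "nonneg_locL1 \<Omega> f" for f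
  by (rule ex[of f]) (use that assms(11) in auto)
 moreover have "\<exists>u. min_large_sol_in \<Omega> g f UNIV u" if "bounded \<Omega>" "wiener \<Omega>" "nonneg_locL1 \<Omega> f" for f
  by (rule ex[of f]) (use that in auto)
 ultimately show ?thesis unfolding min_large_sol_in_def by blast
qed

end
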